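(* Let $\mathcal T$ be a rooted metric tree with compact core and finitely many attached half-lines, let $\mu(\mathrm dx)=\frac{2}{\sqrt\pi}e^{-|x|^2}\,\mathrm dx$, and let $\mathcal A^{\mathrm N}$ be the Neumann realisation of the Ornstein–Uhlenbeck operator on $L^2_\mu(\mathcal T)$ (as in the context). The measure $\mu$ is the unique (up to a multiplicative constant) invariant measure for the semigroup $(e^{-t\mathcal A^{\mathrm N}})_{t\ge0}$. Moreover, $$\lim_{t\to\infty}\big(e^{-t\mathcal A^{\mathrm N}}f\big)(x)=\frac1{\mu(\mathcal T)}\int_{\mathcal T}f\,\mathrm d\mu\qquad\text{for all }f\in L^\infty_\mu(\mathcal T)\text{ and all }x\in\mathcal T.$$
   Context: Tree. Let $\widetilde{\mathcal T}$ be a compact rooted metric tree (a finite tree whose edges have finite positive lengths) with vertex set $\mathsf V$ and root $\mathsf o\in\mathsf V$; let $\mathsf L\subset\mathsf V\setminus\{\mathsf o\}$, assumed nonempty, be the set of its leaves (vertices of degree one, excluding the root). $\mathcal T$ is obtained from $\widetilde{\mathcal T}$ by attaching to each vertex of $\mathsf L$ a finite non-zero number of half-lines. For $x\in\mathcal T$, $|x|$ is the path distance from $x$ to $\mathsf o$; $\mathrm dx$ is Lebesgue measure on the edges. Each edge is parametrised by arc length in the direction away from the root, and $f'$ denotes the weak derivative in this coordinate. Operator. $H^1_\mu(\mathcal T)$ is the space of continuous functions on $\mathcal T$ lying in $\bigoplus_{\mathsf e}H^1_\mu(\mathsf e)$, the sum being over all edges $\mathsf e$. $\mathcal A^{\mathrm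 N}$ is the non-negative self-adjoint operator on $L^2_\mu(\mathcal T)$ associated with the closed symmetric form $\mathfrak a^{\mathrm N}(f,g)=\frac12\int_{\mathcal T}f'\,\overline{g'}\,\mathrm d\mu$ with domain $H^1_\mu(\mathcal T)$. Equivalently, $\mathcal A^{\mathrm N}f=-\frac12f''+|x|f'$ on edges, with domain the functions that are in $H^2_\mu$ on each edge, continuous at every vertex, and such that at every vertex (including $\mathsf o$) the sum over incident edges of the derivatives pointing away from the vertex is zero. Conventions. For $t>0$ and $f\in L^\infty_\mu(\mathcal T)\subset L^2_\mu(\mathcal T)$ the function $e^{-t\mathcal A^{\mathrm N}}f$ has a (unique) bounded continuous representative, which is used for pointwise values; the operators $e^{-t\mathcal A^{\mathrm N}}$, $t>0$, are integral operators and in this way act on bounded Borel functions on $\mathcal T$. A non-zero positive Borel measure $\sigma$ on $\mathcal T$ is invariant for the semigroup if $\int_{\mathcal T}e^{-t\mathcal A^{\mathrm N}}f\,\mathrm d\sigma=\int_{\mathcal T}f\,\mathrm d\sigma$ for all $t>0$ and all bounded Borel functions $f\ge0$ on $\mathcal T$.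
   Formalization: Since the Borel measure that is infinity times μ also satisfies the invariance identity, the multiplicative constant is allowed to be infinite; it is non-zero, and finite whenever the invariant measure is sigma-finite. *)

theory Defs
  imports "HOL-Analysis.Analysis" "Graph_Theory.Arc_Walk"
begin

section \<open>Rooted metric trees with half-lines attached to the leaves\<close>

text \<open>
  The compact core is a finite directed graph whose arcs point away from the root.
  \<^term>\<open>arc_len\<close> gives the edge lengths, and \<^term>\<open>rays\<close> the number of half-lines attached to
  a vertex; only its values at the leaves matter.
\<close>

record ('v, 'e) metric_tree =
  core :: "('v, 'e) pre_digraph"
  origin :: 'v
  arc_len :: "'e \<Rightarrow> real"
  rays :: "'v \<Rightarrow> nat"

definition leaves :: "('v, 'e) metric_tree \<Rightarrow> 'v set" where
  "leaves G =
    {v \<in> verts (core G) - {origin G}. in_degree (core G) v + out_degree (core G) v = 1}"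

text \<open>
  A finite directed graph is a tree with all edges oriented away from the root iff each vertex is
  reached from the root by exactly one directed walk. (The predicate \<open>tree\<close> of
  \<open>Digraph_Component\<close> does not apply to oriented trees: it excludes directed cycles only.)
\<close>

definition rooted_metric_tree :: "('v, 'e) metric_tree \<Rightarrow> bool" where
  "rooted_metric_tree G \<longleftrightarrow>
    fin_digraph (core G) \<and>
    origin G \<in> verts (core G) \<and>
    (\<forall>v \<in> verts (core G). \<exists>!p. pre_digraph.awalk (core G) (origin G) p v) \<and>
    (\<forall>e \<in> arcs (core G). 0 < arc_len G e) \<and>
    leaves G \<noteq> {} \<and>
    (\<forall>v \<in> leaves G. 0 < rays G v)"

datatype ('v, 'e) edge = Arc 'e | Ray 'v nat

definition edges :: "('v, 'e) metric_tree \<Rightarrow> ('v, 'e) edge set" where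
  "edges G = Arc ` arcs (core G) \<union> {Ray v k |v k. v \<in> leaves G \<and> k < rays G v}"

fun edge_interior :: "('v, 'e) metric_tree \<Rightarrow> ('v, 'e) edge \<Rightarrow> real set" where
  "edge_interior G (Arc e) = {0<..<arc_len G e}"
| "edge_interior G (Ray v k) = {0<..}"

fun edge_closure :: "('v, 'e) metric_tree \<Rightarrow> ('v, 'e) edge \<Rightarrow> real set" where
  "edge_closure G (Arc e) = {0..arc_len G e}"
| "edge_closure G (Ray v k) = {0..}"

datatype ('v, 'e) point = Vertex 'v | Inner "('v, 'e) edge" real

definition points :: "('v, 'e) metric_tree \<Rightarrow> ('v, 'e) point set" where
  "points G =
    Vertex ` verts (core G) \<union> {Inner e s |e s. e \<in> edges G \<and> s \<in> edge_interior G e}"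

text \<open>Arc-length parametrisation of the closed edges, in the direction away from the root.\<close>

fun chart :: "('v, 'e) metric_tree \<Rightarrow> ('v, 'e) edge \<Rightarrow> real \<Rightarrow> ('v, 'e) point" where
  "chart G (Arc e) s =
    (if s = 0 then Vertex (tail (core G) e)
     else if s = arc_len G e then Vertex (head (core G) e)
     else Inner (Arc e) s)"
| "chart G (Ray v k) s = (if s = 0 then Vertex v else Inner (Ray v k) s)"

definition vertex_dist :: "('v, 'e) metric_tree \<Rightarrow> 'v \<Rightarrow> real" where
  "vertex_dist G v =
    sum_list (map (arc_len G) (THE p. pre_digraph.awalk (core G) (origin G) p v))"

fun root_dist :: "('v, 'e) metric_tree \<Rightarrow> ('v, 'e) point \<Rightarrow> real" where
  "root_dist G (Vertex v) = vertex_dist G v"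
| "root_dist G (Inner (Arc e) s) = vertex_dist G (tail (core G) e) + s"
| "root_dist G (Inner (Ray v k) s) = vertex_dist G v + s"

text \<open>
  The topology of the tree is the quotient topology obtained by gluing the closed edges at the
  vertices. Since there are finitely many edges, it is the topology of the path metric.
\<close>

definition open_in_tree :: "('v, 'e) metric_tree \<Rightarrow> ('v, 'e) point set \<Rightarrow> bool" where
  "open_in_tree G U \<longleftrightarrow>
    U \<subseteq> points G \<and>
    (\<forall>e \<in> edges G. openin (top_of_set (edge_closure G e)) {s \<in> edge_closure G e. chart G e s \<in> U})"

definition tree_topology :: "('v, 'e) metric_tree \<Rightarrow> ('v, 'e) point topology" where
  "tree_topology G = topology (open_in_tree G)"

lemma istopology_open_in_tree: "istopology (open_in_tree G)"
proof -
  have "open_in_tree G (S \<inter> T)" if "open_in_tree G S" "open_in_tree G T" for S T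
  proof -
    have "{s \<in> edge_closure G e. chart G e s \<in> S \<inter> T} =
        {s \<in> edge_closure G e. chart G e s \<in> S} \<inter> {s \<in> edge_closure G e. chart G e s \<in> T}" for e
      by blast
    then show ?thesis
      using that unfolding open_in_tree_def by auto
  qed
  moreover have "open_in_tree G (\<Union>\<K>)" if "\<forall>K\<in>\<K>. open_in_tree G K" for \<K>
  proof -
    have "{s \<in> edge_closure G e. chart G e s \<in> \<Union>\<K>} =
        (\<Union>K\<in>\<K>. {s \<in> edge_closure G e. chart G e s \<in> K})" for e
      by blast
    then show ?thesis
      using that unfolding open_in_tree_def by auto
  qed
  ultimately show ?thesis
    unfolding istopology_def by blast
qed

lemma openin_tree_topology: "openin (tree_topology G) = open_in_tree G"
  unfolding tree_topology_def by (simp add: istopology_open_in_tree topology_inverse')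

definition tree_borel :: "('v, 'e) metric_tree \<Rightarrow> ('v, 'e) point measure" where
  "tree_borel G = sigma (points G) {U. openin (tree_topology G) U}"

text \<open>
  Lebesgue measure on the edges, transported from the disjoint union of the open edges; the
  vertices are null sets.
\<close>

definition tree_lebesgue :: "('v, 'e) metric_tree \<Rightarrow> ('v, 'e) point measure" where
  "tree_lebesgue G =
    distr (restrict_space (count_space (edges G) \<Otimes>\<^sub>M lborel) (SIGMA e:edges G. edge_interior G e))
      (tree_borel G) (\<lambda>(e, s). chart G e s)"

definition mu :: "('v, 'e) metric_tree \<Rightarrow> ('v, 'e) point measure" where
  "mu G = density (tree_lebesgue G) (\<lambda>x. ennreal (2 / sqrt pi * exp (- (root_dist G x)\<^sup>2)))"


section \<open>Function spaces\<close>

text \<open>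
  Elements of \<open>L\<^sup>2\<close> are represented by functions and not by classes, so that
  identities between them have to be read almost everywhere. Values of functions outside
  \<^term>\<open>points G\<close> are irrelevant throughout.
\<close>

definition L2 :: "('v, 'e) metric_tree \<Rightarrow> (('v, 'e) point \<Rightarrow> complex) set" where
  "L2 G = {f \<in> borel_measurable (mu G). integrable (mu G) (\<lambda>x. (cmod (f x))\<^sup>2)}"

definition L2_norm :: "('v, 'e) metric_tree \<Rightarrow> (('v, 'e) point \<Rightarrow> complex) \<Rightarrow> real" where
  "L2_norm G f = sqrt (LINT x|mu G. (cmod (f x))\<^sup>2)"

definition L2_inner ::
  "('v, 'e) metric_tree \<Rightarrow> (('v, 'e) point \<Rightarrow> complex) \<Rightarrow> (('v, 'e) point \<Rightarrow> complex) \<Rightarrow> complex"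
where
  "L2_inner G f g = (LINT x|mu G. f x * cnj (g x))"

definition Linfty :: "('v, 'e) metric_tree \<Rightarrow> (('v, 'e) point \<Rightarrow> complex) set" where
  "Linfty G = {f \<in> borel_measurable (mu G). \<exists>C. AE x in mu G. cmod (f x) \<le> C}"

definition test_function :: "real set \<Rightarrow> (real \<Rightarrow> real) \<Rightarrow> bool" where
  "test_function I \<phi> \<longleftrightarrow>
    (\<forall>n x. (deriv ^^ n) \<phi> differentiable (at x)) \<and>
    (\<exists>K. compact K \<and> K \<subseteq> I \<and> (\<forall>x. x \<notin> K \<longrightarrow> \<phi> x = 0))"

definition weak_derivative_on :: "real set \<Rightarrow> (real \<Rightarrow> complex) \<Rightarrow> (real \<Rightarrow> complex) \<Rightarrow> bool" where
  "weak_derivative_on I u v \<longleftrightarrow>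
    (\<forall>K. compact K \<and> K \<subseteq> I \<longrightarrow> set_integrable lborel K u \<and> set_integrable lborel K v) \<and>
    (\<forall>\<phi>. test_function I \<phi> \<longrightarrow>
      (LINT x:I|lborel. u x * of_real (deriv \<phi> x)) = - (LINT x:I|lborel. v x * of_real (\<phi> x)))"

definition has_weak_derivative ::
  "('v, 'e) metric_tree \<Rightarrow> (('v, 'e) point \<Rightarrow> complex) \<Rightarrow> (('v, 'e) point \<Rightarrow> complex) \<Rightarrow> bool"
where
  "has_weak_derivative G f f' \<longleftrightarrow>
    (\<forall>e \<in> edges G. weak_derivative_on (edge_interior G e)
      (\<lambda>s. f (chart G e s)) (\<lambda>s. f' (chart G e s)))"

text \<open>There are finitely many edges, so the edgewise \<open>L\<^sup>2\<close> conditions can be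
  stated globally.\<close>

definition H1 :: "('v, 'e) metric_tree \<Rightarrow> (('v, 'e) point \<Rightarrow> complex) set" where
  "H1 G = {f \<in> L2 G. continuous_map (tree_topology G) euclidean f \<and>
    (\<exists>f' \<in> L2 G. has_weak_derivative G f f')}"

text \<open>The choice determines the derivative almost everywhere.\<close>

definition tree_deriv ::
  "('v, 'e) metric_tree \<Rightarrow> (('v, 'e) point \<Rightarrow> complex) \<Rightarrow> ('v, 'e) point \<Rightarrow> complex"
where
  "tree_deriv G f = (SOME f'. f' \<in> L2 G \<and> has_weak_derivative G f f')"


section \<open>The Neumann realisation of the Ornstein--Uhlenbeck operator\<close>

definition neumann_form ::
  "('v, 'e) metric_tree \<Rightarrow> (('v, 'e) point \<Rightarrow> complex) \<Rightarrow> (('v, 'e) point \<Rightarrow> complex) \<Rightarrow> complex"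
where
  "neumann_form G f g = 1 / 2 * (LINT x|mu G. tree_deriv G f x * cnj (tree_deriv G g x))"

text \<open>The (graph of the) operator associated with the form. An element of \<open>L\<^sup>2\<close> lies
  in the form domain iff it has a representative in \<^term>\<open>H1 G\<close>.\<close>

definition neumann_operator ::
  "('v, 'e) metric_tree \<Rightarrow> ((('v, 'e) point \<Rightarrow> complex) \<times> (('v, 'e) point \<Rightarrow> complex)) set"
where
  "neumann_operator G =
    {(f, g). f \<in> L2 G \<and> g \<in> L2 G \<and>
      (\<exists>f\<^sub>0 \<in> H1 G. (AE x in mu G. f x = f\<^sub>0 x) \<and>
        (\<forall>h \<in> H1 G. neumann_form G f\<^sub>0 h = L2_inner G g h))}"


section \<open>The semigroup\<close>

definition c0_semigroup ::
  "('v, 'e) metric_tree \<Rightarrow> (real \<Rightarrow> (('v, 'e) point \<Rightarrow> complex) \<Rightarrow> ('v, 'e) point \<Rightarrow> complex) \<Rightarrow> bool"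
where
  "c0_semigroup G T \<longleftrightarrow>
    (\<forall>t\<ge>0. \<forall>f \<in> L2 G. T t f \<in> L2 G) \<and>
    (\<forall>t\<ge>0. \<forall>f \<in> L2 G. \<forall>g \<in> L2 G. \<forall>a b.
      AE x in mu G. T t (\<lambda>y. a * f y + b * g y) x = a * T t f x + b * T t g x) \<and>
    (\<forall>t\<ge>0. \<exists>C. \<forall>f \<in> L2 G. L2_norm G (T t f) \<le> C * L2_norm G f) \<and>
    (\<forall>f \<in> L2 G. AE x in mu G. T 0 f x = f x) \<and>
    (\<forall>s\<ge>0. \<forall>t\<ge>0. \<forall>f \<in> L2 G. AE x in mu G. T (s + t) f x = T s (T t f) x) \<and>
    (\<forall>f \<in> L2 G. ((\<lambda>t. L2_norm G (\<lambda>x. T t f x - f x)) \<longlongrightarrow> 0) (at_right 0))"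

definition generator ::
  "('v, 'e) metric_tree \<Rightarrow> (real \<Rightarrow> (('v, 'e) point \<Rightarrow> complex) \<Rightarrow> ('v, 'e) point \<Rightarrow> complex) \<Rightarrow>
    ((('v, 'e) point \<Rightarrow> complex) \<times> (('v, 'e) point \<Rightarrow> complex)) set"
where
  "generator G T =
    {(f, g). f \<in> L2 G \<and> g \<in> L2 G \<and>
      ((\<lambda>t. L2_norm G (\<lambda>x. (T t f x - f x) / of_real t - g x)) \<longlongrightarrow> 0) (at_right 0)}"

text \<open>
  The strongly continuous semigroup on \<open>L\<^sup>2\<close> generated by minus the Neumann operator.
  It is determined up to the choice of representatives.
\<close>

definition neumann_semigroup ::
  "('v, 'e) metric_tree \<Rightarrow> real \<Rightarrow> (('v, 'e) point \<Rightarrow> complex) \<Rightarrow> ('v, 'e) point \<Rightarrow> complex"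
where
  "neumann_semigroup G = (SOME T. c0_semigroup G T \<and>
    generator G T = {(f, \<lambda>x. - g x) |f g. (f, g) \<in> neumann_operator G})"

text \<open>
  For \<open>t > 0\<close> and \<open>f\<close> in \<open>L\<^sup>\<infinity>\<close>, the bounded continuous representative, used for
  pointwise values. It is unique on \<^term>\<open>points G\<close>, since non-empty open sets have positive
  measure.
\<close>

definition neumann_heat ::
  "('v, 'e) metric_tree \<Rightarrow> real \<Rightarrow> (('v, 'e) point \<Rightarrow> complex) \<Rightarrow> ('v, 'e) point \<Rightarrow> complex"
where
  "neumann_heat G t f = (SOME u. continuous_map (tree_topology G) euclidean u \<and>
    bounded (u ` points G) \<and> (AE x in mu G. neumann_semigroup G t f x = u x))"

text \<open>
  Both integrals are Lebesgue integrals of non-negative functions and may be infinite: \<open>\<sigma>\<close>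
  need not be finite, or even sigma-finite.
\<close>

definition invariant_measure ::
  "('v, 'e) metric_tree \<Rightarrow> ('v, 'e) point measure \<Rightarrow> bool"
where
  "invariant_measure G \<sigma> \<longleftrightarrow>
    space \<sigma> = points G \<and> sets \<sigma> = sets (tree_borel G) \<and>
    emeasure \<sigma> (space \<sigma>) \<noteq> 0 \<and>
    (\<forall>t>0. \<forall>f :: ('v, 'e) point \<Rightarrow> real.
      f \<in> borel_measurable (tree_borel G) \<longrightarrow> bounded (f ` points G) \<longrightarrow>
      (\<forall>x \<in> points G. 0 \<le> f x) \<longrightarrow>
      (\<integral>\<^sup>+x. ennreal (Re (neumann_heat G t (\<lambda>y. complex_of_real (f y)) x)) \<partial>\<sigma>) =
      (\<integral>\<^sup>+x. ennreal (f x) \<partial>\<sigma>))"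

end

theory Submission
  imports Defs "HOL-Probability.Probability"
begin

text \<open>
  The semigroup is the limit of implicit Euler schemes \<open>(1 + t / 2\<^sup>k A)\<close> to the power \<open>- 2\<^sup>k\<close>; along
  these schemes the energy decreases, so that \<open>t \<parallel>u\<^sub>t'\<parallel>\<^sup>2 \<le> \<parallel>f\<parallel>\<^sup>2\<close> for \<open>u\<^sub>t = e\<close> to the \<open>- t A\<close> applied to \<open>f\<close>.
  On the tree the difference of the values of a function at two points is bounded by the
  \<open>L\<^sup>2(\<mu>)\<close>-norm of its derivative, hence \<open>u\<^sub>t\<close> flattens out pointwise as \<open>t \<rightarrow> \<infinity>\<close>. Constants have no
  energy, so the \<open>\<mu>\<close>-integral of \<open>u\<^sub>t\<close> is conserved and \<open>u\<^sub>t\<close> converges to the mean of \<open>f\<close>. Positivity and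
  boundedness come from the fact that \<open>u \<mapsto> \<bar>Re u\<bar>\<close> does not increase the energy.

  If \<open>\<sigma>\<close> is invariant, Fatou's lemma applied to the flow of the indicator of \<open>B\<close> gives
  \<open>\<sigma>(B) \<ge> \<mu>(B) / \<mu>(T) \<sigma>(T)\<close>. When \<open>\<sigma>\<close> is finite, the same bound for the complement of \<open>B\<close> yields equality.
  When \<open>\<sigma>(T) = \<infinity>\<close>, every set that is not \<open>\<mu>\<close>-null has infinite measure, while the flow of
  the indicator of a \<open>\<mu>\<close>-null set vanishes identically; so \<open>\<sigma> = \<infinity> \<mu>\<close>.
\<close>

section \<open>Resolvents of closed operators\<close>

text \<open>The operator theory takes place in a real Hilbert space given as a type, whereas the
  space of the theorem depends on the measure of the tree and is complex. Two devices bridge the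
  gap: one type that contains all L2 spaces at once, and the isometries \<open>cscale z\<close> with
  \<open>cmod z = 1\<close>, which restore the complex structure. The semigroup of the statement is
  a Hilbert choice among all strongly continuous semigroups with the prescribed generator.
  Contractivity is not part of their definition: \<open>c0_semigroup\<close> supplies only a
  separate bound at each time. A construction is therefore not enough; uniqueness has to be proved
  as well, and it rests on the uniform boundedness principle. The Euler scheme uses dyadic steps
  because halving them compares \<open>R (a + a)\<close> with \<open>R a o R a\<close>, an error of
  order \<open>a^2\<close> on the domain of the squared operator, so that successive approximations
  differ by a geometric sequence. Weak derivatives are replaced by the integral identity
  \<open>ac\<close> on closed edges, which includes the gluing at the vertices and passes to
  limits.\<close>

lemma linear_coeff_zero:
  fixes b c :: real
  assumes "\<And>s. 0 \<le> s * b + s\<^sup>2 * c"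
  shows "b = 0"
proof (rule ccontr)
  assume "b \<noteq> 0"
  have "0 < b\<^sup>2" using \<open>b \<noteq> 0\<close> by simp
  \<comment> \<open>The quadratic is negative at \<open>s = - b / k\<close> as soon as
    \<open>k > c\<close>; the summand 1 makes \<open>k\<close> positive as well.\<close>
  define k where "k = \<bar>c\<bar> + 1"
  have k: "k > 0" "c < k" by (auto simp: k_def)
  have "0 \<le> (- b / k) * b + (- b / k)\<^sup>2 * c" by (rule assms)
  also have "\<dots> = (b\<^sup>2 / k\<^sup>2) * (c - k)"
    using k by (simp add: field_simps power2_eq_square)
  also have "\<dots> < 0"
    using k \<open>0 < b\<^sup>2\<close> by (intro mult_pos_neg) auto
  finally show False by simp
qed

text \<open>\<open>D\<close> stands for the derivative up to a factor, and
  \<open>inner (D u) (D v)\<close> for the form. Closedness of the graph is what keeps limits of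
  minimising sequences in \<open>V\<close>.\<close>

locale closed_operator =
  fixes V :: "'h::{real_inner,banach} set"
    and D :: "'h \<Rightarrow> 'k::{real_inner,banach}"
  assumes subspace_V: "subspace V"
    and D_add: "x \<in> V \<Longrightarrow> y \<in> V \<Longrightarrow> D (x + y) = D x + D y"
    and D_scale: "x \<in> V \<Longrightarrow> D (c *\<^sub>R x) = c *\<^sub>R D x"
    and D_closed: "(\<And>n. X n \<in> V) \<Longrightarrow> X \<longlonglongrightarrow> x \<Longrightarrow> (\<lambda>n. D (X n)) \<longlonglongrightarrow> d \<Longrightarrow> x \<in> V \<and> D x = d"
begin

lemma V_simps [simp]: "0 \<in> V" "x \<in> V \<Longrightarrow> y \<in> V \<Longrightarrow> x + y \<in> V" "x \<in> V \<Longrightarrow> y \<in> V \<Longrightarrow> x - y \<in> V"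
    "x \<in> V \<Longrightarrow> c *\<^sub>R x \<in> V" "x \<in> V \<Longrightarrow> - x \<in> V"
  using subspace_V by (auto intro: subspace_0 subspace_add subspace_diff subspace_scale subspace_neg)

lemma D_minus: "x \<in> V \<Longrightarrow> D (- x) = - D x"
  using D_scale[of x "-1"] by simp

lemma D_diff: "x \<in> V \<Longrightarrow> y \<in> V \<Longrightarrow> D (x - y) = D x - D y"
  using D_add[of x "- y"] by (simp add: D_minus)

definition energy :: "real \<Rightarrow> 'h \<Rightarrow> 'h \<Rightarrow> real" where
  "energy h f u = (norm (f - u))\<^sup>2 + h * (norm (D u))\<^sup>2"

text \<open>The weak form of \<open>u + h A u = f\<close> for \<open>A = D* D\<close>, that is, of
  one implicit Euler step of length \<open>h\<close>; it is the Euler-Lagrange equation of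
  \<open>energy h f\<close>.\<close>

definition solves :: "real \<Rightarrow> 'h \<Rightarrow> 'h \<Rightarrow> bool" where
  "solves h f u \<longleftrightarrow> u \<in> V \<and> (\<forall>v\<in>V. inner (f - u) v = h * inner (D u) (D v))"

text \<open>In the expansion around \<open>u\<close> the mixed terms are exactly those of the weak
  equation and cancel. For \<open>h > 0\<close> the remaining excess is positive unless
  \<open>w = u\<close>, so a solution is the unique minimiser.\<close>

lemma energy_solves:
  assumes "solves h f u" "w \<in> V"
  shows "energy h f w = energy h f u + (norm (w - u))\<^sup>2 + h * (norm (D (w - u)))\<^sup>2"
proof -
  have uV: "u \<in> V" and EL: "inner (f - u) (w - u) = h * inner (D u) (D (w - u))"
    using assms by (auto simp: solves_def)
  have "energy h f w = (norm ((f - u) - (w - u)))\<^sup>2 + h * (norm (D u + D (w - u)))\<^sup>2"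
    using uV assms by (simp add: energy_def flip: D_add)
  also have "\<dots> = (norm (f-u))\<^sup>2 - 2 * inner (f-u) (w-u) + (norm (w-u))\<^sup>2 +
      h * ((norm (D u))\<^sup>2 + 2 * inner (D u) (D (w-u)) + (norm (D (w-u)))\<^sup>2)"
    unfolding power2_norm_eq_inner by (simp add: inner_add inner_diff inner_commute algebra_simps)
  also have "\<dots> = energy h f u + (norm (w - u))\<^sup>2 + h * (norm (D (w - u)))\<^sup>2"
    unfolding EL energy_def by (simp add: algebra_simps)
  finally show ?thesis .
qed

lemma solves_minimizer_unique:
  assumes "h > 0" "solves h f u" "w \<in> V" "energy h f w \<le> energy h f u"
  shows "w = u"
proof -
  have "(norm (w - u))\<^sup>2 + h * (norm (D (w - u)))\<^sup>2 \<le> 0"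
    using energy_solves[OF assms(2,3)] assms(4) by simp
  moreover have "h * (norm (D (w - u)))\<^sup>2 \<ge> 0" using assms(1) by simp
  ultimately have "(norm (w - u))\<^sup>2 \<le> 0" by linarith
  then show ?thesis by simp
qed

text \<open>The parallelogram law for the norm with square
  \<open>(norm x)^2 + h * (norm (D x))^2\<close>. Two nearly minimal vectors are close in this norm,
  since their midpoint cannot have an energy below the infimum.\<close>

lemma energy_parallelogram:
  assumes "x \<in> V" "y \<in> V"
  shows "(norm (x - y))\<^sup>2 + h * (norm (D (x - y)))\<^sup>2 =
    2 * energy h f x + 2 * energy h f y - 4 * energy h f ((1/2) *\<^sub>R (x + y))"
proof -
  have e: "f - (1/2) *\<^sub>R (x + y) = (1/2) *\<^sub>R ((f - x) + (f - y))" "x - y = (f - y) - (f - x)"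
    by (auto simp: algebra_simps simp flip: scaleR_add_left)
  have d: "D ((1/2) *\<^sub>R (x + y)) = (1/2) *\<^sub>R (D x + D y)" "D (x - y) = D x - D y"
    using assms by (simp_all add: D_scale D_add D_diff)
  show ?thesis
    unfolding energy_def d e(1) unfolding e(2) power2_norm_eq_inner
    by (simp add: inner_add inner_diff inner_commute algebra_simps)
qed

text \<open>The direct method: a minimising sequence is Cauchy together with its image under
  \<open>D\<close>, closedness provides the limit in \<open>V\<close>, and the vanishing first
  variation is the weak equation.\<close>

lemma solution_exists:
  assumes h: "h > 0"
  shows "\<exists>u. solves h f u"
proof -
  define m where "m = Inf (energy h f ` V)"
  have bdd: "bdd_below (energy h f ` V)"
    by (rule bdd_belowI[of _ 0]) (use h in \<open>auto simp: energy_def\<close>)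
  have m: "m \<le> energy h f v" if "v \<in> V" for v
    unfolding m_def by (rule cInf_lower[OF _ bdd]) (use that in auto)
  have "\<exists>u\<in>V. energy h f u < m + inverse (real (Suc n))" for n
  proof -
    have ne: "energy h f ` V \<noteq> {}" using V_simps(1) by blast
    have "m < m + inverse (real (Suc n))" by simp
    then show ?thesis
      unfolding m_def using cInf_lessD[OF ne] by fastforce
  qed
  then obtain u where uV: "\<And>n. u n \<in> V" and u: "\<And>n. energy h f (u n) < m + inverse (real (Suc n))"
    by metis
  have est: "(norm (u i - u j))\<^sup>2 + h * (norm (D (u i - u j)))\<^sup>2 \<le> 2 * inverse (real (Suc i)) + 2 * inverse (real (Suc j))" for i j
  proof -
    have "m \<le> energy h f ((1/2) *\<^sub>R (u i + u j))" by (rule m) (simp add: uV)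
    then show ?thesis
      unfolding energy_parallelogram[OF uV uV, where f = f] using u[of i] u[of j] by linarith
  qed
  have small: "\<exists>N. \<forall>i\<ge>N. \<forall>j\<ge>N. 2 * inverse (real (Suc i)) + 2 * inverse (real (Suc j)) < e" if e: "e > 0" for e
  proof -
    obtain N where N: "inverse (real (Suc N)) < e / 4"
      using reals_Archimedean[of "e/4"] e by (metis zero_less_divide_iff zero_less_numeral)
    have "2 * inverse (real (Suc i)) + 2 * inverse (real (Suc j)) < e" if "i \<ge> N" "j \<ge> N" for i j
    proof -
      have "inverse (real (Suc i)) \<le> inverse (real (Suc N))" "inverse (real (Suc j)) \<le> inverse (real (Suc N))"
        using that by auto
      then show ?thesis using N by linarith
    qed
    then show ?thesis by blast
  qed
  have "Cauchy u"
  proof (rule CauchyI)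
    fix e :: real assume "e > 0"
    then obtain N where N: "\<And>i j. i \<ge> N \<Longrightarrow> j \<ge> N \<Longrightarrow> 2 * inverse (real (Suc i)) + 2 * inverse (real (Suc j)) < e\<^sup>2"
      using small[of "e\<^sup>2"] by (metis zero_less_power)
    have "norm (u i - u j) < e" if "i \<ge> N" "j \<ge> N" for i j
    proof -
      have "h * (norm (D (u i - u j)))\<^sup>2 \<ge> 0" using h by simp
      then have "(norm (u i - u j))\<^sup>2 < e\<^sup>2"
        using N[OF that] est[of i j] by linarith
      then show ?thesis using \<open>e > 0\<close> by (simp add: power_less_imp_less_base)
    qed
    then show "\<exists>M. \<forall>m\<ge>M. \<forall>n\<ge>M. norm (u m - u n) < e" by blast
  qed
  then obtain x where x: "u \<longlonglongrightarrow> x" using Cauchy_convergent_iff convergent_def by blast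
  have "Cauchy (\<lambda>n. D (u n))"
  proof (rule CauchyI)
    fix e :: real assume "e > 0"
    then obtain N where N: "\<And>i j. i \<ge> N \<Longrightarrow> j \<ge> N \<Longrightarrow> 2 * inverse (real (Suc i)) + 2 * inverse (real (Suc j)) < h * e\<^sup>2"
      using small[of "h * e\<^sup>2"] h by (metis mult_pos_pos zero_less_power)
    have "norm (D (u i) - D (u j)) < e" if "i \<ge> N" "j \<ge> N" for i j
    proof -
      have "(norm (u i - u j))\<^sup>2 \<ge> 0" by simp
      then have "h * (norm (D (u i) - D (u j)))\<^sup>2 < h * e\<^sup>2"
        using N[OF that] est[of i j] unfolding D_diff[OF uV uV] by linarith
      then show ?thesis using \<open>e > 0\<close> h by (simp add: power_less_imp_less_base)
    qed
    then show "\<exists>M. \<forall>m\<ge>M. \<forall>n\<ge>M. norm (D (u m) - D (u n)) < e" by blast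
  qed
  then obtain y where y: "(\<lambda>n. D (u n)) \<longlonglongrightarrow> y" using Cauchy_convergent_iff convergent_def by blast
  have xV: "x \<in> V" and Dx: "D x = y" using D_closed[OF uV x y] by auto
  have "(\<lambda>n. energy h f (u n)) \<longlonglongrightarrow> energy h f x"
    unfolding energy_def Dx by (intro tendsto_intros x y)
  moreover have "(\<lambda>n. m + inverse (real (Suc n))) \<longlonglongrightarrow> m + 0"
    by (intro tendsto_intros LIMSEQ_inverse_real_of_nat)
  ultimately have "energy h f x \<le> m + 0"
    by (rule LIMSEQ_le) (use u in \<open>blast intro: less_imp_le\<close>)
  then have Jx: "energy h f x \<le> m" by simp
  have "inner (f - x) v = h * inner (D x) (D v)" if v: "v \<in> V" for v
  proof -
    have "0 \<le> s * (2 * h * inner (D x) (D v) - 2 * inner (f - x) v) + s\<^sup>2 * ((norm v)\<^sup>2 + h * (norm (D v))\<^sup>2)" for s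
    proof -
      have "energy h f x \<le> energy h f (x + s *\<^sub>R v)"
        using Jx m[of "x + s *\<^sub>R v"] xV v by simp
      also have "energy h f (x + s *\<^sub>R v) = (norm ((f - x) - s *\<^sub>R v))\<^sup>2 + h * (norm (D x + s *\<^sub>R D v))\<^sup>2"
        using xV v by (simp add: energy_def D_add D_scale algebra_simps)
      also have "\<dots> = energy h f x + s * (2 * h * inner (D x) (D v) - 2 * inner (f - x) v) + s\<^sup>2 * ((norm v)\<^sup>2 + h * (norm (D v))\<^sup>2)"
        unfolding energy_def power2_norm_eq_inner
        by (simp add: inner_add inner_diff inner_commute algebra_simps power2_eq_square)
      finally show ?thesis by simp
    qed
    from linear_coeff_zero[OF this] show ?thesis by simp
  qed
  then show ?thesis using xV by (auto simp: solves_def)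
qed

lemma solves_unique:
  assumes "h > 0" "solves h f u" "solves h f w"
  shows "w = u"
proof -
  have "energy h f w \<le> energy h f u \<or> energy h f u \<le> energy h f w" by linarith
  then show ?thesis
    using solves_minimizer_unique[OF assms(1,2), of w] solves_minimizer_unique[OF assms(1,3), of u] assms
    by (auto simp: solves_def)
qed

definition R :: "real \<Rightarrow> 'h \<Rightarrow> 'h" where "R h f = (THE u. solves h f u)"

lemma R_solves: "h > 0 \<Longrightarrow> solves h f (R h f)"
  unfolding R_def using solution_exists solves_unique by (metis theI)

lemma R_unique: "h > 0 \<Longrightarrow> solves h f u \<Longrightarrow> R h f = u"
  using R_solves solves_unique by metis

lemma R_V: "h > 0 \<Longrightarrow> R h f \<in> V"
  using R_solves solves_def by auto

lemma R_eq: "h > 0 \<Longrightarrow> v \<in> V \<Longrightarrow> inner (f - R h f) v = h * inner (D (R h f)) (D v)"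
  using R_solves solves_def by auto

lemma R_add: "h > 0 \<Longrightarrow> R h (f + g) = R h f + R h g"
  by (rule R_unique)
    (use R_eq[of h _ f] R_eq[of h _ g] in \<open>auto simp: solves_def R_V D_add inner_add inner_diff algebra_simps\<close>)

lemma R_scale: "h > 0 \<Longrightarrow> R h (c *\<^sub>R f) = c *\<^sub>R R h f"
  by (rule R_unique)
    (use R_eq[of h _ f] in \<open>auto simp: solves_def R_V D_scale inner_add inner_diff algebra_simps simp flip: right_diff_distrib\<close>)

text \<open>Test the equation with the solution itself and drop \<open>(norm (f - R h f))^2\<close>.
  The second term is the energy dissipated in one step; \<open>euler_energy\<close> sums it over the
  steps.\<close>

lemma R_norm_energy: "h > 0 \<Longrightarrow> (norm (R h f))\<^sup>2 + 2 * h * (norm (D (R h f)))\<^sup>2 \<le> (norm f)\<^sup>2"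
proof -
  assume h: "h > 0"
  have "inner (f - R h f) (R h f) = h * (norm (D (R h f)))\<^sup>2"
    using R_eq[OF h R_V[OF h]] by (simp add: power2_norm_eq_inner)
  moreover have "(norm f)\<^sup>2 = (norm (f - R h f))\<^sup>2 + 2 * inner (f - R h f) (R h f) + (norm (R h f))\<^sup>2"
    unfolding power2_norm_eq_inner by (simp add: inner_add inner_diff inner_commute algebra_simps)
  moreover have "(norm (f - R h f))\<^sup>2 \<ge> 0" by simp
  ultimately show ?thesis by linarith
qed

lemma R_contraction: "h > 0 \<Longrightarrow> norm (R h f) \<le> norm f"
proof -
  assume h: "h > 0"
  have "2 * h * (norm (D (R h f)))\<^sup>2 \<ge> 0" using h by simp
  then have "(norm (R h f))\<^sup>2 \<le> (norm f)\<^sup>2" using R_norm_energy[OF h, of f] by linarith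
  then show ?thesis by (rule power2_le_imp_le) simp
qed

end

section \<open>Limits and powers of linear contractions\<close>

lemma geometric_increments:
  fixes X :: "nat \<Rightarrow> 'a::banach"
  assumes "\<And>k. norm (X k - X (Suc k)) \<le> c * (1/2)^k"
  shows "convergent X" and "norm (X k - X 0) \<le> 2 * c"
proof -
  have "summable (\<lambda>k. X (Suc k) - X k)"
  proof (rule summable_comparison_test)
    show "\<exists>N. \<forall>n\<ge>N. norm (X (Suc n) - X n) \<le> c * (1/2)^n"
      using assms by (auto simp: norm_minus_commute)
    show "summable (\<lambda>n. c * (1/2::real)^n)"
      by (intro summable_mult summable_geometric) auto
  qed
  then have "convergent (\<lambda>n. \<Sum>k<n. X (Suc k) - X k)"
    by (simp add: summable_iff_convergent)
  then have "convergent (\<lambda>n. X n - X 0)"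
    by (simp add: sum_lessThan_telescope)
  then show "convergent X"
    using convergent_add[OF _ convergent_const[of "X 0"]] by fastforce
  \<comment> \<open>The factor \<open>2 - 2 * (1/2)^k\<close> is a partial sum of the geometric
    series, the exact form under which the induction closes.\<close>
  have "norm (X k - X 0) \<le> c * (2 - 2 * (1/2)^k)"
  proof (induction k)
    case (Suc k)
    have "norm (X (Suc k) - X 0) \<le> norm (X (Suc k) - X k) + norm (X k - X 0)"
      using norm_triangle_ineq[of "X (Suc k) - X k" "X k - X 0"] by simp
    also have "\<dots> \<le> c * (1/2)^k + c * (2 - 2 * (1/2)^k)"
      using assms[of k] Suc by (intro add_mono) (simp_all add: norm_minus_commute)
    finally show ?case by (simp add: algebra_simps)
  qed simp
  also have "\<dots> \<le> 2 * c"
  proof -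
    have "0 \<le> c" using order_trans[OF norm_ge_zero assms[of 0]] by simp
    then have "0 \<le> c * (1/2)^k" by simp
    then show ?thesis by (simp add: algebra_simps)
  qed
  finally show "norm (X k - X 0) \<le> 2 * c" .
qed

definition lin_contraction :: "('a::real_normed_vector \<Rightarrow> 'a) \<Rightarrow> bool" where
  "lin_contraction P \<longleftrightarrow> linear P \<and> (\<forall>x. norm (P x) \<le> norm x)"

lemma lin_contraction_simps:
  assumes "lin_contraction P"
  shows "P (x + y) = P x + P y" "P (x - y) = P x - P y" "P (c *\<^sub>R x) = c *\<^sub>R P x" "norm (P x) \<le> norm x"
    "P 0 = 0" "P (- x) = - P x"
  using assms unfolding lin_contraction_def by (auto simp: linear_add linear_diff linear_scale linear_0 linear_neg)

lemma lin_contraction_id: "lin_contraction id"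
  by (auto simp: lin_contraction_def linear_id)

lemma lin_contraction_comp: "lin_contraction P \<Longrightarrow> lin_contraction Q \<Longrightarrow> lin_contraction (P \<circ> Q)"
  unfolding lin_contraction_def by (auto simp: linear_compose intro: order_trans)

lemma lin_contraction_funpow: "lin_contraction P \<Longrightarrow> lin_contraction (P ^^ n)"
  by (induction n) (auto simp: lin_contraction_comp lin_contraction_id)

lemma lin_contraction_bounded_linear: "lin_contraction P \<Longrightarrow> bounded_linear P"
  unfolding lin_contraction_def by (auto simp: bounded_linear_def bounded_linear_axioms_def intro!: exI[of _ 1])

lemma lin_contraction_continuous: "lin_contraction P \<Longrightarrow> continuous_on S P"
  by (simp add: lin_contraction_bounded_linear linear_continuous_on)

lemma lin_contraction_tendsto: "lin_contraction P \<Longrightarrow> (X \<longlongrightarrow> x) F \<Longrightarrow> ((\<lambda>n. P (X n)) \<longlongrightarrow> P x) F"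
  by (rule bounded_linear.tendsto[OF lin_contraction_bounded_linear])

lemma lin_contraction_dense_eqI:
  assumes "lin_contraction P" "lin_contraction Q" "closure S = UNIV" "\<And>x. x \<in> S \<Longrightarrow> P x = Q x"
  shows "P x = Q x"
proof -
  have "closed {x. P x = Q x}"
    by (intro closed_Collect_eq lin_contraction_continuous assms)
  then have "closure S \<subseteq> {x. P x = Q x}"
    by (intro closure_minimal) (use assms in auto)
  then show ?thesis using assms(3) by auto
qed

lemma closure_UNIV_approx: "closure S = UNIV \<Longrightarrow> e > 0 \<Longrightarrow> \<exists>y\<in>S. norm (y - x) < e"
  using closure_approachable[of x S] by (auto simp: dist_norm)

text \<open>A three-term estimate: the common norm bound 1 of the maps transfers the Cauchy property
  from the dense set to every vector.\<close>

lemma lin_contraction_dense_convergent: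
  fixes F :: "nat \<Rightarrow> 'a::banach \<Rightarrow> 'a"
  assumes F: "\<And>k. lin_contraction (F k)" and S: "closure S = UNIV" and conv: "\<And>x. x \<in> S \<Longrightarrow> convergent (\<lambda>k. F k x)"
  shows "convergent (\<lambda>k. F k x)"
  unfolding Cauchy_convergent_iff[symmetric]
proof (rule CauchyI)
  fix e :: real assume "e > 0"
  then obtain y where y: "y \<in> S" "norm (y - x) < e / 3"
    using closure_UNIV_approx[OF S, of "e/3" x] by auto
  obtain M where M: "\<And>m n. m \<ge> M \<Longrightarrow> n \<ge> M \<Longrightarrow> norm (F m y - F n y) < e / 3"
    using conv[OF y(1)] \<open>e > 0\<close> unfolding Cauchy_convergent_iff[symmetric] Cauchy_iff
    by (meson divide_pos_pos zero_less_numeral)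
  have "norm (F m x - F n x) < e" if "m \<ge> M" "n \<ge> M" for m n
  proof -
    have "F m x - F n x = F m (x - y) + (F m y - F n y) + F n (y - x)"
      by (simp add: lin_contraction_simps[OF F])
    then have "norm (F m x - F n x) \<le> norm (F m (x - y)) + norm (F m y - F n y) + norm (F n (y - x))"
      by (metis norm_triangle_ineq norm_triangle_le add_right_mono)
    also have "\<dots> < e / 3 + e / 3 + e / 3"
      using lin_contraction_simps(4)[OF F, of m "x - y"] lin_contraction_simps(4)[OF F, of n "y - x"] M[OF that] y
      by (smt (verit) norm_minus_commute)
    finally show ?thesis by simp
  qed
  then show "\<exists>M. \<forall>m\<ge>M. \<forall>n\<ge>M. norm (F m x - F n x) < e" by blast
qed

lemma funpow_commute_point:
  assumes "\<And>x. P (Q x) = Q (P x)"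
  shows "(P ^^ n) (Q x) = Q ((P ^^ n) x)"
  by (induction n) (auto simp: assms)

text \<open>Since \<open>P\<close> and \<open>Q\<close> commute, \<open>P^n - Q^n\<close> telescopes
  into \<open>n\<close> terms \<open>P^i Q^j (P - Q)\<close>, which contractions do not enlarge. The
  error of \<open>n\<close> steps is thus at most \<open>n\<close> times the error of one.\<close>

lemma funpow_diff_le:
  assumes P: "lin_contraction P" and Q: "lin_contraction Q" and comm: "\<And>x. P (Q x) = Q (P x)"
  shows "norm ((P ^^ n) u - (Q ^^ n) u) \<le> real n * norm (P u - Q u)"
proof (induction n)
  case (Suc n)
  have "(P ^^ Suc n) u - (Q ^^ Suc n) u = (P ^^ n) (P u - Q u) + Q ((P ^^ n) u - (Q ^^ n) u)"
    by (simp add: lin_contraction_simps[OF lin_contraction_funpow[OF P]] lin_contraction_simps[OF Q]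
        funpow_commute_point[of P Q, OF comm] funpow_swap1)
  then have "norm ((P ^^ Suc n) u - (Q ^^ Suc n) u) \<le> norm ((P ^^ n) (P u - Q u)) + norm (Q ((P ^^ n) u - (Q ^^ n) u))"
    by (metis norm_triangle_ineq)
  also have "\<dots> \<le> norm (P u - Q u) + norm ((P ^^ n) u - (Q ^^ n) u)"
    by (intro add_mono lin_contraction_simps lin_contraction_funpow P Q)
  also have "\<dots> \<le> real (Suc n) * norm (P u - Q u)"
    using Suc by (simp add: algebra_simps)
  finally show ?case .
qed simp

text \<open>Banach-Steinhaus: by Baire, one of the closed sets on which all \<open>F n\<close> are
  bounded by some \<open>m\<close> contains a ball. It serves to bound a semigroup near time 0,
  where each operator comes with its own constant.\<close>

lemma uniform_boundedness:
  fixes F :: "nat \<Rightarrow> 'a::banach \<Rightarrow> 'b::real_normed_vector"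
  assumes F: "\<And>n. bounded_linear (F n)" and pw: "\<And>x. \<exists>B. \<forall>n. norm (F n x) \<le> B"
  shows "\<exists>M. \<forall>n x. norm (F n x) \<le> M * norm x"
proof -
  define C where "C m = {x. \<forall>n. norm (F n x) \<le> real m}" for m :: nat
  have cl: "closed (C m)" for m
  proof -
    have "C m = (\<Inter>n. {x. norm (F n x) \<le> real m})" by (auto simp: C_def)
    then show ?thesis
      by (auto intro!: closed_INT closed_Collect_le continuous_on_norm linear_continuous_on[OF F] continuous_on_const)
  qed
  have "\<exists>m. interior (C m) \<noteq> {}"
  proof (rule ccontr)
    assume "\<not> ?thesis"
    then have i: "interior (C m) = {}" for m by auto
    have "completely_metrizable_space (euclidean :: 'a topology)"
      using Met_TC.completely_metrizable_space_mtopology[where 'a='a] by (simp add: complete_UNIV)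
    then have "(euclidean :: 'a topology) interior_of \<Union>(range C) = {}"
      by (intro Baire_category_alt) (auto simp: cl i)
    moreover have "\<Union>(range C) = UNIV"
    proof -
      have "\<exists>m. x \<in> C m" for x
      proof -
        obtain B where "\<forall>n. norm (F n x) \<le> B" using pw by blast
        then have "x \<in> C (nat \<lceil>B\<rceil>)" unfolding C_def
          by (auto intro: order_trans[OF _ real_nat_ceiling_ge])
        then show ?thesis by blast
      qed
      then show ?thesis by blast
    qed
    ultimately show False by simp
  qed
  then obtain m x r where r: "r > 0" "cball x r \<subseteq> C m"
    by (metis all_not_in_conv mem_interior_cball)
  \<comment> \<open>A vector of the ball about 0 is the difference of two points of
    \<open>cball x r\<close>, hence the factor 2.\<close>
  have bd: "norm (F n z) \<le> 2 * real m" if "norm z \<le> r" for n z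
  proof -
    have "x + z \<in> C m" "x \<in> C m" using r that by (auto simp: subset_iff dist_norm)
    then have "norm (F n (x + z)) \<le> real m" "norm (F n x) \<le> real m" by (auto simp: C_def)
    moreover have "F n z = F n (x + z) - F n x"
      using F[of n] by (simp add: bounded_linear.linear linear_add)
    ultimately show ?thesis using norm_triangle_ineq4[of "F n (x + z)" "F n x"] by simp
  qed
  have "norm (F n z) \<le> (2 * real m / r) * norm z" for n z
  proof (cases "z = 0")
    case True
    then show ?thesis using F[of n] by (simp add: bounded_linear.linear linear_0)
  next
    case False
    have "norm (F n ((r / norm z) *\<^sub>R z)) \<le> 2 * real m"
      by (rule bd) (use False r in auto)
    also have "F n ((r / norm z) *\<^sub>R z) = (r / norm z) *\<^sub>R F n z"
      using F[of n] by (simp add: bounded_linear.linear linear_scale)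
    finally show ?thesis using False r by (simp add: field_simps)
  qed
  then show ?thesis by blast
qed

text \<open>The set where \<open>g t \<le> g 0 + e * t\<close> is closed, and its supremum can be
  pushed further unless it is \<open>c\<close>. Only increments to the right enter, because
  difference quotients of semigroup orbits are available only from that side.\<close>

lemma dini_nonincreasing:
  fixes g :: "real \<Rightarrow> real"
  assumes cont: "continuous_on {0..c} g" and c: "0 \<le> c"
    and dini: "\<And>t e. 0 \<le> t \<Longrightarrow> t < c \<Longrightarrow> e > 0 \<Longrightarrow> eventually (\<lambda>h. g (t + h) \<le> g t + e * h) (at_right 0)"
  shows "g c \<le> g 0"
proof -
  have "g c \<le> g 0 + e * c" if e: "e > 0" for e
  proof -
    define B where "B = {t\<in>{0..c}. g t \<le> g 0 + e * t}"
    have "closed B"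
      unfolding B_def
      by (rule continuous_on_closed_Collect_le) (intro cont continuous_intros closed_atLeastAtMost)+
    have "0 \<in> B" "bdd_above B" using c by (auto simp: B_def)
    define s where "s = Sup B"
    have sB: "s \<in> B"
      unfolding s_def using \<open>closed B\<close> \<open>0 \<in> B\<close> \<open>bdd_above B\<close> by (intro closed_contains_Sup) auto
    have "s = c"
    proof (rule ccontr)
      assume "s \<noteq> c"
      then have "0 \<le> s" "s < c" using sB by (auto simp: B_def)
      then have "eventually (\<lambda>h. g (s + h) \<le> g s + e * h) (at_right 0)" using dini e by blast
      then obtain d where d: "d > 0" "\<And>h. 0 < h \<Longrightarrow> h < d \<Longrightarrow> g (s + h) \<le> g s + e * h"
        unfolding eventually_at_right_field by auto
      define h where "h = min (d / 2) (c - s)"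
      have h: "0 < h" "h < d" "s + h \<le> c" using d(1) \<open>s < c\<close> by (auto simp: h_def)
      have "g (s + h) \<le> g 0 + e * (s + h)"
        using d(2)[OF h(1,2)] sB by (auto simp: B_def algebra_simps)
      then have "s + h \<in> B" using h \<open>0 \<le> s\<close> by (auto simp: B_def)
      then have "s + h \<le> s" unfolding s_def using \<open>bdd_above B\<close> by (rule cSup_upper)
      then show False using h by simp
    qed
    then show ?thesis using sB by (auto simp: B_def)
  qed
  note le = this
  show ?thesis
  proof (rule field_le_epsilon)
    fix e :: real assume "e > 0"
    have "e / (c + 1) * c \<le> e" using c \<open>e > 0\<close> by (simp add: field_simps)
    moreover have "g c \<le> g 0 + e / (c + 1) * c" by (rule le) (use c \<open>e > 0\<close> in auto)
    ultimately show "g c \<le> g 0 + e" by linarith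
  qed
qed

section \<open>The semigroup of a closed operator\<close>

text \<open>\<open>total\<close> states that the orthogonal complement of \<open>V\<close> is
  trivial; density of \<open>V\<close> is derived from it in \<open>closure_V\<close>.\<close>

locale densely_defined_closed_operator = closed_operator +
  assumes total: "(\<And>v. v \<in> V \<Longrightarrow> inner f v = 0) \<Longrightarrow> f = 0"
begin

lemma subspace_closure: "subspace (closure V)"
proof (intro subspaceI)
  show "0 \<in> closure V" using closure_subset[of V] by auto
next
  fix x y assume "x \<in> closure V" "y \<in> closure V"
  then obtain X Y where X: "\<And>n. X n \<in> V" "X \<longlonglongrightarrow> x" and Y: "\<And>n. Y n \<in> V" "Y \<longlonglongrightarrow> y"
    unfolding closure_sequential by blast
  have "(\<lambda>n. X n + Y n) \<longlonglongrightarrow> x + y" by (intro tendsto_add X Y)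
  then show "x + y \<in> closure V" unfolding closure_sequential
    by (intro exI[of _ "\<lambda>n. X n + Y n"]) (simp add: X Y)
next
  fix x and c :: real assume "x \<in> closure V"
  then obtain X where X: "\<And>n. X n \<in> V" "X \<longlonglongrightarrow> x"
    unfolding closure_sequential by blast
  have "(\<lambda>n. c *\<^sub>R X n) \<longlonglongrightarrow> c *\<^sub>R x" by (intro tendsto_intros X)
  then show "c *\<^sub>R x \<in> closure V" unfolding closure_sequential
    by (intro exI[of _ "\<lambda>n. c *\<^sub>R X n"]) (simp add: X)
qed

text \<open>The zero operator on \<open>closure V\<close> is closed, and its resolvent
  \<open>C.R 1\<close> is the orthogonal projection onto \<open>closure V\<close>. The remainder
  \<open>f - C.R 1 f\<close> is orthogonal to \<open>V\<close> and vanishes by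
  \<open>total\<close>.\<close>

lemma closure_V: "closure V = UNIV"
proof -
  have cl: "x \<in> closure V \<and> 0 = d"
    if X: "\<And>n. X n \<in> closure V" "X \<longlonglongrightarrow> x" "(\<lambda>n. 0) \<longlonglongrightarrow> d" for X x and d :: 'a
    using closed_sequentially[OF closed_closure X(1,2)] LIMSEQ_unique[OF X(3) tendsto_const] by blast
  have "closed_operator (closure V) (\<lambda>_. 0 :: 'a)"
    by (rule closed_operator.intro, rule subspace_closure, simp, simp, erule (2) cl)
  then interpret C: closed_operator "closure V" "\<lambda>_. 0 :: 'a" .
  have "f \<in> closure V" for f
  proof -
    have "f - C.R 1 f = 0"
    proof (rule total)
      fix v assume "v \<in> V"
      then have "v \<in> closure V" using closure_subset by blast
      from C.R_eq[OF zero_less_one this, of f] show "inner (f - C.R 1 f) v = 0"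
        by (simp only: inner_zero_left mult_zero_right)
    qed
    then have "f = C.R 1 f" by (rule eq_iff_diff_eq_0[THEN iffD2])
    then show ?thesis using C.R_V[OF zero_less_one, of f] by argo
  qed
  then show ?thesis by blast
qed

definition dom :: "'a set" where
  "dom = {u \<in> V. \<exists>g. \<forall>v\<in>V. inner (D u) (D v) = inner g v}"

text \<open>The operator associated with the form, \<open>D* D\<close>. The representing vector is
  unique by \<open>total\<close>.\<close>

definition A :: "'a \<Rightarrow> 'a" where
  "A u = (THE g. \<forall>v\<in>V. inner (D u) (D v) = inner g v)"

lemma A_unique:
  assumes "u \<in> V" "\<And>v. v \<in> V \<Longrightarrow> inner (D u) (D v) = inner g v"
  shows "u \<in> dom" "A u = g"
proof -
  show "u \<in> dom" using assms by (auto simp: dom_def)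
  show "A u = g" unfolding A_def
  proof (rule the_equality)
    fix g' assume "\<forall>v\<in>V. inner (D u) (D v) = inner g' v"
    then have "g' - g = 0" by (intro total) (use assms in \<open>simp add: inner_diff\<close>)
    then show "g' = g" by simp
  qed (use assms in auto)
qed

lemma dom_V: "u \<in> dom \<Longrightarrow> u \<in> V" by (simp add: dom_def)

lemma A_eq: "u \<in> dom \<Longrightarrow> v \<in> V \<Longrightarrow> inner (D u) (D v) = inner (A u) v"
  using A_unique(2) unfolding dom_def by blast

lemma A_add: "u \<in> dom \<Longrightarrow> v \<in> dom \<Longrightarrow> u + v \<in> dom \<and> A (u + v) = A u + A v"
  using A_unique[of "u + v" "A u + A v"] by (simp add: dom_V D_add inner_add A_eq)

lemma A_scale: "u \<in> dom \<Longrightarrow> c *\<^sub>R u \<in> dom \<and> A (c *\<^sub>R u) = c *\<^sub>R A u"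
  using A_unique[of "c *\<^sub>R u" "c *\<^sub>R A u"] by (simp add: dom_V D_scale A_eq)

lemma A_diff: "u \<in> dom \<Longrightarrow> v \<in> dom \<Longrightarrow> u - v \<in> dom \<and> A (u - v) = A u - A v"
  using A_unique[of "u - v" "A u - A v"] by (simp add: dom_V D_diff inner_diff A_eq)

lemma R_dom:
  assumes h: "h > 0"
  shows "R h f \<in> dom" "A (R h f) = (1 / h) *\<^sub>R (f - R h f)"
  using A_unique[OF R_V[OF h], of f "(1 / h) *\<^sub>R (f - R h f)"] R_eq[OF h, of _ f] h by simp_all

lemma R_inverse: "h > 0 \<Longrightarrow> u \<in> dom \<Longrightarrow> R h (u + h *\<^sub>R A u) = u"
  by (rule R_unique) (auto simp: solves_def dom_V A_eq)

lemma R_A_decomp: "h > 0 \<Longrightarrow> R h f + h *\<^sub>R A (R h f) = f"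
  by (simp add: R_dom)

lemma R_lin_contraction: "h > 0 \<Longrightarrow> lin_contraction (R h)"
  unfolding lin_contraction_def by (auto intro!: linearI simp: R_add R_scale R_contraction)

lemmas R_simps = lin_contraction_simps[OF R_lin_contraction]

text \<open>Applying \<open>R h\<close> to \<open>u + h A u\<close> gives
  \<open>R h u + h R h (A u) = u\<close>, while the resolvent equation for the datum
  \<open>u\<close> reads \<open>R h u + h A (R h u) = u\<close>.\<close>

lemma A_R: "h > 0 \<Longrightarrow> u \<in> dom \<Longrightarrow> A (R h u) = R h (A u)"
  using R_inverse[of h u] by (simp add: R_dom R_simps) (metis add_diff_cancel_left' scaleR_scaleR
      nonzero_divide_eq_eq order_less_irrefl scaleR_one)

text \<open>With \<open>x = R a (R b f)\<close> and \<open>y = x + b A x\<close> one has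
  \<open>(1 + a A) y = (1 + b A) (R b f) = f\<close>, so \<open>y = R a f\<close> and
  \<open>x = R b y\<close>. Here \<open>A x\<close> lies in the domain as a combination of
  \<open>R b f\<close> and \<open>x\<close>.\<close>

lemma R_commute:
  assumes a: "a > 0" and b: "b > 0"
  shows "R a (R b f) = R b (R a f)"
proof -
  define x where "x = R a (R b f)"
  have x: "x \<in> dom" "A x = (1 / a) *\<^sub>R (R b f - x)" using R_dom[OF a] by (auto simp: x_def)
  have Ax: "A x \<in> dom" unfolding x(2) using A_scale A_diff x R_dom[OF b] by blast
  define y where "y = x + b *\<^sub>R A x"
  have y: "y \<in> dom" "A y = A x + b *\<^sub>R A (A x)"
    using A_add[OF x(1)] A_scale[OF Ax] Ax by (auto simp: y_def)
  have e: "R b f = x + a *\<^sub>R A x" using x(2) a by simp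
  have Ae: "A (R b f) = A x + a *\<^sub>R A (A x)" unfolding e
    using A_add[OF x(1)] A_scale[OF Ax] Ax by auto
  have "y + a *\<^sub>R A y = R b f + b *\<^sub>R A (R b f)"
    unfolding y Ae unfolding e y_def by (simp add: algebra_simps)
  also have "\<dots> = f" using R_A_decomp[OF b] .
  finally have "R a f = y" using R_inverse[OF a y(1)] by simp
  then have "R b (R a f) = x" using R_inverse[OF b x(1)] by (simp add: y_def)
  then show ?thesis by (simp add: x_def)
qed

text \<open>The domain of the square of \<open>A\<close>, a dense set on which one resolvent step
  has an error of second order.\<close>

definition dom2 :: "'a set" where "dom2 = {u \<in> dom. A u \<in> dom}"

lemma R_dom2: "h > 0 \<Longrightarrow> u \<in> dom \<Longrightarrow> R h u \<in> dom2"
  unfolding dom2_def by (auto simp: A_R R_dom)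

text \<open>\<open>v\<close> itself competes in the minimisation that defines \<open>R h v\<close>,
  and its energy is just \<open>h * (norm (D v))^2\<close>.\<close>

lemma R_near_V: "h > 0 \<Longrightarrow> v \<in> V \<Longrightarrow> (norm (R h v - v))\<^sup>2 \<le> h * (norm (D v))\<^sup>2"
proof -
  assume h: "h > 0" and v: "v \<in> V"
  have "0 \<le> h * (norm (D (R h v)))\<^sup>2" "0 \<le> h * (norm (D (v - R h v)))\<^sup>2" using h by simp_all
  moreover have "energy h v v = energy h v (R h v) + (norm (v - R h v))\<^sup>2 + h * (norm (D (v - R h v)))\<^sup>2"
    by (rule energy_solves[OF R_solves[OF h] v])
  ultimately have "(norm (v - R h v))\<^sup>2 \<le> h * (norm (D v))\<^sup>2"
    unfolding energy_def by (simp add: norm_minus_commute)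
  then show ?thesis by (simp add: norm_minus_commute)
qed

lemma strong_continuity_at_0:
  assumes P: "\<And>h. h > 0 \<Longrightarrow> lin_contraction (P h)" and S: "closure S = UNIV"
    and lim: "\<And>v. v \<in> S \<Longrightarrow> ((\<lambda>h. P h v) \<longlongrightarrow> v) (at_right 0)"
  shows "((\<lambda>h. P h f) \<longlongrightarrow> f) (at_right (0::real))"
proof (rule tendstoI)
  fix e :: real assume "e > 0"
  then obtain v where v: "v \<in> S" "norm (v - f) < e / 3"
    using closure_UNIV_approx[OF S, of "e/3" f] by auto
  have "eventually (\<lambda>h. dist (P h v) v < e / 3) (at_right 0)"
    using lim[OF v(1)] \<open>e > 0\<close> by (intro tendstoD) auto
  then show "eventually (\<lambda>h. dist (P h f) f < e) (at_right 0)"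
    using eventually_at_right_less[of 0]
  proof eventually_elim
    case (elim h)
    have "P h f - f = P h (f - v) + (P h v - v) + (v - f)"
      using elim by (simp add: lin_contraction_simps[OF P])
    then have "norm (P h f - f) \<le> norm (P h (f - v)) + norm (P h v - v) + norm (v - f)"
      by (metis norm_triangle_ineq norm_triangle_le add_right_mono)
    also have "\<dots> < e / 3 + e / 3 + e / 3"
      using lin_contraction_simps(4)[OF P, of h "f - v"] elim v
      by (smt (verit) norm_minus_commute dist_norm)
    finally show ?case by (simp add: dist_norm)
  qed
qed

lemma R_tendsto: "((\<lambda>h. R h f) \<longlongrightarrow> f) (at_right 0)"
proof (rule strong_continuity_at_0[of R V, OF R_lin_contraction closure_V])
  fix v assume v: "v \<in> V"
  have "((\<lambda>h. sqrt h) \<longlongrightarrow> sqrt 0) (at_right 0)"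
    by (intro tendsto_intros)
  then have l: "((\<lambda>h. sqrt h * norm (D v)) \<longlongrightarrow> 0) (at_right 0)"
    by (intro tendsto_mult_left_zero) simp
  have e: "eventually (\<lambda>h. norm (R h v - v) \<le> sqrt h * norm (D v)) (at_right 0)"
    using eventually_at_right_less[of 0]
  proof eventually_elim
    case (elim h)
    have "(norm (R h v - v))\<^sup>2 \<le> (sqrt h * norm (D v))\<^sup>2"
      using R_near_V[OF elim v] elim by (simp add: power_mult_distrib)
    then show ?case by (rule power2_le_imp_le) (use elim in simp)
  qed
  have "((\<lambda>h. R h v - v) \<longlongrightarrow> 0) (at_right 0)"
    by (rule Lim_null_comparison[OF e l])
  then show "((\<lambda>h. R h v) \<longlongrightarrow> v) (at_right 0)" by (simp add: LIM_zero_iff)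
qed auto

text \<open>Two applications of \<open>R h\<close> land in \<open>dom2\<close>, and for small
  \<open>h\<close> each of them moves the vector only a little.\<close>

lemma closure_dom2: "closure dom2 = UNIV"
proof -
  have "f \<in> closure dom2" for f
  proof -
    have "\<exists>y\<in>dom2. dist y f < e" if e: "e > 0" for e
    proof -
      have "eventually (\<lambda>h. dist (R h f) f < e / 2) (at_right 0)"
        using e by (intro tendstoD[OF R_tendsto]) auto
      then have "eventually (\<lambda>h. h > 0 \<and> dist (R h f) f < e / 2) (at_right 0)"
        using eventually_at_right_less[of 0] by eventually_elim auto
      then obtain h where h: "h > 0" "norm (R h f - f) < e / 2"
        using eventually_happens'[OF trivial_limit_at_right_real] unfolding dist_norm by blast
      have "R h (R h f) - f = R h (R h f - f) + (R h f - f)" by (simp add: R_simps h)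
      then have "norm (R h (R h f) - f) \<le> norm (R h (R h f - f)) + norm (R h f - f)"
        by (metis norm_triangle_ineq)
      also have "\<dots> < e" using R_contraction[OF h(1), of "R h f - f"] h(2) by linarith
      finally show ?thesis using R_dom2[OF h(1) R_dom(1)[OF h(1)]] by (auto simp: dist_norm)
    qed
    then show ?thesis by (simp add: closure_approachable)
  qed
  then show ?thesis by blast
qed

text \<open>Since \<open>(1 + a A) (1 + b A) = (1 + (a + b) A) + a b A\<^sup>2\<close>, resolvents satisfy the semigroup
  law up to second order.\<close>

lemma R_add_mult:
  assumes a: "a > 0" and b: "b > 0" and u: "u \<in> dom2"
  shows "norm (R (a + b) u - R a (R b u)) \<le> a * b * norm (A (A u))"
proof -
  define x where "x = R a (R b u)"
  have ud: "u \<in> dom" "A u \<in> dom" using u by (auto simp: dom2_def)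
  have Ax: "A x = R a (R b (A u))" "A (A x) = R a (R b (A (A u)))" "x \<in> dom" "A x \<in> dom"
    using a b ud by (simp_all add: x_def A_R R_dom)
  have "R b u = x + a *\<^sub>R A x" using R_A_decomp[OF a, of "R b u"] by (simp add: x_def)
  moreover have "A (x + a *\<^sub>R A x) = A x + a *\<^sub>R A (A x)" using A_add A_scale Ax by auto
  ultimately have "x + a *\<^sub>R A x + b *\<^sub>R (A x + a *\<^sub>R A (A x)) = u"
    using R_A_decomp[OF b, of u] by simp
  then have "u - (a * b) *\<^sub>R A (A x) = x + (a + b) *\<^sub>R A x" by (auto simp: algebra_simps)
  then have "R (a + b) (u - (a * b) *\<^sub>R A (A x)) = x"
    using R_inverse[of "a + b" x] a b Ax by simp
  then have "R (a + b) u - x = (a * b) *\<^sub>R R (a + b) (A (A x))"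
    using a b by (simp add: R_simps algebra_simps)
  then have "norm (R (a + b) u - x) = a * b * norm (R (a + b) (A (A x)))" using a b by simp
  also have "\<dots> \<le> a * b * norm (A (A u))"
    using R_contraction[of "a + b" "A (A x)"] R_contraction[OF a, of "R b (A (A u))"] R_contraction[OF b, of "A (A u)"] a b
    unfolding Ax(2) by (intro mult_left_mono) auto
  finally show ?thesis by (simp add: x_def)
qed

section \<open>Implicit Euler schemes and their limit\<close>

definition euler :: "nat \<Rightarrow> real \<Rightarrow> 'a \<Rightarrow> 'a" where
  "euler k t = R (t / 2^k) ^^ (2^k)"

lemma euler_lin_contraction: "t > 0 \<Longrightarrow> lin_contraction (euler k t)"
  unfolding euler_def by (intro lin_contraction_funpow R_lin_contraction) simp

lemma euler_0: "euler 0 t = R t" by (simp add: euler_def)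

text \<open>Halving the step replaces each \<open>R (a + a)\<close> by two factors
  \<open>R a\<close>, at a cost of \<open>a^2 * norm (A (A u))\<close>. With
  \<open>a = t / 2^(k+1)\<close> the \<open>2^k\<close> replacements add up to
  \<open>t^2 / 4 * (1/2)^k\<close> times that norm.\<close>

lemma euler_step:
  assumes t: "t > 0" and u: "u \<in> dom2"
  shows "norm (euler k t u - euler (Suc k) t u) \<le> (t\<^sup>2 / 4 * norm (A (A u))) * (1/2)^k"
proof -
  define a where "a = t / 2 ^ Suc k"
  have a: "a > 0" "t / 2^k = a + a" using t by (auto simp: a_def)
  have "euler (Suc k) t = (R a ^^ 2) ^^ (2^k)"
    unfolding euler_def a_def funpow_mult by simp
  also have "R a ^^ 2 = R a \<circ> R a" by (simp add: numeral_2_eq_2)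
  finally have eS: "euler (Suc k) t = (R a \<circ> R a) ^^ (2^k)" .
  have "norm (euler k t u - euler (Suc k) t u) = norm ((R (a + a) ^^ (2^k)) u - ((R a \<circ> R a) ^^ (2^k)) u)"
    unfolding eS unfolding euler_def a(2) ..
  also have "\<dots> \<le> real (2^k) * norm (R (a + a) u - (R a \<circ> R a) u)"
    using a(1) R_commute[of "a + a" a]
    by (intro funpow_diff_le lin_contraction_comp R_lin_contraction) (metis add_pos_pos comp_apply)+
  also have "\<dots> \<le> real (2^k) * (a * a * norm (A (A u)))"
    using R_add_mult[OF a(1) a(1) u] by (intro mult_left_mono) auto
  also have "\<dots> = (t\<^sup>2 / 4 * norm (A (A u))) * (1/2)^k"
    by (simp add: a_def power2_eq_square field_simps)
  finally show ?thesis .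
qed

text \<open>For \<open>t < 0\<close> the value is the identity by convention, so that contractivity
  and linearity hold at every \<open>t\<close>.\<close>

definition T :: "real \<Rightarrow> 'a \<Rightarrow> 'a" where
  "T t f = (if t \<le> 0 then f else lim (\<lambda>k. euler k t f))"

lemma euler_tendsto: "t > 0 \<Longrightarrow> (\<lambda>k. euler k t f) \<longlonglongrightarrow> T t f"
proof -
  assume t: "t > 0"
  have "convergent (\<lambda>k. euler k t u)" if "u \<in> dom2" for u
    by (rule geometric_increments(1)) (rule euler_step[OF t that])
  then have "convergent (\<lambda>k. euler k t f)"
    by (rule lin_contraction_dense_convergent[of "\<lambda>k. euler k t" dom2 f, OF euler_lin_contraction[OF t] closure_dom2])
  then show ?thesis using t by (simp add: T_def convergent_LIMSEQ_iff)
qed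

lemma T_0 [simp]: "T 0 f = f" by (simp add: T_def)

lemma T_lin_contraction: "lin_contraction (T t)"
proof (cases "t > 0")
  case True
  note E = lin_contraction_simps[OF euler_lin_contraction[OF True]]
  show ?thesis unfolding lin_contraction_def
  proof (intro conjI allI linearI)
    fix x y :: 'a and c :: real
    show "T t (x + y) = T t x + T t y"
      by (rule LIMSEQ_unique[OF euler_tendsto[OF True]]) (unfold E, intro tendsto_intros euler_tendsto True)
    show "T t (c *\<^sub>R x) = c *\<^sub>R T t x"
      by (rule LIMSEQ_unique[OF euler_tendsto[OF True]]) (unfold E, intro tendsto_intros euler_tendsto True)
    show "norm (T t x) \<le> norm x"
      by (rule LIMSEQ_le_const2[OF tendsto_norm[OF euler_tendsto[OF True]]]) (use E in auto)
  qed
next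
  case False
  then have "T t = id" by (auto simp: T_def)
  then show ?thesis by (simp add: lin_contraction_id)
qed

lemmas T_simps = lin_contraction_simps[OF T_lin_contraction]

text \<open>At level \<open>k\<close>, \<open>R (a + b)\<close> and \<open>R a o R b\<close> differ
  on \<open>dom2\<close> by at most \<open>a * b * norm (A (A u))\<close>, where
  \<open>a = s / 2^k\<close> and \<open>b = t / 2^k\<close>; the sum of \<open>2^k\<close> such
  errors still tends to 0.\<close>

lemma T_add:
  assumes s: "s \<ge> 0" and t: "t \<ge> 0"
  shows "T (s + t) f = T s (T t f)"
proof (cases "s > 0 \<and> t > 0")
  case True
  then have s: "s > 0" and t: "t > 0" by auto
  have "T (s + t) f = (T s \<circ> T t) f"
  proof (rule lin_contraction_dense_eqI[OF T_lin_contraction lin_contraction_comp[OF T_lin_contraction T_lin_contraction] closure_dom2])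
    fix u assume u: "u \<in> dom2"
    have "norm (euler k (s + t) u - euler k s (euler k t u)) \<le> s * t * norm (A (A u)) * (1/2)^k" for k
    proof -
      define a b where "a = s / 2^k" and "b = t / 2^k"
      have ab: "a > 0" "b > 0" "(s + t) / 2^k = a + b" using s t by (auto simp: a_def b_def add_divide_distrib)
      have "(R a ^^ n) ((R b ^^ n) x) = ((R a \<circ> R b) ^^ n) x" for n x
      proof (induction n)
        case (Suc n)
        have "(R a ^^ n) (R b y) = R b ((R a ^^ n) y)" for y
          using ab by (intro funpow_commute_point) (auto simp: R_commute[of a b])
        then show ?case using Suc by simp
      qed simp
      then have "norm (euler k (s + t) u - euler k s (euler k t u)) =
         norm ((R (a + b) ^^ (2^k)) u - ((R a \<circ> R b) ^^ (2^k)) u)"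
        unfolding euler_def ab(3) by (simp add: a_def b_def)
      also have "\<dots> \<le> real (2^k) * norm (R (a + b) u - (R a \<circ> R b) u)"
        using ab by (intro funpow_diff_le lin_contraction_comp R_lin_contraction)
          (auto simp: R_commute[of "a + b" a] R_commute[of "a + b" b])
      also have "\<dots> \<le> real (2^k) * (a * b * norm (A (A u)))"
        using R_add_mult[OF ab(1,2) u] by (intro mult_left_mono) auto
      also have "\<dots> = s * t * norm (A (A u)) * (1/2)^k"
        by (simp add: a_def b_def field_simps)
      finally show ?thesis .
    qed
    then have "eventually (\<lambda>k. norm (euler k (s + t) u - euler k s (euler k t u)) \<le> s * t * norm (A (A u)) * (1/2)^k) sequentially"
      by (intro always_eventually allI) simp
    moreover have "(\<lambda>k. s * t * norm (A (A u)) * (1/2)^k) \<longlonglongrightarrow> s * t * norm (A (A u)) * 0"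
      by (rule tendsto_mult_left[OF LIMSEQ_power_zero]) simp
    then have "(\<lambda>k. s * t * norm (A (A u)) * (1/2)^k) \<longlonglongrightarrow> 0" by simp
    ultimately have 1: "(\<lambda>k. euler k (s + t) u - euler k s (euler k t u)) \<longlonglongrightarrow> 0"
      by (rule Lim_null_comparison)
    \<comment> \<open>The inner scheme is replaced by its limit before the outer limit is taken;
      contractivity of \<open>euler k s\<close> makes the error vanish.\<close>
    have "(\<lambda>k. euler k s (euler k t u - T t u)) \<longlonglongrightarrow> 0"
    proof (rule Lim_null_comparison)
      show "eventually (\<lambda>k. norm (euler k s (euler k t u - T t u)) \<le> norm (euler k t u - T t u)) sequentially"
        by (intro always_eventually allI lin_contraction_simps(4) euler_lin_contraction s)
      show "(\<lambda>k. norm (euler k t u - T t u)) \<longlonglongrightarrow> 0"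
        by (rule tendsto_norm_zero) (use euler_tendsto[OF t] in \<open>simp add: LIM_zero\<close>)
    qed
    then have "(\<lambda>k. (euler k (s + t) u - euler k s (euler k t u)) + euler k s (euler k t u - T t u) + euler k s (T t u)) \<longlonglongrightarrow> 0 + 0 + T s (T t u)"
      by (intro tendsto_add 1 euler_tendsto s)
    then have "(\<lambda>k. euler k (s + t) u) \<longlonglongrightarrow> T s (T t u)"
      by (simp add: lin_contraction_simps[OF euler_lin_contraction[OF s]])
    then show "T (s + t) u = (T s \<circ> T t) u"
      using LIMSEQ_unique[OF euler_tendsto[of "s + t"]] s t by simp
  qed
  then show ?thesis by simp
next
  case False
  then have "s = 0 \<or> t = 0" using assms by auto
  then show ?thesis by auto
qed

text \<open>The scheme is compared with powers of the identity: a single step of length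
  \<open>a\<close> moves \<open>u\<close> by \<open>a * norm (R a (A u))\<close> only.\<close>

lemma T_A_bound:
  assumes t: "t > 0" and u: "u \<in> dom"
  shows "norm (T t u - u) \<le> t * norm (A u)"
proof (rule LIMSEQ_le_const2)
  show "(\<lambda>k. norm (euler k t u - u)) \<longlonglongrightarrow> norm (T t u - u)"
    by (intro tendsto_intros euler_tendsto t)
  have "norm (euler k t u - u) \<le> t * norm (A u)" for k
  proof -
    define a where "a = t / 2^k"
    have a: "a > 0" using t by (simp add: a_def)
    have "norm (euler k t u - u) = norm ((R a ^^ (2^k)) u - (id ^^ (2^k)) u)"
      by (simp add: euler_def a_def id_funpow)
    also have "\<dots> \<le> real (2^k) * norm (R a u - id u)"
      by (intro funpow_diff_le R_lin_contraction a lin_contraction_id) simp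
    finally have 1: "norm (euler k t u - u) \<le> real (2^k) * norm (R a u - u)" by simp
    have "R a u - u = - (a *\<^sub>R R a (A u))"
      using R_A_decomp[OF a, of u] A_R[OF a u] by (simp add: algebra_simps)
    then have "norm (R a u - u) = a * norm (R a (A u))" using a by simp
    then have "real (2^k) * norm (R a u - u) = t * norm (R a (A u))" by (simp add: a_def)
    moreover have "t * norm (R a (A u)) \<le> t * norm (A u)" using R_contraction[OF a] t by simp
    ultimately show ?thesis using 1 by linarith
  qed
  then show "\<exists>N. \<forall>n\<ge>N. norm (euler n t u - u) \<le> t * norm (A u)" by blast
qed

lemma closure_dom: "closure dom = UNIV"
  using closure_mono[of dom2 dom] closure_dom2 by (auto simp: dom2_def)

lemma T_tendsto: "((\<lambda>t. T t f) \<longlongrightarrow> f) (at_right 0)"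
proof (rule strong_continuity_at_0[of T dom, OF T_lin_contraction closure_dom])
  fix v assume v: "v \<in> dom"
  have l: "((\<lambda>t. t * norm (A v)) \<longlongrightarrow> 0) (at_right 0)"
    by (rule tendsto_mult_left_zero) simp
  have e: "eventually (\<lambda>t. norm (T t v - v) \<le> t * norm (A v)) (at_right 0)"
    using eventually_at_right_less[of 0] by eventually_elim (rule T_A_bound[OF _ v])
  have "((\<lambda>t. T t v - v) \<longlongrightarrow> 0) (at_right 0)"
    by (rule Lim_null_comparison[OF e l])
  then show "((\<lambda>t. T t v) \<longlongrightarrow> v) (at_right 0)" by (simp add: LIM_zero_iff)
qed

text \<open>The sum of all refinements from level 0 on, where the scheme is the single resolvent
  \<open>R t\<close>. As the difference is of order \<open>t^2\<close>, \<open>T\<close> and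
  \<open>R\<close> have the same right derivative at 0 on \<open>dom2\<close>.\<close>

lemma T_R_diff:
  assumes t: "t > 0" and u: "u \<in> dom2"
  shows "norm (T t u - R t u) \<le> t\<^sup>2 / 2 * norm (A (A u))"
proof (rule LIMSEQ_le_const2)
  show "(\<lambda>k. norm (euler k t u - euler 0 t u)) \<longlonglongrightarrow> norm (T t u - R t u)"
    unfolding euler_0 by (intro tendsto_intros euler_tendsto t)
  have "norm (euler k t u - euler 0 t u) \<le> 2 * (t\<^sup>2 / 4 * norm (A (A u)))" for k
    by (rule geometric_increments(2)[of "\<lambda>k. euler k t u"]) (rule euler_step[OF t u])
  then show "\<exists>N. \<forall>k\<ge>N. norm (euler k t u - euler 0 t u) \<le> t\<^sup>2 / 2 * norm (A (A u))" by auto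
qed

text \<open>For the resolvent the difference quotient is exactly \<open>- R t (A u)\<close>, and
  \<open>T_R_diff\<close> leaves an error of order \<open>t\<close>.\<close>

lemma generator_dom2:
  assumes u: "u \<in> dom2"
  shows "((\<lambda>t. (1 / t) *\<^sub>R (T t u - u)) \<longlongrightarrow> - A u) (at_right 0)"
proof -
  have ud: "u \<in> dom" using u by (simp add: dom2_def)
  have lim: "((\<lambda>t. t / 2 * norm (A (A u))) \<longlongrightarrow> 0 / 2 * norm (A (A u))) (at_right 0)"
    by (intro tendsto_intros) simp
  have "((\<lambda>t. (1 / t) *\<^sub>R (T t u - R t u)) \<longlongrightarrow> 0) (at_right 0)"
  proof (rule Lim_null_comparison)
    show "eventually (\<lambda>t. norm ((1 / t) *\<^sub>R (T t u - R t u)) \<le> t / 2 * norm (A (A u))) (at_right 0)"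
      using eventually_at_right_less[of 0]
    proof eventually_elim
      case (elim t)
      have "norm ((1 / t) *\<^sub>R (T t u - R t u)) = (1 / t) * norm (T t u - R t u)" using elim by simp
      also have "\<dots> \<le> (1 / t) * (t\<^sup>2 / 2 * norm (A (A u)))"
        using T_R_diff[OF elim u] elim by (intro mult_left_mono) auto
      finally show ?case using elim by (simp add: power2_eq_square)
    qed
  qed (use lim in simp)
  then have "((\<lambda>t. (1 / t) *\<^sub>R (T t u - R t u) - R t (A u)) \<longlongrightarrow> 0 - A u) (at_right 0)"
    by (intro tendsto_diff R_tendsto)
  moreover have "eventually (\<lambda>t. (1 / t) *\<^sub>R (T t u - R t u) - R t (A u) = (1 / t) *\<^sub>R (T t u - u)) (at_right 0)"
    using eventually_at_right_less[of 0]
  proof eventually_elim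
    case (elim t)
    then show ?case by (simp add: R_dom ud scaleR_diff_right flip: A_R)
  qed
  ultimately show ?thesis using Lim_transform_eventually by force
qed

text \<open>\<open>R h u\<close> is in \<open>dom2\<close> and approximates \<open>u\<close> in the
  graph norm because \<open>A (R h u) = R h (A u)\<close>. By \<open>T_A_bound\<close> the
  difference quotients are continuous in this norm, uniformly in \<open>t\<close>.\<close>

lemma generator_dom:
  assumes u: "u \<in> dom"
  shows "((\<lambda>t. (1 / t) *\<^sub>R (T t u - u)) \<longlongrightarrow> - A u) (at_right 0)"
proof (rule tendstoI)
  fix e :: real assume e: "e > 0"
  have "eventually (\<lambda>h. dist (R h (A u)) (A u) < e / 3) (at_right 0)"
    using e by (intro tendstoD[OF R_tendsto]) auto
  then have "eventually (\<lambda>h. h > 0 \<and> dist (R h (A u)) (A u) < e / 3) (at_right 0)"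
    using eventually_at_right_less[of 0] by eventually_elim auto
  then obtain h where h: "h > 0" "norm (R h (A u) - A u) < e / 3"
    using eventually_happens'[OF trivial_limit_at_right_real] unfolding dist_norm by blast
  define g where "g = R h u"
  have g: "g \<in> dom2" "g \<in> dom" "A g = R h (A u)" using u h by (auto simp: g_def R_dom2 A_R R_dom)
  have Agu: "A (u - g) = A u - A g" "u - g \<in> dom" using A_diff[OF u g(2)] by auto
  have "eventually (\<lambda>t. dist ((1 / t) *\<^sub>R (T t g - g)) (- A g) < e / 3) (at_right 0)"
    using e by (intro tendstoD[OF generator_dom2[OF g(1)]]) auto
  then show "eventually (\<lambda>t. dist ((1 / t) *\<^sub>R (T t u - u)) (- A u) < e) (at_right 0)"
    using eventually_at_right_less[of 0]
  proof eventually_elim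
    case (elim t)
    have "norm ((1 / t) *\<^sub>R (T t (u - g) - (u - g))) = (1 / t) * norm (T t (u - g) - (u - g))"
      using elim(2) by simp
    also have "\<dots> \<le> (1 / t) * (t * norm (A (u - g)))"
      using T_A_bound[OF elim(2) Agu(2)] elim(2) by (intro mult_left_mono) auto
    also have "\<dots> = norm (A (u - g))" using elim(2) by simp
    also have "\<dots> < e / 3" using h(2) unfolding Agu(1) g(3) by (simp add: norm_minus_commute)
    finally have 1: "norm ((1 / t) *\<^sub>R (T t (u - g) - (u - g))) < e / 3" .
    have 2: "norm (A u - A g) < e / 3" using h(2) unfolding g(3) by (simp add: norm_minus_commute)
    have "(1 / t) *\<^sub>R (T t u - u) - (- A u) = (1 / t) *\<^sub>R (T t (u - g) - (u - g)) + ((1 / t) *\<^sub>R (T t g - g) - (- A g)) + (A u - A g)"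
      by (simp add: T_simps algebra_simps)
    then have "norm ((1 / t) *\<^sub>R (T t u - u) - (- A u)) \<le> norm ((1 / t) *\<^sub>R (T t (u - g) - (u - g))) + norm ((1 / t) *\<^sub>R (T t g - g) - (- A g)) + norm (A u - A g)"
      by (metis norm_triangle_ineq norm_triangle_le add_right_mono)
    also have "\<dots> < e / 3 + e / 3 + e / 3"
      using 1 2 elim(1) unfolding dist_norm by linarith
    finally show ?case by (simp add: dist_norm)
  qed
qed

text \<open>Let \<open>w\<close> solve \<open>w + A w = u - g\<close>. The difference
  \<open>z = u - w\<close> has right derivative \<open>z\<close> at 0 under the flow, which
  contractivity forbids for \<open>z \<noteq> 0\<close>, since \<open>inner (T t z - z) z\<close> is
  never positive.\<close>

lemma generator_converse:
  assumes lim: "((\<lambda>t. (1 / t) *\<^sub>R (T t u - u)) \<longlongrightarrow> g) (at_right 0)"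
  shows "u \<in> dom" "A u = - g"
proof -
  define w where "w = R 1 (u - g)"
  have w: "w \<in> dom" "A w = (u - g) - w" using R_dom[of 1] by (auto simp: w_def)
  define z where "z = u - w"
  have "((\<lambda>t. (1 / t) *\<^sub>R (T t u - u) - (1 / t) *\<^sub>R (T t w - w)) \<longlongrightarrow> g - (- A w)) (at_right 0)"
    by (intro tendsto_diff lim generator_dom w)
  then have "((\<lambda>t. (1 / t) *\<^sub>R (T t z - z)) \<longlongrightarrow> z) (at_right 0)"
    unfolding w z_def by (simp add: T_simps algebra_simps)
  then have "((\<lambda>t. inner ((1 / t) *\<^sub>R (T t z - z)) z) \<longlongrightarrow> inner z z) (at_right 0)"
    by (intro tendsto_intros)
  moreover have "eventually (\<lambda>t. inner ((1 / t) *\<^sub>R (T t z - z)) z \<le> 0) (at_right 0)"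
    using eventually_at_right_less[of 0]
  proof eventually_elim
    case (elim t)
    have "inner (T t z) z \<le> norm (T t z) * norm z" by (rule norm_cauchy_schwarz)
    also have "\<dots> \<le> norm z * norm z" by (intro mult_right_mono T_simps) auto
    finally have "inner (T t z - z) z \<le> 0" by (simp add: inner_diff power2_norm_eq_inner flip: power2_eq_square)
    then show ?case using elim by (simp add: mult_nonneg_nonpos divide_nonpos_pos)
  qed
  ultimately have "inner z z \<le> 0"
    by (intro tendsto_upperbound[OF _ _ trivial_limit_at_right_real]) auto
  then have "inner z z = 0" using inner_ge_zero[of z] by linarith
  then have "z = 0" by simp
  then show "u \<in> dom" "A u = - g" using w by (auto simp: z_def)
qed

text \<open>Convergence of \<open>X n + A (X n)\<close> passes through the continuous inverse
  \<open>R 1\<close> of \<open>1 + A\<close>.\<close>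

lemma A_closed:
  assumes X: "\<And>n. X n \<in> dom" "X \<longlonglongrightarrow> x" "(\<lambda>n. A (X n)) \<longlonglongrightarrow> y"
  shows "x \<in> dom" "A x = y"
proof -
  have "(\<lambda>n. X n + 1 *\<^sub>R A (X n)) \<longlonglongrightarrow> x + 1 *\<^sub>R y" by (intro tendsto_add tendsto_scaleR tendsto_const X)
  then have "(\<lambda>n. R 1 (X n + 1 *\<^sub>R A (X n))) \<longlonglongrightarrow> R 1 (x + 1 *\<^sub>R y)"
    by (rule lin_contraction_tendsto[OF R_lin_contraction[OF zero_less_one]])
  moreover have "(\<lambda>n. R 1 (X n + 1 *\<^sub>R A (X n))) = X" by (intro ext R_inverse X) simp
  ultimately have "X \<longlonglongrightarrow> R 1 (x + 1 *\<^sub>R y)" by (simp only:)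
  then have "R 1 (x + y) = x" unfolding scaleR_one by (rule LIMSEQ_unique[OF _ X(2)])
  then show "x \<in> dom" "A x = y" using R_dom[of 1 "x + y"] by auto
qed

lemma euler_dom:
  assumes t: "t > 0" and u: "u \<in> dom"
  shows "euler k t u \<in> dom" "A (euler k t u) = euler k t (A u)"
proof -
  define a where "a = t / 2^k"
  have a: "a > 0" using t by (simp add: a_def)
  have "(R a ^^ n) u \<in> dom \<and> A ((R a ^^ n) u) = (R a ^^ n) (A u)" for n
    by (induction n) (use a u in \<open>auto simp: R_dom(1) A_R\<close>)
  then show "euler k t u \<in> dom" "A (euler k t u) = euler k t (A u)"
    by (auto simp: euler_def a_def)
qed

lemma T_dom:
  assumes t: "t > 0" and u: "u \<in> dom"
  shows "T t u \<in> dom" "A (T t u) = T t (A u)"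
  using A_closed[of "\<lambda>k. euler k t u", OF euler_dom(1)[OF t u] euler_tendsto[OF t], of "T t (A u)"]
    euler_tendsto[OF t, of "A u"] by (auto simp: euler_dom[OF t u])

lemma D_norm_dom: "u \<in> dom \<Longrightarrow> (norm (D u))\<^sup>2 \<le> norm (A u) * norm u"
  using A_eq[of u u] norm_cauchy_schwarz[of "A u" u] by (simp add: dom_V power2_norm_eq_inner)

text \<open>By the interpolation inequality \<open>D_norm_dom\<close>, convergence in the graph norm
  of \<open>A\<close> entails convergence under \<open>D\<close>.\<close>

lemma D_tendsto_dom:
  assumes X: "\<And>n. X n \<in> dom" "X \<longlonglongrightarrow> x" "(\<lambda>n. A (X n)) \<longlonglongrightarrow> y"
  shows "(\<lambda>n. D (X n)) \<longlonglongrightarrow> D x"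
proof -
  have x: "x \<in> dom" "A x = y" using A_closed[OF X] by auto
  have "(\<lambda>n. (norm (D (X n) - D x))\<^sup>2) \<longlonglongrightarrow> 0"
  proof (rule Lim_null_comparison)
    have "(norm (D (X n) - D x))\<^sup>2 \<le> norm (A (X n) - A x) * norm (X n - x)" for n
      using D_norm_dom[of "X n - x"] A_diff[OF X(1) x(1), of n] D_diff[of "X n" x] X x by (simp add: dom_V)
    then show "eventually (\<lambda>n. norm ((norm (D (X n) - D x))\<^sup>2) \<le> norm (A (X n) - A x) * norm (X n - x)) sequentially"
      by (intro always_eventually) auto
    have "(\<lambda>n. norm (A (X n) - A x) * norm (X n - x)) \<longlonglongrightarrow> norm (y - A x) * norm (x - x)"
      by (intro tendsto_intros X)
    then show "(\<lambda>n. norm (A (X n) - A x) * norm (X n - x)) \<longlonglongrightarrow> 0" by simp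
  qed
  then have "(\<lambda>n. sqrt ((norm (D (X n) - D x))\<^sup>2)) \<longlonglongrightarrow> sqrt 0" by (rule tendsto_real_sqrt)
  then have "(\<lambda>n. norm (D (X n) - D x)) \<longlonglongrightarrow> 0" by simp
  then show ?thesis by (rule LIM_zero_cancel[OF tendsto_norm_zero_cancel])
qed

text \<open>In each step the squared norm loses at least \<open>2 * a\<close> times the new energy,
  and the energy does not increase from one step to the next. Hence \<open>2 * n * a\<close> times
  the last energy is at most \<open>(norm f)^2\<close>, for arbitrary \<open>f\<close>.\<close>

lemma euler_energy:
  assumes t: "t > 0"
  shows "euler k t f \<in> V" "2 * t * (norm (D (euler k t f)))\<^sup>2 \<le> (norm f)\<^sup>2"
proof -
  define a where "a = t / 2^k"
  have a: "a > 0" using t by (simp add: a_def)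
  have *: "(R a ^^ Suc n) f \<in> V \<and> (norm ((R a ^^ Suc n) f))\<^sup>2 + 2 * real (Suc n) * a * (norm (D ((R a ^^ Suc n) f)))\<^sup>2 \<le> (norm f)\<^sup>2" for n
  proof (induction n)
    case 0
    then show ?case using R_norm_energy[OF a, of f] by (simp add: R_V a)
  next
    case (Suc n)
    define x where "x = (R a ^^ Suc n) f"
    have x: "x \<in> V" "(norm x)\<^sup>2 + 2 * real (Suc n) * a * (norm (D x))\<^sup>2 \<le> (norm f)\<^sup>2"
      using Suc by (auto simp: x_def)
    \<comment> \<open>The difference \<open>x - R a x\<close> is an admissible test vector only
      because \<open>x\<close> is already in \<open>V\<close>; this is why the induction starts
      after the first step.\<close>
    have "0 \<le> inner (x - R a x) (x - R a x)" by simp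
    also have "\<dots> = a * inner (D (R a x)) (D x - D (R a x))"
      using R_eq[OF a, of "x - R a x" x] x R_V[OF a] by (simp add: D_diff)
    finally have "inner (D (R a x)) (D (R a x)) \<le> inner (D (R a x)) (D x)"
      using a by (simp add: inner_diff zero_le_mult_iff)
    also have "\<dots> \<le> norm (D (R a x)) * norm (D x)" by (rule norm_cauchy_schwarz)
    finally have "norm (D (R a x)) * norm (D (R a x)) \<le> norm (D (R a x)) * norm (D x)"
      by (simp add: power2_norm_eq_inner flip: power2_eq_square)
    then have "norm (D (R a x)) \<le> norm (D x)"
      by (cases "norm (D (R a x)) = 0") (auto simp: mult_le_cancel_left)
    then have "(norm (D (R a x)))\<^sup>2 \<le> (norm (D x))\<^sup>2" by (simp add: power_mono)
    then have "2 * real (Suc n) * a * (norm (D (R a x)))\<^sup>2 \<le> 2 * real (Suc n) * a * (norm (D x))\<^sup>2"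
      using a by (intro mult_left_mono) auto
    moreover have "(norm (R a x))\<^sup>2 + 2 * a * (norm (D (R a x)))\<^sup>2 \<le> (norm x)\<^sup>2"
      using R_norm_energy[OF a, of x] .
    moreover have "2 * real (Suc (Suc n)) * a * (norm (D (R a x)))\<^sup>2 = 2 * real (Suc n) * a * (norm (D (R a x)))\<^sup>2 + 2 * a * (norm (D (R a x)))\<^sup>2"
      by (simp add: algebra_simps)
    ultimately have "(norm (R a x))\<^sup>2 + 2 * real (Suc (Suc n)) * a * (norm (D (R a x)))\<^sup>2 \<le> (norm f)\<^sup>2"
      using x(2) by linarith
    then show ?case using R_V[OF a, of x] by (simp add: x_def)
  qed
  obtain n where n: "2^k = Suc n" by (metis not0_implies_Suc power_not_zero zero_neq_numeral)
  have "real (Suc n) * a = t" unfolding a_def n[symmetric] by simp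
  then have 2: "2 * real (Suc n) * a = 2 * t" by (simp only: mult.assoc)
  have e: "euler k t f = (R a ^^ Suc n) f" by (simp only: euler_def n a_def)
  show "euler k t f \<in> V" using *[of n] unfolding e by blast
  have "(norm (euler k t f))\<^sup>2 \<ge> 0" by simp
  then show "2 * t * (norm (D (euler k t f)))\<^sup>2 \<le> (norm f)\<^sup>2"
    using *[of n] unfolding 2 e by linarith
qed

lemma T_energy_dom:
  assumes t: "t > 0" and u: "u \<in> dom"
  shows "2 * t * (norm (D (T t u)))\<^sup>2 \<le> (norm u)\<^sup>2"
proof (rule LIMSEQ_le_const2)
  have "(\<lambda>k. D (euler k t u)) \<longlonglongrightarrow> D (T t u)"
    using D_tendsto_dom[of "\<lambda>k. euler k t u", OF euler_dom(1)[OF t u] euler_tendsto[OF t], of "T t (A u)"]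
      euler_tendsto[OF t, of "A u"] by (simp add: euler_dom[OF t u])
  then show "(\<lambda>k. 2 * t * (norm (D (euler k t u)))\<^sup>2) \<longlonglongrightarrow> 2 * t * (norm (D (T t u)))\<^sup>2"
    by (intro tendsto_intros)
  show "\<exists>N. \<forall>n\<ge>N. 2 * t * (norm (D (euler n t u)))\<^sup>2 \<le> (norm u)\<^sup>2"
    using euler_energy(2)[OF t] by blast
qed

text \<open>For domain vectors approximating \<open>f\<close>, the estimate of
  \<open>T_energy_dom\<close> applied to their differences makes the images under \<open>D\<close>
  Cauchy, and closedness puts the limit into \<open>V\<close>.\<close>

lemma T_energy:
  assumes t: "t > 0"
  shows "T t f \<in> V" "2 * t * (norm (D (T t f)))\<^sup>2 \<le> (norm f)\<^sup>2"
proof -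
  obtain X where X: "\<And>n. X n \<in> dom" "X \<longlonglongrightarrow> f"
    using closure_sequential[of f dom] closure_dom by auto
  have lim: "(\<lambda>n. T t (X n)) \<longlonglongrightarrow> T t f" by (rule lin_contraction_tendsto[OF T_lin_contraction X(2)])
  have TX: "T t (X n) \<in> dom" "T t (X n) \<in> V" for n using T_dom(1)[OF t X(1)] by (auto simp: dom_V)
  have "Cauchy (\<lambda>n. D (T t (X n)))"
  proof (rule CauchyI)
    fix e :: real assume e: "e > 0"
    have "Cauchy X" using X(2) Cauchy_convergent_iff convergent_def by blast
    then obtain M where M: "\<And>m n. m \<ge> M \<Longrightarrow> n \<ge> M \<Longrightarrow> norm (X m - X n) < sqrt (2 * t) * e"
      using e t unfolding Cauchy_iff by (metis mult_pos_pos real_sqrt_gt_zero zero_less_numeral)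
    have "norm (D (T t (X m)) - D (T t (X n))) < e" if "m \<ge> M" "n \<ge> M" for m n
    proof -
      have "2 * t * (norm (D (T t (X m - X n))))\<^sup>2 \<le> (norm (X m - X n))\<^sup>2"
        by (intro T_energy_dom t) (use A_diff X(1) in blast)
      also have "\<dots> < (sqrt (2 * t) * e)\<^sup>2"
        using M[OF that] by (intro power_strict_mono) auto
      also have "\<dots> = 2 * t * e\<^sup>2" using t by (simp add: power_mult_distrib)
      finally have "(norm (D (T t (X m - X n))))\<^sup>2 < e\<^sup>2" using t by simp
      then have "norm (D (T t (X m - X n))) < e" using e power_less_imp_less_base by fastforce
      then show ?thesis using D_diff[OF TX(2) TX(2)] by (simp add: T_simps)
    qed
    then show "\<exists>M. \<forall>m\<ge>M. \<forall>n\<ge>M. norm (D (T t (X m)) - D (T t (X n))) < e" by blast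
  qed
  then obtain d where d: "(\<lambda>n. D (T t (X n))) \<longlonglongrightarrow> d" using Cauchy_convergent_iff convergent_def by blast
  have TV: "T t f \<in> V" and Dd: "D (T t f) = d" using D_closed[OF TX(2) lim d] by auto
  show "T t f \<in> V" by (rule TV)
  show "2 * t * (norm (D (T t f)))\<^sup>2 \<le> (norm f)\<^sup>2"
  proof (rule LIMSEQ_le)
    show "(\<lambda>n. 2 * t * (norm (D (T t (X n))))\<^sup>2) \<longlonglongrightarrow> 2 * t * (norm (D (T t f)))\<^sup>2"
      unfolding Dd by (intro tendsto_intros d)
    show "(\<lambda>n. (norm (X n))\<^sup>2) \<longlonglongrightarrow> (norm f)\<^sup>2" by (intro tendsto_intros X)
    show "\<exists>N. \<forall>n\<ge>N. 2 * t * (norm (D (T t (X n))))\<^sup>2 \<le> (norm (X n))\<^sup>2"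
      using T_energy_dom[OF t X(1)] by blast
  qed
qed

section \<open>Invariance principles for the flow\<close>

text \<open>Positivity, conservation of the integral and stationarity of constants are all of this
  form, so that each of them need only be checked for a single resolvent.\<close>

lemma T_invariant_set:
  assumes C: "closed C" and R: "\<And>h x. h > 0 \<Longrightarrow> x \<in> C \<Longrightarrow> R h x \<in> C" and f: "f \<in> C"
  shows "T t f \<in> C"
proof (cases "t > 0")
  case True
  have "euler k t f \<in> C" for k
  proof -
    have "(R (t / 2^k) ^^ n) f \<in> C" for n
      by (induction n) (use f R True in auto)
    then show ?thesis by (simp add: euler_def)
  qed
  then show ?thesis using closed_sequentially[OF C _ euler_tendsto[OF True]] by blast
qed (use f in \<open>auto simp: T_def\<close>)

text \<open>If \<open>N x = x\<close>, then \<open>N\<close> does not increase the functional minimised by \<open>R h x\<close>.\<close>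

lemma T_fixed_points:
  assumes N: "\<And>x. x \<in> V \<Longrightarrow> N x \<in> V" "\<And>x. x \<in> V \<Longrightarrow> norm (D (N x)) \<le> norm (D x)"
    "\<And>x y. norm (N x - N y) \<le> norm (x - y)" and f: "N f = f"
  shows "N (T t f) = T t f"
proof -
  have "continuous_on UNIV N"
    unfolding continuous_on_iff dist_norm using N(3) by (meson le_less_trans)
  then have cl: "closed {x. N x = x}" by (intro closed_Collect_eq continuous_intros)
  have "R h x \<in> {x. N x = x}" if h: "h > 0" and x: "x \<in> {x. N x = x}" for h x
  proof -
    have "norm (x - N (R h x)) \<le> norm (x - R h x)" using N(3)[of x "R h x"] x by simp
    then have "(norm (x - N (R h x)))\<^sup>2 \<le> (norm (x - R h x))\<^sup>2" by (simp add: power_mono)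
    moreover have "h * (norm (D (N (R h x))))\<^sup>2 \<le> h * (norm (D (R h x)))\<^sup>2"
      using h N(2)[OF R_V[OF h]] by (simp add: power_mono)
    ultimately have "energy h x (N (R h x)) \<le> energy h x (R h x)" unfolding energy_def by linarith
    then show ?thesis using solves_minimizer_unique[OF h R_solves[OF h] N(1)[OF R_V[OF h]]] by simp
  qed
  then have "T t f \<in> {x. N x = x}" by (intro T_invariant_set cl) (use f in auto)
  then show ?thesis by simp
qed

text \<open>Testing the resolvent equation with \<open>v\<close> leaves no right-hand side.
  Conservation of the integral is the case of constant \<open>v\<close>.\<close>

lemma T_conserved:
  assumes "v \<in> V" "D v = 0"
  shows "inner (T t f) v = inner f v"
proof -
  have "T t f \<in> {x. inner x v = inner f v}"
  proof (rule T_invariant_set)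
    show "closed {x. inner x v = inner f v}" by (intro closed_Collect_eq continuous_intros)
    show "R h x \<in> {x. inner x v = inner f v}" if "h > 0" "x \<in> {x. inner x v = inner f v}" for h x
      using R_eq[OF that(1) assms(1), of x] that assms by (simp add: inner_diff)
  qed simp
  then show ?thesis by simp
qed

lemma T_fixed:
  assumes "v \<in> V" "D v = 0"
  shows "T t v = v"
proof -
  have "T t v \<in> {v}"
  proof (rule T_invariant_set)
    show "R h x \<in> {v}" if "h > 0" "x \<in> {v}" for h x
      using R_unique[of h v v] that assms by (simp add: solves_def)
  qed auto
  then show ?thesis by simp
qed

text \<open>\<open>S (R h x)\<close> solves the equation with datum \<open>S x\<close>, since
  \<open>S\<close> permutes the test space and preserves both sides. The case in view is
  multiplication by a complex unit, on functions and on derivatives.\<close>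

lemma T_commute_isometry:
  assumes S: "bounded_linear S" "\<And>x y. inner (S x) (S y) = inner x y" "S ` V = V"
    and S': "\<And>x. x \<in> V \<Longrightarrow> D (S x) = S' (D x)" "\<And>x y. inner (S' x) (S' y) = inner x y"
  shows "T t (S f) = S (T t f)"
proof (cases "t > 0")
  case True
  have R: "R h (S x) = S (R h x)" if h: "h > 0" for h x
  proof (rule R_unique[OF h])
    have "inner (S x - S (R h x)) v = h * inner (D (S (R h x))) (D v)" if "v \<in> V" for v
    proof -
      obtain w where w: "w \<in> V" "v = S w" using \<open>v \<in> V\<close> S(3) by blast
      have "inner (S x - S (R h x)) v = inner (x - R h x) w"
        unfolding w(2) by (simp add: S(2) flip: linear_diff[OF bounded_linear.linear[OF S(1)]])
      also have "\<dots> = h * inner (D (R h x)) (D w)" by (rule R_eq[OF h w(1)])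
      also have "\<dots> = h * inner (D (S (R h x))) (D v)"
        by (simp add: w S' R_V h)
      finally show ?thesis .
    qed
    then show "solves h (S x) (S (R h x))" using R_V[OF h, of x] S(3) by (auto simp: solves_def)
  qed
  have "(R a ^^ n) (S f) = S ((R a ^^ n) f)" if "a > 0" for a n
    by (induction n) (auto simp: R that)
  then have "(\<lambda>k. euler k t (S f)) = (\<lambda>k. S (euler k t f))" using True by (simp add: euler_def)
  moreover have "(\<lambda>k. S (euler k t f)) \<longlonglongrightarrow> S (T t f)"
    by (intro bounded_linear.tendsto[OF S(1)] euler_tendsto True)
  ultimately show ?thesis using euler_tendsto[OF True, of "S f"] LIMSEQ_unique by metis
qed (auto simp: T_def)

section \<open>Uniqueness of the semigroup with a given generator\<close>

text \<open>Factoring out the smaller time reduces continuity at any time, from either side, to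
  right continuity at 0 together with a bound on the time interval.\<close>

lemma orbit_continuous:
  fixes S :: "real \<Rightarrow> 'a \<Rightarrow> 'a"
  assumes lin: "\<And>t. t \<ge> 0 \<Longrightarrow> bounded_linear (S t)" and S0: "\<And>f. S 0 f = f"
    and add: "\<And>s t f. s \<ge> 0 \<Longrightarrow> t \<ge> 0 \<Longrightarrow> S (s + t) f = S s (S t f)"
    and cont: "((\<lambda>t. S t f) \<longlongrightarrow> f) (at_right 0)"
    and bound: "\<And>t x. 0 \<le> t \<Longrightarrow> t \<le> c \<Longrightarrow> norm (S t x) \<le> K * norm x"
  shows "continuous_on {0..c} (\<lambda>t. S t f)"
  unfolding continuous_on_iff
proof (intro ballI allI impI)
  fix t e :: real assume t: "t \<in> {0..c}" and e: "e > 0"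
  define K' where "K' = \<bar>K\<bar> + 1"
  have K': "K' > 0" "K \<le> K'" by (auto simp: K'_def)
  have "eventually (\<lambda>t. dist (S t f) f < e / K') (at_right 0)"
    using cont e K' by (intro tendstoD) auto
  then obtain d where d: "d > 0" "\<And>h. 0 < h \<Longrightarrow> h < d \<Longrightarrow> dist (S h f) f < e / K'"
    unfolding eventually_at_right_field by auto
  have *: "dist (S r f) (S s f) < e" if "0 \<le> s" "s \<le> r" "r \<le> c" "r - s < d" for r s
  proof (cases "r = s")
    case False
    then have h: "0 < r - s" using that by simp
    have "S r f - S s f = S s (S (r - s) f - f)"
      using add[of s "r - s" f] that lin[of s] by (simp add: bounded_linear.linear linear_diff)
    then have "norm (S r f - S s f) \<le> K * norm (S (r - s) f - f)"
      using bound[of s "S (r - s) f - f"] that by simp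
    also have "\<dots> \<le> K' * norm (S (r - s) f - f)" using K' by (intro mult_right_mono) auto
    also have "\<dots> < K' * (e / K')"
      using d(2)[OF h that(4)] K' by (intro mult_strict_left_mono) (auto simp: dist_norm)
    finally show ?thesis using K' by (simp add: dist_norm)
  qed (use e in simp)
  have "\<forall>x\<in>{0..c}. dist x t < d \<longrightarrow> dist (S x f) (S t f) < e"
  proof (intro ballI impI)
    fix x assume x: "x \<in> {0..c}" "dist x t < d"
    show "dist (S x f) (S t f) < e"
    proof (cases "t \<le> x")
      case True
      then show ?thesis using *[of t x] x t by (auto simp: dist_real_def)
    next
      case False
      then show ?thesis using *[of x t] x t by (auto simp: dist_real_def dist_commute)
    qed
  qed
  then show "\<exists>d>0. \<forall>x\<in>{0..c}. dist x t < d \<longrightarrow> dist (S x f) (S t f) < e" using d(1) by blast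
qed

text \<open>Without a bound near 0 there would be times tending to 0 whose operators have norms
  exceeding every \<open>n\<close>, although they converge pointwise to the identity; this
  contradicts \<open>uniform_boundedness\<close>. The semigroup law extends the bound to
  \<open>{0..c}\<close>.\<close>

lemma semigroup_locally_bounded:
  fixes S :: "real \<Rightarrow> 'a \<Rightarrow> 'a"
  assumes lin: "\<And>t. t \<ge> 0 \<Longrightarrow> bounded_linear (S t)" and S0: "\<And>f. S 0 f = f"
    and add: "\<And>s t f. s \<ge> 0 \<Longrightarrow> t \<ge> 0 \<Longrightarrow> S (s + t) f = S s (S t f)"
    and cont: "\<And>f. ((\<lambda>t. S t f) \<longlongrightarrow> f) (at_right 0)"
  shows "\<exists>K. \<forall>t x. 0 \<le> t \<longrightarrow> t \<le> c \<longrightarrow> norm (S t x) \<le> K * norm x"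
proof -
  \<comment> \<open>The same \<open>n\<close> bounds the norm and fixes the length of the time
    interval, so that the negation directly gives a sequence of times tending to 0.\<close>
  have "\<exists>n::nat. \<forall>t\<in>{0..inverse (real (Suc n))}. \<forall>x. norm (S t x) \<le> real n * norm x"
  proof (rule ccontr)
    assume "\<not> ?thesis"
    then have "\<forall>n::nat. \<exists>t. 0 \<le> t \<and> t \<le> inverse (real (Suc n)) \<and> (\<exists>x. real n * norm x < norm (S t x))"
      by (meson atLeastAtMost_iff not_le)
    then obtain \<tau> where \<tau>: "\<And>n. 0 \<le> \<tau> n" "\<And>n. \<tau> n \<le> inverse (real (Suc n))" "\<And>n. \<exists>x. real n * norm x < norm (S (\<tau> n) x)"
      by metis
    have "\<exists>B. \<forall>n. norm (S (\<tau> n) x) \<le> B" for x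
    proof -
      have "(\<lambda>n. S (\<tau> n) x) \<longlonglongrightarrow> x"
      proof (rule tendstoI)
        fix e :: real assume e: "e > 0"
        obtain d where d: "d > 0" "\<And>h. 0 < h \<Longrightarrow> h < d \<Longrightarrow> dist (S h x) x < e"
          using tendstoD[OF cont e, of x] unfolding eventually_at_right_field by auto
        have "eventually (\<lambda>n. inverse (real (Suc n)) < d) sequentially"
          using order_tendstoD(2)[OF LIMSEQ_inverse_real_of_nat d(1)] .
        then show "eventually (\<lambda>n. dist (S (\<tau> n) x) x < e) sequentially"
        proof eventually_elim
          case (elim n)
          show ?case
          proof (cases "\<tau> n = 0")
            case False
            then have "0 < \<tau> n" "\<tau> n < d" using \<tau>(1,2)[of n] elim by linarith+
            then show ?thesis by (rule d)
          qed (use e S0 in simp)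
        qed
      qed
      then have "Bseq (\<lambda>n. S (\<tau> n) x)" using convergent_def convergent_imp_Bseq by blast
      then show ?thesis unfolding Bseq_def by blast
    qed
    then obtain M where M: "\<And>n x. norm (S (\<tau> n) x) \<le> M * norm x"
      using uniform_boundedness[of "\<lambda>n. S (\<tau> n)"] lin \<tau>(1) by blast
    obtain n :: nat where n: "M \<le> real n" using real_arch_simple by blast
    obtain x where "real n * norm x < norm (S (\<tau> n) x)" using \<tau>(3) by blast
    also have "\<dots> \<le> M * norm x" by (rule M)
    also have "\<dots> \<le> real n * norm x" using n by (intro mult_right_mono) auto
    finally show False by simp
  qed
  then obtain n0 :: nat where n0: "\<And>t x. 0 \<le> t \<Longrightarrow> t \<le> inverse (real (Suc n0)) \<Longrightarrow> norm (S t x) \<le> real n0 * norm x"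
    unfolding Ball_def atLeastAtMost_iff by blast
  define \<delta> where "\<delta> = inverse (real (Suc n0))"
  \<comment> \<open>Raised to at least 1, so that \<open>M\<close> is also bounded by every power
    \<open>M ^ Suc n\<close>.\<close>
  define M where "M = real n0 + 1"
  have \<delta>: "\<delta> > 0" "M \<ge> 1" by (simp_all add: \<delta>_def M_def)
  have M: "norm (S t x) \<le> M * norm x" if "0 \<le> t" "t \<le> \<delta>" for t x
    using n0[of t x] that norm_ge_zero[of x] unfolding M_def \<delta>_def distrib_right by linarith
  have iter: "0 \<le> t \<Longrightarrow> t \<le> real n * \<delta> \<Longrightarrow> norm (S t x) \<le> M ^ n * norm x" for n t x
  proof (induction n arbitrary: t x)
    case 0
    then have "t = 0" by simp
    then show ?case by (simp add: S0)
  next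
    case (Suc n)
    show ?case
    proof (cases "t \<le> \<delta>")
      case True
      have "norm (S t x) \<le> M * norm x" using M Suc True by blast
      also have "\<dots> \<le> M ^ Suc n * norm x" using power_increasing[of 1 "Suc n" M] \<delta> by (intro mult_right_mono) auto
      finally show ?thesis .
    next
      case False
      have "S t x = S \<delta> (S (t - \<delta>) x)" using add[of \<delta> "t - \<delta>" x] False \<delta> by simp
      then have "norm (S t x) \<le> M * norm (S (t - \<delta>) x)" using M[of \<delta>] \<delta> by simp
      also have "\<dots> \<le> M * (M ^ n * norm x)"
        using Suc False \<delta> by (intro mult_left_mono Suc.IH) (auto simp: algebra_simps)
      finally show ?thesis by simp
    qed
  qed
  obtain n :: nat where n: "c / \<delta> \<le> real n" using real_arch_simple by blast
  then have "c \<le> real n * \<delta>" using \<delta> by (simp add: field_simps)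
  then have "\<forall>t x. 0 \<le> t \<longrightarrow> t \<le> c \<longrightarrow> norm (S t x) \<le> M ^ n * norm x" using iter by fastforce
  then show ?thesis by blast
qed

text \<open>The square norm of the difference of the two orbits of a domain element has derivative
  \<open>-2\<parallel>D w\<parallel>\<^sup>2\<close>.\<close>

lemma semigroup_unique:
  fixes S :: "real \<Rightarrow> 'a \<Rightarrow> 'a"
  assumes lin: "\<And>t. t \<ge> 0 \<Longrightarrow> bounded_linear (S t)" and S0: "\<And>f. S 0 f = f"
    and add: "\<And>s t f. s \<ge> 0 \<Longrightarrow> t \<ge> 0 \<Longrightarrow> S (s + t) f = S s (S t f)"
    and cont: "\<And>f. ((\<lambda>t. S t f) \<longlongrightarrow> f) (at_right 0)"
    and gen: "\<And>u. u \<in> dom \<Longrightarrow> ((\<lambda>t. (1 / t) *\<^sub>R (S t u - u)) \<longlongrightarrow> - A u) (at_right 0)"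
    and gen': "\<And>u g. ((\<lambda>t. (1 / t) *\<^sub>R (S t u - u)) \<longlongrightarrow> g) (at_right 0) \<Longrightarrow> u \<in> dom"
    and c: "c \<ge> 0"
  shows "S c f = T c f"
proof -
  have dom: "S c f = T c f" if f: "f \<in> dom" for f
  proof -
    define w where "w t = S t f - T t f" for t
    obtain K where K: "\<And>t x. 0 \<le> t \<Longrightarrow> t \<le> c \<Longrightarrow> norm (S t x) \<le> K * norm x"
      using semigroup_locally_bounded[OF lin S0 add cont, of c] by blast
    have "continuous_on {0..c} (\<lambda>t. T t f)"
      by (rule orbit_continuous[where K = 1])
        (auto simp: lin_contraction_bounded_linear T_lin_contraction T_add T_tendsto T_simps)
    moreover have "continuous_on {0..c} (\<lambda>t. S t f)"
      by (rule orbit_continuous[OF lin S0 add cont K])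
    ultimately have wc: "continuous_on {0..c} w" unfolding w_def by (intro continuous_intros)
    have "(norm (w c))\<^sup>2 \<le> (norm (w 0))\<^sup>2"
    proof (rule dini_nonincreasing[where g = "\<lambda>t. (norm (w t))\<^sup>2"])
      show "continuous_on {0..c} (\<lambda>t. (norm (w t))\<^sup>2)" by (intro continuous_intros wc)
      fix t e :: real assume t: "0 \<le> t" "t < c" and e: "e > 0"
      \<comment> \<open>\<open>S t\<close> commutes with the difference quotients at 0, so the orbit
        of a domain vector stays in the domain by \<open>gen'\<close>.\<close>
      have "((\<lambda>h. S t ((1 / h) *\<^sub>R (S h f - f))) \<longlongrightarrow> S t (- A f)) (at_right 0)"
        by (rule bounded_linear.tendsto[OF lin[OF t(1)] gen[OF f]])
      moreover have "eventually (\<lambda>h. S t ((1 / h) *\<^sub>R (S h f - f)) = (1 / h) *\<^sub>R (S h (S t f) - S t f)) (at_right 0)"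
        using eventually_at_right_less[of 0]
      proof eventually_elim
        case (elim h)
        have "S h (S t f) = S t (S h f)" using add[of h t f] add[of t h f] elim t by (simp add: add.commute)
        then show ?case using lin[OF t(1)] by (simp add: bounded_linear.linear linear_diff linear_scale)
      qed
      ultimately have "((\<lambda>h. (1 / h) *\<^sub>R (S h (S t f) - S t f)) \<longlongrightarrow> S t (- A f)) (at_right 0)"
        using Lim_transform_eventually by force
      then have Sd: "S t f \<in> dom" by (rule gen')
      have Td: "T t f \<in> dom" using T_dom(1)[of t f] f t by (cases "t = 0") auto
      have wd: "w t \<in> dom" "A (w t) = A (S t f) - A (T t f)" using A_diff[OF Sd Td] by (auto simp: w_def)
      have "((\<lambda>h. (1 / h) *\<^sub>R (S h (S t f) - S t f) - (1 / h) *\<^sub>R (T h (T t f) - T t f)) \<longlongrightarrow> - A (S t f) - (- A (T t f))) (at_right 0)"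
        by (intro tendsto_diff gen generator_dom Sd Td)
      moreover have "- A (S t f) - (- A (T t f)) = - A (w t)" by (simp add: wd)
      ultimately have d1: "((\<lambda>h. (1 / h) *\<^sub>R (S h (S t f) - S t f) - (1 / h) *\<^sub>R (T h (T t f) - T t f)) \<longlongrightarrow> - A (w t)) (at_right 0)"
        by simp
      have d2: "((\<lambda>h. S h (S t f) - T h (T t f) + w t) \<longlongrightarrow> S t f - T t f + w t) (at_right 0)"
        by (intro tendsto_intros cont T_tendsto)
      have "((\<lambda>h. inner ((1 / h) *\<^sub>R (S h (S t f) - S t f) - (1 / h) *\<^sub>R (T h (T t f) - T t f)) (S h (S t f) - T h (T t f) + w t)) \<longlongrightarrow> inner (- A (w t)) (S t f - T t f + w t)) (at_right 0)"
        by (intro tendsto_inner d1 d2)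
      moreover have "inner (- A (w t)) (S t f - T t f + w t) < e"
      proof -
        have "S t f - T t f = w t" by (simp add: w_def)
        then have "inner (- A (w t)) (S t f - T t f + w t) = - 2 * inner (A (w t)) (w t)" by (simp add: inner_add)
        moreover have "inner (A (w t)) (w t) = inner (D (w t)) (D (w t))" by (rule A_eq[symmetric]) (auto intro: wd dom_V)
        ultimately show ?thesis using e inner_ge_zero[of "D (w t)"] by linarith
      qed
      ultimately have "eventually (\<lambda>h. inner ((1 / h) *\<^sub>R (S h (S t f) - S t f) - (1 / h) *\<^sub>R (T h (T t f) - T t f)) (S h (S t f) - T h (T t f) + w t) < e) (at_right 0)"
        by (rule order_tendstoD)
      then show "eventually (\<lambda>h. (norm (w (t + h)))\<^sup>2 \<le> (norm (w t))\<^sup>2 + e * h) (at_right 0)"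
        using eventually_at_right_less[of 0]
      proof eventually_elim
        case (elim h)
        have wh: "S h (S t f) - T h (T t f) = w (t + h)"
          using add[of h t f] T_add[of h t f] elim t by (simp add: w_def add.commute)
        have "(1 / h) *\<^sub>R (S h (S t f) - S t f) - (1 / h) *\<^sub>R (T h (T t f) - T t f) = (1 / h) *\<^sub>R (w (t + h) - w t)"
          unfolding wh[symmetric] by (simp add: w_def algebra_simps)
        then have "inner ((1 / h) *\<^sub>R (w (t + h) - w t)) (w (t + h) + w t) < e" using elim(1) wh by simp
        then have "inner (w (t + h) - w t) (w (t + h) + w t) / h < e" by simp
        then have "inner (w (t + h) - w t) (w (t + h) + w t) < e * h" using elim(2) by (simp only: pos_divide_less_eq)
        moreover have "inner (w (t + h) - w t) (w (t + h) + w t) = (norm (w (t + h)))\<^sup>2 - (norm (w t))\<^sup>2"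
          unfolding power2_norm_eq_inner by (simp add: inner_add inner_diff inner_commute)
        ultimately show ?case by simp
      qed
    qed (rule c)
    then show ?thesis by (simp add: w_def S0)
  qed
  have "closed {x. S c x = T c x}"
    by (rule closed_Collect_eq[OF linear_continuous_on[OF lin[OF c]] lin_contraction_continuous[OF T_lin_contraction]])
  moreover have "dom \<subseteq> {x. S c x = T c x}" using dom by blast
  ultimately have "closure dom \<subseteq> {x. S c x = T c x}" by (simp only: closure_minimal)
  then show ?thesis unfolding closure_dom by blast
qed

end

section \<open>Square-integrable functions\<close>

text \<open>The disjoint union of all measures on \<open>'a\<close>: its \<open>L\<^sup>2\<close>-space provides a single Hilbert space
  type that contains \<open>L\<^sup>2(M)\<close> for every \<open>M\<close>.\<close>

definition total_measure :: "('a measure \<times> 'a) measure" where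
  "total_measure = measure_of (Sigma UNIV space) {A. A \<subseteq> Sigma UNIV space \<and> (\<forall>M. Pair M -` A \<in> sets M)}
    (\<lambda>A. \<integral>\<^sup>+M. emeasure M (Pair M -` A) \<partial>count_space UNIV)"

lemma sigma_algebra_total:
  "sigma_algebra (Sigma UNIV space) {A. A \<subseteq> Sigma UNIV space \<and> (\<forall>M :: 'a measure. Pair M -` A \<in> sets M)}"
  unfolding sigma_algebra_iff2
proof (intro conjI allI impI ballI)
  fix A assume A: "A \<in> {A. A \<subseteq> Sigma UNIV space \<and> (\<forall>M :: 'a measure. Pair M -` A \<in> sets M)}"
  have "Pair M -` (Sigma UNIV space - A) = space M - Pair M -` A" for M :: "'a measure" by auto
  then show "Sigma UNIV space - A \<in> {A. A \<subseteq> Sigma UNIV space \<and> (\<forall>M :: 'a measure. Pair M -` A \<in> sets M)}"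
    using A by auto
next
  fix A :: "nat \<Rightarrow> ('a measure \<times> 'a) set"
  assume A: "range A \<subseteq> {A. A \<subseteq> Sigma UNIV space \<and> (\<forall>M :: 'a measure. Pair M -` A \<in> sets M)}"
  then have "Pair M -` A i \<in> sets M" for M i by (auto simp: subset_iff)
  moreover have "Pair M -` (\<Union>i. A i) = (\<Union>i. Pair M -` A i)" for M by auto
  ultimately show "(\<Union>i. A i) \<in> {A. A \<subseteq> Sigma UNIV space \<and> (\<forall>M :: 'a measure. Pair M -` A \<in> sets M)}"
    using A by auto
qed auto

lemma space_total: "space total_measure = Sigma UNIV space"
  unfolding total_measure_def by (rule space_measure_of) auto

lemma sets_total: "sets total_measure = {A. A \<subseteq> Sigma UNIV space \<and> (\<forall>M. Pair M -` A \<in> sets M)}"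
  unfolding total_measure_def by (rule sigma_algebra.sets_measure_of_eq[OF sigma_algebra_total])

lemma emeasure_total:
  assumes "A \<in> sets total_measure"
  shows "emeasure total_measure A = (\<integral>\<^sup>+M. emeasure M (Pair M -` A) \<partial>count_space UNIV)"
proof (rule emeasure_measure_of[OF total_measure_def])
  show "countably_additive (sets total_measure) (\<lambda>A :: ('a measure \<times> 'a) set. \<integral>\<^sup>+M. emeasure M (Pair M -` A) \<partial>count_space UNIV)"
    unfolding countably_additive_def
  proof (intro allI impI)
    fix A :: "nat \<Rightarrow> ('a measure \<times> 'a) set"
    assume A: "range A \<subseteq> sets total_measure" "disjoint_family A"
    then have sA: "Pair M -` A i \<in> sets M" for M i by (auto simp: sets_total subset_iff)
    have "(\<Sum>i. \<integral>\<^sup>+M. emeasure M (Pair M -` A i) \<partial>count_space UNIV) =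
        (\<integral>\<^sup>+M. (\<Sum>i. emeasure M (Pair M -` A i)) \<partial>count_space UNIV)"
      by (rule nn_integral_suminf[symmetric]) simp
    also have "\<dots> = (\<integral>\<^sup>+M. emeasure M (Pair M -` (\<Union>i. A i)) \<partial>count_space UNIV)"
    proof (rule nn_integral_cong)
      fix M :: "'a measure"
      have "(\<Sum>i. emeasure M (Pair M -` A i)) = emeasure M (\<Union>i. Pair M -` A i)"
      proof (rule suminf_emeasure)
        show "range (\<lambda>i. Pair M -` A i) \<subseteq> sets M" using sA by blast
        show "disjoint_family (\<lambda>i. Pair M -` A i)"
          using A(2) unfolding disjoint_family_on_def by blast
      qed
      then show "(\<Sum>i. emeasure M (Pair M -` A i)) = emeasure M (Pair M -` (\<Union>i. A i))"
        by (simp add: vimage_UN)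
    qed
    finally show "(\<Sum>i. \<integral>\<^sup>+M. emeasure M (Pair M -` A i) \<partial>count_space UNIV) =
      (\<integral>\<^sup>+M. emeasure M (Pair M -` (\<Union>i. A i)) \<partial>count_space UNIV)" .
  qed
qed (use assms in \<open>auto simp: positive_def sets_total\<close>)

lemma measurable_Pair_total: "Pair M \<in> measurable M total_measure"
proof (rule measurableI)
  fix A assume A: "A \<in> sets (total_measure :: ('a measure \<times> 'a) measure)"
  then have "Pair M -` A \<in> sets M" by (auto simp: sets_total)
  then show "Pair M -` A \<inter> space M \<in> sets M" by auto
qed (auto simp: space_total)

lemma measurable_total_iff:
  fixes F :: "'a measure \<times> 'a \<Rightarrow> 'b"
  shows "F \<in> measurable total_measure N \<longleftrightarrow> (\<forall>M. (\<lambda>x. F (M, x)) \<in> measurable M N)"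
proof
  assume F: "F \<in> measurable total_measure N"
  show "\<forall>M. (\<lambda>x. F (M, x)) \<in> measurable M N"
    using measurable_compose[OF measurable_Pair_total F] by blast
next
  assume F: "\<forall>M. (\<lambda>x. F (M, x)) \<in> measurable M N"
  show "F \<in> measurable total_measure N"
  proof (rule measurableI)
    fix p :: "'a measure \<times> 'a" assume "p \<in> space total_measure"
    then show "F p \<in> space N" using F measurable_space[of "\<lambda>x. F (fst p, x)" "fst p" N "snd p"]
      by (cases p) (auto simp: space_total)
  next
    fix A assume A: "A \<in> sets N"
    have "Pair M -` (F -` A \<inter> space total_measure) = (\<lambda>x. F (M, x)) -` A \<inter> space M" for M
      by (auto simp: space_total)
    then show "F -` A \<inter> space total_measure \<in> sets total_measure"
      using F A by (auto simp: sets_total space_total intro: measurable_sets)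
  qed
qed

text \<open>Cut down to one component, the total measure is a copy of \<open>M\<close>; integrals
  over \<open>M\<close> thereby become integrals of functions supported in that component.\<close>

lemma density_total:
  "density total_measure (indicator ({M} \<times> space M)) = distr M total_measure (Pair M)"
proof (rule measure_eqI)
  fix A assume "A \<in> sets (density total_measure (indicator ({M} \<times> space M)))"
  then have A: "A \<in> sets total_measure" by simp
  have I: "{M} \<times> space M \<in> sets total_measure"
  proof -
    have "Pair M' -` ({M} \<times> space M) = (if M' = M then space M else {})" for M' by auto
    then show ?thesis by (auto simp: sets_total)
  qed
  have 1: "Pair M' -` ({M} \<times> space M \<inter> A) = (if M' = M then Pair M -` A else {})" for M'
    using A by (auto simp: sets_total)
  have "emeasure (density total_measure (indicator ({M} \<times> space M))) A = emeasure total_measure ({M} \<times> space M \<inter> A)"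
    using I A by (subst emeasure_density) (auto simp: nn_integral_indicator simp flip: indicator_inter_arith)
  also have "\<dots> = (\<integral>\<^sup>+M'. emeasure M' (Pair M' -` ({M} \<times> space M \<inter> A)) \<partial>count_space UNIV)"
    using I A by (intro emeasure_total) auto
  also have "\<dots> = (\<integral>\<^sup>+M'. emeasure M (Pair M -` A) * indicator {M} M' \<partial>count_space UNIV)"
    unfolding 1 by (intro nn_integral_cong) (auto simp: indicator_def)
  also have "\<dots> = emeasure M (Pair M -` A)" by (simp add: nn_integral_cmult_indicator)
  also have "Pair M -` A = Pair M -` A \<inter> space M" using A by (auto simp: sets_total)
  also have "emeasure M (Pair M -` A \<inter> space M) = emeasure (distr M total_measure (Pair M)) A"
    using A by (simp add: emeasure_distr measurable_Pair_total)
  finally show "emeasure (density total_measure (indicator ({M} \<times> space M))) A = emeasure (distr M total_measure (Pair M)) A" .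
qed simp

lemma single_in_sets_total: "{M} \<times> space M \<in> sets total_measure"
proof -
  have "Pair M' -` ({M} \<times> space M) = (if M' = M then space M else {})" for M' by auto
  then show ?thesis by (auto simp: sets_total)
qed

lemma
  fixes F :: "'a measure \<times> 'a \<Rightarrow> 'b::{banach, second_countable_topology}"
  assumes F: "F \<in> borel_measurable total_measure" and z: "\<And>M' x. M' \<noteq> M \<or> x \<notin> space M \<Longrightarrow> F (M', x) = 0"
  shows integral_total: "integral\<^sup>L total_measure F = integral\<^sup>L M (\<lambda>x. F (M, x))"
    and integrable_total: "integrable total_measure F \<longleftrightarrow> integrable M (\<lambda>x. F (M, x))"
proof -
  have e: "F = (\<lambda>p. indicator ({M} \<times> space M) p *\<^sub>R F p)"
    using z by (auto simp: indicator_def fun_eq_iff)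
  have d: "density total_measure (\<lambda>p. ennreal (indicator ({M} \<times> space M) p)) = distr M total_measure (Pair M)"
    using density_total[of M] by (simp only: ennreal_indicator)
  have m: "indicator ({M} \<times> space M) \<in> borel_measurable total_measure"
    by (rule borel_measurable_indicator[OF single_in_sets_total])
  have "integral\<^sup>L total_measure F = integral\<^sup>L (density total_measure (\<lambda>p. ennreal (indicator ({M} \<times> space M) p))) F"
    by (subst e, subst integral_density) (auto simp: m F)
  also have "\<dots> = integral\<^sup>L M (\<lambda>x. F (M, x))"
    unfolding d by (rule integral_distr[OF measurable_Pair_total F])
  finally show "integral\<^sup>L total_measure F = integral\<^sup>L M (\<lambda>x. F (M, x))" .
  have "integrable total_measure F \<longleftrightarrow> integrable (density total_measure (\<lambda>p. ennreal (indicator ({M} \<times> space M) p))) F"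
    by (subst e, subst integrable_density) (auto simp: m F)
  also have "\<dots> \<longleftrightarrow> integrable M (\<lambda>x. F (M, x))"
    unfolding d by (rule integrable_distr_eq[OF measurable_Pair_total F])
  finally show "integrable total_measure F \<longleftrightarrow> integrable M (\<lambda>x. F (M, x))" .
qed

section \<open>The Hilbert space of square-integrable functions\<close>

definition sqint :: "'a measure \<Rightarrow> ('a \<Rightarrow> complex) \<Rightarrow> bool" where
  "sqint M f \<longleftrightarrow> f \<in> borel_measurable M \<and> integrable M (\<lambda>x. (cmod (f x))\<^sup>2)"

lemma sqint_measurable [measurable_dest]: "sqint M f \<Longrightarrow> f \<in> borel_measurable M"
  by (simp add: sqint_def)

lemma sqint_bound:
  assumes "f \<in> borel_measurable M" "integrable M g" "\<And>x. x \<in> space M \<Longrightarrow> (cmod (f x))\<^sup>2 \<le> g x"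
  shows "sqint M f"
  unfolding sqint_def
proof
  show "integrable M (\<lambda>x. (cmod (f x))\<^sup>2)"
  proof (rule Bochner_Integration.integrable_bound[OF assms(2)])
    show "(\<lambda>x. (cmod (f x))\<^sup>2) \<in> borel_measurable M" using assms(1) by measurable
    show "AE x in M. norm ((cmod (f x))\<^sup>2) \<le> norm (g x)"
      using assms(3) by (intro AE_I2) (simp add: order_trans[OF _ abs_ge_self])
  qed
qed (rule assms)

lemma sqint_0 [simp]: "sqint M (\<lambda>_. 0)" by (simp add: sqint_def)

lemma sqint_scale: "sqint M f \<Longrightarrow> sqint M (\<lambda>x. c * f x)"
  unfolding sqint_def by (auto simp: norm_mult power_mult_distrib)

lemma norm_add_square_le: "(norm (a + b))\<^sup>2 \<le> 2 * (norm a)\<^sup>2 + 2 * (norm (b :: 'a::real_normed_vector))\<^sup>2"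
proof -
  have "(norm (a + b))\<^sup>2 \<le> (norm a + norm b)\<^sup>2" by (intro power_mono norm_triangle_ineq) auto
  also have "\<dots> \<le> 2 * (norm a)\<^sup>2 + 2 * (norm b)\<^sup>2"
    using sum_squares_bound[of "norm a" "norm b"] by (simp add: power2_sum)
  finally show ?thesis .
qed

lemma sqint_add: "sqint M f \<Longrightarrow> sqint M g \<Longrightarrow> sqint M (\<lambda>x. f x + g x)"
  by (rule sqint_bound[where g = "\<lambda>x. 2 * (cmod (f x))\<^sup>2 + 2 * (cmod (g x))\<^sup>2"])
    (auto simp: sqint_def norm_add_square_le)

lemma sqint_diff: "sqint M f \<Longrightarrow> sqint M g \<Longrightarrow> sqint M (\<lambda>x. f x - g x)"
  using sqint_add[of M f "\<lambda>x. - 1 * g x"] sqint_scale[of M g "- 1"] by simp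

lemma borel_measurable_cnj: "cnj \<in> borel_measurable borel"
  by (intro borel_measurable_continuous_onI continuous_intros)

lemma sqint_mult_cnj:
  assumes "sqint M f" "sqint M g"
  shows "integrable M (\<lambda>x. f x * cnj (g x))"
proof (rule Bochner_Integration.integrable_bound)
  show "integrable M (\<lambda>x. (cmod (f x))\<^sup>2 + (cmod (g x))\<^sup>2)"
    using assms by (auto simp: sqint_def)
  have "cmod (f x * cnj (g x)) \<le> (cmod (f x))\<^sup>2 + (cmod (g x))\<^sup>2" for x
  proof -
    have "0 \<le> cmod (f x) * cmod (g x)" by simp
    then show ?thesis
      using sum_squares_bound[of "cmod (f x)" "cmod (g x)"] unfolding norm_mult complex_mod_cnj mult.assoc by linarith
  qed
  then show "AE x in M. norm (f x * cnj (g x)) \<le> norm ((cmod (f x))\<^sup>2 + (cmod (g x))\<^sup>2)"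
    by auto
qed (intro borel_measurable_times measurable_compose[OF _ borel_measurable_cnj] sqint_measurable assms)

lemma sqint_Re_mult_cnj:
  assumes "sqint M f" "sqint M g"
  shows "integrable M (\<lambda>x. Re (f x * cnj (g x)))"
  using sqint_mult_cnj[OF assms] by (rule integrable_Re)

lemma sqint_cong_AE:
  assumes f: "sqint M f" and g: "g \<in> borel_measurable M" and e: "AE x in M. f x = g x"
  shows "sqint M g"
proof -
  have "AE x in M. (cmod (f x))\<^sup>2 = (cmod (g x))\<^sup>2" using e by eventually_elim simp
  then have "integrable M (\<lambda>x. (cmod (g x))\<^sup>2)"
    using f g integrable_cong_AE[of "\<lambda>x. (cmod (f x))\<^sup>2" M "\<lambda>x. (cmod (g x))\<^sup>2"] by (auto simp: sqint_def)
  then show ?thesis using g by (simp add: sqint_def)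
qed

lemma borel_measurable_Re_mult_cnj:
  "f \<in> borel_measurable M \<Longrightarrow> g \<in> borel_measurable M \<Longrightarrow> (\<lambda>x. Re (f x * cnj (g x))) \<in> borel_measurable M"
  by (intro measurable_compose[OF _ borel_measurable_Re] borel_measurable_times measurable_compose[OF _ borel_measurable_cnj])

quotient_type 'a l2 = "'a measure \<times> 'a \<Rightarrow> complex" / partial:
  "\<lambda>f g. sqint total_measure f \<and> sqint total_measure g \<and> (AE x in total_measure. f x = g x)"
proof (rule part_equivpI)
  show "\<exists>f :: 'a measure \<times> 'a \<Rightarrow> complex. sqint total_measure f \<and> sqint total_measure f \<and> (AE x in total_measure. f x = f x)"
    by (rule exI[of _ "\<lambda>_. 0"]) simp
  show "symp (\<lambda>f g :: 'a measure \<times> 'a \<Rightarrow> complex. sqint total_measure f \<and> sqint total_measure g \<and> (AE x in total_measure. f x = g x))"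
    by (rule sympI) (auto elim: eventually_mono)
  show "transp (\<lambda>f g :: 'a measure \<times> 'a \<Rightarrow> complex. sqint total_measure f \<and> sqint total_measure g \<and> (AE x in total_measure. f x = g x))"
  proof (rule transpI)
    fix f g h :: "'a measure \<times> 'a \<Rightarrow> complex"
    assume a: "sqint total_measure f \<and> sqint total_measure g \<and> (AE x in total_measure. f x = g x)"
      "sqint total_measure g \<and> sqint total_measure h \<and> (AE x in total_measure. g x = h x)"
    then have "AE x in total_measure. f x = g x" "AE x in total_measure. g x = h x" by auto
    then have "AE x in total_measure. f x = h x" by eventually_elim simp
    then show "sqint total_measure f \<and> sqint total_measure h \<and> (AE x in total_measure. f x = h x)" using a by auto
  qed
qed

instantiation l2 :: (type) real_vector
begin

lift_definition zero_l2 :: "'a l2" is "\<lambda>_. 0" by simp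

lift_definition plus_l2 :: "'a l2 \<Rightarrow> 'a l2 \<Rightarrow> 'a l2" is "\<lambda>f g x. f x + g x"
  by (auto intro: sqint_add)

lift_definition minus_l2 :: "'a l2 \<Rightarrow> 'a l2 \<Rightarrow> 'a l2" is "\<lambda>f g x. f x - g x"
  by (auto intro: sqint_diff)

lift_definition uminus_l2 :: "'a l2 \<Rightarrow> 'a l2" is "\<lambda>f x. - f x"
  using sqint_scale[of _ _ "- 1"] by auto

lift_definition scaleR_l2 :: "real \<Rightarrow> 'a l2 \<Rightarrow> 'a l2" is "\<lambda>c f x. complex_of_real c * f x"
  by (auto intro: sqint_scale)

instance
proof
  fix x y z :: "'a l2" and a b :: real
  show "x + y + z = x + (y + z)" by transfer (auto intro!: sqint_add simp: add.assoc)
  show "x + y = y + x" by transfer (auto intro!: sqint_add simp: add.commute)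
  show "0 + x = x" by transfer auto
  show "- x + x = 0" by transfer auto
  show "x - y = x + - y" by transfer (auto intro!: sqint_diff)
  show "a *\<^sub>R (x + y) = a *\<^sub>R x + a *\<^sub>R y"
    by transfer (auto intro!: sqint_add sqint_scale simp: distrib_left distrib_right)
  show "(a + b) *\<^sub>R x = a *\<^sub>R x + b *\<^sub>R x"
    by transfer (auto intro!: sqint_add sqint_scale simp: distrib_left distrib_right)
  show "a *\<^sub>R b *\<^sub>R x = (a * b) *\<^sub>R x"
    by transfer (auto intro!: sqint_scale simp: mult.assoc)
  show "1 *\<^sub>R x = x" by transfer auto
qed

end

text \<open>The inner product is the real part of the hermitian one, because the abstract theory is
  over the reals.\<close>

instantiation l2 :: (type) real_inner
begin

lift_definition inner_l2 :: "'a l2 \<Rightarrow> 'a l2 \<Rightarrow> real" is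
  "\<lambda>f g. LINT x|total_measure. Re (f x * cnj (g x))"
  by (rule integral_cong_AE) (auto simp: sqint_def)

definition norm_l2 :: "'a l2 \<Rightarrow> real" where "norm_l2 x = sqrt (inner x x)"
definition dist_l2 :: "'a l2 \<Rightarrow> 'a l2 \<Rightarrow> real" where "dist_l2 x y = norm (x - y)"
definition sgn_l2 :: "'a l2 \<Rightarrow> 'a l2" where "sgn_l2 x = x /\<^sub>R norm x"
definition uniformity_l2 :: "('a l2 \<times> 'a l2) filter" where
  "uniformity_l2 = (INF e\<in>{0<..}. principal {(x, y). dist x y < e})"
definition open_l2 :: "'a l2 set \<Rightarrow> bool" where
  "open_l2 U = (\<forall>x\<in>U. eventually (\<lambda>(x', y). x' = x \<longrightarrow> y \<in> U) uniformity)"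

instance
proof
  fix x y z :: "'a l2" and a b :: real and U :: "'a l2 set"
  show "dist x y = norm (x - y)" by (rule dist_l2_def)
  show "sgn x = x /\<^sub>R norm x" by (rule sgn_l2_def)
  show "uniformity = (INF e\<in>{0<..}. principal {(x :: 'a l2, y). dist x y < e})" by (rule uniformity_l2_def)
  show "open U \<longleftrightarrow> (\<forall>x\<in>U. \<forall>\<^sub>F (x', y) in uniformity. x' = x \<longrightarrow> y \<in> U)" by (rule open_l2_def)
  show "inner x y = inner y x" by transfer (simp add: mult.commute)
  show "inner (x + y) z = inner x z + inner y z"
  proof (transfer, goal_cases)
    case (1 x y z)
    then have "integrable total_measure (\<lambda>p. Re (x p * cnj (z p)))" "integrable total_measure (\<lambda>p. Re (y p * cnj (z p)))"
      using sqint_Re_mult_cnj by blast+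
    then have "(LINT p|total_measure. Re (x p * cnj (z p)) + Re (y p * cnj (z p))) =
      (LINT p|total_measure. Re (x p * cnj (z p))) + (LINT p|total_measure. Re (y p * cnj (z p)))"
      by (rule Bochner_Integration.integral_add)
    then show ?case by (simp only: distrib_right plus_complex.sel)
  qed
  show "inner (a *\<^sub>R x) y = a * inner x y"
  proof (transfer, goal_cases)
    case (1 a x y)
    have "Re (complex_of_real a * x p * cnj (y p)) = a * Re (x p * cnj (y p))" for p by (simp add: algebra_simps)
    then show ?case by simp
  qed
  show "0 \<le> inner x x" by transfer (auto intro!: Bochner_Integration.integral_nonneg simp: complex_mult_cnj)
  show "inner x x = 0 \<longleftrightarrow> x = 0"
  proof (transfer, goal_cases)
    case (1 x)
    then have x: "sqint total_measure x" by simp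
    have e: "Re (x p * cnj (x p)) = (cmod (x p))\<^sup>2" for p by (simp add: complex_norm_square[symmetric] del: of_real_power)
    have "(LINT p|total_measure. (cmod (x p))\<^sup>2) = 0 \<longleftrightarrow> (AE p in total_measure. (cmod (x p))\<^sup>2 = 0)"
      by (rule integral_nonneg_eq_0_iff_AE) (use x in \<open>auto simp: sqint_def\<close>)
    then show ?case unfolding e using x by simp
  qed
  show "norm x = sqrt (inner x x)" by (rule norm_l2_def)
qed

end

lemma norm_abs_l2:
  assumes f: "sqint total_measure f"
  shows "(norm (abs_l2 f))\<^sup>2 = (LINT x|total_measure. (cmod (f x))\<^sup>2)"
proof -
  have e: "Re (f p * cnj (f p)) = (cmod (f p))\<^sup>2" for p by (simp add: complex_norm_square[symmetric] del: of_real_power)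
  have "inner (abs_l2 f) (abs_l2 f) = (LINT p|total_measure. Re (f p * cnj (f p)))"
    using f by (subst inner_l2.abs_eq) auto
  then show ?thesis unfolding power2_norm_eq_inner[of "abs_l2 f"] e .
qed

lemma sqint_rep_l2: "sqint total_measure (rep_l2 h)"
  using Quotient_rep_reflp[OF Quotient_l2, of h] by auto

lemma abs_rep_l2: "abs_l2 (rep_l2 h) = h"
  using Quotient_abs_rep[OF Quotient_l2] .

lemma norm_rep_l2_diff:
  "(norm (h - k))\<^sup>2 = (LINT x|total_measure. (cmod (rep_l2 h x - rep_l2 k x))\<^sup>2)"
proof -
  have "h - k = abs_l2 (\<lambda>x. rep_l2 h x - rep_l2 k x)"
    using minus_l2.abs_eq[of "rep_l2 h" "rep_l2 k"] by (simp add: sqint_rep_l2 abs_rep_l2)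
  then show ?thesis using norm_abs_l2[OF sqint_diff[OF sqint_rep_l2[of h] sqint_rep_l2[of k]]] by simp
qed

lemma nn_integral_rep_l2_diff:
  "(\<integral>\<^sup>+x. ennreal ((cmod (rep_l2 h x - rep_l2 k x))\<^sup>2) \<partial>total_measure) = ennreal ((norm (h - k))\<^sup>2)"
  unfolding norm_rep_l2_diff using sqint_diff[OF sqint_rep_l2[of h] sqint_rep_l2[of k]]
  by (intro nn_integral_eq_integral) (auto simp: sqint_def)

text \<open>The Riesz-Fischer argument: almost everywhere convergence first, then Fatou's lemma for
  the norm distance to the pointwise limit.\<close>

lemma l2_rapid_convergent:
  fixes X :: "nat \<Rightarrow> 'a l2"
  assumes X: "\<And>k. norm (X (Suc k) - X k) \<le> (1/4)^k"
  shows "convergent X"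
proof -
  define d where "d k x = cmod (rep_l2 (X (Suc k)) x - rep_l2 (X k) x)" for k x
  have [measurable]: "rep_l2 h \<in> borel_measurable total_measure" for h :: "'a l2"
    using sqint_rep_l2 sqint_measurable by blast
  have [measurable]: "d k \<in> borel_measurable total_measure" for k unfolding d_def by measurable
  have "(\<integral>\<^sup>+x. (\<Sum>k. ennreal (4^k * (d k x)\<^sup>2)) \<partial>total_measure) = (\<Sum>k. \<integral>\<^sup>+x. ennreal (4^k * (d k x)\<^sup>2) \<partial>total_measure)"
    by (rule nn_integral_suminf) measurable
  \<comment> \<open>The weight \<open>4^k\<close> leaves room on both sides: each integral is at
    most \<open>4^k * (1/4)^(2 k) = (1/4)^k\<close>, and a weighted term below 1 forces
    \<open>d k x \<le> (1/2)^k\<close>.\<close>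
  also have "\<dots> \<le> (\<Sum>k. ennreal ((1/4)^k))"
  proof (rule suminf_le)
    fix k
    have "(\<integral>\<^sup>+x. ennreal (4^k * (d k x)\<^sup>2) \<partial>total_measure) = ennreal (4^k) * (\<integral>\<^sup>+x. ennreal ((d k x)\<^sup>2) \<partial>total_measure)"
      by (simp add: ennreal_mult nn_integral_cmult)
    also have "\<dots> = ennreal (4^k * (norm (X (Suc k) - X k))\<^sup>2)"
      unfolding d_def nn_integral_rep_l2_diff by (simp add: ennreal_mult)
    also have "\<dots> \<le> ennreal (4^k * ((1/4)^k)\<^sup>2)"
      using X[of k] by (intro ennreal_leI mult_left_mono power_mono) auto
    also have "(4::real)^k * ((1/4)^k)\<^sup>2 = (1/4)^k"
      by (simp add: power2_eq_square power_divide)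
    finally show "(\<integral>\<^sup>+x. ennreal (4^k * (d k x)\<^sup>2) \<partial>total_measure) \<le> ennreal ((1/4)^k)" .
  qed auto
  also have "\<dots> = ennreal (\<Sum>k. (1/4)^k)"
    by (rule suminf_ennreal2) (auto intro: summable_geometric)
  finally have "(\<integral>\<^sup>+x. (\<Sum>k. ennreal (4^k * (d k x)\<^sup>2)) \<partial>total_measure) < \<infinity>"
    by (simp add: le_less_trans)
  then have "AE x in total_measure. (\<Sum>k. ennreal (4^k * (d k x)\<^sup>2)) \<noteq> \<infinity>"
    by (intro nn_integral_noteq_infinite) auto
  then have conv: "AE x in total_measure. convergent (\<lambda>k. rep_l2 (X k) x)"
  proof eventually_elim
    case (elim x)
    have "summable (\<lambda>k. 4^k * (d k x)\<^sup>2)"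
      by (rule summable_suminf_not_top) (use elim in auto)
    then have "(\<lambda>k. 4^k * (d k x)\<^sup>2) \<longlonglongrightarrow> 0" by (rule summable_LIMSEQ_zero)
    then have "eventually (\<lambda>k. 4^k * (d k x)\<^sup>2 < 1) sequentially" by (rule order_tendstoD) simp
    then obtain N where N: "\<And>k. k \<ge> N \<Longrightarrow> 4^k * (d k x)\<^sup>2 < 1" by (auto simp: eventually_sequentially)
    have "norm (rep_l2 (X (Suc k)) x - rep_l2 (X k) x) \<le> (1/2)^k" if "k \<ge> N" for k
    proof -
      have "(2^k * d k x)\<^sup>2 < 1\<^sup>2" using N[OF that]
        by (simp add: power_mult_distrib) (simp add: power_mult[symmetric] power_mult mult.commute[of k])
      then have "2^k * d k x < 1" by (rule power_less_imp_less_base) simp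
      then show ?thesis by (simp add: d_def power_divide field_simps)
    qed
    then have "summable (\<lambda>k. rep_l2 (X (Suc k)) x - rep_l2 (X k) x)"
      by (intro summable_comparison_test[OF _ summable_geometric[of "1/2 :: real"]]) auto
    then have "convergent (\<lambda>n. \<Sum>k<n. rep_l2 (X (Suc k)) x - rep_l2 (X k) x)"
      by (simp add: summable_iff_convergent)
    then have "convergent (\<lambda>n. rep_l2 (X n) x - rep_l2 (X 0) x)"
      using sum_lessThan_telescope[of "\<lambda>n. rep_l2 (X n) x"] by simp
    then show ?case using convergent_add[OF _ convergent_const[of "rep_l2 (X 0) x"]] by fastforce
  qed
  define F where "F x = lim (\<lambda>k. rep_l2 (X k) x)" for x
  have Fm [measurable]: "F \<in> borel_measurable total_measure" unfolding F_def by measurable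
  have lim: "AE x in total_measure. (\<lambda>k. rep_l2 (X k) x) \<longlonglongrightarrow> F x"
    using conv by eventually_elim (simp add: F_def convergent_LIMSEQ_iff)
  have tail: "norm (X j - X k) \<le> 2 * (1/4)^k" if "k \<le> j" for j k
  proof -
    have "norm (X (k + i) - X k) \<le> (1/4)^k * (\<Sum>m<i. (1/4)^m)" for i
    proof (induction i)
      case (Suc i)
      have "norm (X (k + Suc i) - X k) \<le> norm (X (Suc (k + i)) - X (k + i)) + norm (X (k + i) - X k)"
        using norm_triangle_ineq[of "X (Suc (k + i)) - X (k + i)" "X (k + i) - X k"] by simp
      also have "\<dots> \<le> (1/4)^(k + i) + (1/4)^k * (\<Sum>m<i. (1/4)^m)"
        by (intro add_mono X Suc)
      finally show ?case by (simp add: algebra_simps power_add)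
    qed simp
    also have "(1/4::real)^k * (\<Sum>m<j - k. (1/4)^m) \<le> (1/4)^k * 2"
    proof (rule mult_left_mono)
      have "(\<Sum>m<j - k. (1/4::real)^m) \<le> (\<Sum>m. (1/4)^m)"
        by (rule sum_le_suminf) (auto intro: summable_geometric)
      also have "\<dots> \<le> 2" by (simp add: suminf_geometric)
      finally show "(\<Sum>m<j - k. (1/4::real)^m) \<le> 2" .
    qed simp
    finally show ?thesis using that by (simp add: mult.commute)
  qed
  \<comment> \<open>Fatou's lemma in the index \<open>j\<close>, with \<open>k\<close> fixed;
    \<open>tail\<close> bounds the norms uniformly in \<open>j\<close>.\<close>
  have bound: "(\<integral>\<^sup>+x. ennreal ((cmod (F x - rep_l2 (X k) x))\<^sup>2) \<partial>total_measure) \<le> ennreal ((2 * (1/4)^k)\<^sup>2)" for k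
  proof -
    have "(\<integral>\<^sup>+x. ennreal ((cmod (F x - rep_l2 (X k) x))\<^sup>2) \<partial>total_measure) =
        (\<integral>\<^sup>+x. liminf (\<lambda>j. ennreal ((cmod (rep_l2 (X j) x - rep_l2 (X k) x))\<^sup>2)) \<partial>total_measure)"
    proof (rule nn_integral_cong_AE)
      show "AE x in total_measure. ennreal ((cmod (F x - rep_l2 (X k) x))\<^sup>2) = liminf (\<lambda>j. ennreal ((cmod (rep_l2 (X j) x - rep_l2 (X k) x))\<^sup>2))"
        using lim
      proof eventually_elim
        case (elim x)
        have "(\<lambda>j. ennreal ((cmod (rep_l2 (X j) x - rep_l2 (X k) x))\<^sup>2)) \<longlonglongrightarrow> ennreal ((cmod (F x - rep_l2 (X k) x))\<^sup>2)"
          by (intro tendsto_ennrealI tendsto_intros elim)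
        then show ?case by (rule lim_imp_Liminf[OF trivial_limit_sequentially, symmetric])
      qed
    qed
    also have "\<dots> \<le> liminf (\<lambda>j. \<integral>\<^sup>+x. ennreal ((cmod (rep_l2 (X j) x - rep_l2 (X k) x))\<^sup>2) \<partial>total_measure)"
      by (rule nn_integral_liminf) measurable
    also have "\<dots> = liminf (\<lambda>j. ennreal ((norm (X j - X k))\<^sup>2))" by (simp add: nn_integral_rep_l2_diff)
    also have "\<dots> \<le> liminf (\<lambda>j. ennreal ((2 * (1/4)^k)\<^sup>2))"
    proof (rule Liminf_mono)
      show "eventually (\<lambda>j. ennreal ((norm (X j - X k))\<^sup>2) \<le> ennreal ((2 * (1/4)^k)\<^sup>2)) sequentially"
        using eventually_ge_at_top[of k] by eventually_elim (intro ennreal_leI power_mono tail norm_ge_zero)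
    qed
    also have "\<dots> = ennreal ((2 * (1/4)^k)\<^sup>2)" by (simp add: Liminf_const)
    finally show ?thesis .
  qed
  have diff: "sqint total_measure (\<lambda>x. F x - rep_l2 (X k) x)" for k
  proof -
    have "integrable total_measure (\<lambda>x. (cmod (F x - rep_l2 (X k) x))\<^sup>2)"
      by (rule integrableI_nonneg) (use le_less_trans[OF bound[of k]] in auto)
    then show ?thesis by (simp add: sqint_def)
  qed
  have F: "sqint total_measure F" using sqint_add[OF diff[of 0] sqint_rep_l2[of "X 0"]] by simp
  have "norm (X k - abs_l2 F) \<le> 2 * (1/4)^k" for k
  proof -
    have "abs_l2 F - X k = abs_l2 (\<lambda>x. F x - rep_l2 (X k) x)"
      using minus_l2.abs_eq[of F "rep_l2 (X k)"] by (simp add: sqint_rep_l2 abs_rep_l2 F)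
    then have "ennreal ((norm (abs_l2 F - X k))\<^sup>2) = ennreal (LINT x|total_measure. (cmod (F x - rep_l2 (X k) x))\<^sup>2)"
      using norm_abs_l2[OF diff] by simp
    also have "\<dots> = (\<integral>\<^sup>+x. ennreal ((cmod (F x - rep_l2 (X k) x))\<^sup>2) \<partial>total_measure)"
      by (rule nn_integral_eq_integral[symmetric]) (use diff[of k] in \<open>auto simp: sqint_def\<close>)
    also have "\<dots> \<le> ennreal ((2 * (1/4)^k)\<^sup>2)" by (rule bound)
    finally have "(norm (abs_l2 F - X k))\<^sup>2 \<le> (2 * (1/4)^k)\<^sup>2" by simp
    then have "norm (abs_l2 F - X k) \<le> 2 * (1/4)^k" by (rule power2_le_imp_le) simp
    then show ?thesis by (simp add: norm_minus_commute)
  qed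
  moreover have "(\<lambda>k. 2 * (1/4)^k) \<longlonglongrightarrow> (0::real)"
    by (intro tendsto_mult_right_zero LIMSEQ_power_zero) simp
  ultimately have "(\<lambda>k. X k - abs_l2 F) \<longlonglongrightarrow> 0"
    by (rule Lim_null_comparison[OF always_eventually[OF allI]])
  then show ?thesis using LIM_zero_cancel convergent_def by blast
qed

instance l2 :: (type) banach
proof
  fix X :: "nat \<Rightarrow> 'a l2" assume C: "Cauchy X"
  have ex: "\<exists>N. \<forall>m\<ge>N. \<forall>n\<ge>N. norm (X m - X n) < (1/4)^k" for k :: nat
    using CauchyD[OF C, of "(1/4)^k"] by simp
  \<comment> \<open>Indices are chosen so that all later differences are below
    \<open>(1/4)^k\<close>; a Cauchy sequence converges as soon as this subsequence does.\<close>
  have "\<exists>r. \<forall>k. (\<forall>m\<ge>r k. \<forall>n\<ge>r k. norm (X m - X n) < (1/4)^k) \<and> r k < r (Suc k)"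
  proof (rule dependent_nat_choice)
    show "\<exists>x. \<forall>m\<ge>x. \<forall>n\<ge>x. norm (X m - X n) < (1/4)^0" by (rule ex)
    fix N n :: nat
    obtain M where M: "\<And>m k. m \<ge> M \<Longrightarrow> k \<ge> M \<Longrightarrow> norm (X m - X k) < (1/4)^Suc n"
      using ex[of "Suc n"] by (metis (no_types))
    show "\<exists>y. (\<forall>m\<ge>y. \<forall>k\<ge>y. norm (X m - X k) < (1/4)^Suc n) \<and> N < y"
      by (rule exI[of _ "max M (Suc N)"], intro conjI allI impI M) linarith+
  qed
  then obtain r where r: "\<And>k m n. m \<ge> r k \<Longrightarrow> n \<ge> r k \<Longrightarrow> norm (X m - X n) < (1/4)^k" "\<And>k. r k < r (Suc k)"
    by blast
  have "strict_mono r" using r(2) by (simp add: strict_mono_Suc_iff)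
  have "norm ((X \<circ> r) (Suc k) - (X \<circ> r) k) \<le> (1/4)^k" for k
    using r(1)[of k "r (Suc k)" "r k"] r(2)[of k] by simp
  then obtain l where "(X \<circ> r) \<longlonglongrightarrow> l" using l2_rapid_convergent[of "X \<circ> r"] by (auto simp: convergent_def)
  then have "X \<longlonglongrightarrow> l" by (rule Cauchy_converges_subseq[OF C \<open>strict_mono r\<close>])
  then show "convergent X" by (auto simp: convergent_def)
qed

section \<open>One measure inside the common Hilbert space\<close>

definition embed :: "'a measure \<Rightarrow> ('a \<Rightarrow> complex) \<Rightarrow> 'a measure \<times> 'a \<Rightarrow> complex" where
  "embed M f p = (if fst p = M \<and> snd p \<in> space M then f (snd p) else 0)"

text \<open>The isometric embedding of L2 of \<open>M\<close> as one summand of the common Hilbert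
  space; \<open>rp M\<close> picks a representative of the component of a vector in this
  summand.\<close>

definition cls :: "'a measure \<Rightarrow> ('a \<Rightarrow> complex) \<Rightarrow> 'a l2" where
  "cls M f = abs_l2 (embed M f)"

definition rp :: "'a measure \<Rightarrow> 'a l2 \<Rightarrow> 'a \<Rightarrow> complex" where
  "rp M h x = rep_l2 h (M, x)"

lemma sqint_embed:
  assumes f: "sqint M f"
  shows "sqint total_measure (embed M f)"
proof -
  have m: "embed M f \<in> borel_measurable total_measure"
    unfolding measurable_total_iff
  proof
    fix M' :: "'a measure"
    show "(\<lambda>x. embed M f (M', x)) \<in> borel_measurable M'"
    proof (cases "M' = M")
      case True
      have "(\<lambda>x. embed M f (M, x)) \<in> borel_measurable M \<longleftrightarrow> f \<in> borel_measurable M"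
        by (rule measurable_cong) (auto simp: embed_def)
      then show ?thesis using f True by (simp add: sqint_def)
    qed (simp add: embed_def)
  qed
  moreover have "integrable total_measure (\<lambda>p. (cmod (embed M f p))\<^sup>2)"
  proof (subst integrable_total[of _ M])
    show "integrable M (\<lambda>x. (cmod (embed M f (M, x)))\<^sup>2)"
      using f by (subst Bochner_Integration.integrable_cong[where g = "\<lambda>x. (cmod (f x))\<^sup>2"]) (auto simp: embed_def sqint_def)
    show "(\<lambda>p. (cmod (embed M f p))\<^sup>2) \<in> borel_measurable total_measure" using m by measurable
  qed (auto simp: embed_def)
  ultimately show ?thesis by (simp add: sqint_def)
qed

lemma sqint_rp: "sqint M (rp M h)"
proof -
  have m: "rp M h \<in> borel_measurable M"
    using sqint_measurable[OF sqint_rep_l2[of h]] unfolding measurable_total_iff rp_def by blast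
  define F where "F p = indicator ({M} \<times> space M) p *\<^sub>R rep_l2 h p" for p
  have F: "integrable total_measure (\<lambda>p. (cmod (F p))\<^sup>2)"
  proof (rule Bochner_Integration.integrable_bound)
    show "integrable total_measure (\<lambda>p. (cmod (rep_l2 h p))\<^sup>2)" using sqint_rep_l2 sqint_def by blast
    show "(\<lambda>p. (cmod (F p))\<^sup>2) \<in> borel_measurable total_measure"
      unfolding F_def
      by (intro borel_measurable_power measurable_compose[OF _ borel_measurable_norm] borel_measurable_scaleR
          sqint_measurable[OF sqint_rep_l2] borel_measurable_indicator[OF single_in_sets_total])
    show "AE p in total_measure. norm ((cmod (F p))\<^sup>2) \<le> norm ((cmod (rep_l2 h p))\<^sup>2)"
      by (auto simp: F_def indicator_def)
  qed
  have "integrable M (\<lambda>x. (cmod (F (M, x)))\<^sup>2)"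
    by (subst integrable_total[symmetric]) (use F in \<open>auto simp: F_def\<close>)
  then have "integrable M (\<lambda>x. (cmod (rp M h x))\<^sup>2)"
    by (subst Bochner_Integration.integrable_cong[where g = "\<lambda>x. (cmod (F (M, x)))\<^sup>2"]) (auto simp: F_def rp_def)
  then show ?thesis using m by (simp add: sqint_def)
qed

lemma inner_cls_right:
  assumes f: "sqint M f"
  shows "inner h (cls M f) = (LINT x|M. Re (rp M h x * cnj (f x)))"
proof -
  have "inner h (cls M f) = inner (abs_l2 (rep_l2 h)) (abs_l2 (embed M f))" by (simp add: abs_rep_l2 cls_def)
  also have "\<dots> = (LINT p|total_measure. Re (rep_l2 h p * cnj (embed M f p)))"
    using sqint_rep_l2[of h] sqint_embed[OF f] by (subst inner_l2.abs_eq) auto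
  also have "\<dots> = (LINT x|M. Re (rep_l2 h (M, x) * cnj (embed M f (M, x))))"
    by (rule integral_total[of _ M])
      (intro borel_measurable_Re_mult_cnj sqint_measurable sqint_rep_l2 sqint_embed f, auto simp: embed_def)
  also have "\<dots> = (LINT x|M. Re (rp M h x * cnj (f x)))"
    by (rule Bochner_Integration.integral_cong) (auto simp: embed_def rp_def)
  finally show ?thesis .
qed

lemma inner_cls:
  assumes f: "sqint M f" and g: "sqint M g"
  shows "inner (cls M f) (cls M g) = (LINT x|M. Re (f x * cnj (g x)))"
proof -
  have "inner (cls M f) (cls M g) = (LINT p|total_measure. Re (embed M f p * cnj (embed M g p)))"
    unfolding cls_def using sqint_embed[OF g] sqint_embed[OF f] by (subst inner_l2.abs_eq) auto
  also have "\<dots> = (LINT x|M. Re (embed M f (M, x) * cnj (embed M g (M, x))))"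
    by (rule integral_total[of _ M])
      (intro borel_measurable_Re_mult_cnj sqint_measurable sqint_embed f g, auto simp: embed_def)
  also have "\<dots> = (LINT x|M. Re (f x * cnj (g x)))"
    by (rule Bochner_Integration.integral_cong) (auto simp: embed_def)
  finally show ?thesis .
qed

lemma Re_mult_cnj_self: "Re (z * cnj z) = (cmod z)\<^sup>2"
  by (simp add: complex_norm_square[symmetric] del: of_real_power)

lemma norm_cls: "sqint M f \<Longrightarrow> (norm (cls M f))\<^sup>2 = (LINT x|M. (cmod (f x))\<^sup>2)"
  unfolding power2_norm_eq_inner[of "cls M f"] by (simp only: inner_cls Re_mult_cnj_self)

lemma cls_add: "sqint M f \<Longrightarrow> sqint M g \<Longrightarrow> cls M (\<lambda>x. f x + g x) = cls M f + cls M g"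
  unfolding cls_def using plus_l2.abs_eq[of "embed M f" "embed M g"]
  by (simp add: sqint_embed) (rule arg_cong[where f = abs_l2], auto simp: embed_def)

lemma cls_diff: "sqint M f \<Longrightarrow> sqint M g \<Longrightarrow> cls M (\<lambda>x. f x - g x) = cls M f - cls M g"
  unfolding cls_def using minus_l2.abs_eq[of "embed M f" "embed M g"]
  by (simp add: sqint_embed) (rule arg_cong[where f = abs_l2], auto simp: embed_def)

lemma cls_scaleR: "sqint M f \<Longrightarrow> cls M (\<lambda>x. complex_of_real c * f x) = c *\<^sub>R cls M f"
  unfolding cls_def using scaleR_l2.abs_eq[of "embed M f" c]
  by (simp add: sqint_embed) (rule arg_cong[where f = abs_l2], auto simp: embed_def)

lemma norm_cls_diff: "sqint M f \<Longrightarrow> sqint M g \<Longrightarrow> (norm (cls M f - cls M g))\<^sup>2 = (LINT x|M. (cmod (f x - g x))\<^sup>2)"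
  by (simp add: norm_cls sqint_diff flip: cls_diff)

lemma cls_eq_iff:
  assumes f: "sqint M f" and g: "sqint M g"
  shows "cls M f = cls M g \<longleftrightarrow> (AE x in M. f x = g x)"
proof -
  have "cls M f = cls M g \<longleftrightarrow> (norm (cls M f - cls M g))\<^sup>2 = 0" by simp
  also have "\<dots> \<longleftrightarrow> (AE x in M. (cmod (f x - g x))\<^sup>2 = 0)"
    unfolding norm_cls_diff[OF f g]
    by (rule integral_nonneg_eq_0_iff_AE) (use sqint_diff[OF f g] in \<open>auto simp: sqint_def\<close>)
  finally show ?thesis by simp
qed

text \<open>The orthogonal projection onto the range of \<open>cls M\<close>. Its fixed points are
  the vectors that come from functions on \<open>M\<close>.\<close>

definition proj :: "'a measure \<Rightarrow> 'a l2 \<Rightarrow> 'a l2" where "proj M h = cls M (rp M h)"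

lemma inner_proj: "sqint M f \<Longrightarrow> inner (proj M h) (cls M f) = inner h (cls M f)"
  unfolding proj_def[of M h] inner_cls_right[of M f h] inner_cls[OF sqint_rp] ..

lemma cls_eq_0I:
  assumes "sqint M f" "\<And>g. sqint M g \<Longrightarrow> inner (cls M f) (cls M g) = 0"
  shows "cls M f = 0"
  using assms(2)[OF assms(1)] by simp

lemma proj_cls [simp]:
  assumes f: "sqint M f"
  shows "proj M (cls M f) = cls M f"
proof -
  have "cls M (\<lambda>x. rp M (cls M f) x - f x) = 0"
  proof (rule cls_eq_0I)
    fix g assume g: "sqint M g"
    show "inner (cls M (\<lambda>x. rp M (cls M f) x - f x)) (cls M g) = 0"
      using inner_proj[OF g, of "cls M f"] by (simp add: cls_diff sqint_rp f inner_diff_left proj_def)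
  qed (intro sqint_diff sqint_rp f)
  then show ?thesis by (simp add: cls_diff sqint_rp f proj_def)
qed

lemma proj_proj [simp]: "proj M (proj M h) = proj M h"
  unfolding proj_def[of M h] by (rule proj_cls[OF sqint_rp])

text \<open>Two vectors of the range with the same inner products against the range coincide.
  Linearity and commutation with \<open>cscale\<close> are deduced from this.\<close>

lemma proj_eqI:
  assumes k: "proj M k = k" and *: "\<And>g. sqint M g \<Longrightarrow> inner h (cls M g) = inner k (cls M g)"
  shows "proj M h = k"
proof -
  have "proj M h - k = cls M (\<lambda>x. rp M h x - rp M k x)"
    using k by (simp add: cls_diff sqint_rp) (simp add: proj_def)
  moreover have "cls M (\<lambda>x. rp M h x - rp M k x) = 0"
  proof (rule cls_eq_0I)
    fix g assume g: "sqint M g"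
    show "inner (cls M (\<lambda>x. rp M h x - rp M k x)) (cls M g) = 0"
      using inner_proj[OF g, of h] inner_proj[OF g, of k] *[OF g]
      by (simp add: cls_diff sqint_rp inner_diff_left proj_def)
  qed (intro sqint_diff sqint_rp)
  ultimately show ?thesis by simp
qed

lemma proj_add: "proj M (h + k) = proj M h + proj M k"
proof (rule proj_eqI)
  have "proj M h + proj M k = cls M (\<lambda>x. rp M h x + rp M k x)" by (simp add: proj_def cls_add sqint_rp)
  then show "proj M (proj M h + proj M k) = proj M h + proj M k" by (simp add: sqint_add sqint_rp)
qed (simp add: inner_add_left inner_proj)

lemma proj_scaleR: "proj M (c *\<^sub>R h) = c *\<^sub>R proj M h"
proof (rule proj_eqI)
  have "c *\<^sub>R proj M h = cls M (\<lambda>x. complex_of_real c * rp M h x)" by (simp add: proj_def cls_scaleR sqint_rp)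
  then show "proj M (c *\<^sub>R proj M h) = c *\<^sub>R proj M h" by (simp add: sqint_scale sqint_rp)
qed (simp add: inner_proj)

lemma norm_proj_le: "norm (proj M h) \<le> norm h"
proof -
  have "norm (proj M h) * norm (proj M h) = inner (proj M h) (cls M (rp M h))"
    by (simp add: proj_def flip: power2_norm_eq_inner power2_eq_square)
  also have "\<dots> = inner h (proj M h)" by (simp add: inner_proj sqint_rp) (simp add: proj_def)
  also have "\<dots> \<le> norm h * norm (proj M h)" by (rule norm_cauchy_schwarz)
  finally show ?thesis by (cases "norm (proj M h) = 0") (auto simp: mult_le_cancel_right)
qed

lemma bounded_linear_proj: "bounded_linear (proj M)"
  by (rule bounded_linear_intro[where K = 1]) (auto simp: proj_add proj_scaleR norm_proj_le)

lemma proj_diff: "proj M (h - k) = proj M h - proj M k"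
  using bounded_linear.linear[OF bounded_linear_proj] by (rule linear_diff)

lemma rp_AE: "proj M h = cls M f \<Longrightarrow> sqint M f \<Longrightarrow> AE x in M. rp M h x = f x"
  unfolding proj_def by (simp add: cls_eq_iff sqint_rp)

section \<open>Complex scalars and the absolute value of the real part\<close>

text \<open>The complex structure, on top of the real one. Unit scalars act as isometries and so
  fall under \<open>T_commute_isometry\<close>.\<close>

lift_definition cscale :: "complex \<Rightarrow> 'a l2 \<Rightarrow> 'a l2" is "\<lambda>z f x. z * f x"
  by (auto intro: sqint_scale)

lemma cscale_cls: "sqint M f \<Longrightarrow> cscale z (cls M f) = cls M (\<lambda>x. z * f x)"
  unfolding cls_def using cscale.abs_eq[of "embed M f" z]
  by (simp add: sqint_embed) (rule arg_cong[where f = abs_l2], auto simp: embed_def)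

lemma inner_cscale: "inner (cscale z h) (cscale w k) = inner (cscale (z * cnj w) h) k"
  by transfer (simp add: algebra_simps)

lemma cscale_1: "cscale 1 h = h"
  by transfer simp

lemma cscale_cscale: "cscale z (cscale w h) = cscale (z * w) h"
  by transfer (auto intro: sqint_scale simp: mult.assoc)

lemma cscale_add: "cscale z (h + k) = cscale z h + cscale z k"
  by transfer (auto intro!: sqint_add sqint_scale simp: distrib_left distrib_right)

lemma cscale_of_real: "cscale (complex_of_real c) h = c *\<^sub>R h"
  by transfer (auto intro: sqint_scale)

lemma cscale_scaleR: "cscale z (c *\<^sub>R h) = c *\<^sub>R cscale z h"
  by (simp add: cscale_cscale mult.commute flip: cscale_of_real)

lemma inner_cscale_isometry: "cmod z = 1 \<Longrightarrow> inner (cscale z h) (cscale z k) = inner h k"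
  by (simp add: inner_cscale complex_norm_square[symmetric] cscale_1)

lemma norm_cscale_isometry: "cmod z = 1 \<Longrightarrow> norm (cscale z h) = norm h"
  by (simp add: norm_eq_sqrt_inner inner_cscale_isometry)

lemma bounded_linear_cscale: "cmod z = 1 \<Longrightarrow> bounded_linear (cscale z)"
  by (rule bounded_linear_intro[where K = 1]) (auto simp: cscale_add cscale_scaleR norm_cscale_isometry)

lemma proj_cscale: "proj M (cscale z h) = cscale z (proj M h)"
proof (rule proj_eqI)
  show "proj M (cscale z (proj M h)) = cscale z (proj M h)"
    unfolding proj_def[of M h] by (simp add: cscale_cls sqint_rp sqint_scale)
  fix g assume g: "sqint M g"
  have e: "inner (cscale z k) (cls M g) = inner k (cls M (\<lambda>x. cnj z * g x))" for k
    using inner_cscale[of 1 k "cnj z" "cls M g"] g by (simp add: cscale_1 cscale_cls)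
  show "inner (cscale z h) (cls M g) = inner (cscale z (proj M h)) (cls M g)"
    unfolding e using g by (simp add: inner_proj sqint_scale)
qed

text \<open>Its fixed points are the classes of non-negative real functions on \<open>M\<close>, so
  that positivity of the flow becomes an instance of \<open>T_fixed_points\<close>.\<close>

definition absr :: "'a measure \<Rightarrow> 'a l2 \<Rightarrow> 'a l2" where
  "absr M h = cls M (\<lambda>x. complex_of_real \<bar>Re (rp M h x)\<bar>)"

lemma sqint_abs_Re:
  assumes f: "sqint M f"
  shows "sqint M (\<lambda>x. complex_of_real \<bar>Re (f x)\<bar>)"
proof (rule sqint_bound[where g = "\<lambda>x. (cmod (f x))\<^sup>2"])
  show "(\<lambda>x. complex_of_real \<bar>Re (f x)\<bar>) \<in> borel_measurable M" using sqint_measurable[OF f] by measurable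
  show "(cmod (complex_of_real \<bar>Re (f x)\<bar>))\<^sup>2 \<le> (cmod (f x))\<^sup>2" for x
    using power_mono[OF abs_Re_le_cmod[of "f x"] abs_ge_zero, of 2] by (simp only: norm_of_real abs_abs)
qed (use f in \<open>auto simp: sqint_def\<close>)

lemma absr_cls:
  assumes f: "sqint M f"
  shows "absr M (cls M f) = cls M (\<lambda>x. complex_of_real \<bar>Re (f x)\<bar>)"
proof -
  have "AE x in M. rp M (cls M f) x = f x" using f by (intro rp_AE) auto
  then have "AE x in M. complex_of_real \<bar>Re (rp M (cls M f) x)\<bar> = complex_of_real \<bar>Re (f x)\<bar>"
    by eventually_elim simp
  then show ?thesis unfolding absr_def using f by (simp add: cls_eq_iff sqint_abs_Re sqint_rp)
qed

text \<open>Pointwise, absolute values of real parts are no farther apart than the numbers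
  themselves. Contractivity of \<open>proj M\<close> enters because \<open>absr M\<close> sees only
  the component in \<open>M\<close>.\<close>

lemma norm_absr_diff_le: "norm (absr M h - absr M k) \<le> norm (h - k)"
proof -
  have "(norm (absr M h - absr M k))\<^sup>2 = (LINT x|M. (cmod (complex_of_real \<bar>Re (rp M h x)\<bar> - complex_of_real \<bar>Re (rp M k x)\<bar>))\<^sup>2)"
    unfolding absr_def by (simp add: norm_cls_diff sqint_abs_Re sqint_rp)
  also have "\<dots> \<le> (LINT x|M. (cmod (rp M h x - rp M k x))\<^sup>2)"
  proof (rule integral_mono)
    show "integrable M (\<lambda>x. (cmod (complex_of_real \<bar>Re (rp M h x)\<bar> - complex_of_real \<bar>Re (rp M k x)\<bar>))\<^sup>2)"
      "integrable M (\<lambda>x. (cmod (rp M h x - rp M k x))\<^sup>2)"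
      using sqint_diff[OF sqint_abs_Re[OF sqint_rp[of M h]] sqint_abs_Re[OF sqint_rp[of M k]]] sqint_diff[OF sqint_rp[of M h] sqint_rp[of M k]]
      by (simp_all add: sqint_def)
    fix x
    have "cmod (complex_of_real \<bar>Re (rp M h x)\<bar> - complex_of_real \<bar>Re (rp M k x)\<bar>) = \<bar>\<bar>Re (rp M h x)\<bar> - \<bar>Re (rp M k x)\<bar>\<bar>"
      by (simp only: of_real_diff[symmetric] norm_of_real)
    also have "\<dots> \<le> \<bar>Re (rp M h x - rp M k x)\<bar>" by simp
    also have "\<dots> \<le> cmod (rp M h x - rp M k x)" by (rule abs_Re_le_cmod)
    finally show "(cmod (complex_of_real \<bar>Re (rp M h x)\<bar> - complex_of_real \<bar>Re (rp M k x)\<bar>))\<^sup>2 \<le> (cmod (rp M h x - rp M k x))\<^sup>2"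
      by (simp add: power_mono)
  qed
  also have "\<dots> = (norm (proj M h - proj M k))\<^sup>2" unfolding proj_def by (simp add: norm_cls_diff sqint_rp)
  also have "\<dots> \<le> (norm (h - k))\<^sup>2" using norm_proj_le[of M "h - k"] by (simp add: proj_diff power_mono)
  finally show ?thesis by (rule power2_le_imp_le) simp
qed

section \<open>Weak derivatives on intervals\<close>

lemma DERIV_imp_continuous_on:
  "(\<And>x. (f has_real_derivative f' x) (at x)) \<Longrightarrow> continuous_on S f"
  by (meson DERIV_isCont continuous_at_imp_continuous_on)

section \<open>Smooth cut-off functions\<close>

text \<open>Continued by 0, \<open>p (1 / x) * exp (- 1 / x)\<close> is flat at 0. Letting
  \<open>p\<close> vary makes the family closed under differentiation, which replaces
  \<open>p\<close> by \<open>y^2 * (p - p')\<close> in the variable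
  \<open>y = 1 / x\<close>.\<close>

definition flat_exp :: "real poly \<Rightarrow> real \<Rightarrow> real" where
  "flat_exp p x = (if x \<le> 0 then 0 else poly p (inverse x) * exp (- inverse x))"

lemma poly_exp_tendsto_0: "((\<lambda>y. poly p y * exp (- y)) \<longlongrightarrow> 0) (at_top :: real filter)"
proof -
  have "((\<lambda>y. \<Sum>i\<le>degree p. coeff p i * (y ^ i / exp y)) \<longlongrightarrow> (\<Sum>i\<le>degree p. coeff p i * 0)) (at_top :: real filter)"
    by (intro tendsto_sum tendsto_mult_left tendsto_power_div_exp_0)
  moreover have "(\<Sum>i\<le>degree p. coeff p i * (y ^ i / exp y)) = poly p y * exp (- y)" for y :: real
    unfolding poly_altdef sum_distrib_right by (intro sum.cong) (simp_all add: exp_minus divide_inverse)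
  ultimately show ?thesis by simp
qed

lemma flat_exp_deriv:
  "(flat_exp p has_real_derivative flat_exp (monom 1 2 * (p - pderiv p)) x) (at x)"
proof (cases x "0 :: real" rule: linorder_cases)
  case less
  have "((\<lambda>_. 0) has_real_derivative 0) (at x)" by simp
  then have "(flat_exp p has_real_derivative 0) (at x)"
    by (rule has_field_derivative_transform_within_open[where S = "{..<0}"]) (use less in \<open>auto simp: flat_exp_def\<close>)
  then show ?thesis using less by (simp add: flat_exp_def)
next
  case greater
  have "((\<lambda>x. poly p (inverse x) * exp (- inverse x)) has_real_derivative
      (poly (pderiv p) (inverse x) * (- (inverse x * 1 * inverse x)) * exp (- inverse x) +
       exp (- inverse x) * (- (- (inverse x * 1 * inverse x))) * poly p (inverse x))) (at x)"
    by (rule derivative_eq_intros refl DERIV_chain2[OF poly_DERIV] | use greater in simp)+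
  then have "(flat_exp p has_real_derivative
      (poly (pderiv p) (inverse x) * (- (inverse x * 1 * inverse x)) * exp (- inverse x) +
       exp (- inverse x) * (- (- (inverse x * 1 * inverse x))) * poly p (inverse x))) (at x)"
    by (rule has_field_derivative_transform_within_open[where S = "{0<..}"]) (use greater in \<open>auto simp: flat_exp_def\<close>)
  then show ?thesis using greater
    by (simp add: flat_exp_def poly_monom power2_eq_square algebra_simps)
next
  case equal
  \<comment> \<open>With \<open>y = 1 / h\<close> the right difference quotient at 0 is
    \<open>y * p y * exp (- y)\<close>, which tends to 0; the factor \<open>y\<close> appears as
    \<open>pCons 0\<close>.\<close>
  have "((\<lambda>h. flat_exp p h / h) \<longlongrightarrow> 0) (at 0)"
  proof (rule filterlim_split_at)
    have "eventually (\<lambda>h. 0 = flat_exp p h / h) (at_left 0)"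
      unfolding eventually_at_left_field by (intro exI[of _ "-1"]) (auto simp: flat_exp_def)
    then show "((\<lambda>h. flat_exp p h / h) \<longlongrightarrow> 0) (at_left 0)"
      by (rule Lim_transform_eventually[OF tendsto_const])
    have "((\<lambda>y. poly (pCons 0 p) y * exp (- y)) \<longlongrightarrow> 0) (at_top :: real filter)" by (rule poly_exp_tendsto_0)
    then have "((\<lambda>h. poly (pCons 0 p) (inverse h) * exp (- inverse h)) \<longlongrightarrow> 0) (at_right 0)"
      by (rule filterlim_compose[OF _ filterlim_inverse_at_top_right])
    moreover have "eventually (\<lambda>h. poly (pCons 0 p) (inverse h) * exp (- inverse h) = flat_exp p h / h) (at_right 0)"
      using eventually_at_right_less[of "0::real"] by eventually_elim (simp add: flat_exp_def field_simps)
    ultimately show "((\<lambda>h. flat_exp p h / h) \<longlongrightarrow> 0) (at_right 0)"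
      by (rule Lim_transform_eventually)
  qed
  then show ?thesis using equal by (simp add: DERIV_def flat_exp_def)
qed

text \<open>A family of functions that is closed under differentiation and contains a bump function.\<close>

inductive_set bumps :: "(real \<Rightarrow> real) set" where
  bumps_basic: "(\<lambda>x. poly r x * flat_exp p (x * (1 - x))) \<in> bumps"
| bumps_add: "f \<in> bumps \<Longrightarrow> g \<in> bumps \<Longrightarrow> (\<lambda>x. f x + g x) \<in> bumps"

lemma bumps_deriv: "f \<in> bumps \<Longrightarrow> \<exists>f'\<in>bumps. \<forall>x. (f has_real_derivative f' x) (at x)"
proof (induction rule: bumps.induct)
  case (bumps_basic r p)
  define q where "q = monom 1 2 * (p - pderiv p)"
  define f' where "f' x = poly (pderiv r) x * flat_exp p (x * (1 - x)) + poly (r * [:1, -2:]) x * flat_exp q (x * (1 - x))" for x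
  have "f' \<in> bumps" unfolding f'_def by (intro bumps.intros)
  moreover have "((\<lambda>x. poly r x * flat_exp p (x * (1 - x))) has_real_derivative f' x) (at x)" for x
  proof -
    have "((\<lambda>x. x * (1 - x)) has_real_derivative (1 - 2 * x)) (at x)"
      by (auto intro!: derivative_eq_intros)
    then have "((\<lambda>x. flat_exp p (x * (1 - x))) has_real_derivative flat_exp q (x * (1 - x)) * (1 - 2 * x)) (at x)"
      unfolding q_def by (rule DERIV_chain2[OF flat_exp_deriv])
    from DERIV_mult[OF poly_DERIV[of r x] this] show ?thesis
      by (simp add: f'_def algebra_simps)
  qed
  ultimately show ?case by blast
next
  case (bumps_add f g)
  then obtain f' g' where "f' \<in> bumps" "g' \<in> bumps" "\<forall>x. (f has_real_derivative f' x) (at x)" "\<forall>x. (g has_real_derivative g' x) (at x)"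
    by blast
  then show ?case by (intro bexI[of _ "\<lambda>x. f' x + g' x"]) (auto intro: bumps.intros DERIV_add)
qed

definition smooth :: "(real \<Rightarrow> real) \<Rightarrow> bool" where
  "smooth f \<longleftrightarrow> (\<forall>n x. (deriv ^^ n) f differentiable (at x))"

lemma smooth_DERIV: "smooth f \<Longrightarrow> ((deriv ^^ n) f has_real_derivative (deriv ^^ Suc n) f x) (at x)"
  unfolding smooth_def using DERIV_deriv_iff_real_differentiable by auto

lemma bumps_smooth:
  assumes "f \<in> bumps"
  shows "smooth f"
proof -
  have d: "deriv g \<in> bumps" if g: "g \<in> bumps" for g
  proof -
    obtain g' where g': "g' \<in> bumps" "\<forall>x. (g has_real_derivative g' x) (at x)" using bumps_deriv[OF g] by blast
    then have "deriv g = g'" by (intro ext DERIV_imp_deriv) simp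
    then show ?thesis using g' by simp
  qed
  have "(deriv ^^ n) f \<in> bumps" for n by (induction n) (auto simp: assms d)
  then show ?thesis unfolding smooth_def real_differentiable_def using bumps_deriv by blast
qed

text \<open>The normalised primitive of a bump that is positive exactly on the open unit
  interval.\<close>

lemma smooth_step:
  "\<exists>\<eta>. smooth \<eta> \<and> (\<forall>x\<le>0. \<eta> x = 0) \<and> (\<forall>x\<ge>1. \<eta> x = 1) \<and> (\<forall>x. 0 \<le> \<eta> x \<and> \<eta> x \<le> 1) \<and> mono \<eta>"
proof -
  define b where "b x = poly 1 x * flat_exp 1 (x * (1 - x))" for x :: real
  have b: "b \<in> bumps" unfolding b_def by (rule bumps_basic)
  have b0: "b x \<ge> 0" for x by (simp add: b_def flat_exp_def)
  have bz: "b x = 0" if "x \<le> 0 \<or> 1 \<le> x" for x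
    using that by (auto simp: b_def flat_exp_def mult_nonpos_nonneg mult_nonneg_nonpos)
  have bp: "b x > 0" if "0 < x" "x < 1" for x
    using that by (simp add: b_def flat_exp_def not_le)
  have bc: "continuous_on S b" for S
  proof -
    obtain b' where "\<forall>x. (b has_real_derivative b' x) (at x)" using bumps_deriv[OF b] by blast
    then show ?thesis by (blast intro: DERIV_imp_continuous_on)
  qed
  define B where "B x = (LBINT y=ereal 0..ereal x. b y)" for x :: real
  have B: "(B has_real_derivative b x) (at x)" for x
  proof -
    have "(B has_vector_derivative b x) (at x within {- (\<bar>x\<bar> + 1)..\<bar>x\<bar> + 1})"
      unfolding B_def by (rule interval_integral_FTC2) (linarith, linarith, rule bc, linarith, linarith)
    then have "(B has_vector_derivative b x) (at x)"
      using at_within_Icc_at[of "- (\<bar>x\<bar> + 1)" x "\<bar>x\<bar> + 1"] by (metis abs_ge_self abs_ge_minus_self add.commute less_add_one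
          le_less_trans minus_less_iff)
    then show ?thesis by (simp add: has_real_derivative_iff_has_vector_derivative)
  qed
  have mono: "B x \<le> B y" if "x \<le> y" for x y
    using DERIV_nonneg_imp_nondecreasing[OF that, of B] B b0 by blast
  have B1: "B x = B 0" if "x \<le> 0" for x
  proof (cases "x = 0")
    case False
    then have "x < 0" using that by simp
    then obtain z where "x < z" "z < 0" "B 0 - B x = (0 - x) * b z" using MVT2[of x 0 B b] B by blast
    then show ?thesis using bz[of z] by simp
  qed simp
  have B2: "B x = B 1" if "1 \<le> x" for x
  proof (cases "x = 1")
    case False
    then have "1 < x" using that by simp
    then obtain z where "1 < z" "z < x" "B x - B 1 = (x - 1) * b z" using MVT2[of 1 x B b] B by blast
    then show ?thesis using bz[of z] by simp
  qed simp
  obtain z where "0 < z" "z < 1" "B 1 - B 0 = (1 - 0) * b z" using MVT2[of 0 1 B b] B zero_less_one by blast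
  then have pos: "B 1 - B 0 > 0" using bp[of z] by simp
  define c where "c = inverse (B 1 - B 0)"
  define \<eta> where "\<eta> x = c * (B x - B 0)" for x
  have c: "c > 0" "c * (B 1 - B 0) = 1" using pos by (auto simp: c_def)
  have d: "(\<eta> has_real_derivative c * b x) (at x)" for x
    unfolding \<eta>_def using B by (auto intro!: derivative_eq_intros)
  have cb: "(\<lambda>x. c * b x) \<in> bumps"
    using bumps_basic[of "[:c:]" 1] by (simp add: b_def)
  have "smooth \<eta>"
    unfolding smooth_def
  proof (intro allI)
    fix n x
    have de: "deriv \<eta> = (\<lambda>x. c * b x)" by (intro ext DERIV_imp_deriv d)
    show "(deriv ^^ n) \<eta> differentiable (at x)"
    proof (cases n)
      case 0
      then show ?thesis using d real_differentiable_def by auto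
    next
      case (Suc m)
      have "(deriv ^^ Suc m) \<eta> = (deriv ^^ m) (\<lambda>x. c * b x)" by (simp add: funpow_swap1 de)
      then show ?thesis using bumps_smooth[OF cb] Suc by (simp add: smooth_def)
    qed
  qed
  moreover have "\<eta> x = 0" if "x \<le> 0" for x using B1[OF that] by (simp add: \<eta>_def)
  moreover have "\<eta> x = 1" if "1 \<le> x" for x using B2[OF that] c by (simp add: \<eta>_def)
  moreover have "0 \<le> \<eta> x" for x
  proof -
    have "B 0 \<le> B x" using mono[of 0 x] B1[of x] by (cases "0 \<le> x") auto
    then show ?thesis using c by (simp add: \<eta>_def)
  qed
  moreover have "\<eta> x \<le> 1" for x
  proof -
    have "B x \<le> B 1" using mono[of x 1] B2[of x] by (cases "x \<le> 1") auto
    then have "c * (B x - B 0) \<le> c * (B 1 - B 0)" using c by (intro mult_left_mono) auto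
    then show ?thesis using c by (simp add: \<eta>_def)
  qed
  moreover have "\<eta> x \<le> \<eta> y" if "x \<le> y" for x y
    unfolding \<eta>_def using c mono[OF that] by (intro mult_left_mono) auto
  ultimately show ?thesis unfolding mono_def by blast
qed

lemma deriv_funpow_affine_diff:
  assumes f: "smooth f"
  shows "(deriv ^^ n) (\<lambda>x. f (c * (x - a)) - f (c * (x - b))) =
    (\<lambda>x. c ^ n * (deriv ^^ n) f (c * (x - a)) - c ^ n * (deriv ^^ n) f (c * (x - b)))"
    and "smooth (\<lambda>x. f (c * (x - a)) - f (c * (x - b)))"
proof -
  have D: "((\<lambda>x. c ^ n * (deriv ^^ n) f (c * (x - a)) - c ^ n * (deriv ^^ n) f (c * (x - b))) has_real_derivative
    (c ^ Suc n * (deriv ^^ Suc n) f (c * (x - a)) - c ^ Suc n * (deriv ^^ Suc n) f (c * (x - b)))) (at x)" for n x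
  proof -
    have aff: "((\<lambda>x. c * (x - t)) has_real_derivative c) (at x)" for t by (auto intro!: derivative_eq_intros)
    have "((\<lambda>x. (deriv ^^ n) f (c * (x - t))) has_real_derivative (deriv ^^ Suc n) f (c * (x - t)) * c) (at x)" for t
      by (rule DERIV_chain2[OF smooth_DERIV[OF f] aff])
    from DERIV_diff[OF DERIV_cmult[OF this[of a], of "c ^ n"] DERIV_cmult[OF this[of b], of "c ^ n"]] show ?thesis
      by (simp add: mult.assoc mult.commute mult.left_commute)
  qed
  have e: "(deriv ^^ n) (\<lambda>x. f (c * (x - a)) - f (c * (x - b))) =
    (\<lambda>x. c ^ n * (deriv ^^ n) f (c * (x - a)) - c ^ n * (deriv ^^ n) f (c * (x - b)))" for n
  proof (induction n)
    case (Suc n)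
    have "(deriv ^^ Suc n) (\<lambda>x. f (c * (x - a)) - f (c * (x - b))) =
      deriv (\<lambda>x. c ^ n * (deriv ^^ n) f (c * (x - a)) - c ^ n * (deriv ^^ n) f (c * (x - b)))"
      using Suc by simp
    also have "\<dots> = (\<lambda>x. c ^ Suc n * (deriv ^^ Suc n) f (c * (x - a)) - c ^ Suc n * (deriv ^^ Suc n) f (c * (x - b)))"
      by (intro ext DERIV_imp_deriv D)
    finally show ?case .
  qed simp
  show "(deriv ^^ n) (\<lambda>x. f (c * (x - a)) - f (c * (x - b))) =
    (\<lambda>x. c ^ n * (deriv ^^ n) f (c * (x - a)) - c ^ n * (deriv ^^ n) f (c * (x - b)))" by (rule e)
  show "smooth (\<lambda>x. f (c * (x - a)) - f (c * (x - b)))"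
    unfolding smooth_def e real_differentiable_def using D by blast
qed

text \<open>The difference of two smooth steps compressed by \<open>n + 1\<close> and placed at
  \<open>a\<close> and \<open>b\<close>. Both ramps lie to the right of their points, hence the
  half-open limit \<open>{a<..b}\<close> and the support up to \<open>b + 1 / (n + 1)\<close>. The
  derivative is a difference of approximate point masses, which turns a weak derivative into
  endpoint values.\<close>

lemma plateau_functions:
  assumes ab: "a < (b::real)"
  shows "\<exists>(\<phi> :: nat \<Rightarrow> real \<Rightarrow> real) \<kappa>. (\<forall>n. smooth (\<phi> n)) \<and> (\<forall>n x. x \<notin> {a..b + 1 / real (Suc n)} \<longrightarrow> \<phi> n x = 0) \<and>
    (\<forall>n x. 0 \<le> \<phi> n x \<and> \<phi> n x \<le> 1) \<and> (\<forall>x. (\<lambda>n. \<phi> n x) \<longlonglongrightarrow> indicator {a<..b} x) \<and>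
    (\<forall>n x. deriv (\<phi> n) x = real (Suc n) * \<kappa> (real (Suc n) * (x - a)) - real (Suc n) * \<kappa> (real (Suc n) * (x - b))) \<and>
    continuous_on UNIV \<kappa> \<and> (\<forall>x. x \<notin> {0..1} \<longrightarrow> \<kappa> x = 0) \<and> (LINT x|lborel. \<kappa> x) = 1"
proof -
  obtain \<eta> where \<eta>: "smooth \<eta>" "\<And>x. x \<le> 0 \<Longrightarrow> \<eta> x = 0" "\<And>x. 1 \<le> x \<Longrightarrow> \<eta> x = 1"
    "\<And>x. 0 \<le> \<eta> x" "\<And>x. \<eta> x \<le> 1" "\<And>x y. x \<le> y \<Longrightarrow> \<eta> x \<le> \<eta> y"
    using smooth_step unfolding mono_def by metis
  have D: "(\<eta> has_real_derivative deriv \<eta> x) (at x)" for x using smooth_DERIV[OF \<eta>(1), of 0] by simp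
  define \<phi> where "\<phi> n x = \<eta> (real (Suc n) * (x - a)) - \<eta> (real (Suc n) * (x - b))" for n x
  have sm: "smooth (\<phi> n)" for n unfolding \<phi>_def by (rule deriv_funpow_affine_diff(2)[OF \<eta>(1)])
  have z: "\<phi> n x = 0" if "x \<notin> {a..b + 1 / real (Suc n)}" for n x
  proof (cases "x < a")
    case True
    then have 1: "real (Suc n) * (x - a) \<le> 0" and 2: "real (Suc n) * (x - b) \<le> 0"
      using ab by (simp_all add: mult_nonneg_nonpos)
    show ?thesis unfolding \<phi>_def \<eta>(2)[OF 1] \<eta>(2)[OF 2] by simp
  next
    case False
    then have x: "x - b \<ge> 1 / real (Suc n)" "x - a \<ge> 1 / real (Suc n)" using that ab by auto
    have 1: "1 \<le> real (Suc n) * (x - a)" and 2: "1 \<le> real (Suc n) * (x - b)"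
      using mult_left_mono[OF x(1), of "real (Suc n)"] mult_left_mono[OF x(2), of "real (Suc n)"] by simp_all
    show ?thesis unfolding \<phi>_def \<eta>(3)[OF 1] \<eta>(3)[OF 2] by simp
  qed
  have b01: "0 \<le> \<phi> n x \<and> \<phi> n x \<le> 1" for n x
  proof -
    have "real (Suc n) * (x - b) \<le> real (Suc n) * (x - a)" using ab by (intro mult_left_mono) auto
    from \<eta>(6)[OF this] show ?thesis
      using \<eta>(4)[of "real (Suc n) * (x - b)"] \<eta>(5)[of "real (Suc n) * (x - a)"] by (simp add: \<phi>_def)
  qed
  have step: "(\<lambda>n. \<eta> (real (Suc n) * (x - t))) \<longlonglongrightarrow> indicator {t<..} x" for x t
  proof (cases "x \<le> t")
    case True
    then have "real (Suc n) * (x - t) \<le> 0" for n by (simp add: mult_nonneg_nonpos)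
    then have "(\<lambda>n. \<eta> (real (Suc n) * (x - t))) = (\<lambda>n. 0)" using \<eta>(2) by blast
    then show ?thesis using True by simp
  next
    case False
    obtain N :: nat where N: "1 / (x - t) \<le> real N" using real_arch_simple by blast
    have "\<eta> (real (Suc n) * (x - t)) = 1" if "n \<ge> N" for n
    proof (rule \<eta>(3))
      have "1 / (x - t) \<le> real (Suc n)" using N that by linarith
      then show "1 \<le> real (Suc n) * (x - t)" using False by (simp add: pos_divide_le_eq)
    qed
    then have "eventually (\<lambda>n. \<eta> (real (Suc n) * (x - t)) = 1) sequentially" by (auto simp: eventually_sequentially)
    then show ?thesis using False by (simp add: tendsto_eventually)
  qed
  have lim: "(\<lambda>n. \<phi> n x) \<longlonglongrightarrow> indicator {a<..b} x" for x
  proof -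
    have "(\<lambda>n. \<phi> n x) \<longlonglongrightarrow> indicator {a<..} x - indicator {b<..} x"
      unfolding \<phi>_def by (intro tendsto_diff step)
    also have "indicator {a<..} x - indicator {b<..} x = (indicator {a<..b} x :: real)"
      using ab by (auto simp: indicator_def)
    finally show ?thesis .
  qed
  have d\<phi>: "deriv (\<phi> n) x = real (Suc n) * deriv \<eta> (real (Suc n) * (x - a)) - real (Suc n) * deriv \<eta> (real (Suc n) * (x - b))" for n x
    using deriv_funpow_affine_diff(1)[OF \<eta>(1), of 1 "real (Suc n)" a b] by (simp add: \<phi>_def[abs_def])
  have cont: "continuous_on S (deriv \<eta>)" for S
    by (rule DERIV_imp_continuous_on[OF smooth_DERIV[OF \<eta>(1), of 1, simplified]])
  have zero: "deriv \<eta> x = 0" if "x \<notin> {0..1}" for x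
  proof -
    have "(\<eta> has_real_derivative 0) (at x)"
    proof (cases "x < 0")
      case True
      have "((\<lambda>_. 0) has_real_derivative 0) (at x)" by simp
      then show ?thesis
        by (rule has_field_derivative_transform_within_open[where S = "{..<0}"]) (use True \<eta>(2) in auto)
    next
      case False
      have "((\<lambda>_. 1) has_real_derivative 0) (at x)" by simp
      then show ?thesis
        by (rule has_field_derivative_transform_within_open[where S = "{1<..}"]) (use False that \<eta>(3) in auto)
    qed
    then show ?thesis by (rule DERIV_imp_deriv)
  qed
  have int: "(LINT x|lborel. deriv \<eta> x) = 1"
  proof -
    have "(LINT x|lborel. deriv \<eta> x) = (LINT x|lborel. indicator {0..1} x *\<^sub>R deriv \<eta> x)"
      by (rule Bochner_Integration.integral_cong) (use zero in \<open>auto simp: indicator_def\<close>)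
    also have "\<dots> = \<eta> 1 - \<eta> 0"
      using D by (intro integral_FTC_Icc cont)
        (auto simp: has_real_derivative_iff_has_vector_derivative[symmetric] intro: has_field_derivative_at_within)
    finally show ?thesis using \<eta> by simp
  qed
  show ?thesis
    by (intro exI[of _ \<phi>] exI[of _ "deriv \<eta>"] conjI allI impI sm z lim d\<phi> cont zero int) (use b01 in auto)
qed

text \<open>The substitution \<open>x = t + y / (n + 1)\<close> turns the kernel into a fixed one.\<close>

lemma approximate_identity:
  fixes u :: "real \<Rightarrow> complex" and \<kappa> :: "real \<Rightarrow> real"
  assumes I: "open I" and u: "continuous_on I u" and d: "d > 0" "{t..t + d} \<subseteq> I"
    and \<kappa>: "continuous_on UNIV \<kappa>" "\<And>x. x \<notin> {0..1} \<Longrightarrow> \<kappa> x = 0" "(LINT x|lborel. \<kappa> x) = 1"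
  shows "(\<lambda>n. LINT x:I|lborel. u x * of_real (real (Suc n) * \<kappa> (real (Suc n) * (x - t)))) \<longlonglongrightarrow> u t"
    and "1 / real (Suc n) \<le> d \<Longrightarrow> set_integrable lborel I (\<lambda>x. u x * of_real (real (Suc n) * \<kappa> (real (Suc n) * (x - t))))"
proof -
  define w where "w x = indicator I x *\<^sub>R u x" for x
  have wm: "w \<in> borel_measurable borel"
    unfolding w_def using u I by (intro borel_measurable_continuous_on_indicator) auto
  have \<kappa>m: "\<kappa> \<in> borel_measurable borel" by (rule borel_measurable_continuous_onI[OF \<kappa>(1)])
  have \<kappa>i: "integrable lborel \<kappa>"
    using \<kappa>(3) not_integrable_integral_eq[of lborel \<kappa>] by auto
  have "compact (u ` {t..t + d})"
    by (intro compact_continuous_image continuous_on_subset[OF u d(2)]) auto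
  then have "bounded (u ` {t..t + d})" by (rule compact_imp_bounded)
  then obtain M where M': "\<forall>y\<in>u ` {t..t + d}. norm y \<le> M"
    unfolding bounded_iff by blast
  then have M: "norm (u x) \<le> M" if "x \<in> {t..t + d}" for x using that by blast
  define g where "g n y = w (t + (1 / real (Suc n)) * y) * of_real (\<kappa> y)" for n y
  have gm: "g n \<in> borel_measurable lborel" for n
    unfolding g_def using wm \<kappa>m by measurable
  have bound: "norm (g n y) \<le> M * \<bar>\<kappa> y\<bar>" if n: "1 / real (Suc n) \<le> d" for n y
  proof (cases "y \<in> {0..1}")
    case True
    have "1 / real (Suc n) * y \<le> 1 / real (Suc n) * 1" using True by (intro mult_left_mono) auto
    then have "t + 1 / real (Suc n) * y \<in> {t..t + d}" using True n by auto
    then have "norm (u (t + 1 / real (Suc n) * y)) \<le> M" "t + 1 / real (Suc n) * y \<in> I"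
      using M d(2) by blast+
    then have "norm (w (t + (1 / real (Suc n)) * y)) \<le> M" unfolding w_def by simp
    then show ?thesis unfolding g_def norm_mult norm_of_real by (intro mult_right_mono) auto
  qed (simp add: g_def \<kappa>(2))
  have gi: "integrable lborel (g n)" if n: "1 / real (Suc n) \<le> d" for n
  proof (rule Bochner_Integration.integrable_bound)
    show "integrable lborel (\<lambda>y. M * \<kappa> y)" using \<kappa>i by simp
    have "norm (g n y) \<le> norm (M * \<kappa> y)" for y
    proof -
      have "M * \<bar>\<kappa> y\<bar> \<le> \<bar>M\<bar> * \<bar>\<kappa> y\<bar>" by (intro mult_right_mono) auto
      then show ?thesis using bound[OF n, of y] by (simp add: abs_mult)
    qed
    then show "AE y in lborel. norm (g n y) \<le> norm (M * \<kappa> y)" by simp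
  qed (rule gm)
  define f where "f n x = indicator I x *\<^sub>R (u x * of_real (real (Suc n) * \<kappa> (real (Suc n) * (x - t))))" for n x
  have fg: "f n (t + (1 / real (Suc n)) * y) = real (Suc n) *\<^sub>R g n y" for n y
  proof -
    have "real (Suc n) * (1 / real (Suc n) * y) = y" by simp
    then have "f n (t + (1 / real (Suc n)) * y) = w (t + (1 / real (Suc n)) * y) * of_real (real (Suc n) * \<kappa> y)"
      unfolding f_def w_def by (simp only: add_diff_cancel_left' scaleR_left_distrib mult_scaleR_left)
    then show ?thesis unfolding g_def of_real_mult scaleR_conv_of_real by (simp only: mult.assoc mult.left_commute)
  qed
  have "(LINT x|lborel. f n x) = \<bar>1 / real (Suc n)\<bar> *\<^sub>R (LINT y|lborel. f n (t + (1 / real (Suc n)) * y))" for n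
    by (rule lborel_integral_real_affine) simp
  then have eq: "(LINT x|lborel. f n x) = (LINT y|lborel. g n y)" for n
    unfolding fg by simp
  have "(\<lambda>n. LINT y|lborel. g n y) \<longlonglongrightarrow> (LINT y|lborel. u t * of_real (\<kappa> y))"
  proof -
    obtain N where N: "1 / real (Suc N) \<le> d"
      using reals_Archimedean[OF d(1)] by (auto simp: inverse_eq_divide intro: less_imp_le)
    have N': "1 / real (Suc (n + N)) \<le> d" for n
      using N by (rule order_trans[rotated]) (auto intro!: divide_left_mono)
    have "(\<lambda>n. LINT y|lborel. g (n + N) y) \<longlonglongrightarrow> (LINT y|lborel. u t * of_real (\<kappa> y))"
    proof (rule integral_dominated_convergence[where w = "\<lambda>y. M * \<bar>\<kappa> y\<bar>"])
      show "(\<lambda>y. u t * of_real (\<kappa> y)) \<in> borel_measurable lborel" using \<kappa>m by measurable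
      show "integrable lborel (\<lambda>y. M * \<bar>\<kappa> y\<bar>)" using \<kappa>i by simp
      show "AE y in lborel. norm (g (n + N) y) \<le> M * \<bar>\<kappa> y\<bar>" for n using bound[OF N'] by simp
      have "(\<lambda>n. g n y) \<longlonglongrightarrow> u t * of_real (\<kappa> y)" for y
      proof -
        have tI: "t \<in> I" using d by auto
        have "(\<lambda>n. t + (1 / real (Suc n)) * y) \<longlonglongrightarrow> t + 0 * y"
          using LIMSEQ_inverse_real_of_nat by (intro tendsto_intros) (simp add: inverse_eq_divide)
        then have l: "(\<lambda>n. t + (1 / real (Suc n)) * y) \<longlonglongrightarrow> t" by simp
        have ev: "eventually (\<lambda>n. t + (1 / real (Suc n)) * y \<in> I) sequentially"
          by (rule topological_tendstoD[OF l I tI])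
        have "isCont u t" using u I tI continuous_on_eq_continuous_at by blast
        then have "(\<lambda>n. u (t + (1 / real (Suc n)) * y)) \<longlonglongrightarrow> u t" by (rule isCont_tendsto_compose[OF _ l])
        moreover have "eventually (\<lambda>n. u (t + (1 / real (Suc n)) * y) = w (t + (1 / real (Suc n)) * y)) sequentially"
          using ev by eventually_elim (simp add: w_def)
        ultimately have "(\<lambda>n. w (t + (1 / real (Suc n)) * y)) \<longlonglongrightarrow> u t" by (rule Lim_transform_eventually)
        then show ?thesis unfolding g_def by (intro tendsto_mult tendsto_const)
      qed
      then show "AE y in lborel. (\<lambda>n. g (n + N) y) \<longlonglongrightarrow> u t * of_real (\<kappa> y)"
        using LIMSEQ_ignore_initial_segment by blast
    qed (rule gm)
    then show ?thesis by (rule LIMSEQ_offset)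
  qed
  also have "(LINT y|lborel. u t * of_real (\<kappa> y)) = u t" using \<kappa>(3) by simp
  finally show "(\<lambda>n. LINT x:I|lborel. u x * of_real (real (Suc n) * \<kappa> (real (Suc n) * (x - t)))) \<longlonglongrightarrow> u t"
    unfolding set_lebesgue_integral_def f_def[symmetric] eq .
  assume n: "1 / real (Suc n) \<le> d"
  have "integrable lborel (\<lambda>y. f n (t + (1 / real (Suc n)) * y))"
    unfolding fg using gi[OF n] by simp
  then have "integrable lborel (f n)"
    by (rule lborel_integrable_real_affine_iff[THEN iffD1, rotated]) simp
  then show "set_integrable lborel I (\<lambda>x. u x * of_real (real (Suc n) * \<kappa> (real (Suc n) * (x - t))))"
    unfolding set_integrable_def f_def[abs_def] .
qed

section \<open>Weak derivatives and the fundamental theorem of calculus\<close>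

text \<open>When the weak identity is tested with plateaus, the side with
  \<open>deriv (\<phi> n)\<close> tends to \<open>u a - u b\<close> by
  \<open>approximate_identity\<close>, the other side to minus the integral of \<open>v\<close> over
  \<open>{a<..b}\<close> by dominated convergence.\<close>

lemma weak_derivative_imp_integral:
  fixes u v :: "real \<Rightarrow> complex"
  assumes I: "open I" "is_interval I" and u: "continuous_on I u" and w: "weak_derivative_on I u v"
    and ab: "a \<in> I" "b \<in> I" "a < b"
  shows "u b - u a = (LINT x:{a..b}|lborel. v x)"
proof -
  obtain d where d: "d > 0" "cball b d \<subseteq> I" using I(1) ab(2) open_contains_cball by blast
  have J: "{a..b + d} \<subseteq> I"
  proof -
    have "b + d \<in> I" using d by (auto simp: subset_iff dist_real_def)
    then show ?thesis using mem_is_interval_1_I[OF I(2) ab(1)] by (auto simp only: atLeastAtMost_iff subset_iff)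
  qed
  obtain \<phi> :: "nat \<Rightarrow> real \<Rightarrow> real" and \<kappa> :: "real \<Rightarrow> real" where \<phi>: "\<And>n. smooth (\<phi> n)"
    "\<And>n x. x \<notin> {a..b + 1 / real (Suc n)} \<Longrightarrow> \<phi> n x = 0"
    "\<And>n x. 0 \<le> \<phi> n x \<and> \<phi> n x \<le> 1" "\<And>x. (\<lambda>n. \<phi> n x) \<longlonglongrightarrow> indicator {a<..b} x"
    "\<And>n x. deriv (\<phi> n) x = real (Suc n) * \<kappa> (real (Suc n) * (x - a)) - real (Suc n) * \<kappa> (real (Suc n) * (x - b))"
    and \<kappa>: "continuous_on UNIV \<kappa>" "\<And>x. x \<notin> {0..1} \<Longrightarrow> \<kappa> x = 0" "(LINT x|lborel. \<kappa> x) = 1"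
    using plateau_functions[OF ab(3)] by blast
  have \<phi>m: "\<phi> n \<in> borel_measurable borel" for n
    by (rule borel_measurable_continuous_onI[OF DERIV_imp_continuous_on[OF smooth_DERIV[OF \<phi>(1), of 0, simplified]]])
  \<comment> \<open>The falling ramp lies beyond \<open>b\<close>; from index \<open>N\<close> on it
    stays within the margin \<open>d\<close> inside \<open>I\<close>.\<close>
  obtain N where N: "1 / real (Suc N) \<le> d"
    using reals_Archimedean[OF d(1)] by (auto simp: inverse_eq_divide intro: less_imp_le)
  have N': "1 / real (Suc (n + N)) \<le> d" for n
    using N by (rule order_trans[rotated]) (auto intro!: divide_left_mono)
  have \<phi>J: "\<phi> (n + N) x = 0" if "x \<notin> {a..b + d}" for n x
    using that N'[of n] by (intro \<phi>(2)) auto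
  have test: "test_function I (\<phi> (n + N))" for n
    unfolding test_function_def using \<phi>(1) \<phi>J J by (auto simp: smooth_def intro!: exI[of _ "{a..b + d}"])
  have vi: "integrable lborel (\<lambda>x. indicator {a..b + d} x *\<^sub>R v x)"
    using w J unfolding weak_derivative_on_def set_integrable_def by blast
  have eq: "(LINT x:I|lborel. u x * of_real (deriv (\<phi> (n + N)) x)) = - (LINT x|lborel. (indicator {a..b + d} x *\<^sub>R v x) * of_real (\<phi> (n + N) x))" for n
  proof -
    have "(LINT x:I|lborel. v x * of_real (\<phi> (n + N) x)) = (LINT x|lborel. (indicator {a..b + d} x *\<^sub>R v x) * of_real (\<phi> (n + N) x))"
      unfolding set_lebesgue_integral_def using \<phi>J[of _ n] J
      by (intro Bochner_Integration.integral_cong) (auto simp: indicator_def subset_iff)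
    then show ?thesis using w test[of n] unfolding weak_derivative_on_def by simp
  qed
  have R: "(\<lambda>n. LINT x|lborel. (indicator {a..b + d} x *\<^sub>R v x) * of_real (\<phi> (n + N) x)) \<longlonglongrightarrow>
      (LINT x|lborel. (indicator {a..b + d} x *\<^sub>R v x) * of_real (indicator {a<..b} x))"
  proof (rule integral_dominated_convergence[where w = "\<lambda>x. norm (indicator {a..b + d} x *\<^sub>R v x)"])
    have vm: "(\<lambda>x. indicator {a..b + d} x *\<^sub>R v x) \<in> borel_measurable lborel" using vi by (rule borel_measurable_integrable)
    show "(\<lambda>x. (indicator {a..b + d} x *\<^sub>R v x) * of_real (indicator {a<..b} x)) \<in> borel_measurable lborel"
      by (rule borel_measurable_times[OF vm]) simp
    show "(\<lambda>x. (indicator {a..b + d} x *\<^sub>R v x) * of_real (\<phi> (n + N) x)) \<in> borel_measurable lborel" for n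
      using \<phi>m by (intro borel_measurable_times[OF vm]) simp
    show "integrable lborel (\<lambda>x. norm (indicator {a..b + d} x *\<^sub>R v x))" using vi by (rule integrable_norm)
    have "norm ((indicator {a..b + d} x *\<^sub>R v x) * of_real (\<phi> (n + N) x)) \<le> norm (indicator {a..b + d} x *\<^sub>R v x)" for n x
      unfolding norm_mult using \<phi>(3)[of "n + N" x] by (intro mult_left_le) auto
    then show "AE x in lborel. norm ((indicator {a..b + d} x *\<^sub>R v x) * of_real (\<phi> (n + N) x)) \<le> norm (indicator {a..b + d} x *\<^sub>R v x)" for n
      by simp
    have "(\<lambda>n. (indicator {a..b + d} x *\<^sub>R v x) * of_real (\<phi> (n + N) x)) \<longlonglongrightarrow> (indicator {a..b + d} x *\<^sub>R v x) * of_real (indicator {a<..b} x)" for x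
      by (intro tendsto_mult tendsto_const tendsto_of_real LIMSEQ_ignore_initial_segment \<phi>)
    then show "AE x in lborel. (\<lambda>n. (indicator {a..b + d} x *\<^sub>R v x) * of_real (\<phi> (n + N) x)) \<longlonglongrightarrow> (indicator {a..b + d} x *\<^sub>R v x) * of_real (indicator {a<..b} x)"
      by simp
  qed
  have R': "(LINT x|lborel. (indicator {a..b + d} x *\<^sub>R v x) * of_real (indicator {a<..b} x)) = (LINT x:{a..b}|lborel. v x)"
    unfolding set_lebesgue_integral_def
  proof (rule integral_cong_AE)
    have vm: "(\<lambda>x. indicator {a..b + d} x *\<^sub>R v x) \<in> borel_measurable lborel" using vi by (rule borel_measurable_integrable)
    show "(\<lambda>x. (indicator {a..b + d} x *\<^sub>R v x) * of_real (indicator {a<..b} x)) \<in> borel_measurable lborel"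
      by (rule borel_measurable_times[OF vm]) simp
    have "(\<lambda>x. indicator {a..b} x *\<^sub>R (indicator {a..b + d} x *\<^sub>R v x)) \<in> borel_measurable lborel"
      by (rule borel_measurable_scaleR[OF borel_measurable_indicator vm]) simp
    moreover have "(\<lambda>x. indicator {a..b} x *\<^sub>R (indicator {a..b + d} x *\<^sub>R v x)) = (\<lambda>x. indicator {a..b} x *\<^sub>R v x)"
      using d by (auto simp: indicator_def fun_eq_iff)
    ultimately show "(\<lambda>x. indicator {a..b} x *\<^sub>R v x) \<in> borel_measurable lborel" by simp
    show "AE x in lborel. (indicator {a..b + d} x *\<^sub>R v x) * of_real (indicator {a<..b} x) = indicator {a..b} x *\<^sub>R v x"
      using AE_lborel_singleton[of a] by eventually_elim (use d in \<open>auto simp: indicator_def\<close>)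
  qed
  have sub: "{a..a + d} \<subseteq> I" "{b..b + d} \<subseteq> I" using J ab d by auto
  have L: "(\<lambda>n. LINT x:I|lborel. u x * of_real (deriv (\<phi> (n + N)) x)) \<longlonglongrightarrow> u a - u b"
  proof -
    let ?k = "\<lambda>t n x. u x * complex_of_real (real (Suc n) * \<kappa> (real (Suc n) * (x - t)))"
    have "(\<lambda>n. (LINT x:I|lborel. ?k a n x) - (LINT x:I|lborel. ?k b n x)) \<longlonglongrightarrow> u a - u b"
      by (intro tendsto_diff approximate_identity(1)[OF I(1) u d(1)] sub \<kappa>)
    then have "(\<lambda>n. (LINT x:I|lborel. ?k a (n + N) x) - (LINT x:I|lborel. ?k b (n + N) x)) \<longlonglongrightarrow> u a - u b"
      by (rule LIMSEQ_ignore_initial_segment)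
    moreover have "(LINT x:I|lborel. ?k a (n + N) x) - (LINT x:I|lborel. ?k b (n + N) x) = (LINT x:I|lborel. u x * of_real (deriv (\<phi> (n + N)) x))" for n
    proof -
      note ii = approximate_identity(2)[OF I(1) u d(1) sub(1) \<kappa> N'[of n]]
        approximate_identity(2)[OF I(1) u d(1) sub(2) \<kappa> N'[of n]]
      have "(LINT x:I|lborel. ?k a (n + N) x) - (LINT x:I|lborel. ?k b (n + N) x) = (LINT x:I|lborel. ?k a (n + N) x - ?k b (n + N) x)"
        by (rule set_integral_diff(2)[OF ii, symmetric])
      then show ?thesis unfolding \<phi>(5) of_real_diff right_diff_distrib .
    qed
    ultimately show ?thesis by simp
  qed
  have "(\<lambda>n. - (LINT x|lborel. (indicator {a..b + d} x *\<^sub>R v x) * of_real (\<phi> (n + N) x))) \<longlonglongrightarrow> - (LINT x:{a..b}|lborel. v x)"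
    using tendsto_minus[OF R] unfolding R' .
  then have "u a - u b = - (LINT x:{a..b}|lborel. v x)"
    using LIMSEQ_unique[OF L] unfolding eq by blast
  then show ?thesis by (simp add: algebra_simps)
qed

lemma integral_imp_continuous_Icc:
  fixes u v :: "real \<Rightarrow> 'b::euclidean_space"
  assumes v: "set_integrable lborel {a..b} v"
    and FTC: "\<And>x y. a \<le> x \<Longrightarrow> x \<le> y \<Longrightarrow> y \<le> b \<Longrightarrow> u y - u x = (LINT s:{x..y}|lborel. v s)"
  shows "continuous_on {a..b} u"
proof (cases "a \<le> b")
  case True
  have vi: "v integrable_on {a..b}" using set_borel_integral_eq_integral(1)[OF v] .
  have "u x = u a + integral {a..x} v" if "x \<in> {a..b}" for x
  proof -
    have "set_integrable lborel {a..x} v" by (rule set_integrable_subset[OF v]) (use that in auto)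
    then show ?thesis using FTC[of a x] that set_borel_integral_eq_integral(2)[of "{a..x}" v] by (simp add: algebra_simps)
  qed
  moreover have "continuous_on {a..b} (\<lambda>x. u a + integral {a..x} v)"
    by (intro continuous_intros indefinite_integral_continuous_1 vi)
  ultimately show ?thesis using continuous_on_cong by (metis (no_types, lifting))
qed simp

text \<open>Integration by parts through Fubini's theorem on the triangle
  \<open>a \<le> s \<le> x \<le> b\<close>, where \<open>u x - u a\<close> is written as an integral
  of \<open>v\<close> up to \<open>x\<close>.\<close>

lemma integral_imp_weak_derivative:
  fixes u v :: "real \<Rightarrow> complex"
  assumes I: "open I" "is_interval I" and u: "continuous_on I u"
    and v: "\<And>a b. a \<in> I \<Longrightarrow> b \<in> I \<Longrightarrow> set_integrable lborel {a..b} v"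
    and FTC: "\<And>a b. a \<in> I \<Longrightarrow> b \<in> I \<Longrightarrow> a \<le> b \<Longrightarrow> u b - u a = (LINT s:{a..b}|lborel. v s)"
  shows "weak_derivative_on I u v"
  unfolding weak_derivative_on_def
proof (intro conjI allI impI)
  fix K assume K: "compact K \<and> K \<subseteq> I"
  show "set_integrable lborel K u"
    unfolding set_integrable_def using K by (intro borel_integrable_compact continuous_on_subset[OF u]) auto
  show "set_integrable lborel K v"
  proof (cases "K = {}")
    case False
    obtain p where p: "p \<in> K" "\<And>x. x \<in> K \<Longrightarrow> p \<le> x" using compact_attains_inf[of K] K False by blast
    obtain q where q: "q \<in> K" "\<And>x. x \<in> K \<Longrightarrow> x \<le> q" using compact_attains_sup[of K] K False by blast
    show ?thesis
      by (rule set_integrable_subset[OF v[of p q]]) (use K p q in \<open>auto simp: compact_imp_closed\<close>)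
  qed (simp add: set_integrable_def)
next
  fix \<phi> assume t: "test_function I \<phi>"
  then obtain K where K: "compact K" "K \<subseteq> I" "\<And>x. x \<notin> K \<Longrightarrow> \<phi> x = 0" by (auto simp: test_function_def)
  have sm: "smooth \<phi>" using t by (auto simp: test_function_def smooth_def)
  have D: "(\<phi> has_real_derivative deriv \<phi> x) (at x)" for x using smooth_DERIV[OF sm, of 0] by simp
  have c\<phi>: "continuous_on S \<phi>" for S by (rule DERIV_imp_continuous_on[OF D])
  have cd: "continuous_on S (deriv \<phi>)" for S
    by (rule DERIV_imp_continuous_on[OF smooth_DERIV[OF sm, of 1, simplified]])
  show "(LINT x:I|lborel. u x * of_real (deriv \<phi> x)) = - (LINT x:I|lborel. v x * of_real (\<phi> x))"
  proof (cases "K = {}")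
    case True
    then have "\<phi> = (\<lambda>_. 0)" using K by auto
    then show ?thesis by (simp add: set_lebesgue_integral_def)
  next
    case False
    obtain p where p: "p \<in> K" "\<And>x. x \<in> K \<Longrightarrow> p \<le> x" using compact_attains_inf[OF K(1) False] by blast
    obtain q where q: "q \<in> K" "\<And>x. x \<in> K \<Longrightarrow> x \<le> q" using compact_attains_sup[OF K(1) False] by blast
    obtain d where d: "d > 0" "cball p d \<subseteq> I" using I(1) p(1) K(2) open_contains_cball by blast
    obtain e where e: "e > 0" "cball q e \<subseteq> I" using I(1) q(1) K(2) open_contains_cball by blast
    \<comment> \<open>The interval extends strictly beyond the support, so that
      \<open>\<phi>\<close> vanishes at both endpoints and \<open>deriv \<phi>\<close> vanishes
      outside.\<close>
    define a b where "a = p - d" and "b = q + e"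
    have ab: "a \<in> I" "b \<in> I" "a \<le> b" using d e p(2)[OF q(1)] by (auto simp: a_def b_def subset_iff dist_real_def)
    have J: "{a..b} \<subseteq> I" using mem_is_interval_1_I[OF I(2) ab(1,2)] by (auto simp only: atLeastAtMost_iff subset_iff)
    have z: "\<phi> x = 0" if "x \<le> a \<or> b \<le> x" for x
    proof (rule K(3))
      show "x \<notin> K"
      proof
        assume "x \<in> K"
        then show False using that p(2)[of x] q(2)[of x] d(1) e(1) unfolding a_def b_def by linarith
      qed
    qed
    have dz: "deriv \<phi> x = 0" if "x \<notin> {a..b}" for x
    proof -
      have "((\<lambda>_. 0) has_real_derivative 0) (at x)" by simp
      then have "(\<phi> has_real_derivative 0) (at x)"
        by (rule has_field_derivative_transform_within_open[where S = "- {a..b}"]) (use that z in auto)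
      then show ?thesis by (rule DERIV_imp_deriv)
    qed
    define V where "V s = indicator {a..b} s *\<^sub>R v s" for s
    define P where "P x = indicator {a..b} x * deriv \<phi> x" for x
    have Vi: "integrable lborel V" using v[OF ab(1,2)] by (simp add: set_integrable_def V_def[abs_def])
    have Pi: "integrable lborel P"
      using borel_integrable_compact[OF compact_Icc cd, of a b] by (simp add: P_def[abs_def])
    define G where "G x s = (if s \<le> x then of_real (P x) * V s else 0)" for x s
    have Gm: "case_prod G \<in> borel_measurable (lborel \<Otimes>\<^sub>M lborel)"
      unfolding G_def using borel_measurable_integrable[OF Vi] borel_measurable_integrable[OF Pi] by measurable
    have Gi: "integrable (lborel \<Otimes>\<^sub>M lborel) (case_prod G)"
    proof (rule lborel_pair.Fubini_integrable[OF Gm])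
      have b: "norm (G x s) \<le> \<bar>P x\<bar> * norm (V s)" for x s by (simp add: G_def norm_mult)
      have Gxm: "(\<lambda>s. G x s) \<in> borel_measurable lborel" for x
        using measurable_compose[OF measurable_Pair1' Gm, of x] by simp
      have Gx: "integrable lborel (\<lambda>s. G x s)" for x
      proof (rule Bochner_Integration.integrable_bound[OF _ Gxm])
        show "integrable lborel (\<lambda>s. \<bar>P x\<bar> * norm (V s))" using Vi by auto
        show "AE s in lborel. norm (G x s) \<le> norm (\<bar>P x\<bar> * norm (V s))" using b[of x] by (intro AE_I2) simp
      qed
      show "AE x in lborel. integrable lborel (\<lambda>s. case_prod G (x, s))" using Gx by simp
      show "integrable lborel (\<lambda>x. LINT s|lborel. norm (case_prod G (x, s)))"
      proof (rule Bochner_Integration.integrable_bound)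
        show "integrable lborel (\<lambda>x. P x * (LINT s|lborel. norm (V s)))" using Pi by auto
        show "(\<lambda>x. LINT s|lborel. norm (case_prod G (x, s))) \<in> borel_measurable lborel"
          using Gm by (intro lborel.borel_measurable_lebesgue_integral) (simp add: case_prod_beta')
        have "norm (LINT s|lborel. norm (G x s)) \<le> norm (P x * (LINT s|lborel. norm (V s)))" for x
        proof -
          have "(LINT s|lborel. norm (G x s)) \<le> (LINT s|lborel. \<bar>P x\<bar> * norm (V s))"
            using b Vi Gx by (intro integral_mono) auto
          moreover have "0 \<le> (LINT s|lborel. norm (G x s))" "0 \<le> (LINT s|lborel. norm (V s))"
            by (auto intro: Bochner_Integration.integral_nonneg)
          ultimately show ?thesis by (simp add: abs_mult)
        qed
        then show "AE x in lborel. norm (LINT s|lborel. norm (case_prod G (x, s))) \<le> norm (P x * (LINT s|lborel. norm (V s)))"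
          by simp
      qed
    qed
    have inner1: "(LINT s|lborel. G x s) = of_real (P x) * (u x - u a)" for x
    proof (cases "x \<in> {a..b}")
      case True
      have "(LINT s|lborel. G x s) = (LINT s|lborel. of_real (P x) * (indicator {a..x} s *\<^sub>R v s))"
        by (rule Bochner_Integration.integral_cong) (use True in \<open>auto simp: G_def V_def indicator_def\<close>)
      also have "\<dots> = of_real (P x) * (LINT s:{a..x}|lborel. v s)"
        unfolding set_lebesgue_integral_def by (rule integral_mult_right_zero)
      also have "\<dots> = of_real (P x) * (u x - u a)" using FTC[of a x] True ab J by auto
      finally show ?thesis .
    next
      case False
      then have "P x = 0" by (simp add: P_def)
      then have "G x = (\<lambda>s. 0)" by (auto simp: G_def fun_eq_iff)
      then show ?thesis using \<open>P x = 0\<close> by simp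
    qed
    have inner2: "(LINT x|lborel. G x s) = - (V s * of_real (\<phi> s))" for s
    proof (cases "s \<in> {a..b}")
      case True
      have "(LINT x|lborel. G x s) = (LINT x|lborel. V s * of_real (indicator {s..b} x *\<^sub>R deriv \<phi> x))"
        by (rule Bochner_Integration.integral_cong) (use True in \<open>auto simp: G_def P_def indicator_def\<close>)
      also have "\<dots> = V s * of_real (LINT x|lborel. indicator {s..b} x *\<^sub>R deriv \<phi> x)"
        by (simp only: integral_mult_right_zero integral_complex_of_real)
      also have "(LINT x|lborel. indicator {s..b} x *\<^sub>R deriv \<phi> x) = \<phi> b - \<phi> s"
        using D True by (intro integral_FTC_Icc cd)
          (auto simp: has_real_derivative_iff_has_vector_derivative[symmetric] intro: has_field_derivative_at_within)
      finally show ?thesis using z[of b] by simp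
    next
      case False
      then have "V s = 0" by (simp add: V_def)
      then have "(\<lambda>x. G x s) = (\<lambda>x. 0)" by (auto simp: G_def fun_eq_iff)
      then show ?thesis using \<open>V s = 0\<close> by simp
    qed
    have F: "(LINT x|lborel. of_real (P x) * (u x - u a)) = (LINT s|lborel. - (V s * of_real (\<phi> s)))"
      using lborel_pair.Fubini_integral[OF Gi] unfolding inner1 inner2 by simp
    have Pu: "integrable lborel (\<lambda>x. of_real (P x) * u x)"
    proof -
      have "integrable lborel (\<lambda>x. indicator {a..b} x *\<^sub>R (of_real (deriv \<phi> x) * u x))"
        by (intro borel_integrable_compact compact_Icc continuous_intros cd continuous_on_subset[OF u J])
      moreover have "(\<lambda>x. indicator {a..b} x *\<^sub>R (of_real (deriv \<phi> x) * u x)) = (\<lambda>x. of_real (P x) * u x)"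
        by (auto simp: P_def fun_eq_iff indicator_def)
      ultimately show ?thesis by simp
    qed
    \<comment> \<open>The derivative of a compactly supported function has integral 0, which removes
      the constant \<open>u a\<close> from the identity.\<close>
    have P0: "(LINT x|lborel. P x) = 0"
    proof -
      have "(LINT x|lborel. indicator {a..b} x *\<^sub>R deriv \<phi> x) = \<phi> b - \<phi> a"
        using D ab by (intro integral_FTC_Icc cd)
          (auto simp: has_real_derivative_iff_has_vector_derivative[symmetric] intro: has_field_derivative_at_within)
      then show ?thesis using z[of a] z[of b] by (simp add: P_def)
    qed
    have "(LINT x|lborel. of_real (P x) * (u x - u a)) = (LINT x|lborel. of_real (P x) * u x - of_real (P x) * u a)"
      by (simp only: right_diff_distrib)
    also have "\<dots> = (LINT x|lborel. of_real (P x) * u x) - (LINT x|lborel. of_real (P x) * u a)"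
      by (intro Bochner_Integration.integral_diff Pu integrable_mult_left integrable_of_real Pi)
    also have "(LINT x|lborel. of_real (P x) * u a) = of_real (LINT x|lborel. P x) * u a"
      by (simp only: integral_mult_left_zero integral_complex_of_real)
    finally have F2: "(LINT x|lborel. of_real (P x) * u x) = - (LINT s|lborel. V s * of_real (\<phi> s))"
      using F P0 by simp
    have "(LINT x:I|lborel. u x * of_real (deriv \<phi> x)) = (LINT x|lborel. of_real (P x) * u x)"
      unfolding set_lebesgue_integral_def
      by (rule Bochner_Integration.integral_cong) (use dz J in \<open>auto simp: P_def indicator_def\<close>)
    moreover have "(LINT x:I|lborel. v x * of_real (\<phi> x)) = (LINT s|lborel. V s * of_real (\<phi> s))"
      unfolding set_lebesgue_integral_def
    proof (rule Bochner_Integration.integral_cong)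
      fix x
      have "\<phi> x = 0" if "x \<notin> {a..b}" using z[of x] that by auto
      then show "indicat_real I x *\<^sub>R (v x * complex_of_real (\<phi> x)) = V x * complex_of_real (\<phi> x)"
        using J by (auto simp: V_def indicator_def)
    qed simp
    ultimately show ?thesis using F2 by simp
  qed
qed

section \<open>Chain rule and absolute value for integral functions\<close>

lemma set_integral_Icc_split:
  fixes v :: "real \<Rightarrow> 'b::euclidean_space"
  assumes v: "set_integrable lborel {a..c} v" and "a \<le> b" "b \<le> c"
  shows "(LINT s:{a..c}|lborel. v s) = (LINT s:{a..b}|lborel. v s) + (LINT s:{b..c}|lborel. v s)"
proof -
  have v1: "set_integrable lborel {a..b} v" "set_integrable lborel {b..c} v"
    using assms(2,3) by (auto intro: set_integrable_subset[OF v])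
  have "integral {a..b} v + integral {b..c} v = integral {a..c} v"
    using set_borel_integral_eq_integral(1)[OF v] assms(2,3) by (intro Henstock_Kurzweil_Integration.integral_combine)
  then show ?thesis
    using set_borel_integral_eq_integral(2)[OF v] set_borel_integral_eq_integral(2)[OF v1(1)] set_borel_integral_eq_integral(2)[OF v1(2)]
    by simp
qed

text \<open>On a partition into short intervals each increment of \<open>F\<close> is at most a
  small multiple of that of \<open>V\<close>, and the latter add up to \<open>V b - V a\<close>.
  This takes the place of a vanishing derivative.\<close>

lemma constant_of_square_increments:
  fixes F V :: "real \<Rightarrow> real"
  assumes ab: "a \<le> b" and V: "continuous_on {a..b} V" "\<And>x y. a \<le> x \<Longrightarrow> x \<le> y \<Longrightarrow> y \<le> b \<Longrightarrow> V x \<le> V y"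
    and F: "\<And>x y. a \<le> x \<Longrightarrow> x \<le> y \<Longrightarrow> y \<le> b \<Longrightarrow> \<bar>F y - F x\<bar> \<le> L * (V y - V x)\<^sup>2"
  shows "F b = F a"
proof -
  define K where "K = max L 0"
  have K: "K \<ge> 0" "L \<le> K" by (auto simp: K_def)
  have bound: "\<bar>F b - F a\<bar> \<le> K * e * (V b - V a)" if e: "e > 0" for e
  proof -
    have "uniformly_continuous_on {a..b} V" by (rule compact_uniformly_continuous[OF V(1)]) simp
    then obtain d where d: "d > 0" "\<And>x y. x \<in> {a..b} \<Longrightarrow> y \<in> {a..b} \<Longrightarrow> dist y x < d \<Longrightarrow> dist (V y) (V x) < e"
      unfolding uniformly_continuous_on_def using e by metis
    obtain n :: nat where n: "(b - a) / d < real n" using reals_Archimedean2 by blast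
    have n0: "real n > 0" using n ab d by (meson divide_nonneg_pos diff_ge_0_iff_ge le_less_trans)
    define h where "h = (b - a) / real n"
    have h: "0 \<le> h" "h < d" using n n0 ab d by (auto simp: h_def field_simps)
    define x where "x i = a + real i * h" for i
    have x: "a \<le> x i" "x i \<le> x (Suc i)" for i using h by (auto simp: x_def algebra_simps)
    have xb: "x i \<le> b" if "i \<le> n" for i
    proof -
      have "real i * h \<le> real n * h" using that h by (intro mult_right_mono) auto
      also have "\<dots> = b - a" using n0 by (simp add: h_def)
      finally show ?thesis by (simp add: x_def)
    qed
    have xe: "x 0 = a" "x n = b" using n0 by (auto simp: x_def h_def)
    have step: "\<bar>F (x (Suc i)) - F (x i)\<bar> \<le> K * e * (V (x (Suc i)) - V (x i))" if "i < n" for i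
    proof -
      have i: "x (Suc i) \<le> b" "x i \<le> b" using xb[of "Suc i"] xb[of i] that by auto
      have m: "0 \<le> V (x (Suc i)) - V (x i)" using V(2)[OF x(1) x(2) i(1)] by simp
      have "dist (x (Suc i)) (x i) < d" using h by (simp add: x_def dist_real_def algebra_simps)
      then have "dist (V (x (Suc i))) (V (x i)) < e" using d(2)[of "x i" "x (Suc i)"] i x(1) by auto
      then have s: "V (x (Suc i)) - V (x i) \<le> e" by (simp add: dist_real_def)
      have "\<bar>F (x (Suc i)) - F (x i)\<bar> \<le> L * (V (x (Suc i)) - V (x i))\<^sup>2" by (rule F[OF x(1) x(2) i(1)])
      also have "\<dots> \<le> K * (V (x (Suc i)) - V (x i))\<^sup>2" using K by (intro mult_right_mono) auto
      also have "\<dots> \<le> K * (e * (V (x (Suc i)) - V (x i)))"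
        unfolding power2_eq_square using K m s by (intro mult_left_mono mult_right_mono) auto
      finally show ?thesis by (simp add: mult.assoc)
    qed
    have "F b - F a = (\<Sum>i<n. F (x (Suc i)) - F (x i))"
      using sum_lessThan_telescope[of "\<lambda>i. F (x i)" n] unfolding xe by (rule sym)
    also have "\<bar>\<dots>\<bar> \<le> (\<Sum>i<n. \<bar>F (x (Suc i)) - F (x i)\<bar>)" by (rule sum_abs)
    also have "\<dots> \<le> (\<Sum>i<n. K * e * (V (x (Suc i)) - V (x i)))" by (intro sum_mono step) simp
    also have "\<dots> = K * e * (V b - V a)" using sum_lessThan_telescope[of "\<lambda>i. V (x i)" n] unfolding xe by (simp only: sum_distrib_left[symmetric])
    finally show ?thesis .
  qed
  have "\<bar>F b - F a\<bar> \<le> 0"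
  proof (rule field_le_epsilon)
    fix e :: real assume e: "e > 0"
    \<comment> \<open>The summand 1 keeps \<open>c\<close> positive when
      \<open>K * (V b - V a)\<close> is 0.\<close>
    define c where "c = K * (V b - V a) + 1"
    have c: "c > 0" using K V(2)[of a b] ab by (simp add: c_def add_nonneg_pos)
    have "\<bar>F b - F a\<bar> \<le> K * (e / c) * (V b - V a)" by (rule bound) (use e c in simp)
    also have "\<dots> = e * ((c - 1) / c)" by (simp add: c_def)
    also have "\<dots> \<le> e * 1" using c e by (intro mult_left_mono) (auto simp: field_simps)
    finally show "\<bar>F b - F a\<bar> \<le> 0 + e" by simp
  qed
  then show ?thesis by simp
qed

lemma set_integral_norm_le:
  fixes f :: "'a \<Rightarrow> 'b::{banach, second_countable_topology}"
  shows "norm (LINT x:A|M. f x) \<le> (LINT x:A|M. norm (f x))"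
  unfolding set_lebesgue_integral_def
  by (rule order_trans[OF integral_norm_bound]) (simp add: norm_scaleR)

lemma set_integrable_mult_continuous:
  fixes g v :: "real \<Rightarrow> real"
  assumes v: "set_integrable lborel {a..b} v" and g: "continuous_on {a..b} g"
  shows "set_integrable lborel {a..b} (\<lambda>s. g s * v s)"
proof -
  have "bounded (g ` {a..b})" by (intro compact_imp_bounded compact_continuous_image g) simp
  then obtain M where M': "\<forall>y\<in>g ` {a..b}. norm y \<le> M" unfolding bounded_iff by blast
  have "integrable lborel (\<lambda>s. (indicator {a..b} s *\<^sub>R g s) * (indicator {a..b} s *\<^sub>R v s))"
  proof (rule Bochner_Integration.integrable_bound)
    show "integrable lborel (\<lambda>s. \<bar>M\<bar> * (indicator {a..b} s *\<^sub>R v s))"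
      using v unfolding set_integrable_def by (rule integrable_mult_right)
    show "(\<lambda>s. (indicator {a..b} s *\<^sub>R g s) * (indicator {a..b} s *\<^sub>R v s)) \<in> borel_measurable lborel"
    proof (rule borel_measurable_times)
      show "(\<lambda>s. indicator {a..b} s *\<^sub>R g s) \<in> borel_measurable lborel"
        using borel_measurable_continuous_on_indicator[OF _ g] by simp
      show "(\<lambda>s. indicator {a..b} s *\<^sub>R v s) \<in> borel_measurable lborel"
        using v unfolding set_integrable_def by (rule borel_measurable_integrable)
    qed
    have "norm ((indicator {a..b} s *\<^sub>R g s) * (indicator {a..b} s *\<^sub>R v s)) \<le> norm (\<bar>M\<bar> * (indicator {a..b} s *\<^sub>R v s))" for s
    proof (cases "s \<in> {a..b}")
      case True
      then have "norm (g s) \<le> M" using M' by blast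
      then have "\<bar>g s\<bar> \<le> \<bar>M\<bar>" by simp
      then have "\<bar>g s\<bar> * \<bar>v s\<bar> \<le> \<bar>M\<bar> * \<bar>v s\<bar>" by (rule mult_right_mono) simp
      then show ?thesis using True by (simp add: abs_mult)
    qed simp
    then show "AE s in lborel. norm ((indicator {a..b} s *\<^sub>R g s) * (indicator {a..b} s *\<^sub>R v s)) \<le> norm (\<bar>M\<bar> * (indicator {a..b} s *\<^sub>R v s))"
      by simp
  qed
  moreover have "(\<lambda>s. (indicator {a..b} s *\<^sub>R g s) * (indicator {a..b} s *\<^sub>R v s)) = (\<lambda>s. indicator {a..b} s *\<^sub>R (g s * v s))"
    by (simp add: indicator_def fun_eq_iff)
  ultimately show ?thesis by (simp only: set_integrable_def)
qed

text \<open>Let \<open>V\<close> be the integral of \<open>\<bar>v\<bar>\<close>. On an interval,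
  \<open>\<psi> (u s)\<close> differs from the mean value \<open>\<psi> \<xi>\<close> by at most
  \<open>2 * L\<close> times the increment of \<open>V\<close>, so the two sides of the identity
  differ by an error quadratic in that increment, and \<open>constant_of_square_increments\<close>
  applies.\<close>

lemma chain_rule_integral:
  fixes u v \<phi> \<psi> :: "real \<Rightarrow> real"
  assumes ab: "a \<le> b" and v: "set_integrable lborel {a..b} v"
    and FTC: "\<And>x y. a \<le> x \<Longrightarrow> x \<le> y \<Longrightarrow> y \<le> b \<Longrightarrow> u y - u x = (LINT s:{x..y}|lborel. v s)"
    and D: "\<And>t. (\<phi> has_real_derivative \<psi> t) (at t)"
    and L: "\<And>s t. \<bar>\<psi> s - \<psi> t\<bar> \<le> L * \<bar>s - t\<bar>"
  shows "\<phi> (u b) - \<phi> (u a) = (LINT s:{a..b}|lborel. \<psi> (u s) * v s)"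
    and "set_integrable lborel {a..b} (\<lambda>s. \<psi> (u s) * v s)"
proof -
  have L0: "L \<ge> 0" using L[of 1 0] by simp
  have \<psi>c: "continuous_on UNIV \<psi>"
    unfolding continuous_on_iff
  proof (intro ballI allI impI)
    fix x e :: real assume e: "e > 0"
    show "\<exists>d>0. \<forall>x'\<in>UNIV. dist x' x < d \<longrightarrow> dist (\<psi> x') (\<psi> x) < e"
    proof (intro exI[of _ "e / (L + 1)"] conjI ballI impI)
      show "e / (L + 1) > 0" using e L0 by simp
      fix x' assume "dist x' x < e / (L + 1)"
      then have "\<bar>x' - x\<bar> * (L + 1) < e" using L0 by (simp add: dist_real_def pos_less_divide_eq)
      moreover have "L * \<bar>x' - x\<bar> \<le> \<bar>x' - x\<bar> * (L + 1)" by (simp add: algebra_simps)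
      ultimately show "dist (\<psi> x') (\<psi> x) < e" using L[of x' x] by (simp add: dist_real_def)
    qed
  qed
  have uc: "continuous_on {a..b} u" by (rule integral_imp_continuous_Icc[OF v FTC])
  have "continuous_on {a..b} (\<lambda>s. \<psi> (u s))"
    by (rule continuous_on_compose2[OF \<psi>c uc]) simp
  then show gi: "set_integrable lborel {a..b} (\<lambda>s. \<psi> (u s) * v s)"
    by (rule set_integrable_mult_continuous[OF v])
  define V where "V x = (LINT s:{a..x}|lborel. \<bar>v s\<bar>)" for x
  define F where "F x = \<phi> (u x) - (LINT s:{a..x}|lborel. \<psi> (u s) * v s)" for x
  have va: "set_integrable lborel {a..b} (\<lambda>s. \<bar>v s\<bar>)" by (rule set_integrable_abs[OF v])
  have Vd: "V y - V x = (LINT s:{x..y}|lborel. \<bar>v s\<bar>)" if "a \<le> x" "x \<le> y" "y \<le> b" for x y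
  proof -
    have "set_integrable lborel {a..y} (\<lambda>s. \<bar>v s\<bar>)" by (rule set_integrable_subset[OF va]) (use that in auto)
    from set_integral_Icc_split[OF this that(1,2)] show ?thesis by (simp add: V_def)
  qed
  have Vm: "V x \<le> V y" if "a \<le> x" "x \<le> y" "y \<le> b" for x y
  proof -
    have "0 \<le> (LINT s:{x..y}|lborel. \<bar>v s\<bar>)"
      unfolding set_lebesgue_integral_def by (intro Bochner_Integration.integral_nonneg) simp
    then show ?thesis using Vd[OF that] by simp
  qed
  have "F b = F a"
  proof (rule constant_of_square_increments[OF ab _ Vm])
    show "continuous_on {a..b} V" by (rule integral_imp_continuous_Icc[OF va Vd])
    fix x y assume xy: "a \<le> x" "x \<le> y" "y \<le> b"
    have vxy: "set_integrable lborel {x..y} v" by (rule set_integrable_subset[OF v]) (use xy in auto)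
    have gxy: "set_integrable lborel {x..y} (\<lambda>s. \<psi> (u s) * v s)" by (rule set_integrable_subset[OF gi]) (use xy in auto)
    have inc: "\<bar>u t - u x\<bar> \<le> V y - V x" if t: "t \<in> {x..y}" for t
    proof -
      have "u t - u x = (LINT s:{x..t}|lborel. v s)" using FTC[of x t] t xy by auto
      then have "\<bar>u t - u x\<bar> \<le> (LINT s:{x..t}|lborel. \<bar>v s\<bar>)"
        using set_integral_norm_le[of lborel "{x..t}" v] by simp
      also have "\<dots> = V t - V x" using Vd[of x t] t xy by auto
      also have "\<dots> \<le> V y - V x" using Vm[of t y] t xy by auto
      finally show ?thesis .
    qed
    have "\<exists>\<xi>. \<phi> (u y) - \<phi> (u x) = \<psi> \<xi> * (u y - u x) \<and> \<bar>\<xi> - u x\<bar> \<le> \<bar>u y - u x\<bar>"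
    proof (cases "u x" "u y" rule: linorder_cases)
      case less
      then obtain z where "u x < z" "z < u y" "\<phi> (u y) - \<phi> (u x) = (u y - u x) * \<psi> z"
        using MVT2[of "u x" "u y" \<phi> \<psi>] D by blast
      then show ?thesis by (intro exI[of _ z]) (auto simp: mult.commute)
    next
      case greater
      then obtain z where "u y < z" "z < u x" "\<phi> (u x) - \<phi> (u y) = (u x - u y) * \<psi> z"
        using MVT2[of "u y" "u x" \<phi> \<psi>] D by blast
      then show ?thesis by (intro exI[of _ z]) (auto simp: algebra_simps)
    qed simp
    then obtain \<xi> where \<xi>: "\<phi> (u y) - \<phi> (u x) = \<psi> \<xi> * (u y - u x)" "\<bar>\<xi> - u x\<bar> \<le> \<bar>u y - u x\<bar>" by blast
    have \<xi>V: "\<bar>\<xi> - u x\<bar> \<le> V y - V x" using \<xi>(2) inc[of y] xy by auto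
    have ci: "set_integrable lborel {x..y} (\<lambda>s. \<psi> \<xi> * v s)" using vxy by (rule set_integrable_mult_right)
    have "F y - F x = \<phi> (u y) - \<phi> (u x) - (LINT s:{x..y}|lborel. \<psi> (u s) * v s)"
    proof -
      have "set_integrable lborel {a..y} (\<lambda>s. \<psi> (u s) * v s)" by (rule set_integrable_subset[OF gi]) (use xy in auto)
      from set_integral_Icc_split[OF this xy(1,2)] show ?thesis by (simp add: F_def)
    qed
    also have "\<phi> (u y) - \<phi> (u x) = (LINT s:{x..y}|lborel. \<psi> \<xi> * v s)"
      unfolding \<xi>(1) FTC[OF xy] by (rule set_integral_mult_right[symmetric])
    also have "\<dots> - (LINT s:{x..y}|lborel. \<psi> (u s) * v s) = (LINT s:{x..y}|lborel. \<psi> \<xi> * v s - \<psi> (u s) * v s)"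
      by (rule set_integral_diff(2)[OF ci gxy, symmetric])
    finally have "F y - F x = (LINT s:{x..y}|lborel. \<psi> \<xi> * v s - \<psi> (u s) * v s)" .
    then have "\<bar>F y - F x\<bar> \<le> (LINT s:{x..y}|lborel. \<bar>\<psi> \<xi> * v s - \<psi> (u s) * v s\<bar>)"
      using set_integral_norm_le[of lborel "{x..y}" "\<lambda>s. \<psi> \<xi> * v s - \<psi> (u s) * v s"] by simp
    also have "\<dots> \<le> (LINT s:{x..y}|lborel. (2 * L * (V y - V x)) * \<bar>v s\<bar>)"
    proof (rule set_integral_mono)
      show "set_integrable lborel {x..y} (\<lambda>s. \<bar>\<psi> \<xi> * v s - \<psi> (u s) * v s\<bar>)"
        by (intro set_integrable_abs set_integral_diff(1) ci gxy)
      show "set_integrable lborel {x..y} (\<lambda>s. (2 * L * (V y - V x)) * \<bar>v s\<bar>)"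
        by (intro set_integrable_mult_right set_integrable_abs vxy)
      fix s assume s: "s \<in> {x..y}"
      have "\<bar>\<psi> \<xi> - \<psi> (u s)\<bar> \<le> L * \<bar>\<xi> - u s\<bar>" by (rule L)
      also have "\<dots> \<le> L * (2 * (V y - V x))"
      proof (rule mult_left_mono[OF _ L0])
        show "\<bar>\<xi> - u s\<bar> \<le> 2 * (V y - V x)" using abs_triangle_ineq4[of "\<xi> - u x" "u s - u x"] \<xi>V inc[OF s] by simp
      qed
      finally have "\<bar>\<psi> \<xi> - \<psi> (u s)\<bar> * \<bar>v s\<bar> \<le> (L * (2 * (V y - V x))) * \<bar>v s\<bar>" by (rule mult_right_mono) simp
      then show "\<bar>\<psi> \<xi> * v s - \<psi> (u s) * v s\<bar> \<le> (2 * L * (V y - V x)) * \<bar>v s\<bar>"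
        by (simp add: abs_mult left_diff_distrib[symmetric] mult.assoc mult.left_commute)
    qed
    also have "\<dots> = (2 * L * (V y - V x)) * (V y - V x)"
      unfolding set_integral_mult_right Vd[OF xy] ..
    finally show "\<bar>F y - F x\<bar> \<le> (2 * L) * (V y - V x)\<^sup>2" by (simp add: power2_eq_square mult.assoc)
  qed
  \<comment> \<open>Splitting \<open>{a..a}\<close> at \<open>a\<close> shows that the integral
    equals twice itself.\<close>
  moreover have "(LINT s:{a..a}|lborel. \<psi> (u s) * v s) = 0"
  proof -
    have "set_integrable lborel {a..a} (\<lambda>s. \<psi> (u s) * v s)" by (rule set_integrable_subset[OF gi]) (use ab in auto)
    from set_integral_Icc_split[OF this, of a] show ?thesis by simp
  qed
  ultimately show "\<phi> (u b) - \<phi> (u a) = (LINT s:{a..b}|lborel. \<psi> (u s) * v s)"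
    by (simp add: F_def)
qed

text \<open>A smooth replacement for \<open>\<bar>t\<bar>\<close>. The Lipschitz constant
  \<open>1 / e\<close> of the slope comes from the second derivative \<open>e^2 / r^3\<close>, where
  \<open>r = sqrt (t^2 + e^2)\<close> is at least \<open>e\<close>.\<close>

lemma abs_sqrt_deriv:
  fixes e :: real
  assumes e: "e > 0"
  shows "((\<lambda>t. sqrt (t\<^sup>2 + e\<^sup>2)) has_real_derivative t / sqrt (t\<^sup>2 + e\<^sup>2)) (at t)"
    and "\<bar>s / sqrt (s\<^sup>2 + e\<^sup>2) - t / sqrt (t\<^sup>2 + e\<^sup>2)\<bar> \<le> (1 / e) * \<bar>s - t\<bar>"
    and "\<bar>t / sqrt (t\<^sup>2 + e\<^sup>2)\<bar> \<le> 1"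
proof -
  have pos: "t\<^sup>2 + e\<^sup>2 > 0" "sqrt (t\<^sup>2 + e\<^sup>2) > 0" for t using e by (auto intro: add_nonneg_pos)
  have D: "((\<lambda>t. sqrt (t\<^sup>2 + e\<^sup>2)) has_real_derivative t / sqrt (t\<^sup>2 + e\<^sup>2)) (at t)" for t
  proof -
    have "((\<lambda>t. t\<^sup>2 + e\<^sup>2) has_real_derivative 2 * t) (at t)" by (auto intro!: derivative_eq_intros)
    from DERIV_chain2[OF DERIV_real_sqrt[OF pos(1)] this]
    have "((\<lambda>t. sqrt (t\<^sup>2 + e\<^sup>2)) has_real_derivative inverse (sqrt (t\<^sup>2 + e\<^sup>2)) / 2 * (2 * t)) (at t)" .
    moreover have "inverse r / 2 * (2 * t) = t / r" for r :: real by (cases "r = 0") (simp_all add: field_simps)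
    ultimately show ?thesis by (simp only:)
  qed
  show "((\<lambda>t. sqrt (t\<^sup>2 + e\<^sup>2)) has_real_derivative t / sqrt (t\<^sup>2 + e\<^sup>2)) (at t)" by (rule D)
  show "\<bar>t / sqrt (t\<^sup>2 + e\<^sup>2)\<bar> \<le> 1"
  proof -
    have "\<bar>t\<bar> \<le> sqrt (t\<^sup>2 + e\<^sup>2)" by (rule real_le_rsqrt) simp
    then show ?thesis using pos(2)[of t] by (simp add: abs_divide)
  qed
  have D2: "((\<lambda>t. t / sqrt (t\<^sup>2 + e\<^sup>2)) has_real_derivative e\<^sup>2 / (sqrt (t\<^sup>2 + e\<^sup>2))^3) (at t)" for t
  proof -
    let ?r = "sqrt (t\<^sup>2 + e\<^sup>2)"
    have r: "?r > 0" "?r\<^sup>2 = t\<^sup>2 + e\<^sup>2" using pos[of t] by auto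
    have "((\<lambda>t. t / sqrt (t\<^sup>2 + e\<^sup>2)) has_real_derivative (1 * ?r - t * (t / ?r)) / (?r * ?r)) (at t)"
      by (rule DERIV_divide[OF DERIV_ident D]) (use r(1) in linarith)
    also have "(1 * ?r - t * (t / ?r)) / (?r * ?r) = (?r\<^sup>2 - t\<^sup>2) / ?r^3"
      using r(1) by (simp add: divide_simps power2_eq_square power3_eq_cube)
    also have "?r\<^sup>2 - t\<^sup>2 = e\<^sup>2" unfolding r(2) by simp
    finally show ?thesis .
  qed
  have b: "\<bar>e\<^sup>2 / (sqrt (t\<^sup>2 + e\<^sup>2))^3\<bar> \<le> 1 / e" for t
  proof -
    have "e \<le> sqrt (t\<^sup>2 + e\<^sup>2)" by (rule real_le_rsqrt) simp
    then have "e^3 \<le> (sqrt (t\<^sup>2 + e\<^sup>2))^3" using e by (intro power_mono) auto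
    then have "e\<^sup>2 / (sqrt (t\<^sup>2 + e\<^sup>2))^3 \<le> e\<^sup>2 / e^3" using e pos(2)[of t] by (intro divide_left_mono mult_pos_pos zero_less_power) auto
    also have "\<dots> = 1 / e" using e by (simp add: power2_eq_square power3_eq_cube)
    finally show ?thesis using pos(2)[of t] by simp
  qed
  have *: "\<bar>s / sqrt (s\<^sup>2 + e\<^sup>2) - t / sqrt (t\<^sup>2 + e\<^sup>2)\<bar> \<le> (1 / e) * \<bar>s - t\<bar>" if ts: "t < s" for s t
  proof -
    obtain z where z: "s / sqrt (s\<^sup>2 + e\<^sup>2) - t / sqrt (t\<^sup>2 + e\<^sup>2) = (s - t) * (e\<^sup>2 / (sqrt (z\<^sup>2 + e\<^sup>2))^3)"
      using MVT2[OF ts, of "\<lambda>t. t / sqrt (t\<^sup>2 + e\<^sup>2)" "\<lambda>t. e\<^sup>2 / (sqrt (t\<^sup>2 + e\<^sup>2))^3"] D2 by blast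
    have "\<bar>s - t\<bar> * \<bar>e\<^sup>2 / (sqrt (z\<^sup>2 + e\<^sup>2))^3\<bar> \<le> \<bar>s - t\<bar> * (1 / e)"
      by (intro mult_left_mono b) simp
    then show ?thesis unfolding z abs_mult by (simp only: mult.commute)
  qed
  show "\<bar>s / sqrt (s\<^sup>2 + e\<^sup>2) - t / sqrt (t\<^sup>2 + e\<^sup>2)\<bar> \<le> (1 / e) * \<bar>s - t\<bar>"
    using *[of t s] *[of s t] by (cases s t rule: linorder_cases) (simp_all add: abs_minus_commute)
qed

text \<open>The limit \<open>e \<rightarrow> 0\<close> of the chain rule for the smoothed absolute
  value. At zeros of \<open>u\<close> the approximating slopes vanish as well, in agreement with
  \<open>sgn 0 = 0\<close>.\<close>

lemma abs_integral:
  fixes u v :: "real \<Rightarrow> real"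
  assumes ab: "a \<le> b" and v: "set_integrable lborel {a..b} v"
    and FTC: "\<And>x y. a \<le> x \<Longrightarrow> x \<le> y \<Longrightarrow> y \<le> b \<Longrightarrow> u y - u x = (LINT s:{x..y}|lborel. v s)"
  shows "\<bar>u b\<bar> - \<bar>u a\<bar> = (LINT s:{a..b}|lborel. sgn (u s) * v s)"
proof -
  define e where "e n = 1 / real (Suc n)" for n
  have e: "e n > 0" for n by (simp add: e_def)
  have e0: "e \<longlonglongrightarrow> 0" unfolding e_def using LIMSEQ_inverse_real_of_nat by (simp add: inverse_eq_divide)
  define \<psi> where "\<psi> n t = t / sqrt (t\<^sup>2 + (e n)\<^sup>2)" for n t
  have C: "sqrt ((u b)\<^sup>2 + (e n)\<^sup>2) - sqrt ((u a)\<^sup>2 + (e n)\<^sup>2) = (LINT s:{a..b}|lborel. \<psi> n (u s) * v s)"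
    "set_integrable lborel {a..b} (\<lambda>s. \<psi> n (u s) * v s)" for n
    unfolding \<psi>_def
    by (rule chain_rule_integral[OF ab v FTC abs_sqrt_deriv(1)[OF e[of n]] abs_sqrt_deriv(2)[OF e[of n]]]; assumption)+
  have "(\<lambda>n. sqrt ((u b)\<^sup>2 + (e n)\<^sup>2) - sqrt ((u a)\<^sup>2 + (e n)\<^sup>2)) \<longlonglongrightarrow> sqrt ((u b)\<^sup>2 + 0\<^sup>2) - sqrt ((u a)\<^sup>2 + 0\<^sup>2)"
    by (intro tendsto_intros e0)
  then have 1: "(\<lambda>n. LINT s:{a..b}|lborel. \<psi> n (u s) * v s) \<longlonglongrightarrow> \<bar>u b\<bar> - \<bar>u a\<bar>"
    unfolding C(1) by (simp only: power_zero_numeral add_0_right real_sqrt_abs)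
  have lim: "(\<lambda>n. \<psi> n t) \<longlonglongrightarrow> sgn t" for t
  proof (cases "t = 0")
    case False
    have "(\<lambda>n. \<psi> n t) \<longlonglongrightarrow> t / sqrt (t\<^sup>2 + 0\<^sup>2)"
      unfolding \<psi>_def by (intro tendsto_intros e0) (use False in simp)
    then show ?thesis using False by (simp add: sgn_div_norm divide_inverse mult.commute)
  qed (simp add: \<psi>_def)
  have m: "(\<lambda>s. indicator {a..b} s *\<^sub>R (\<psi> n (u s) * v s)) \<in> borel_measurable lborel" for n
    using C(2)[of n] unfolding set_integrable_def by (rule borel_measurable_integrable)
  have pl: "(\<lambda>n. indicator {a..b} s *\<^sub>R (\<psi> n (u s) * v s)) \<longlonglongrightarrow> indicator {a..b} s *\<^sub>R (sgn (u s) * v s)" for s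
    by (intro tendsto_intros lim)
  have "(\<lambda>n. LINT s|lborel. indicator {a..b} s *\<^sub>R (\<psi> n (u s) * v s)) \<longlonglongrightarrow> (LINT s|lborel. indicator {a..b} s *\<^sub>R (sgn (u s) * v s))"
  proof (rule integral_dominated_convergence[where w = "\<lambda>s. indicator {a..b} s *\<^sub>R \<bar>v s\<bar>"])
    show "(\<lambda>s. indicator {a..b} s *\<^sub>R (sgn (u s) * v s)) \<in> borel_measurable lborel"
      by (rule borel_measurable_LIMSEQ_real[OF pl m])
    show "integrable lborel (\<lambda>s. indicator {a..b} s *\<^sub>R \<bar>v s\<bar>)"
      using set_integrable_abs[OF v] by (simp add: set_integrable_def)
    have "norm (indicator {a..b} s *\<^sub>R (\<psi> n (u s) * v s)) \<le> indicator {a..b} s *\<^sub>R \<bar>v s\<bar>" for n s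
    proof -
      have "\<bar>\<psi> n (u s)\<bar> * \<bar>v s\<bar> \<le> 1 * \<bar>v s\<bar>"
        unfolding \<psi>_def by (intro mult_right_mono abs_sqrt_deriv(3) e) simp
      then show ?thesis by (simp add: abs_mult indicator_def)
    qed
    then show "AE s in lborel. norm (indicator {a..b} s *\<^sub>R (\<psi> n (u s) * v s)) \<le> indicator {a..b} s *\<^sub>R \<bar>v s\<bar>" for n
      by simp
  qed (use pl m in auto)
  then show ?thesis
    using 1 LIMSEQ_unique unfolding set_lebesgue_integral_def by blast
qed

text \<open>The Borel sets over which the integral vanishes form a Dynkin system containing the
  compact intervals, a generator stable under intersection. A density whose integrals all vanish is
  0 almost everywhere.\<close>

lemma integral_zero_imp_AE:
  fixes v :: "real \<Rightarrow> 'b::{banach, second_countable_topology}"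
  assumes v: "set_integrable lborel {a..b} v"
    and z: "\<And>x y. a \<le> x \<Longrightarrow> x \<le> y \<Longrightarrow> y \<le> b \<Longrightarrow> (LINT s:{x..y}|lborel. v s) = 0"
  shows "AE s in lborel. s \<in> {a..b} \<longrightarrow> v s = 0"
proof (cases "a \<le> b")
  case ab: True
  define f where "f s = indicator {a..b} s *\<^sub>R v s" for s
  have f: "integrable lborel f" using v by (simp add: f_def[abs_def] set_integrable_def)
  have fA: "set_integrable lborel A f" if "A \<in> sets lborel" for A
    using f that by (simp add: set_integrable_def integrable_mult_indicator)
  have "(LINT s:A|lborel. f s) = 0" if "A \<in> sets lborel" for A
  proof -
    have A: "A \<in> sigma_sets UNIV (range (\<lambda>(a,b). {a..b :: real}))"
      using that unfolding sets_lborel by (subst (asm) borel_eq_atLeastAtMost) simp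
    have I: "Int_stable (range (\<lambda>(a,b). {a..b :: real}))"
      unfolding Int_stable_def by (auto simp: Int_atLeastAtMost)
    have m: "B \<in> sets lborel" if "B \<in> sigma_sets UNIV (range (\<lambda>(a,b). {a..b :: real}))" for B
      using that unfolding sets_lborel by (subst borel_eq_atLeastAtMost) simp
    have all: "(LINT s|lborel. f s) = 0"
      using z[of a b] ab by (simp add: f_def set_lebesgue_integral_def)
    show ?thesis
    proof (induction rule: sigma_sets_induct_disjoint[OF I _ A, consumes 0])
      case 1
      show ?case by simp
    next
      case (2 B)
      then obtain c d where B: "B = {c..d}" by auto
      show ?case
      proof (cases "max a c \<le> min b d")
        case True
        have "(LINT s:B|lborel. f s) = (LINT s:{max a c..min b d}|lborel. v s)"
          unfolding set_lebesgue_integral_def B f_def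
          by (rule Bochner_Integration.integral_cong) (auto simp: indicator_def)
        also have "\<dots> = 0" by (rule z) (use True in auto)
        finally show ?thesis .
      next
        case False
        have "(\<lambda>s. indicator B s *\<^sub>R f s) = (\<lambda>s. 0)"
          using False by (auto simp: B f_def indicator_def fun_eq_iff)
        then show ?thesis by (simp add: set_lebesgue_integral_def)
      qed
    next
      case 3
      then show ?case by (simp add: set_lebesgue_integral_def)
    next
      case (4 B)
      have i: "integrable lborel (\<lambda>s. indicator B s *\<^sub>R f s)" using fA[OF m[OF 4(1)]] by (simp add: set_integrable_def)
      have "(LINT s:UNIV - B|lborel. f s) = (LINT s|lborel. f s - indicator B s *\<^sub>R f s)"
        unfolding set_lebesgue_integral_def
        by (rule Bochner_Integration.integral_cong) (auto simp: indicator_def)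
      also have "\<dots> = 0"
        using Bochner_Integration.integral_diff[OF f i] all 4(2) by (simp add: set_lebesgue_integral_def)
      finally show ?case .
    next
      case (5 B)
      have mB: "B i \<in> sets lborel" for i using m 5(2) by blast
      have "(LINT s:(\<Union>i. B i)|lborel. f s) = (\<Sum>i. (LINT s:B i|lborel. f s))"
        by (rule lebesgue_integral_countable_add) (use 5(1) mB fA in \<open>auto simp: disjoint_family_on_def\<close>)
      then show ?case using 5(3) by simp
    qed
  qed
  then have "AE s in lborel. f s = 0" by (rule sigma_finite_measure.density_zero[OF sigma_finite_lborel f])
  then show ?thesis by eventually_elim (auto simp: f_def)
qed simp

section \<open>Functions on the tree\<close>

text \<open>The weight is twice the normal density with mean \<open>- c\<close> and variance
  \<open>1 / 2\<close>.\<close>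

lemma integrable_gauss_shift: "integrable lborel (\<lambda>s. 2 / sqrt pi * exp (- (c + s)\<^sup>2))"
proof -
  have "integrable lborel (\<lambda>s. 2 * normal_density (- c) (1 / sqrt 2) s)" by simp
  moreover have "2 * normal_density (- c) (1 / sqrt 2) s = 2 / sqrt pi * exp (- (c + s)\<^sup>2)" for s
    by (simp add: normal_density_def power_divide add.commute)
  ultimately show ?thesis by simp
qed

lemma nn_integral_cls:
  assumes f: "sqint M f"
  shows "(\<integral>\<^sup>+x. ennreal ((cmod (f x))\<^sup>2) \<partial>M) = ennreal ((norm (cls M f))\<^sup>2)"
  unfolding norm_cls[OF f] using f by (intro nn_integral_eq_integral) (auto simp: sqint_def)

fun edge_base :: "('v, 'e) metric_tree \<Rightarrow> ('v, 'e) edge \<Rightarrow> 'v" where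
  "edge_base G (Arc e) = tail (core G) e"
| "edge_base G (Ray v k) = v"

locale rooted_tree =
  fixes G :: "('v, 'e) metric_tree"
  assumes tree: "rooted_metric_tree G"
begin

abbreviation E where "E \<equiv> edges G"
abbreviation I where "I \<equiv> edge_interior G"
abbreviation J where "J \<equiv> edge_closure G"
abbreviation ch where "ch \<equiv> chart G"
abbreviation \<mu> where "\<mu> \<equiv> mu G"

definition off :: "('v, 'e) edge \<Rightarrow> real" where "off e = vertex_dist G (edge_base G e)"
text \<open>The density of \<open>mu\<close> with respect to arc length along \<open>e\<close>; see
  \<open>root_dist_ch\<close>.\<close>

definition W :: "('v, 'e) edge \<Rightarrow> real \<Rightarrow> real" where "W e s = 2 / sqrt pi * exp (- (off e + s)\<^sup>2)"

section \<open>Combinatorics and topology of the tree\<close>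

lemma fin: "fin_digraph (core G)" using tree by (simp add: rooted_metric_tree_def)

lemma wf: "wf_digraph (core G)" using fin by (simp add: fin_digraph_def)

lemma arc_len_pos: "e \<in> arcs (core G) \<Longrightarrow> 0 < arc_len G e" using tree by (simp add: rooted_metric_tree_def)

lemma tail_head: "e \<in> arcs (core G) \<Longrightarrow> tail (core G) e \<in> verts (core G)" "e \<in> arcs (core G) \<Longrightarrow> head (core G) e \<in> verts (core G)"
  using wf by (simp_all add: wf_digraph.tail_in_verts wf_digraph.head_in_verts)

lemma origin_vert: "origin G \<in> verts (core G)" using tree by (simp add: rooted_metric_tree_def)

lemma leaves_vert: "v \<in> leaves G \<Longrightarrow> v \<in> verts (core G)" by (simp add: leaves_def)

lemma finite_E: "finite E"
proof -
  have eq: "{Ray v k |v k. v \<in> leaves G \<and> k < rays G v} = (\<Union>v\<in>leaves G. Ray v ` {..<rays G v})" by auto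
  have "finite (leaves G)"
    using fin_digraph.finite_verts[OF fin] by (rule finite_subset[rotated]) (auto simp: leaves_def)
  then have "finite {Ray v k |v k. v \<in> leaves G \<and> k < rays G v}" unfolding eq by (intro finite_UN_I) auto
  then show ?thesis using fin_digraph.finite_arcs[OF fin] by (simp add: edges_def)
qed

lemma edge_cases:
  assumes "e \<in> E"
  obtains (arc) a where "e = Arc a" "a \<in> arcs (core G)" | (ray) v k where "e = Ray v k" "v \<in> leaves G" "k < rays G v"
  using assms by (auto simp: edges_def)

lemma I_J: "I e \<subseteq> J e" by (cases e) auto

lemma J_0: "e \<in> E \<Longrightarrow> 0 \<in> J e"
  by (erule edge_cases) (auto dest: arc_len_pos)

lemma J_nonneg: "s \<in> J e \<Longrightarrow> 0 \<le> s" by (cases e) auto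

lemma J_interval: "a \<in> J e \<Longrightarrow> b \<in> J e \<Longrightarrow> {a..b} \<subseteq> J e" by (cases e) auto

lemma J_Icc: "e \<in> E \<Longrightarrow> b \<in> J e \<Longrightarrow> {0..b} \<subseteq> J e" using J_interval J_0 by blast

lemma J_Ioo: "b \<in> J e \<Longrightarrow> {0<..<b} \<subseteq> I e" by (cases e) auto

lemma open_I: "open (I e)" by (cases e) auto

lemma interval_I: "is_interval (I e)" by (cases e) (auto simp: is_interval_1)

lemma sets_J: "J e \<in> sets borel" by (cases e) auto

lemma sets_I: "I e \<in> sets borel" using open_I by simp

lemma ex_pos_J: "e \<in> E \<Longrightarrow> \<exists>b\<in>J e. b > 0"
proof (erule edge_cases)
  fix a assume "e = Arc a" "a \<in> arcs (core G)"
  then show ?thesis by (intro bexI[of _ "arc_len G a"]) (auto dest: arc_len_pos)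
qed (auto intro: bexI[of _ 1])

lemma ch_0: "ch e 0 = Vertex (edge_base G e)" by (cases e) auto

lemma ch_I: "s \<in> I e \<Longrightarrow> ch e s = Inner e s" by (cases e) auto

lemma ch_points: "e \<in> E \<Longrightarrow> s \<in> J e \<Longrightarrow> ch e s \<in> points G"
  by (erule edge_cases) (auto simp: points_def edges_def tail_head leaves_vert)

lemma edge_base_vert: "e \<in> E \<Longrightarrow> edge_base G e \<in> verts (core G)"
  by (erule edge_cases) (auto simp: tail_head leaves_vert)

text \<open>Induction along the directed walk from the root to \<open>v\<close>.\<close>

lemma vertex_induct [consumes 1, case_names origin arc]:
  assumes v: "v \<in> verts (core G)" and o: "P (origin G)"
    and a: "\<And>a. a \<in> arcs (core G) \<Longrightarrow> P (tail (core G) a) \<Longrightarrow> P (head (core G) a)"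
  shows "P v"
proof -
  obtain p where p: "pre_digraph.awalk (core G) (origin G) p v"
    using tree v unfolding rooted_metric_tree_def by blast
  have "pre_digraph.cas (core G) u p v \<Longrightarrow> set p \<subseteq> arcs (core G) \<Longrightarrow> P u \<Longrightarrow> P v" for u
  proof (induction p arbitrary: u)
    case Nil
    then show ?case by (simp add: pre_digraph.cas.simps)
  next
    case (Cons e p)
    then have "tail (core G) e = u" "pre_digraph.cas (core G) (head (core G) e) p v" "e \<in> arcs (core G)" "set p \<subseteq> arcs (core G)"
      by (auto simp: pre_digraph.cas.simps)
    then show ?case using Cons.IH a Cons.prems(3) by blast
  qed
  then show ?thesis using p o unfolding pre_digraph.awalk_def by blast
qed

lemma points_ch:
  assumes "p \<in> points G"
  obtains e s where "e \<in> E" "s \<in> J e" "p = ch e s"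
proof -
  note result = that
  consider (v) v where "p = Vertex v" "v \<in> verts (core G)" | (i) e s where "p = Inner e s" "e \<in> E" "s \<in> I e"
    using assms by (auto simp: points_def)
  then show thesis
  proof cases
    case v
    have hd: thesis if a: "a \<in> arcs (core G)" "v = head (core G) a" for a
    proof (rule result)
      show "Arc a \<in> E" using a by (simp add: edges_def)
      show "arc_len G a \<in> J (Arc a)" using arc_len_pos[OF a(1)] by simp
      show "p = ch (Arc a) (arc_len G a)" using arc_len_pos[OF a(1)] v(1) a(2) by simp
    qed
    have tl: thesis if a: "a \<in> arcs (core G)" "v = tail (core G) a" for a
    proof (rule result)
      show "Arc a \<in> E" using a by (simp add: edges_def)
      show "0 \<in> J (Arc a)" using arc_len_pos[OF a(1)] by simp
      show "p = ch (Arc a) 0" using v(1) a(2) by simp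
    qed
    have "v = origin G \<or> (\<exists>a\<in>arcs (core G). v = head (core G) a)"
      using v(2) by (induction rule: vertex_induct) auto
    then consider "v = origin G" | a where "a \<in> arcs (core G)" "v = head (core G) a" by blast
    note v_cases = this
    \<comment> \<open>The root, too, must lie on an edge. A leaf differs from the root, so the walk
      leading to it uses an arc that starts at the root; the induction proves this as a
      disjunction.\<close>
    obtain l where l: "l \<in> leaves G" using tree unfolding rooted_metric_tree_def by blast
    have "l = origin G \<or> (\<exists>a\<in>arcs (core G). tail (core G) a = origin G)"
      using leaves_vert[OF l] by (induction rule: vertex_induct) blast+
    moreover have "l \<noteq> origin G" using l by (simp add: leaves_def)
    ultimately have "\<exists>a\<in>arcs (core G). origin G = tail (core G) a" by metis
    then show ?thesis using v_cases hd tl by metis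
  next
    case i
    show ?thesis by (rule result[of e s]) (use i I_J ch_I[of s e] in auto)
  qed
qed

text \<open>Appending the arc to the walk to its tail gives the unique walk to its head. This makes
  \<open>root_dist\<close> consistent at the far end of an arc.\<close>

lemma vertex_dist_head:
  assumes a: "a \<in> arcs (core G)"
  shows "vertex_dist G (head (core G) a) = vertex_dist G (tail (core G) a) + arc_len G a"
proof -
  have ex: "\<exists>!p. pre_digraph.awalk (core G) (origin G) p v" if "v \<in> verts (core G)" for v
    using tree that unfolding rooted_metric_tree_def by blast
  define p where "p = (THE p. pre_digraph.awalk (core G) (origin G) p (tail (core G) a))"
  have p: "pre_digraph.awalk (core G) (origin G) p (tail (core G) a)"
    unfolding p_def by (rule theI'[OF ex[OF tail_head(1)[OF a]]])
  have cas: "pre_digraph.cas (core G) u q (tail (core G) a) \<Longrightarrow> pre_digraph.cas (core G) u (q @ [a]) (head (core G) a)" for u q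
    by (induction q arbitrary: u) (auto simp: pre_digraph.cas.simps)
  have "pre_digraph.awalk (core G) (origin G) (p @ [a]) (head (core G) a)"
    using p cas a unfolding pre_digraph.awalk_def by auto
  then have "(THE p. pre_digraph.awalk (core G) (origin G) p (head (core G) a)) = p @ [a]"
    by (rule the1_equality[OF ex[OF tail_head(2)[OF a]]])
  then show ?thesis by (simp add: vertex_dist_def p_def)
qed

lemma root_dist_ch: "e \<in> E \<Longrightarrow> s \<in> J e \<Longrightarrow> root_dist G (ch e s) = off e + s"
  by (erule edge_cases) (auto simp: off_def vertex_dist_head)

lemma topspace_tree: "topspace (tree_topology G) = points G"
proof -
  have "{s \<in> J e. ch e s \<in> points G} = J e" if "e \<in> E" for e using ch_points[OF that] by auto
  then have "openin (tree_topology G) (points G)" unfolding openin_tree_topology open_in_tree_def by simp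
  moreover have "U \<subseteq> points G" if "openin (tree_topology G) U" for U
    using that unfolding openin_tree_topology open_in_tree_def by blast
  ultimately show ?thesis unfolding topspace_def by blast
qed

text \<open>The universal property of the gluing topology; continuity on the tree is checked edge by
  edge through it.\<close>

lemma continuous_tree_iff:
  "continuous_map (tree_topology G) euclidean f \<longleftrightarrow> (\<forall>e\<in>E. continuous_on (J e) (\<lambda>s. f (ch e s)))"
proof -
  have e: "{s \<in> J e. ch e s \<in> {x \<in> points G. f x \<in> U}} = {s \<in> J e. f (ch e s) \<in> U}" if "e \<in> E" for e U
    using ch_points[OF that] by auto
  have "continuous_map (tree_topology G) euclidean f \<longleftrightarrow>
      (\<forall>U. open U \<longrightarrow> (\<forall>e\<in>E. openin (top_of_set (J e)) {s \<in> J e. f (ch e s) \<in> U}))"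
    unfolding continuous_map_def topspace_tree openin_tree_topology open_in_tree_def using e
    by (auto simp: open_openin[symmetric])
  also have "\<dots> \<longleftrightarrow> (\<forall>e\<in>E. continuous_map (top_of_set (J e)) euclidean (\<lambda>s. f (ch e s)))"
    unfolding continuous_map_def by (auto simp: open_openin[symmetric])
  finally show ?thesis by (simp only: continuous_map_iff_continuous)
qed

lemma opens_Pow: "{U. openin (tree_topology G) U} \<subseteq> Pow (points G)"
  using openin_subset[of "tree_topology G"] by (auto simp: topspace_tree)

lemma space_tree_borel [simp]: "space (tree_borel G) = points G"
  unfolding tree_borel_def by (rule space_measure_of[OF opens_Pow])

lemma sets_tree_borel: "sets (tree_borel G) = sigma_sets (points G) {U. openin (tree_topology G) U}"
  unfolding tree_borel_def by (rule sets_measure_of[OF opens_Pow])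

lemma continuous_tree_measurable:
  fixes f :: "('v, 'e) point \<Rightarrow> 'b::topological_space"
  assumes "continuous_map (tree_topology G) euclidean f"
  shows "f \<in> borel_measurable (tree_borel G)"
proof (rule borel_measurableI)
  fix S :: "'b set" assume S: "open S"
  have "openin (tree_topology G) {x \<in> points G. f x \<in> S}"
    using assms S unfolding continuous_map_def topspace_tree by (auto simp: open_openin[symmetric])
  then show "f -` S \<inter> space (tree_borel G) \<in> sets (tree_borel G)"
    unfolding sets_tree_borel by (intro sigma_sets.Basic) (auto simp: vimage_def Int_def conj_commute)
qed

lemma chart_measurable:
  assumes e: "e \<in> E"
  shows "ch e \<in> measurable (restrict_space borel (J e)) (tree_borel G)"
  unfolding tree_borel_def
proof (rule measurable_measure_of[OF opens_Pow])
  show "ch e \<in> space (restrict_space borel (J e)) \<rightarrow> points G"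
    using ch_points[OF e] by (auto simp: space_restrict_space)
  fix U assume U: "U \<in> {U. openin (tree_topology G) U}"
  then have "openin (top_of_set (J e)) {s \<in> J e. ch e s \<in> U}"
    using e unfolding openin_tree_topology open_in_tree_def by blast
  then obtain S where "open S" "{s \<in> J e. ch e s \<in> U} = J e \<inter> S" by (auto simp: openin_open)
  then have "{s \<in> J e. ch e s \<in> U} \<in> sets borel" using sets_J by simp
  moreover have "ch e -` U \<inter> space (restrict_space borel (J e)) = {s \<in> J e. ch e s \<in> U}"
    by (auto simp: space_restrict_space)
  ultimately show "ch e -` U \<inter> space (restrict_space borel (J e)) \<in> sets (restrict_space borel (J e))"
    using sets_J by (auto simp: sets_restrict_space_iff)
qed

lemma measurable_edge:
  fixes f :: "('v, 'e) point \<Rightarrow> 'b::real_normed_vector"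
  assumes e: "e \<in> E" and f: "f \<in> borel_measurable (tree_borel G)"
  shows "(\<lambda>s. indicator (J e) s *\<^sub>R f (ch e s)) \<in> borel_measurable borel"
  using measurable_compose[OF chart_measurable[OF e] f] sets_J
  by (subst (asm) borel_measurable_restrict_space_iff) auto

lemma measurable_edge_ennreal:
  fixes f :: "('v, 'e) point \<Rightarrow> ennreal"
  assumes e: "e \<in> E" and f: "f \<in> borel_measurable (tree_borel G)"
  shows "(\<lambda>s. f (ch e s) * indicator (I e) s) \<in> borel_measurable borel"
proof -
  have "(\<lambda>s. f (ch e s) * indicator (J e) s) \<in> borel_measurable borel"
    using measurable_compose[OF chart_measurable[OF e] f] sets_J
    by (subst (asm) borel_measurable_restrict_space_iff_ennreal) auto
  then have "(\<lambda>s. f (ch e s) * indicator (J e) s * indicator (I e) s) \<in> borel_measurable borel"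
    by (rule borel_measurable_times_ennreal[OF _ borel_measurable_indicator]) (rule sets_I)
  moreover have "f (ch e s) * indicator (J e) s * indicator (I e) s = f (ch e s) * indicator (I e) s" for s
    using I_J[of e] by (auto simp: indicator_def)
  ultimately show ?thesis by simp
qed

section \<open>The measure on the edges\<close>

abbreviation "param \<equiv> restrict_space (count_space E \<Otimes>\<^sub>M (lborel :: real measure)) (SIGMA e:E. I e)"

lemma sets_edges_union:
  assumes "\<And>e. e \<in> E \<Longrightarrow> A e \<in> sets borel"
  shows "(SIGMA e:E. A e) \<in> sets (count_space E \<Otimes>\<^sub>M (lborel :: real measure))"
proof -
  have "(SIGMA e:E. A e) = (\<Union>e\<in>E. {e} \<times> A e)" by auto
  moreover have "{e} \<times> A e \<in> sets (count_space E \<Otimes>\<^sub>M (lborel :: real measure))" if "e \<in> E" for e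
    using assms[OF that] that by (intro pair_measureI) auto
  ultimately show ?thesis using finite_E by (metis (no_types, lifting) sets.finite_UN)
qed

lemma chart_param_measurable: "(\<lambda>(e, s). ch e s) \<in> measurable param (tree_borel G)"
  unfolding tree_borel_def
proof (rule measurable_measure_of[OF opens_Pow])
  have sp: "space param = (SIGMA e:E. I e)" by (auto simp: space_restrict_space space_pair_measure)
  show "(\<lambda>(e, s). ch e s) \<in> space param \<rightarrow> points G"
    unfolding sp using ch_points I_J by auto
  fix U assume U: "U \<in> {U. openin (tree_topology G) U}"
  have "{s \<in> I e. ch e s \<in> U} \<in> sets borel" if e: "e \<in> E" for e
  proof -
    have "openin (top_of_set (J e)) {s \<in> J e. ch e s \<in> U}"
      using U e unfolding openin_tree_topology open_in_tree_def by blast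
    then obtain S where S: "open S" "{s \<in> J e. ch e s \<in> U} = J e \<inter> S" by (auto simp: openin_open)
    then have "{s \<in> I e. ch e s \<in> U} = I e \<inter> S" using I_J[of e] by auto
    then show ?thesis using S open_I[of e] by simp
  qed
  then have "(SIGMA e:E. {s \<in> I e. ch e s \<in> U}) \<in> sets (count_space E \<Otimes>\<^sub>M (lborel :: real measure))"
    by (rule sets_edges_union)
  moreover have "(\<lambda>(e, s). ch e s) -` U \<inter> space param = (SIGMA e:E. {s \<in> I e. ch e s \<in> U})"
    unfolding sp by auto
  ultimately show "(\<lambda>(e, s). ch e s) -` U \<inter> space param \<in> sets param"
    using sets_edges_union[of I, OF sets_I] by (auto simp: sets_restrict_space_iff)
qed

lemma nn_integral_tree_lebesgue:
  assumes f: "f \<in> borel_measurable (tree_borel G)"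
  shows "(\<integral>\<^sup>+x. f x \<partial>tree_lebesgue G) = (\<Sum>e\<in>E. \<integral>\<^sup>+s. f (ch e s) * indicator (I e) s \<partial>lborel)"
proof -
  let ?C = "count_space E \<Otimes>\<^sub>M (lborel :: real measure)"
  have S: "(SIGMA e:E. I e) \<in> sets ?C" by (rule sets_edges_union[OF sets_I])
  have m: "(\<lambda>p. f (case p of (e, s) \<Rightarrow> ch e s)) \<in> borel_measurable param"
    using measurable_compose[OF chart_param_measurable f] by simp
  have m': "(\<lambda>p. f (case p of (e, s) \<Rightarrow> ch e s) * indicator (SIGMA e:E. I e) p) \<in> borel_measurable ?C"
    using m S by (subst (asm) borel_measurable_restrict_space_iff_ennreal) auto
  have "(\<integral>\<^sup>+x. f x \<partial>tree_lebesgue G) = (\<integral>\<^sup>+p. f (case p of (e, s) \<Rightarrow> ch e s) \<partial>param)"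
    unfolding tree_lebesgue_def using chart_param_measurable f by (subst nn_integral_distr) auto
  also have "\<dots> = (\<integral>\<^sup>+p. f (case p of (e, s) \<Rightarrow> ch e s) * indicator (SIGMA e:E. I e) p \<partial>?C)"
    using S by (intro nn_integral_restrict_space) auto
  also have "\<dots> = (\<integral>\<^sup>+e. \<integral>\<^sup>+s. f (ch e s) * indicator (SIGMA e:E. I e) (e, s) \<partial>lborel \<partial>count_space E)"
    using lborel.nn_integral_fst[OF m'] by simp
  also have "\<dots> = (\<Sum>e\<in>E. \<integral>\<^sup>+s. f (ch e s) * indicator (SIGMA e:E. I e) (e, s) \<partial>lborel)"
    by (rule nn_integral_count_space_finite[OF finite_E])
  also have "\<dots> = (\<Sum>e\<in>E. \<integral>\<^sup>+s. f (ch e s) * indicator (I e) s \<partial>lborel)"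
    by (intro sum.cong nn_integral_cong refl) (auto simp: indicator_def)
  finally show ?thesis .
qed

lemma sets_tree_lebesgue: "sets (tree_lebesgue G) = sets (tree_borel G)"
  by (simp add: tree_lebesgue_def)

lemma sets_mu [simp]: "sets \<mu> = sets (tree_borel G)"
  by (simp add: mu_def sets_tree_lebesgue)

lemma space_mu [simp]: "space \<mu> = points G"
  using sets_eq_imp_space_eq[OF sets_mu] by simp

lemma measurable_mu: "borel_measurable \<mu> = borel_measurable (tree_borel G)"
  by (rule measurable_cong_sets) auto

lemma weight_measurable: "(\<lambda>x. ennreal (2 / sqrt pi * exp (- (root_dist G x)\<^sup>2))) \<in> borel_measurable (tree_borel G)"
proof -
  have "continuous_map (tree_topology G) euclidean (root_dist G)"
    unfolding continuous_tree_iff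
  proof
    fix e assume e: "e \<in> E"
    have "continuous_on (J e) (\<lambda>s. off e + s)" by (intro continuous_intros)
    then show "continuous_on (J e) (\<lambda>s. root_dist G (ch e s))"
      by (rule continuous_on_eq) (simp only: root_dist_ch[OF e])
  qed
  then have [measurable]: "root_dist G \<in> borel_measurable (tree_borel G)" by (rule continuous_tree_measurable)
  show ?thesis by measurable
qed

text \<open>Norms and null sets of \<open>mu\<close> are accessed through this reduction to finitely
  many weighted Lebesgue integrals.\<close>

lemma nn_integral_mu:
  assumes f: "f \<in> borel_measurable (tree_borel G)"
  shows "(\<integral>\<^sup>+x. f x \<partial>\<mu>) = (\<Sum>e\<in>E. \<integral>\<^sup>+s. ennreal (W e s) * f (ch e s) * indicator (I e) s \<partial>lborel)"
proof -
  have m: "borel_measurable (tree_lebesgue G) = borel_measurable (tree_borel G)"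
    by (rule measurable_cong_sets) (auto simp: sets_tree_lebesgue)
  have "(\<integral>\<^sup>+x. f x \<partial>\<mu>) = (\<integral>\<^sup>+x. ennreal (2 / sqrt pi * exp (- (root_dist G x)\<^sup>2)) * f x \<partial>tree_lebesgue G)"
    unfolding mu_def by (rule nn_integral_density) (simp_all only: m f weight_measurable)
  also have "\<dots> = (\<Sum>e\<in>E. \<integral>\<^sup>+s. ennreal (2 / sqrt pi * exp (- (root_dist G (ch e s))\<^sup>2)) * f (ch e s) * indicator (I e) s \<partial>lborel)"
    by (intro nn_integral_tree_lebesgue borel_measurable_times_ennreal f weight_measurable)
  also have "\<dots> = (\<Sum>e\<in>E. \<integral>\<^sup>+s. ennreal (W e s) * f (ch e s) * indicator (I e) s \<partial>lborel)"
  proof (intro sum.cong nn_integral_cong refl)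
    fix e s assume e: "e \<in> E"
    show "ennreal (2 / sqrt pi * exp (- (root_dist G (ch e s))\<^sup>2)) * f (ch e s) * indicator (I e) s =
      ennreal (W e s) * f (ch e s) * indicator (I e) s"
      using root_dist_ch[OF e, of s] I_J[of e] by (cases "s \<in> I e") (auto simp: W_def)
  qed
  finally show ?thesis .
qed

lemma W_pos: "W e s > 0" by (simp add: W_def)

lemma W_continuous: "continuous_on S (W e)" unfolding W_def by (intro continuous_intros)

lemma W_integrable: "integrable lborel (W e)" unfolding W_def by (rule integrable_gauss_shift)

lemma finite_mu: "finite_measure \<mu>"
proof
  have "emeasure \<mu> (space \<mu>) = (\<integral>\<^sup>+x. 1 \<partial>\<mu>)" by simp
  also have "\<dots> = (\<Sum>e\<in>E. \<integral>\<^sup>+s. ennreal (W e s) * 1 * indicator (I e) s \<partial>lborel)" by (rule nn_integral_mu) simp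
  also have "\<dots> < \<infinity>"
  proof -
    have "(\<integral>\<^sup>+s. ennreal (W e s) * 1 * indicator (I e) s \<partial>lborel) < top" for e
    proof -
      have "(\<integral>\<^sup>+s. ennreal (W e s) * 1 * indicator (I e) s \<partial>lborel) \<le> (\<integral>\<^sup>+s. ennreal (W e s) \<partial>lborel)"
        by (intro nn_integral_mono) (auto simp: indicator_def)
      also have "\<dots> < top"
        using W_integrable[of e] nn_integral_eq_integral[OF W_integrable[of e]] W_pos[of e] by (simp add: less_imp_le)
      finally show ?thesis .
    qed
    then show ?thesis using finite_E by simp
  qed
  finally show "emeasure \<mu> (space \<mu>) \<noteq> \<infinity>" by simp
qed

text \<open>The density \<open>W e\<close> is positive, so a null set of \<open>mu\<close> has a
  Lebesgue null trace in every open edge.\<close>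

lemma AE_mu_edge:
  assumes "AE x in \<mu>. P x" and e: "e \<in> E"
  shows "AE s in lborel. s \<in> I e \<longrightarrow> P (ch e s)"
proof -
  obtain N where N: "{x \<in> space \<mu>. \<not> P x} \<subseteq> N" "emeasure \<mu> N = 0" "N \<in> sets \<mu>"
    using AE_E[OF assms(1)] .
  have m: "indicator N \<in> borel_measurable (tree_borel G)" using N(3) by simp
  have "(\<Sum>e\<in>E. \<integral>\<^sup>+s. ennreal (W e s) * indicator N (ch e s) * indicator (I e) s \<partial>lborel) = (\<integral>\<^sup>+x. indicator N x \<partial>\<mu>)"
    by (rule nn_integral_mu[OF m, symmetric])
  also have "\<dots> = 0" using N by simp
  finally have z: "(\<integral>\<^sup>+s. ennreal (W e s) * indicator N (ch e s) * indicator (I e) s \<partial>lborel) = 0"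
    using finite_E e by simp
  have m2: "(\<lambda>s. ennreal (W e s) * indicator N (ch e s) * indicator (I e) s) \<in> borel_measurable lborel"
  proof -
    have "(\<lambda>s. ennreal (W e s)) \<in> borel_measurable borel"
      using borel_measurable_continuous_onI[OF W_continuous[of UNIV e]] by simp
    then show ?thesis using measurable_edge_ennreal[OF e m] by (simp add: mult.assoc)
  qed
  have "AE s in lborel. ennreal (W e s) * indicator N (ch e s) * indicator (I e) s = 0"
    using z by (subst (asm) nn_integral_0_iff_AE[OF m2])
  then show ?thesis
  proof eventually_elim
    case (elim s)
    show ?case
    proof
      assume s: "s \<in> I e"
      then have "indicator N (ch e s) = (0 :: ennreal)" using elim W_pos[of e s] by simp
      then have "ch e s \<notin> N" by (simp add: indicator_eq_0_iff)
      moreover have "ch e s \<in> points G" using ch_points[OF e] s I_J by blast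
      ultimately show "P (ch e s)" using N(1) by auto
    qed
  qed
qed

text \<open>A violation in the interior of an edge would occur on a non-empty open set, which has
  positive measure; the endpoints follow by closure.\<close>

lemma continuous_AE_imp_all:
  fixes f :: "('v, 'e) point \<Rightarrow> real"
  assumes f: "continuous_map (tree_topology G) euclidean f" and ae: "AE x in \<mu>. f x \<le> c" and p: "p \<in> points G"
  shows "f p \<le> c"
proof -
  obtain e s where e: "e \<in> E" "s \<in> J e" "p = ch e s" using points_ch[OF p] .
  obtain b0 where b0: "b0 \<in> J e" "b0 > 0" using ex_pos_J[OF e(1)] by blast
  \<comment> \<open>For \<open>s = 0\<close> the segment \<open>{0..s}\<close> degenerates, hence
    the maximum with a positive length.\<close>
  define b where "b = max s b0"
  have b: "b \<in> J e" "b > 0" "s \<in> {0..b}" using e b0 J_nonneg[of s e] by (auto simp: b_def max_def)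
  have cont: "continuous_on {0..b} (\<lambda>s. f (ch e s))"
    using f e(1) J_Icc[OF e(1) b(1)] unfolding continuous_tree_iff by (blast intro: continuous_on_subset)
  have "f (ch e t) \<le> c" if t: "t \<in> {0<..<b}" for t
  proof (rule ccontr)
    assume "\<not> f (ch e t) \<le> c"
    define S where "S = {0<..<b} \<inter> (\<lambda>s. f (ch e s)) -` {c<..}"
    have "open S" unfolding S_def
      by (rule continuous_open_preimage[OF continuous_on_subset[OF cont]]) auto
    moreover have "t \<in> S" using t \<open>\<not> f (ch e t) \<le> c\<close> by (auto simp: S_def)
    ultimately have "\<not> negligible S" using open_not_negligible by blast
    moreover have "AE s in lborel. s \<notin> S"
      using AE_mu_edge[OF ae e(1)] by eventually_elim (use J_Ioo[OF b(1)] in \<open>auto simp: S_def\<close>)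
    then have "S \<in> null_sets lborel"
      using \<open>open S\<close> by (subst (asm) AE_iff_null_sets[symmetric]) auto
    then have "negligible S" by (simp add: negligible_iff_null_sets null_sets_completionI)
    ultimately show False by blast
  qed
  then have "\<forall>t\<in>closure {0<..<b}. f (ch e t) \<le> c"
    using b(2) cont continuous_le_on_closure[of "{0<..<b}" "\<lambda>s. f (ch e s)" _ c] by auto
  then show ?thesis using b e by auto
qed

lemma set_integrable_norm':
  fixes f :: "'a \<Rightarrow> 'b::{banach, second_countable_topology}"
  assumes "set_integrable M A f"
  shows "set_integrable M A (\<lambda>x. norm (f x))"
proof -
  have "integrable M (\<lambda>x. norm (indicator A x *\<^sub>R f x))"
    using assms unfolding set_integrable_def by (rule integrable_norm)
  then show ?thesis unfolding set_integrable_def norm_scaleR by simp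
qed

text \<open>On the bounded segment \<open>{0..b}\<close> the weight has a positive minimum
  \<open>c\<close>, so the norm with respect to \<open>mu\<close> controls the unweighted L1 norm.
  The constant depends on the segment only.\<close>

lemma edge_L1_estimate:
  assumes e: "e \<in> E" and b: "b \<in> J e"
  shows "\<exists>C\<ge>0. \<forall>g. sqint \<mu> g \<longrightarrow> set_integrable lborel {0..b} (\<lambda>s. g (ch e s)) \<and>
    (LINT s:{0..b}|lborel. cmod (g (ch e s))) \<le> C * norm (cls \<mu> g)"
proof -
  have "compact (W e ` {0..b})" by (intro compact_continuous_image W_continuous) simp
  moreover have b0: "0 \<le> b" by (rule J_nonneg[OF b])
  ultimately obtain s0 where s0: "\<And>s. s \<in> {0..b} \<Longrightarrow> W e s0 \<le> W e s"
    using compact_attains_inf[of "W e ` {0..b}"] by fastforce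
  define c where "c = W e s0"
  have c: "c > 0" by (simp add: c_def W_pos)
  show ?thesis
  proof (intro exI[of _ "b / 2 + 1 / (2 * c)"] conjI allI impI)
    show "0 \<le> b / 2 + 1 / (2 * c)" using b0 c by simp
    fix g assume g: "sqint \<mu> g"
    define h where "h s = indicator {0..b} s *\<^sub>R (indicator (J e) s *\<^sub>R g (ch e s))" for s
    define N where "N = norm (cls \<mu> g)"
    have he: "h s = indicator {0..b} s *\<^sub>R g (ch e s)" for s
      using J_Icc[OF e b] by (auto simp: h_def indicator_def)
    have gm: "g \<in> borel_measurable (tree_borel G)" using sqint_measurable[OF g] by (simp add: measurable_mu)
    have hm [measurable]: "h \<in> borel_measurable borel"
      unfolding h_def by (intro borel_measurable_scaleR measurable_edge[OF e gm]) simp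
    have "(\<integral>\<^sup>+s. ennreal (c * (cmod (h s))\<^sup>2) \<partial>lborel) \<le> (\<integral>\<^sup>+s. ennreal (W e s) * ennreal ((cmod (g (ch e s)))\<^sup>2) * indicator (I e) s \<partial>lborel)"
    proof (rule nn_integral_mono_AE)
      show "AE s in lborel. ennreal (c * (cmod (h s))\<^sup>2) \<le> ennreal (W e s) * ennreal ((cmod (g (ch e s)))\<^sup>2) * indicator (I e) s"
        using AE_lborel_singleton[of 0] AE_lborel_singleton[of b]
      proof eventually_elim
        case (elim s)
        show ?case
        proof (cases "s \<in> {0..b}")
          case True
          then have "s \<in> I e" using elim J_Ioo[OF b] by auto
          moreover have "c * (cmod (g (ch e s)))\<^sup>2 \<le> W e s * (cmod (g (ch e s)))\<^sup>2"
            using s0[OF True] by (intro mult_right_mono) (auto simp: c_def)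
          ultimately show ?thesis using True W_pos[of e s]
            by (simp add: he ennreal_mult[symmetric] less_imp_le ennreal_leI)
        qed (simp add: he)
      qed
    qed
    also have "\<dots> \<le> (\<Sum>e\<in>E. \<integral>\<^sup>+s. ennreal (W e s) * ennreal ((cmod (g (ch e s)))\<^sup>2) * indicator (I e) s \<partial>lborel)"
      by (rule member_le_sum[OF e]) (auto simp: finite_E)
    also have "\<dots> = (\<integral>\<^sup>+x. ennreal ((cmod (g x))\<^sup>2) \<partial>\<mu>)"
      by (rule nn_integral_mu[symmetric]) (use gm in measurable)
    also have "\<dots> = ennreal (N\<^sup>2)" unfolding N_def by (rule nn_integral_cls[OF g])
    finally have le: "(\<integral>\<^sup>+s. ennreal (c * (cmod (h s))\<^sup>2) \<partial>lborel) \<le> ennreal (N\<^sup>2)" .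
    have i2: "integrable lborel (\<lambda>s. c * (cmod (h s))\<^sup>2)"
      by (rule integrableI_nonneg) (use le c in \<open>auto intro: le_less_trans\<close>)
    have le2: "c * (LINT s|lborel. (cmod (h s))\<^sup>2) \<le> N\<^sup>2"
    proof -
      have "ennreal (LINT s|lborel. c * (cmod (h s))\<^sup>2) \<le> ennreal (N\<^sup>2)"
        using nn_integral_eq_integral[OF i2] c le by simp
      then have "(LINT s|lborel. c * (cmod (h s))\<^sup>2) \<le> N\<^sup>2" by simp
      then show ?thesis by simp
    qed
    have i3: "integrable lborel (\<lambda>s. (cmod (h s))\<^sup>2)"
      using integrable_mult_right[OF i2, of "1 / c"] c by simp
    have i1: "integrable lborel (indicator {0..b} :: real \<Rightarrow> real)" using b0 by simp
    \<comment> \<open>The AM-GM inequality with a free parameter replaces Cauchy-Schwarz; after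
      integration the choice \<open>d = N\<close> produces the constant
      \<open>b / 2 + 1 / (2 * c)\<close>.\<close>
    have amgm: "cmod (h s) \<le> indicator {0..b} s * (d / 2) + (cmod (h s))\<^sup>2 / (2 * d)" if d: "d > 0" for d s
    proof (cases "s \<in> {0..b}")
      case True
      have "2 * (cmod (h s) * d) \<le> (cmod (h s))\<^sup>2 + d\<^sup>2" using sum_squares_bound[of "cmod (h s)" d] by (simp add: mult.assoc)
      then have "cmod (h s) * (2 * d) \<le> (d / 2 + (cmod (h s))\<^sup>2 / (2 * d)) * (2 * d)"
        using d by (simp add: power2_eq_square algebra_simps)
      then have "cmod (h s) \<le> d / 2 + (cmod (h s))\<^sup>2 / (2 * d)" using d by simp
      then show ?thesis using True by simp
    qed (simp add: he)
    have ih: "integrable lborel h"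
    proof (rule Bochner_Integration.integrable_bound)
      show "integrable lborel (\<lambda>s. indicator {0..b} s * (1 / 2) + (cmod (h s))\<^sup>2 / (2 * 1))"
        using i1 i3 by (intro Bochner_Integration.integrable_add integrable_mult_left integrable_divide) auto
      show "AE s in lborel. norm (h s) \<le> norm (indicator {0..b} s * (1 / 2) + (cmod (h s))\<^sup>2 / (2 * 1))"
        using amgm[of 1] by (intro AE_I2) (auto intro: order_trans[OF _ abs_ge_self])
    qed simp
    show "set_integrable lborel {0..b} (\<lambda>s. g (ch e s))"
      using ih unfolding set_integrable_def he[abs_def] .
    have est: "(LINT s|lborel. cmod (h s)) \<le> b * (d / 2) + N\<^sup>2 / (c * (2 * d))" if d: "d > 0" for d
    proof -
      have "(LINT s|lborel. cmod (h s)) \<le> (LINT s|lborel. indicator {0..b} s * (d / 2) + (cmod (h s))\<^sup>2 / (2 * d))"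
        using amgm[OF d] ih i1 i3
        by (intro integral_mono Bochner_Integration.integrable_add integrable_mult_left integrable_divide integrable_norm) auto
      also have "\<dots> = b * (d / 2) + (LINT s|lborel. (cmod (h s))\<^sup>2) / (2 * d)"
        using i1 i3 b0 by (subst Bochner_Integration.integral_add) auto
      also have "(LINT s|lborel. (cmod (h s))\<^sup>2) \<le> N\<^sup>2 / c" using le2 c by (simp add: pos_le_divide_eq mult.commute)
      then have "(LINT s|lborel. (cmod (h s))\<^sup>2) / (2 * d) \<le> (N\<^sup>2 / c) / (2 * d)" using d by (intro divide_right_mono) auto
      finally show ?thesis by simp
    qed
    have "(LINT s|lborel. cmod (h s)) \<le> (b / 2 + 1 / (2 * c)) * N"
    proof (cases "N = 0")
      case True
      \<comment> \<open>Here \<open>d = N\<close> is not admissible and the parameter tends to 0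
        instead; the denominator \<open>b + 1\<close> also covers \<open>b = 0\<close>.\<close>
      have "(LINT s|lborel. cmod (h s)) \<le> 0"
      proof (rule field_le_epsilon)
        fix d :: real assume d: "d > 0"
        have "b / (b + 1) \<le> 1" using b0 by simp
        then have "d * (b / (b + 1)) \<le> d * 1" using d by (intro mult_left_mono) auto
        moreover have "b * ((2 * d / (b + 1)) / 2) = d * (b / (b + 1))" using b0 by (simp add: field_simps)
        ultimately have "b * ((2 * d / (b + 1)) / 2) \<le> d" by linarith
        moreover have "(LINT s|lborel. cmod (h s)) \<le> b * ((2 * d / (b + 1)) / 2)"
          using est[of "2 * d / (b + 1)"] d b0 True by simp
        ultimately show "(LINT s|lborel. cmod (h s)) \<le> 0 + d" by simp
      qed
      then show ?thesis using True by simp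
    next
      case False
      then have "N > 0" by (simp add: N_def)
      from est[OF this] this show ?thesis by (simp add: field_simps power2_eq_square)
    qed
    moreover have "(LINT s:{0..b}|lborel. cmod (g (ch e s))) = (LINT s|lborel. cmod (h s))"
      unfolding set_lebesgue_integral_def he by (rule Bochner_Integration.integral_cong) auto
    ultimately show "(LINT s:{0..b}|lborel. cmod (g (ch e s))) \<le> (b / 2 + 1 / (2 * c)) * norm (cls \<mu> g)"
      unfolding N_def by simp
  qed
qed

lemma edge_set_integrable:
  assumes "e \<in> E" "a \<in> J e" "b \<in> J e" "sqint \<mu> g"
  shows "set_integrable lborel {a..b} (\<lambda>s. g (ch e s))"
proof -
  have "set_integrable lborel {0..b} (\<lambda>s. g (ch e s))" using edge_L1_estimate[OF assms(1,3)] assms(4) by blast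
  then show ?thesis by (rule set_integrable_subset) (use J_nonneg[OF assms(2)] in auto)
qed

section \<open>Functions with a derivative on the closed edges\<close>

text \<open>For square-integrable \<open>g\<close>, absolute continuity along every closed edge with
  derivative \<open>g\<close>. As \<open>chart\<close> sends endpoints to vertices, continuity at
  the vertices is included.\<close>

definition ac :: "(('v, 'e) point \<Rightarrow> complex) \<Rightarrow> (('v, 'e) point \<Rightarrow> complex) \<Rightarrow> bool" where
  "ac f g \<longleftrightarrow> (\<forall>e\<in>E. \<forall>a\<in>J e. \<forall>b\<in>J e. a \<le> b \<longrightarrow> f (ch e b) - f (ch e a) = (LINT s:{a..b}|lborel. g (ch e s)))"

lemma acD: "ac f g \<Longrightarrow> e \<in> E \<Longrightarrow> a \<in> J e \<Longrightarrow> b \<in> J e \<Longrightarrow> a \<le> b \<Longrightarrow> f (ch e b) - f (ch e a) = (LINT s:{a..b}|lborel. g (ch e s))"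
  by (auto simp: ac_def)

lemma ac_combine:
  assumes "ac f g" "ac f' g'" "sqint \<mu> g" "sqint \<mu> g'"
  shows "ac (\<lambda>x. a * f x + b * f' x) (\<lambda>x. a * g x + b * g' x)"
  unfolding ac_def
proof (intro ballI impI)
  fix e x y assume e: "e \<in> E" "x \<in> J e" "y \<in> J e" "x \<le> y"
  have i: "set_integrable lborel {x..y} (\<lambda>s. a * g (ch e s))" "set_integrable lborel {x..y} (\<lambda>s. b * g' (ch e s))"
    using assms e by (auto intro: edge_set_integrable)
  have "(LINT s:{x..y}|lborel. a * g (ch e s) + b * g' (ch e s)) = a * (f (ch e y) - f (ch e x)) + b * (f' (ch e y) - f' (ch e x))"
    using set_integral_add(2)[OF i] acD[OF assms(1) e] acD[OF assms(2) e] by simp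
  then show "a * f (ch e y) + b * f' (ch e y) - (a * f (ch e x) + b * f' (ch e x)) = (LINT s:{x..y}|lborel. a * g (ch e s) + b * g' (ch e s))"
    by (simp add: algebra_simps)
qed

lemma ac_diff:
  assumes "ac f g" "ac f' g'" "sqint \<mu> g" "sqint \<mu> g'"
  shows "ac (\<lambda>x. f x - f' x) (\<lambda>x. g x - g' x)"
  using ac_combine[OF assms, of 1 "- 1"] by simp

lemma ac_continuous:
  assumes f: "ac f g" and g: "sqint \<mu> g"
  shows "continuous_map (tree_topology G) euclidean f"
  unfolding continuous_tree_iff
proof
  fix e assume e: "e \<in> E"
  have c: "continuous_on {0..b} (\<lambda>s. f (ch e s))" if b: "b \<in> J e" for b
  proof (rule integral_imp_continuous_Icc)
    show "set_integrable lborel {0..b} (\<lambda>s. g (ch e s))" using e b g by (intro edge_set_integrable J_0)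
    fix x y assume "0 \<le> x" "x \<le> y" "y \<le> b"
    then show "f (ch e y) - f (ch e x) = (LINT s:{x..y}|lborel. g (ch e s))"
      using J_Icc[OF e b] by (intro acD[OF f e]) auto
  qed
  show "continuous_on (J e) (\<lambda>s. f (ch e s))"
  proof (cases e)
    case (Arc a)
    then have "arc_len G a \<in> J e" using e arc_len_pos[of a] by (auto simp: edges_def)
    then show ?thesis using c[of "arc_len G a"] Arc by simp
  next
    case (Ray v k)
    show ?thesis
      unfolding continuous_on_eq_continuous_within
    proof
      fix x assume x: "x \<in> J e"
      have xJ: "x + 1 \<in> J e" using x Ray by auto
      have "continuous (at x within {0..x + 1}) (\<lambda>s. f (ch e s))"
        using c[OF xJ] x Ray by (auto simp: continuous_on_eq_continuous_within)
      moreover have "at x within J e = at x within {0..x + 1}"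
        by (rule at_within_nhd[where S = "{..<x + 1}"]) (use Ray in auto)
      ultimately show "continuous (at x within J e) (\<lambda>s. f (ch e s))" by simp
    qed
  qed
qed

text \<open>A weak derivative tests only the open edges. By \<open>edge_L1_estimate\<close> it is
  integrable up to the endpoints, so the integral identity between interior points extends to the
  closed edges by continuity. The converse is \<open>integral_imp_weak_derivative\<close>.\<close>

lemma has_weak_derivative_iff_ac:
  assumes f: "continuous_map (tree_topology G) euclidean f" and g: "sqint \<mu> g"
  shows "has_weak_derivative G f g \<longleftrightarrow> ac f g"
proof
  assume w: "has_weak_derivative G f g"
  show "ac f g" unfolding ac_def
  proof (intro ballI impI)
    fix e a b assume e: "e \<in> E" "a \<in> J e" "b \<in> J e" "a \<le> b"
    define u where "u s = f (ch e s)" for s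
    define v where "v s = g (ch e s)" for s
    have vi: "set_integrable lborel {0..b} v" unfolding v_def using e g by (intro edge_set_integrable J_0)
    have uc: "continuous_on (J e) u" using f e(1) unfolding continuous_tree_iff u_def by blast
    have W: "weak_derivative_on (I e) u v"
      using w e(1) unfolding has_weak_derivative_def u_def v_def by blast
    define U where "U x = (LINT s:{0..x}|lborel. v s)" for x
    have Ud: "U y - U x = (LINT s:{x..y}|lborel. v s)" if "0 \<le> x" "x \<le> y" "y \<le> b" for x y
    proof -
      have "set_integrable lborel {0..y} v" by (rule set_integrable_subset[OF vi]) (use that in auto)
      from set_integral_Icc_split[OF this that(1,2)] show ?thesis by (simp add: U_def)
    qed
    have Uc: "continuous_on {0..b} U" by (rule integral_imp_continuous_Icc[OF vi Ud])
    have ab: "0 \<le> a" "0 \<le> b" using e J_nonneg by auto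
    show "f (ch e b) - f (ch e a) = (LINT s:{a..b}|lborel. g (ch e s))"
    proof (cases "b = 0")
      case True
      then have "a = b" using ab e by simp
      then show ?thesis using Ud[of b b] ab by (simp add: v_def)
    next
      case False
      then have b: "0 < b" using ab by simp
      \<comment> \<open>\<open>h\<close> is constant on the open interval, hence on its closure,
        which contains \<open>a\<close> and \<open>b\<close>.\<close>
      define h where "h s = u s - U s" for s
      have hc: "continuous_on {0..b} h"
        unfolding h_def using J_Icc[OF e(1,3)] by (intro continuous_intros Uc continuous_on_subset[OF uc])
      have const: "h x = h (b / 2)" if x: "x \<in> {0<..<b}" for x
      proof -
        have *: "h y = h x" if "x < y" "x \<in> {0<..<b}" "y \<in> {0<..<b}" for x y
        proof -
          have xy: "x \<in> I e" "y \<in> I e" using that J_Ioo[OF e(3)] by auto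
          have "u y - u x = (LINT s:{x..y}|lborel. v s)"
            by (rule weak_derivative_imp_integral[OF open_I interval_I continuous_on_subset[OF uc I_J] W xy that(1)])
          also have "\<dots> = U y - U x" using that by (intro Ud[symmetric]) auto
          finally have "(u y - u x) - (U y - U x) = 0" by (simp only: diff_self)
          moreover have "h y - h x = (u y - u x) - (U y - U x)" by (simp add: h_def)
          ultimately show ?thesis by simp
        qed
        show ?thesis using *[of x "b / 2"] *[of "b / 2" x] x b by (cases x "b / 2" rule: linorder_cases) auto
      qed
      have cl: "closure {0<..<b} = {0..b}" using b by simp
      have "h x = h (b / 2)" if "x \<in> {0..b}" for x
        by (rule continuous_constant_on_closure[of "{0<..<b}" h "h (b / 2)"], unfold cl, rule hc, erule const, rule that)
      from this[of a] this[of b] have "h b = h a" using ab e(4) by simp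
      then have "u b - u a = U b - U a" by (simp add: h_def algebra_simps)
      also have "\<dots> = (LINT s:{a..b}|lborel. v s)" using ab e by (intro Ud) auto
      finally show ?thesis by (simp add: u_def v_def)
    qed
  qed
next
  assume a: "ac f g"
  show "has_weak_derivative G f g"
    unfolding has_weak_derivative_def
  proof
    fix e assume e: "e \<in> E"
    show "weak_derivative_on (I e) (\<lambda>s. f (ch e s)) (\<lambda>s. g (ch e s))"
    proof (rule integral_imp_weak_derivative[OF open_I interval_I])
      show "continuous_on (I e) (\<lambda>s. f (ch e s))"
        using f e I_J unfolding continuous_tree_iff by (blast intro: continuous_on_subset)
    qed (use e g a I_J in \<open>blast intro: edge_set_integrable acD\<close>)+
  qed
qed

lemma L2_sqint: "L2 G = {f. sqint \<mu> f}" by (auto simp: L2_def sqint_def)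

lemma H1_iff: "f \<in> H1 G \<longleftrightarrow> sqint \<mu> f \<and> (\<exists>g. sqint \<mu> g \<and> ac f g)"
  unfolding H1_def L2_sqint using has_weak_derivative_iff_ac ac_continuous by blast

section \<open>Pointwise bounds\<close>

lemma ac_edge_bound:
  assumes e: "e \<in> E" and b: "b \<in> J e"
  shows "\<exists>C\<ge>0. \<forall>f g. sqint \<mu> g \<longrightarrow> ac f g \<longrightarrow> (\<forall>s\<in>{0..b}. cmod (f (ch e s) - f (ch e 0)) \<le> C * norm (cls \<mu> g))"
proof -
  obtain C where C: "C \<ge> 0" "\<And>g. sqint \<mu> g \<Longrightarrow> set_integrable lborel {0..b} (\<lambda>s. g (ch e s)) \<and>
    (LINT s:{0..b}|lborel. cmod (g (ch e s))) \<le> C * norm (cls \<mu> g)" using edge_L1_estimate[OF assms] by blast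
  have "cmod (f (ch e s) - f (ch e 0)) \<le> C * norm (cls \<mu> g)" if g: "sqint \<mu> g" and f: "ac f g" and s: "s \<in> {0..b}" for f g s
  proof -
    have sJ: "s \<in> J e" using J_Icc[OF e b] s by blast
    have "cmod (f (ch e s) - f (ch e 0)) = cmod (LINT t:{0..s}|lborel. g (ch e t))"
      using acD[OF f e J_0[OF e] sJ] s by simp
    also have "\<dots> \<le> (LINT t:{0..s}|lborel. cmod (g (ch e t)))" by (rule set_integral_norm_le)
    also have "\<dots> \<le> (LINT t:{0..b}|lborel. cmod (g (ch e t)))"
    proof -
      have i: "set_integrable lborel {0..b} (\<lambda>t. cmod (g (ch e t)))"
        using C(2)[OF g] by (intro set_integrable_norm') blast
      then have i2: "set_integrable lborel {0..s} (\<lambda>t. cmod (g (ch e t)))"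
        by (rule set_integrable_subset) (use s in auto)
      show ?thesis unfolding set_lebesgue_integral_def
        by (rule integral_mono) (use i i2 s in \<open>auto simp: set_integrable_def indicator_def\<close>)
    qed
    also have "\<dots> \<le> C * norm (cls \<mu> g)" using C(2)[OF g] by blast
    finally show ?thesis .
  qed
  then show ?thesis using C(1) by blast
qed

text \<open>The difference of the values at the two points is controlled by the derivative alone,
  without the norm of the function. The relation is symmetric and transitive; walks from the root
  link all points.\<close>

definition near :: "('v, 'e) point \<Rightarrow> ('v, 'e) point \<Rightarrow> bool" where
  "near p q \<longleftrightarrow> (\<exists>C\<ge>0. \<forall>f g. sqint \<mu> g \<longrightarrow> ac f g \<longrightarrow> cmod (f p - f q) \<le> C * norm (cls \<mu> g))"

lemma near_sym: "near p q \<Longrightarrow> near q p"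
  unfolding near_def by (simp add: norm_minus_commute)

lemma near_trans:
  assumes "near p q" "near q r"
  shows "near p r"
proof -
  obtain C1 where 1: "C1 \<ge> 0" "\<And>f g. sqint \<mu> g \<Longrightarrow> ac f g \<Longrightarrow> cmod (f p - f q) \<le> C1 * norm (cls \<mu> g)"
    using assms(1) unfolding near_def by blast
  obtain C2 where 2: "C2 \<ge> 0" "\<And>f g. sqint \<mu> g \<Longrightarrow> ac f g \<Longrightarrow> cmod (f q - f r) \<le> C2 * norm (cls \<mu> g)"
    using assms(2) unfolding near_def by blast
  have "cmod (f p - f r) \<le> (C1 + C2) * norm (cls \<mu> g)" if "sqint \<mu> g" "ac f g" for f g
  proof -
    have "cmod (f p - f r) \<le> cmod (f p - f q) + cmod (f q - f r)"
      using norm_triangle_ineq[of "f p - f q" "f q - f r"] by simp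
    then show ?thesis using 1(2)[OF that] 2(2)[OF that] by (simp add: distrib_right)
  qed
  then show ?thesis unfolding near_def using 1(1) 2(1) by (intro exI[of _ "C1 + C2"]) auto
qed

lemma near_edge: "e \<in> E \<Longrightarrow> s \<in> J e \<Longrightarrow> near (ch e s) (ch e 0)"
  unfolding near_def using ac_edge_bound[of e s] J_nonneg[of s e] by (meson atLeastAtMost_iff order_refl)

lemma near_vertex:
  assumes "v \<in> verts (core G)"
  shows "near (Vertex v) (Vertex (origin G))"
  using assms
proof (induction rule: vertex_induct)
  case origin
  show ?case unfolding near_def by (intro exI[of _ 0]) simp
next
  case (arc a)
  have E: "Arc a \<in> E" "arc_len G a \<in> J (Arc a)" "arc_len G a \<noteq> 0"
    using arc arc_len_pos[of a] by (auto simp: edges_def)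
  from near_edge[OF E(1,2)] E(3) have "near (Vertex (head (core G) a)) (Vertex (tail (core G) a))" by simp
  then show ?case using arc(2) near_trans by blast
qed

lemma near_origin:
  assumes "p \<in> points G"
  shows "near p (Vertex (origin G))"
proof -
  obtain e s where e: "e \<in> E" "s \<in> J e" "p = ch e s" using points_ch[OF assms] .
  show ?thesis using near_edge[OF e(1,2)] near_vertex[OF edge_base_vert[OF e(1)]] near_trans
    unfolding e(3) ch_0 by blast
qed

lemma near_all: "p \<in> points G \<Longrightarrow> q \<in> points G \<Longrightarrow> near p q"
  using near_origin near_sym near_trans by blast

lemma ex_edge: "\<exists>e. e \<in> E"
proof -
  obtain v where "v \<in> leaves G" using tree unfolding rooted_metric_tree_def by blast
  then have "Ray v 0 \<in> E" using tree unfolding rooted_metric_tree_def edges_def by auto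
  then show ?thesis by blast
qed

lemma origin_point: "Vertex (origin G) \<in> points G"
  using origin_vert by (simp add: points_def)

text \<open>The value at the root is compared with the values on a fixed segment and averaged over
  it; the average of \<open>cmod f\<close> is controlled by the norm of \<open>f\<close>.\<close>

lemma ac_origin_bound:
  "\<exists>C\<ge>0. \<forall>f g. sqint \<mu> f \<longrightarrow> sqint \<mu> g \<longrightarrow> ac f g \<longrightarrow>
    cmod (f (Vertex (origin G))) \<le> C * (norm (cls \<mu> f) + norm (cls \<mu> g))"
proof -
  let ?o = "Vertex (origin G) :: ('v, 'e) point"
  obtain e where e: "e \<in> E" using ex_edge by blast
  obtain b where b: "b \<in> J e" "b > 0" using ex_pos_J[OF e] by blast
  obtain C1 where 1: "C1 \<ge> 0" "\<And>f g s. sqint \<mu> g \<Longrightarrow> ac f g \<Longrightarrow> s \<in> {0..b} \<Longrightarrow> cmod (f (ch e s) - f (ch e 0)) \<le> C1 * norm (cls \<mu> g)"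
    using ac_edge_bound[OF e b(1)] by blast
  obtain C2 where 2: "C2 \<ge> 0" "\<And>f g. sqint \<mu> g \<Longrightarrow> ac f g \<Longrightarrow> cmod (f (ch e 0) - f ?o) \<le> C2 * norm (cls \<mu> g)"
    using near_origin[OF ch_points[OF e J_0[OF e]]] unfolding near_def by blast
  obtain C3 where 3: "C3 \<ge> 0" "\<And>g. sqint \<mu> g \<Longrightarrow> set_integrable lborel {0..b} (\<lambda>s. g (ch e s)) \<and>
    (LINT s:{0..b}|lborel. cmod (g (ch e s))) \<le> C3 * norm (cls \<mu> g)" using edge_L1_estimate[OF e b(1)] by blast
  have "cmod (f ?o) \<le> (C3 / b + C1 + C2) * (norm (cls \<mu> f) + norm (cls \<mu> g))" if f: "sqint \<mu> f" and g: "sqint \<mu> g" and a: "ac f g" for f g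
  proof -
    let ?N = "norm (cls \<mu> g)"
    have pw: "cmod (f ?o) \<le> cmod (f (ch e s)) + (C1 + C2) * ?N" if s: "s \<in> {0..b}" for s
    proof -
      have "f ?o = f (ch e s) - (f (ch e s) - f (ch e 0)) - (f (ch e 0) - f ?o)" by simp
      then have "cmod (f ?o) \<le> cmod (f (ch e s)) + cmod (f (ch e s) - f (ch e 0)) + cmod (f (ch e 0) - f ?o)"
        using order_trans[OF norm_triangle_ineq4 add_right_mono[OF norm_triangle_ineq4]] by metis
      then show ?thesis using 1(2)[OF g a s] 2(2)[OF g a] by (simp add: distrib_right)
    qed
    have i: "set_integrable lborel {0..b} (\<lambda>t. cmod (f (ch e t)))"
      using 3(2)[OF f] by (intro set_integrable_norm') blast
    have ic: "set_integrable lborel {0..b} (\<lambda>t. c)" for c :: real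
      unfolding set_integrable_def using b by simp
    have "(LINT s:{0..b}|lborel. cmod (f ?o)) \<le> (LINT s:{0..b}|lborel. cmod (f (ch e s)) + (C1 + C2) * ?N)"
      by (rule set_integral_mono[OF ic set_integral_add(1)[OF i ic] pw])
    also have "\<dots> = (LINT s:{0..b}|lborel. cmod (f (ch e s))) + (LINT s:{0..b}|lborel. (C1 + C2) * ?N)"
      by (rule set_integral_add(2)[OF i ic])
    also have "\<dots> \<le> C3 * norm (cls \<mu> f) + b * ((C1 + C2) * ?N)"
      using 3(2)[OF f] b by (simp add: set_lebesgue_integral_def)
    finally have "b * cmod (f ?o) \<le> C3 * norm (cls \<mu> f) + b * ((C1 + C2) * ?N)"
      using b by (simp add: set_lebesgue_integral_def)
    then have "cmod (f ?o) \<le> C3 / b * norm (cls \<mu> f) + (C1 + C2) * ?N"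
      using b by (simp add: field_simps)
    also have "\<dots> \<le> (C3 / b + C1 + C2) * norm (cls \<mu> f) + (C3 / b + C1 + C2) * ?N"
      using 1(1) 2(1) 3(1) b by (intro add_mono mult_right_mono) auto
    finally show ?thesis by (simp add: distrib_left)
  qed
  then show ?thesis using 1(1) 2(1) 3(1) b by (intro exI[of _ "C3 / b + C1 + C2"]) auto
qed

text \<open>A Sobolev embedding: point evaluation is continuous in the graph norm. It provides the
  pointwise limits in \<open>ac_closed\<close>.\<close>

lemma ac_pointwise_bound:
  assumes p: "p \<in> points G"
  shows "\<exists>C\<ge>0. \<forall>f g. sqint \<mu> f \<longrightarrow> sqint \<mu> g \<longrightarrow> ac f g \<longrightarrow> cmod (f p) \<le> C * (norm (cls \<mu> f) + norm (cls \<mu> g))"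
proof -
  let ?o = "Vertex (origin G) :: ('v, 'e) point"
  obtain C1 where 1: "C1 \<ge> 0" "\<And>f g. sqint \<mu> g \<Longrightarrow> ac f g \<Longrightarrow> cmod (f p - f ?o) \<le> C1 * norm (cls \<mu> g)"
    using near_origin[OF p] unfolding near_def by blast
  obtain C2 where 2: "C2 \<ge> 0" "\<And>f g. sqint \<mu> f \<Longrightarrow> sqint \<mu> g \<Longrightarrow> ac f g \<Longrightarrow>
    cmod (f ?o) \<le> C2 * (norm (cls \<mu> f) + norm (cls \<mu> g))" using ac_origin_bound by blast
  have "cmod (f p) \<le> (C1 + C2) * (norm (cls \<mu> f) + norm (cls \<mu> g))" if f: "sqint \<mu> f" and g: "sqint \<mu> g" and a: "ac f g" for f g
  proof -
    have "cmod (f p) \<le> cmod (f p - f ?o) + cmod (f ?o)" using norm_triangle_ineq[of "f p - f ?o" "f ?o"] by simp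
    also have "\<dots> \<le> C1 * (norm (cls \<mu> f) + norm (cls \<mu> g)) + C2 * (norm (cls \<mu> f) + norm (cls \<mu> g))"
      using 1(2)[OF g a] 2(2)[OF f g a] mult_nonneg_nonneg[OF 1(1) norm_ge_zero[of "cls \<mu> f"]]
      by (simp add: distrib_left)
    finally show ?thesis by (simp add: distrib_right)
  qed
  then show ?thesis using 1(1) 2(1) by (intro exI[of _ "C1 + C2"]) auto
qed

text \<open>By \<open>ac_pointwise_bound\<close> the functions converge at every point. The limit
  \<open>h\<close> inherits the integral identity because the derivatives converge in L1 on
  segments, and Fatou's lemma identifies \<open>h\<close> with the L2 limit.\<close>

lemma ac_closed:
  assumes f: "\<And>n. sqint \<mu> (f n)" and g: "\<And>n. sqint \<mu> (g n)" and a: "\<And>n. ac (f n) (g n)"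
    and F: "(\<lambda>n. cls \<mu> (f n)) \<longlonglongrightarrow> F" and D: "(\<lambda>n. cls \<mu> (g n)) \<longlonglongrightarrow> D"
  shows "\<exists>h k. sqint \<mu> h \<and> sqint \<mu> k \<and> ac h k \<and> F = cls \<mu> h \<and> D = cls \<mu> k"
proof -
  have pF: "proj \<mu> F = F" if "(\<lambda>n. cls \<mu> (w n)) \<longlonglongrightarrow> F" "\<And>n. sqint \<mu> (w n)" for F w
  proof -
    have "(\<lambda>n. proj \<mu> (cls \<mu> (w n))) \<longlonglongrightarrow> proj \<mu> F"
      by (rule bounded_linear.tendsto[OF bounded_linear_proj that(1)])
    then have "(\<lambda>n. cls \<mu> (w n)) \<longlonglongrightarrow> proj \<mu> F" using that(2) by simp
    then show ?thesis using that(1) LIMSEQ_unique by blast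
  qed
  define k where "k = rp \<mu> D"
  define F' where "F' = rp \<mu> F"
  have k: "sqint \<mu> k" "cls \<mu> k = D" and F': "sqint \<mu> F'" "cls \<mu> F' = F"
    using pF[OF D g] pF[OF F f] by (auto simp: k_def F'_def sqint_rp proj_def)
  have conv: "convergent (\<lambda>n. f n p)" if p: "p \<in> points G" for p
  proof -
    obtain C where C: "C \<ge> 0" "\<And>f g. sqint \<mu> f \<Longrightarrow> sqint \<mu> g \<Longrightarrow> ac f g \<Longrightarrow> cmod (f p) \<le> C * (norm (cls \<mu> f) + norm (cls \<mu> g))"
      using ac_pointwise_bound[OF p] by blast
    have le: "cmod (f m p - f n p) \<le> C * (norm (cls \<mu> (f m) - cls \<mu> (f n)) + norm (cls \<mu> (g m) - cls \<mu> (g n)))" for m n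
      using C(2)[OF sqint_diff[OF f f] sqint_diff[OF g g] ac_diff[OF a a g g], of m n]
      by (simp only: cls_diff f g)
    have "Cauchy (\<lambda>n. f n p)"
    proof (rule CauchyI)
      fix e :: real assume e: "e > 0"
      define d where "d = e / 2 / (C + 1)"
      have C1: "C + 1 > 0" using C(1) by linarith
      have d: "d > 0" using e C1 by (simp add: d_def)
      have d2: "(C + 1) * d = e / 2"
        unfolding d_def using C1 by (metis less_irrefl nonzero_mult_div_cancel_left times_divide_eq_right)
      have "Cauchy (\<lambda>n. cls \<mu> (f n))" "Cauchy (\<lambda>n. cls \<mu> (g n))"
        using F D LIMSEQ_imp_Cauchy by blast+
      then obtain M1 M2 where M: "\<And>m n. m \<ge> M1 \<Longrightarrow> n \<ge> M1 \<Longrightarrow> norm (cls \<mu> (f m) - cls \<mu> (f n)) < d"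
        "\<And>m n. m \<ge> M2 \<Longrightarrow> n \<ge> M2 \<Longrightarrow> norm (cls \<mu> (g m) - cls \<mu> (g n)) < d"
        unfolding Cauchy_iff using d by metis
      have "norm (f m p - f n p) < e" if "m \<ge> max M1 M2" "n \<ge> max M1 M2" for m n
      proof -
        have s: "norm (cls \<mu> (f m) - cls \<mu> (f n)) + norm (cls \<mu> (g m) - cls \<mu> (g n)) < 2 * d"
          using M(1)[of m n] M(2)[of m n] that by simp
        have "norm (f m p - f n p) \<le> C * (2 * d)"
          using le[of m n] mult_left_mono[OF less_imp_le[OF s] C(1)] by linarith
        also have "\<dots> < e" using d d2 by (simp add: algebra_simps)
        finally show ?thesis .
      qed
      then show "\<exists>M. \<forall>m\<ge>M. \<forall>n\<ge>M. norm (f m p - f n p) < e" by blast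
    qed
    then show ?thesis by (simp add: Cauchy_convergent_iff)
  qed
  define h where "h p = lim (\<lambda>n. f n p)" for p
  have lim: "(\<lambda>n. f n p) \<longlonglongrightarrow> h p" if "p \<in> points G" for p
    using conv[OF that] by (simp add: h_def convergent_LIMSEQ_iff)
  have hk: "ac h k"
    unfolding ac_def
  proof (intro ballI impI)
    fix e x y assume e: "e \<in> E" "x \<in> J e" "y \<in> J e" "x \<le> y"
    obtain C where C: "C \<ge> 0" "\<And>g. sqint \<mu> g \<Longrightarrow> set_integrable lborel {0..y} (\<lambda>s. g (ch e s)) \<and>
      (LINT s:{0..y}|lborel. cmod (g (ch e s))) \<le> C * norm (cls \<mu> g)" using edge_L1_estimate[OF e(1,3)] by blast
    have "(\<lambda>n. f n (ch e y) - f n (ch e x)) \<longlonglongrightarrow> h (ch e y) - h (ch e x)"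
      using e by (intro tendsto_diff lim ch_points)
    moreover have "(\<lambda>n. (f n (ch e y) - f n (ch e x)) - (LINT s:{x..y}|lborel. k (ch e s))) \<longlonglongrightarrow> 0"
    proof (rule Lim_null_comparison)
      show "(\<lambda>n. C * norm (cls \<mu> (g n) - D)) \<longlonglongrightarrow> 0"
        using tendsto_mult_right_zero[OF tendsto_norm_zero[OF LIM_zero[OF D]]] .
      have "norm ((f n (ch e y) - f n (ch e x)) - (LINT s:{x..y}|lborel. k (ch e s))) \<le> C * norm (cls \<mu> (g n) - D)" for n
      proof -
        have gk: "sqint \<mu> (\<lambda>p. g n p - k p)" by (rule sqint_diff[OF g k(1)])
        have ii: "set_integrable lborel {x..y} (\<lambda>s. g n (ch e s))" "set_integrable lborel {x..y} (\<lambda>s. k (ch e s))"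
          using e g k(1) by (auto intro: edge_set_integrable)
        have "(f n (ch e y) - f n (ch e x)) - (LINT s:{x..y}|lborel. k (ch e s)) = (LINT s:{x..y}|lborel. g n (ch e s) - k (ch e s))"
          unfolding acD[OF a e] by (rule set_integral_diff(2)[OF ii, symmetric])
        also have "norm \<dots> \<le> (LINT s:{x..y}|lborel. cmod (g n (ch e s) - k (ch e s)))" by (rule set_integral_norm_le)
        also have "\<dots> \<le> (LINT s:{0..y}|lborel. cmod (g n (ch e s) - k (ch e s)))"
        proof -
          have i: "set_integrable lborel {0..y} (\<lambda>s. cmod (g n (ch e s) - k (ch e s)))"
            using C(2)[OF gk] by (intro set_integrable_norm') blast
          then have i2: "set_integrable lborel {x..y} (\<lambda>s. cmod (g n (ch e s) - k (ch e s)))"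
            by (rule set_integrable_subset) (use J_nonneg[OF e(2)] in auto)
          show ?thesis unfolding set_lebesgue_integral_def
            by (rule integral_mono) (use i i2 J_nonneg[OF e(2)] in \<open>auto simp: set_integrable_def indicator_def\<close>)
        qed
        also have "\<dots> \<le> C * norm (cls \<mu> (g n) - D)"
          using C(2)[OF gk] unfolding cls_diff[OF g k(1)] k(2) by blast
        finally show ?thesis .
      qed
      then show "eventually (\<lambda>n. norm ((f n (ch e y) - f n (ch e x)) - (LINT s:{x..y}|lborel. k (ch e s))) \<le> C * norm (cls \<mu> (g n) - D)) sequentially"
        by simp
    qed
    then have "(\<lambda>n. f n (ch e y) - f n (ch e x)) \<longlonglongrightarrow> (LINT s:{x..y}|lborel. k (ch e s))"
      by (rule LIM_zero_cancel)
    ultimately show "h (ch e y) - h (ch e x) = (LINT s:{x..y}|lborel. k (ch e s))" by (rule LIMSEQ_unique)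
  qed
  have hm: "h \<in> borel_measurable \<mu>"
    unfolding measurable_mu by (rule continuous_tree_measurable[OF ac_continuous[OF hk k(1)]])
  have "AE x in \<mu>. h x = F' x"
  proof -
    have "(\<integral>\<^sup>+x. ennreal ((cmod (h x - F' x))\<^sup>2) \<partial>\<mu>) = (\<integral>\<^sup>+x. liminf (\<lambda>n. ennreal ((cmod (f n x - F' x))\<^sup>2)) \<partial>\<mu>)"
    proof (rule nn_integral_cong)
      fix x assume "x \<in> space \<mu>"
      then have "(\<lambda>n. ennreal ((cmod (f n x - F' x))\<^sup>2)) \<longlonglongrightarrow> ennreal ((cmod (h x - F' x))\<^sup>2)"
        by (intro tendsto_ennrealI tendsto_intros lim) simp
      then show "ennreal ((cmod (h x - F' x))\<^sup>2) = liminf (\<lambda>n. ennreal ((cmod (f n x - F' x))\<^sup>2))"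
        by (rule lim_imp_Liminf[OF trivial_limit_sequentially, symmetric])
    qed
    also have "\<dots> \<le> liminf (\<lambda>n. \<integral>\<^sup>+x. ennreal ((cmod (f n x - F' x))\<^sup>2) \<partial>\<mu>)"
    proof (rule nn_integral_liminf)
      note [measurable] = sqint_measurable[OF f] sqint_measurable[OF F'(1)]
      show "(\<lambda>x. ennreal ((cmod (f n x - F' x))\<^sup>2)) \<in> borel_measurable \<mu>" for n by measurable
    qed
    also have "\<dots> = liminf (\<lambda>n. ennreal ((norm (cls \<mu> (f n) - F))\<^sup>2))"
      using nn_integral_cls[OF sqint_diff[OF f F'(1)]] by (simp only: cls_diff f F')
    also have "\<dots> = ennreal (0\<^sup>2)"
    proof (rule lim_imp_Liminf[OF trivial_limit_sequentially])
      have "(\<lambda>n. norm (cls \<mu> (f n) - F)) \<longlonglongrightarrow> 0" by (rule tendsto_norm_zero[OF LIM_zero[OF F]])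
      then show "(\<lambda>n. ennreal ((norm (cls \<mu> (f n) - F))\<^sup>2)) \<longlonglongrightarrow> ennreal (0\<^sup>2)"
        by (intro tendsto_ennrealI tendsto_power)
    qed
    finally have "(\<integral>\<^sup>+x. ennreal ((cmod (h x - F' x))\<^sup>2) \<partial>\<mu>) = 0" by simp
    then have "AE x in \<mu>. ennreal ((cmod (h x - F' x))\<^sup>2) = 0"
      using hm sqint_measurable[OF F'(1)] by (subst (asm) nn_integral_0_iff_AE) auto
    then show ?thesis by eventually_elim simp
  qed
  then have ae: "AE x in \<mu>. F' x = h x" by eventually_elim simp
  have h: "sqint \<mu> h" by (rule sqint_cong_AE[OF F'(1) hm ae])
  have "cls \<mu> h = F" using ae cls_eq_iff[OF F'(1) h] F'(2) by simp
  then show ?thesis using h hk k by blast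
qed

lemma cls_zero_edges:
  assumes g: "sqint \<mu> g" and z: "\<And>e. e \<in> E \<Longrightarrow> AE s in lborel. s \<in> I e \<longrightarrow> g (ch e s) = 0"
  shows "cls \<mu> g = 0"
proof -
  note [measurable] = sqint_measurable[OF g, unfolded measurable_mu]
  have "(\<integral>\<^sup>+x. ennreal ((cmod (g x))\<^sup>2) \<partial>\<mu>) = (\<Sum>e\<in>E. \<integral>\<^sup>+s. ennreal (W e s) * ennreal ((cmod (g (ch e s)))\<^sup>2) * indicator (I e) s \<partial>lborel)"
    by (rule nn_integral_mu) measurable
  also have "\<dots> = (\<Sum>e\<in>E. 0)"
  proof (rule sum.cong[OF refl])
    fix e assume e: "e \<in> E"
    have "(\<integral>\<^sup>+s. ennreal (W e s) * ennreal ((cmod (g (ch e s)))\<^sup>2) * indicator (I e) s \<partial>lborel) = (\<integral>\<^sup>+(s::real). 0 \<partial>lborel)"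
    proof (rule nn_integral_cong_AE)
      show "AE s in lborel. ennreal (W e s) * ennreal ((cmod (g (ch e s)))\<^sup>2) * indicator (I e) s = 0"
        using z[OF e] by eventually_elim (auto simp: indicator_def)
    qed
    then show "(\<integral>\<^sup>+s. ennreal (W e s) * ennreal ((cmod (g (ch e s)))\<^sup>2) * indicator (I e) s \<partial>lborel) = 0" by simp
  qed
  finally have "ennreal ((norm (cls \<mu> g))\<^sup>2) = 0" unfolding nn_integral_cls[OF g] by simp
  then show ?thesis by simp
qed

text \<open>The exceptional null set may depend on the interval; rational endpoints suffice to
  exhaust the open edge and leave only countably many of these sets.\<close>

lemma AE_I_from_Icc:
  assumes "\<And>a b. a \<in> I e \<Longrightarrow> b \<in> I e \<Longrightarrow> AE s in lborel. s \<in> {a..b} \<longrightarrow> P s"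
  shows "AE s in (lborel :: real measure). s \<in> I e \<longrightarrow> P s"
proof -
  have "AE s in (lborel :: real measure). \<forall>a\<in>\<rat>. \<forall>b\<in>\<rat>. a \<in> I e \<longrightarrow> b \<in> I e \<longrightarrow> s \<in> {a..b} \<longrightarrow> P s"
  proof (subst AE_ball_countable[OF countable_rat], rule ballI, subst AE_ball_countable[OF countable_rat], rule ballI)
    fix a b :: real
    show "AE s in lborel. a \<in> I e \<longrightarrow> b \<in> I e \<longrightarrow> s \<in> {a..b} \<longrightarrow> P s"
    proof (cases "a \<in> I e \<and> b \<in> I e")
      case True
      then have "AE s in lborel. s \<in> {a..b} \<longrightarrow> P s" using assms by blast
      then show ?thesis by eventually_elim blast
    qed auto
  qed
  then show ?thesis
  proof eventually_elim
    case (elim s)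
    show ?case
    proof
      assume s: "s \<in> I e"
      then obtain d where d: "d > 0" "cball s d \<subseteq> I e" using open_I open_contains_cball by blast
      obtain a where a: "a \<in> \<rat>" "s - d < a" "a < s" using Rats_dense_in_real[of "s - d" s] d by auto
      obtain b where b: "b \<in> \<rat>" "s < b" "b < s + d" using Rats_dense_in_real[of s "s + d"] d by auto
      have "a \<in> cball s d" "b \<in> cball s d" using a b by (auto simp: dist_real_def)
      then have "a \<in> I e" "b \<in> I e" using d by auto
      then show "P s" using elim a b by auto
    qed
  qed
qed

text \<open>A class determines its continuous representative, and the increments of the latter
  determine the derivative almost everywhere. This makes \<open>form_deriv\<close> well
  defined.\<close>

lemma ac_deriv_unique:
  assumes f: "sqint \<mu> f" "sqint \<mu> f'" and g: "sqint \<mu> g" "sqint \<mu> g'" and a: "ac f g" "ac f' g'" and e: "cls \<mu> f = cls \<mu> f'"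
  shows "cls \<mu> g = cls \<mu> g'" and "p \<in> points G \<Longrightarrow> f p = f' p"
proof -
  have d: "ac (\<lambda>x. f x - f' x) (\<lambda>x. g x - g' x)" by (rule ac_diff[OF a g])
  have gd: "sqint \<mu> (\<lambda>x. g x - g' x)" by (rule sqint_diff[OF g])
  have c: "continuous_map (tree_topology G) euclidean (\<lambda>x. f x - f' x)" by (rule ac_continuous[OF d gd])
  have c': "continuous_map (tree_topology G) euclidean (\<lambda>x. cmod (f x - f' x))"
    using c unfolding continuous_tree_iff by (auto intro: continuous_on_norm)
  have ae: "AE x in \<mu>. f x = f' x" using e cls_eq_iff[OF f] by simp
  then have "AE x in \<mu>. cmod (f x - f' x) \<le> 0" by eventually_elim simp
  then have z: "f p = f' p" if "p \<in> points G" for p using continuous_AE_imp_all[OF c' \<open>AE x in \<mu>. cmod (f x - f' x) \<le> 0\<close> that] by simp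
  show "p \<in> points G \<Longrightarrow> f p = f' p" by (rule z)
  have "cls \<mu> (\<lambda>x. g x - g' x) = 0"
  proof (rule cls_zero_edges[OF gd])
    fix e assume e: "e \<in> E"
    show "AE s in lborel. s \<in> I e \<longrightarrow> g (ch e s) - g' (ch e s) = 0"
    proof (rule AE_I_from_Icc)
      fix x y assume xy: "x \<in> I e" "y \<in> I e"
      then have J: "x \<in> J e" "y \<in> J e" using I_J by auto
      show "AE s in lborel. s \<in> {x..y} \<longrightarrow> g (ch e s) - g' (ch e s) = 0"
      proof (rule integral_zero_imp_AE)
        show "set_integrable lborel {x..y} (\<lambda>s. g (ch e s) - g' (ch e s))" by (rule edge_set_integrable[OF e J gd])
        fix u v assume uv: "x \<le> u" "u \<le> v" "v \<le> y"
        then have uvJ: "u \<in> J e" "v \<in> J e" using J_interval[OF J] by auto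
        show "(LINT s:{u..v}|lborel. g (ch e s) - g' (ch e s)) = 0"
          using acD[OF d e uvJ uv(2)] z[OF ch_points[OF e uvJ(1)]] z[OF ch_points[OF e uvJ(2)]] by simp
      qed
    qed
  qed
  then show "cls \<mu> g = cls \<mu> g'" by (simp add: cls_diff g)
qed

lemma sqint_bounded:
  assumes "f \<in> borel_measurable \<mu>" "\<And>x. x \<in> points G \<Longrightarrow> cmod (f x) \<le> M"
  shows "sqint \<mu> f"
proof (rule sqint_bound[OF assms(1)])
  show "integrable \<mu> (\<lambda>_. M\<^sup>2)" by (rule finite_measure.integrable_const[OF finite_mu])
  show "(cmod (f x))\<^sup>2 \<le> M\<^sup>2" if "x \<in> space \<mu>" for x using assms(2)[of x] that by (simp add: power_mono)
qed

section \<open>Test functions on a single edge\<close>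

definition edge_fun :: "('v, 'e) edge \<Rightarrow> (real \<Rightarrow> real) \<Rightarrow> ('v, 'e) point \<Rightarrow> complex" where
  "edge_fun e \<phi> p = (case p of Vertex v \<Rightarrow> 0 | Inner e' s \<Rightarrow> if e' = e then complex_of_real (\<phi> s) else 0)"

lemma edge_fun_ch:
  assumes "s \<in> J e'" and z: "\<And>x. x \<notin> I e \<Longrightarrow> \<phi> x = 0"
  shows "edge_fun e \<phi> (ch e' s) = (if e' = e then complex_of_real (\<phi> s) else 0)"
proof (cases "s \<in> I e'")
  case True
  then show ?thesis by (simp add: ch_I edge_fun_def)
next
  case False
  then have "\<exists>v. ch e' s = Vertex v" using assms(1) by (cases e') auto
  then show ?thesis using z[of s] False by (auto simp: edge_fun_def)
qed

lemma edge_fun_regular: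
  assumes c: "continuous_on UNIV \<phi>" and K: "compact K" "K \<subseteq> I e" "\<And>x. x \<notin> K \<Longrightarrow> \<phi> x = 0"
  shows "continuous_map (tree_topology G) euclidean (edge_fun e \<phi>)" "sqint \<mu> (edge_fun e \<phi>)"
proof -
  have z: "\<phi> x = 0" if "x \<notin> I e" for x using K that by blast
  show cm: "continuous_map (tree_topology G) euclidean (edge_fun e \<phi>)"
    unfolding continuous_tree_iff
  proof
    fix e' assume "e' \<in> E"
    have "continuous_on (J e') (\<lambda>s. if e' = e then complex_of_real (\<phi> s) else 0)"
      using continuous_on_subset[OF c, of "J e'"] by (cases "e' = e") (auto intro: continuous_on_of_real)
    then show "continuous_on (J e') (\<lambda>s. edge_fun e \<phi> (ch e' s))"
      by (rule continuous_on_eq) (rule edge_fun_ch[symmetric], assumption, rule z)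
  qed
  have "bounded (\<phi> ` K)" by (intro compact_imp_bounded compact_continuous_image continuous_on_subset[OF c] K) auto
  then obtain M where M: "\<forall>y\<in>\<phi> ` K. norm y \<le> M" unfolding bounded_iff by blast
  have b: "\<bar>\<phi> x\<bar> \<le> \<bar>M\<bar>" for x
  proof (cases "x \<in> K")
    case True
    then have "norm (\<phi> x) \<le> M" using M by blast
    then show ?thesis by simp
  qed (simp add: K)
  show "sqint \<mu> (edge_fun e \<phi>)"
  proof (rule sqint_bounded)
    show "edge_fun e \<phi> \<in> borel_measurable \<mu>" unfolding measurable_mu by (rule continuous_tree_measurable[OF cm])
    show "cmod (edge_fun e \<phi> x) \<le> \<bar>M\<bar>" for x using b by (auto simp: edge_fun_def split: point.split)
  qed
qed

lemma edge_fun_ac: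
  assumes t: "test_function (I e) \<phi>"
  shows "ac (edge_fun e \<phi>) (edge_fun e (deriv \<phi>))" "sqint \<mu> (edge_fun e \<phi>)" "sqint \<mu> (edge_fun e (deriv \<phi>))"
proof -
  obtain K where K: "compact K" "K \<subseteq> I e" "\<And>x. x \<notin> K \<Longrightarrow> \<phi> x = 0" using t by (auto simp: test_function_def)
  have sm: "smooth \<phi>" using t by (auto simp: test_function_def smooth_def)
  have D: "(\<phi> has_real_derivative deriv \<phi> x) (at x)" for x using smooth_DERIV[OF sm, of 0] by simp
  have c\<phi>: "continuous_on S \<phi>" for S by (rule DERIV_imp_continuous_on[OF D])
  have cd: "continuous_on S (deriv \<phi>)" for S by (rule DERIV_imp_continuous_on[OF smooth_DERIV[OF sm, of 1, simplified]])
  have dz: "deriv \<phi> x = 0" if "x \<notin> K" for x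
  proof -
    have "((\<lambda>_. 0) has_real_derivative 0) (at x)" by simp
    then have "(\<phi> has_real_derivative 0) (at x)"
      by (rule has_field_derivative_transform_within_open[where S = "- K"])
        (use that K(3) compact_imp_closed[OF K(1)] in auto)
    then show ?thesis by (rule DERIV_imp_deriv)
  qed
  show "sqint \<mu> (edge_fun e \<phi>)" "sqint \<mu> (edge_fun e (deriv \<phi>))"
    by (rule edge_fun_regular(2)[OF c\<phi> K], assumption, rule edge_fun_regular(2)[OF cd K(1,2) dz], assumption)
  have z: "\<phi> x = 0" "deriv \<phi> x = 0" if "x \<notin> I e" for x using K that dz by blast+
  show "ac (edge_fun e \<phi>) (edge_fun e (deriv \<phi>))"
    unfolding ac_def
  proof (intro ballI impI)
    fix e' a b assume e': "e' \<in> E" "a \<in> J e'" "b \<in> J e'" "a \<le> b"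
    have i: "(LINT s:{a..b}|lborel. edge_fun e (deriv \<phi>) (ch e' s)) = (LINT s|lborel. indicator {a..b} s *\<^sub>R (if e' = e then complex_of_real (deriv \<phi> s) else 0))"
      unfolding set_lebesgue_integral_def
    proof (rule Bochner_Integration.integral_cong[OF refl])
      fix s
      show "indicat_real {a..b} s *\<^sub>R edge_fun e (deriv \<phi>) (ch e' s) = indicat_real {a..b} s *\<^sub>R (if e' = e then complex_of_real (deriv \<phi> s) else 0)"
        using edge_fun_ch[of s e' e "deriv \<phi>", OF _ z(2)] J_interval[OF e'(2,3)] by (cases "s \<in> {a..b}") auto
    qed
    show "edge_fun e \<phi> (ch e' b) - edge_fun e \<phi> (ch e' a) = (LINT s:{a..b}|lborel. edge_fun e (deriv \<phi>) (ch e' s))"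
    proof (cases "e' = e")
      case True
      have "(LINT s|lborel. indicator {a..b} s *\<^sub>R complex_of_real (deriv \<phi> s)) = complex_of_real (\<phi> b) - complex_of_real (\<phi> a)"
      proof (rule integral_FTC_Icc[OF e'(4)])
        show "continuous_on {a..b} (\<lambda>s. complex_of_real (deriv \<phi> s))" by (intro continuous_intros cd)
        show "((\<lambda>s. complex_of_real (\<phi> s)) has_vector_derivative complex_of_real (deriv \<phi> x)) (at x within {a..b})" for x
          by (rule has_vector_derivative_at_within[OF has_vector_derivative_of_real])
            (use D[of x] in \<open>simp add: has_real_derivative_iff_has_vector_derivative\<close>)
      qed
      then show ?thesis unfolding i using True e' edge_fun_ch[OF _ z(1)] by simp
    next
      case False
      then show ?thesis unfolding i using e' edge_fun_ch[OF _ z(1)] by simp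
    qed
  qed
qed

lemma integral_mu_edge:
  fixes H :: "('v, 'e) point \<Rightarrow> real"
  assumes e: "e \<in> E" and H: "integrable \<mu> H" and z: "\<And>e' s. e' \<in> E \<Longrightarrow> e' \<noteq> e \<Longrightarrow> s \<in> I e' \<Longrightarrow> H (ch e' s) = 0"
  shows "(LINT x|\<mu>. H x) = (LINT s:I e|lborel. W e s * H (ch e s))"
proof -
  have Hm: "H \<in> borel_measurable (tree_borel G)" using borel_measurable_integrable[OF H] by (simp add: measurable_mu)
  define h where "h s = indicator (I e) s * (W e s * H (ch e s))" for s
  \<comment> \<open>\<open>c = 1\<close> and \<open>c = - 1\<close> give the integrals of the
    positive and the negative part of \<open>H\<close>.\<close>
  have nn: "(\<integral>\<^sup>+x. ennreal (c * H x) \<partial>\<mu>) = (\<integral>\<^sup>+s. ennreal (c * h s) \<partial>lborel)" for c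
  proof -
    have "(\<integral>\<^sup>+x. ennreal (c * H x) \<partial>\<mu>) = (\<Sum>e\<in>E. \<integral>\<^sup>+s. ennreal (W e s) * ennreal (c * H (ch e s)) * indicator (I e) s \<partial>lborel)"
      by (rule nn_integral_mu) (use Hm in measurable)
    also have "\<dots> = (\<Sum>e'\<in>E. if e' = e then (\<integral>\<^sup>+s. ennreal (W e s) * ennreal (c * H (ch e s)) * indicator (I e) s \<partial>lborel) else 0)"
    proof (rule sum.cong[OF refl])
      fix e' assume e': "e' \<in> E"
      have "(\<integral>\<^sup>+s. ennreal (W e' s) * ennreal (c * H (ch e' s)) * indicator (I e') s \<partial>lborel) = (\<integral>\<^sup>+(s::real). 0 \<partial>lborel)" if "e' \<noteq> e"
        by (rule nn_integral_cong) (use z[OF e' that] in \<open>auto simp: indicator_def\<close>)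
      then show "(\<integral>\<^sup>+s. ennreal (W e' s) * ennreal (c * H (ch e' s)) * indicator (I e') s \<partial>lborel) =
        (if e' = e then (\<integral>\<^sup>+s. ennreal (W e s) * ennreal (c * H (ch e s)) * indicator (I e) s \<partial>lborel) else 0)" by auto
    qed
    also have "\<dots> = (\<integral>\<^sup>+s. ennreal (W e s) * ennreal (c * H (ch e s)) * indicator (I e) s \<partial>lborel)"
      using e finite_E by simp
    also have "\<dots> = (\<integral>\<^sup>+s. ennreal (c * h s) \<partial>lborel)"
    proof (rule nn_integral_cong)
      fix s
      have "ennreal (W e s) * ennreal (c * H (ch e s)) = ennreal (W e s * (c * H (ch e s)))"
        using W_pos[of e s] by (simp add: ennreal_mult' less_imp_le)
      then show "ennreal (W e s) * ennreal (c * H (ch e s)) * indicator (I e) s = ennreal (c * h s)"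
        by (simp add: h_def indicator_def mult.left_commute)
    qed
    finally show ?thesis .
  qed
  have hm: "h \<in> borel_measurable lborel"
  proof -
    have "(\<lambda>s. indicator (I e) s * (W e s * (indicator (J e) s *\<^sub>R H (ch e s)))) \<in> borel_measurable borel"
      by (intro borel_measurable_times borel_measurable_indicator sets_I measurable_edge[OF e Hm]
          borel_measurable_continuous_onI[OF W_continuous])
    moreover have "indicator (I e) s * (W e s * (indicator (J e) s *\<^sub>R H (ch e s))) = h s" for s
      using I_J[of e] by (auto simp: h_def indicator_def)
    ultimately show ?thesis by simp
  qed
  have fin: "(\<integral>\<^sup>+x. ennreal (H x) \<partial>\<mu>) \<noteq> \<infinity>" "(\<integral>\<^sup>+x. ennreal (- H x) \<partial>\<mu>) \<noteq> \<infinity>"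
    using H unfolding real_integrable_def by auto
  have hi: "integrable lborel h"
    unfolding real_integrable_def using hm fin nn[of 1] nn[of "- 1"] by simp
  have "(LINT x|\<mu>. H x) = (LINT s|lborel. h s)"
    using real_lebesgue_integral_def[OF H] real_lebesgue_integral_def[OF hi] nn[of 1] nn[of "- 1"] by simp
  then show ?thesis by (simp add: set_lebesgue_integral_def h_def)
qed

text \<open>The du Bois-Reymond argument, edge by edge: orthogonality to all test functions on an
  edge says that the weighted component of \<open>f\<close> in the direction \<open>z\<close> is a
  weak derivative of 0, so its integrals over intervals vanish. The directions 1 and
  \<open>\<i>\<close> give both parts of \<open>f\<close>.\<close>

lemma ac_total:
  assumes pF: "proj \<mu> F = F" and o: "\<And>f g. sqint \<mu> f \<Longrightarrow> sqint \<mu> g \<Longrightarrow> ac f g \<Longrightarrow> inner F (cls \<mu> f) = 0"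
  shows "F = 0"
proof -
  define f where "f = rp \<mu> F"
  have f: "sqint \<mu> f" "cls \<mu> f = F" using pF by (simp_all add: f_def sqint_rp proj_def)
  have part: "AE s in lborel. s \<in> I e \<longrightarrow> Re (f (ch e s) * cnj z) = 0" if e: "e \<in> E" for e z
  proof (rule AE_I_from_Icc)
    fix a b assume ab: "a \<in> I e" "b \<in> I e"
    define r where "r s = Re (f (ch e s) * cnj z)" for s
    define q where "q s = W e s * r s" for s
    have ri: "set_integrable lborel {x..y} r" if "x \<in> J e" "y \<in> J e" for x y
    proof -
      have "set_integrable lborel {x..y} (\<lambda>s. cnj z * f (ch e s))"
        by (rule set_integrable_mult_right) (rule edge_set_integrable[OF e that f(1)])
      then have "integrable lborel (\<lambda>s. Re (indicator {x..y} s *\<^sub>R (cnj z * f (ch e s))))"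
        unfolding set_integrable_def by (rule integrable_Re)
      moreover have "Re (indicator {x..y} s *\<^sub>R (cnj z * f (ch e s))) = indicator {x..y} s *\<^sub>R r s" for s
        by (simp add: r_def mult.commute)
      ultimately show ?thesis by (simp only: set_integrable_def)
    qed
    have qi: "set_integrable lborel {x..y} q" if "x \<in> J e" "y \<in> J e" for x y
      unfolding q_def by (rule set_integrable_mult_continuous[OF ri[OF that] W_continuous])
    have qc: "set_integrable lborel {x..y} (\<lambda>s. complex_of_real (q s))" if "x \<in> J e" "y \<in> J e" for x y
    proof -
      have "integrable lborel (\<lambda>s. complex_of_real (indicator {x..y} s *\<^sub>R q s))"
        using qi[OF that] unfolding set_integrable_def by (rule integrable_of_real)
      moreover have "complex_of_real (indicator {x..y} s *\<^sub>R q s) = indicator {x..y} s *\<^sub>R complex_of_real (q s)" for s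
        by (simp add: scaleR_conv_of_real)
      ultimately show ?thesis by (simp only: set_integrable_def)
    qed
    have w: "weak_derivative_on (I e) (\<lambda>_. 0) (\<lambda>s. complex_of_real (q s))"
      unfolding weak_derivative_on_def
    proof (intro conjI allI impI)
      fix K assume K: "compact K \<and> K \<subseteq> I e"
      show "set_integrable lborel K (\<lambda>_. 0 :: complex)" by (simp add: set_integrable_def)
      show "set_integrable lborel K (\<lambda>s. complex_of_real (q s))"
      proof (cases "K = {}")
        case False
        obtain x where x: "x \<in> K" "\<And>t. t \<in> K \<Longrightarrow> x \<le> t" using compact_attains_inf[of K] K False by blast
        obtain y where y: "y \<in> K" "\<And>t. t \<in> K \<Longrightarrow> t \<le> y" using compact_attains_sup[of K] K False by blast
        have xy: "x \<in> J e" "y \<in> J e" using K x y I_J by blast+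
        show ?thesis
          by (rule set_integrable_subset[OF qc[OF xy]]) (use K x y in \<open>auto simp: compact_imp_closed\<close>)
      qed (simp add: set_integrable_def)
    next
      fix \<phi> assume t: "test_function (I e) \<phi>"
      note a = edge_fun_ac[OF t]
      obtain K where K: "compact K" "K \<subseteq> I e" "\<And>x. x \<notin> K \<Longrightarrow> \<phi> x = 0" using t by (auto simp: test_function_def)
      have z0: "\<phi> x = 0" if "x \<notin> I e" for x using K that by blast
      have s: "sqint \<mu> (\<lambda>p. z * edge_fun e \<phi> p)" by (rule sqint_scale[OF a(2)])
      have "ac (\<lambda>p. z * edge_fun e \<phi> p + 0 * edge_fun e \<phi> p) (\<lambda>p. z * edge_fun e (deriv \<phi>) p + 0 * edge_fun e (deriv \<phi>) p)"
        by (rule ac_combine[OF a(1) a(1) a(3) a(3)])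
      then have ac: "ac (\<lambda>p. z * edge_fun e \<phi> p) (\<lambda>p. z * edge_fun e (deriv \<phi>) p)" by simp
      define H where "H p = Re (f p * cnj (z * edge_fun e \<phi> p))" for p
      have Hi: "integrable \<mu> H" unfolding H_def by (rule sqint_Re_mult_cnj[OF f(1) s])
      have He: "H (ch e' s) = (if e' = e then r s * \<phi> s else 0)" if "s \<in> I e'" for e' s
        using edge_fun_ch[of s e' e \<phi>, OF _ z0] that I_J[of e'] by (auto simp: H_def r_def algebra_simps)
      have "(LINT x|\<mu>. H x) = inner (cls \<mu> f) (cls \<mu> (\<lambda>p. z * edge_fun e \<phi> p))"
        unfolding H_def by (rule inner_cls[OF f(1) s, symmetric])
      also have "\<dots> = 0" using o[OF s sqint_scale[OF a(3)] ac] f by simp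
      finally have "(LINT s:I e|lborel. W e s * H (ch e s)) = 0"
        using integral_mu_edge[OF e Hi] He by auto
      moreover have "(LINT s:I e|lborel. W e s * H (ch e s)) = (LINT s:I e|lborel. q s * \<phi> s)"
        unfolding set_lebesgue_integral_def
        by (rule Bochner_Integration.integral_cong) (auto simp: He q_def indicator_def)
      ultimately have "complex_of_real (LINT s:I e|lborel. q s * \<phi> s) = 0" by simp
      then have "(LINT s:I e|lborel. complex_of_real (q s) * complex_of_real (\<phi> s)) = 0"
        unfolding set_integral_complex_of_real[symmetric] of_real_mult .
      then show "(LINT x:I e|lborel. 0 * complex_of_real (deriv \<phi> x)) = - (LINT x:I e|lborel. complex_of_real (q x) * complex_of_real (\<phi> x))"
        by (simp add: set_lebesgue_integral_def)
    qed
    have "AE s in lborel. s \<in> {a..b} \<longrightarrow> complex_of_real (q s) = 0"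
    proof (rule integral_zero_imp_AE)
      show "set_integrable lborel {a..b} (\<lambda>s. complex_of_real (q s))" using ab I_J by (intro qc) auto
      fix x y assume xy: "a \<le> x" "x \<le> y" "y \<le> b"
      have xyI: "x \<in> I e" "y \<in> I e" using mem_is_interval_1_I[OF interval_I ab] xy by auto
      show "(LINT s:{x..y}|lborel. complex_of_real (q s)) = 0"
      proof (cases "x = y")
        case True
        have "set_integrable lborel {x..x} (\<lambda>s. complex_of_real (q s))" using xyI I_J by (intro qc) auto
        from set_integral_Icc_split[OF this, of x] show ?thesis using True by simp
      next
        case False
        then show ?thesis
          using weak_derivative_imp_integral[OF open_I interval_I continuous_on_const w xyI] xy by simp
      qed
    qed
    then show "AE s in lborel. s \<in> {a..b} \<longrightarrow> Re (f (ch e s) * cnj z) = 0"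
    proof eventually_elim
      case (elim s)
      then have "s \<in> {a..b} \<longrightarrow> q s = 0" by (simp only: of_real_eq_0_iff)
      then show ?case using W_pos[of e s] by (auto simp: q_def r_def)
    qed
  qed
  have "cls \<mu> f = 0"
  proof (rule cls_zero_edges[OF f(1)])
    fix e assume e: "e \<in> E"
    show "AE s in lborel. s \<in> I e \<longrightarrow> f (ch e s) = 0"
      using part[OF e, of 1] part[OF e, of "\<i>"] by eventually_elim (simp add: complex_eq_iff)
  qed
  then show ?thesis using f by simp
qed

end

section \<open>The Neumann operator\<close>

lemma inner_diff_proj: "inner (h - proj M h) (proj M k) = 0"
  using inner_proj[OF sqint_rp[of M k], of h]
  by (simp add: inner_diff_left flip: proj_def)

lemma cls_lincomb: "sqint M f \<Longrightarrow> sqint M g \<Longrightarrow> cls M (\<lambda>x. a * f x + b * g x) = cscale a (cls M f) + cscale b (cls M g)"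
  by (simp add: cls_add sqint_scale cscale_cls)

lemma cls_eqI: "sqint M f \<Longrightarrow> sqint M g \<Longrightarrow> (AE x in M. f x = g x) \<Longrightarrow> cls M f = cls M g"
  by (simp add: cls_eq_iff)

lemma cls_zero [simp]: "cls M (\<lambda>_. 0) = 0"
  using cls_scaleR[of M "\<lambda>_. 0" 0] by simp

lemma cls_rp_cong: "sqint M f \<Longrightarrow> cls M (rp M (cls M f)) = cls M f"
  by (simp flip: proj_def)

text \<open>A unit acts as an isometry and a real factor commutes with every linear map; the
  splitting extends commutation with the flow from units to all scalars.\<close>

lemma cscale_polar: "cscale z h = cmod z *\<^sub>R cscale (sgn z) h"
proof -
  have "z = sgn z * complex_of_real (cmod z)" by (cases "z = 0") (simp_all add: sgn_eq)
  then have "cscale z h = cscale (sgn z * complex_of_real (cmod z)) h" by simp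
  also have "\<dots> = cmod z *\<^sub>R cscale (sgn z) h"
    unfolding cscale_cscale[symmetric] cscale_of_real cscale_scaleR ..
  finally show ?thesis .
qed

lemma absr_proj: "absr M (proj M h) = absr M h"
  unfolding proj_def by (simp add: absr_cls sqint_rp) (simp add: absr_def)

context rooted_tree
begin

section \<open>The form on the common Hilbert space\<close>

lemma ac_0: "ac (\<lambda>_. c) (\<lambda>_. 0)"
  by (simp add: ac_def set_lebesgue_integral_def)

text \<open>The form lives on a type larger than \<open>L\<^sup>2(\<mu>)\<close>. It is extended by zero to the orthogonal
  complement of \<open>L\<^sup>2(\<mu>)\<close>, so that the operator is densely defined on the whole type and generates the identity there.\<close>

definition form_domain :: "('v, 'e) point l2 set" where
  "form_domain = {h. \<exists>f g. sqint \<mu> f \<and> sqint \<mu> g \<and> ac f g \<and> proj \<mu> h = cls \<mu> f}"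

text \<open>The factor \<open>1 / sqrt 2\<close> gives
  \<open>inner (form_deriv u) (form_deriv v)\<close> the coefficient \<open>1 / 2\<close> of the
  Neumann form. The description is unique by \<open>ac_deriv_unique\<close>.\<close>

definition form_deriv :: "('v, 'e) point l2 \<Rightarrow> ('v, 'e) point l2" where
  "form_deriv h = (1 / sqrt 2) *\<^sub>R (THE k. \<exists>f g. sqint \<mu> f \<and> sqint \<mu> g \<and> ac f g \<and> proj \<mu> h = cls \<mu> f \<and> k = cls \<mu> g)"

lemma form_deriv_eq:
  assumes "sqint \<mu> f" "sqint \<mu> g" "ac f g" "proj \<mu> h = cls \<mu> f"
  shows "h \<in> form_domain" "form_deriv h = (1 / sqrt 2) *\<^sub>R cls \<mu> g"
proof -
  show "h \<in> form_domain" using assms by (auto simp: form_domain_def)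
  have "(THE k. \<exists>f g. sqint \<mu> f \<and> sqint \<mu> g \<and> ac f g \<and> proj \<mu> h = cls \<mu> f \<and> k = cls \<mu> g) = cls \<mu> g"
  proof (rule the_equality)
    show "\<exists>f g'. sqint \<mu> f \<and> sqint \<mu> g' \<and> ac f g' \<and> proj \<mu> h = cls \<mu> f \<and> cls \<mu> g = cls \<mu> g'" using assms by blast
    fix k assume "\<exists>f g. sqint \<mu> f \<and> sqint \<mu> g \<and> ac f g \<and> proj \<mu> h = cls \<mu> f \<and> k = cls \<mu> g"
    then obtain f' g' where k: "sqint \<mu> f'" "sqint \<mu> g'" "ac f' g'" "proj \<mu> h = cls \<mu> f'" "k = cls \<mu> g'" by blast
    have "cls \<mu> f' = cls \<mu> f" using k(4) assms(4) by simp
    then show "k = cls \<mu> g"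
      unfolding k(5) by (rule ac_deriv_unique(1)[OF k(1) assms(1) k(2) assms(2) k(3) assms(3)])
  qed
  then show "form_deriv h = (1 / sqrt 2) *\<^sub>R cls \<mu> g" by (simp add: form_deriv_def)
qed

lemma form_domain_E:
  assumes "h \<in> form_domain"
  obtains f g where "sqint \<mu> f" "sqint \<mu> g" "ac f g" "proj \<mu> h = cls \<mu> f" "form_deriv h = (1 / sqrt 2) *\<^sub>R cls \<mu> g"
proof -
  obtain f g where h: "sqint \<mu> f" "sqint \<mu> g" "ac f g" "proj \<mu> h = cls \<mu> f" using assms unfolding form_domain_def by blast
  show thesis by (rule that[OF h form_deriv_eq(2)[OF h]])
qed

lemma form_deriv_cls:
  assumes "sqint \<mu> f" "sqint \<mu> g" "ac f g"
  shows "cls \<mu> f \<in> form_domain" "form_deriv (cls \<mu> f) = (1 / sqrt 2) *\<^sub>R cls \<mu> g"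
  using form_deriv_eq[OF assms, of "cls \<mu> f"] assms(1) by simp_all

lemma form_deriv_kernel: "proj \<mu> h = 0 \<Longrightarrow> h \<in> form_domain" "proj \<mu> h = 0 \<Longrightarrow> form_deriv h = 0"
  using form_deriv_eq[OF _ _ ac_0[of 0], of h] by simp_all

lemma sqint_const: "sqint \<mu> (\<lambda>_. c)"
  by (rule sqint_bounded[of _ "cmod c"]) simp_all

lemma form_deriv_const: "cls \<mu> (\<lambda>_. c) \<in> form_domain" "form_deriv (cls \<mu> (\<lambda>_. c)) = 0"
  using form_deriv_cls[OF sqint_const _ ac_0[of c]] by simp_all

lemma form_deriv_add:
  assumes "x \<in> form_domain" "y \<in> form_domain"
  shows "x + y \<in> form_domain" "form_deriv (x + y) = form_deriv x + form_deriv y"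
proof -
  obtain f g where x: "sqint \<mu> f" "sqint \<mu> g" "ac f g" "proj \<mu> x = cls \<mu> f" "form_deriv x = (1 / sqrt 2) *\<^sub>R cls \<mu> g"
    using form_domain_E[OF assms(1)] .
  obtain f' g' where y: "sqint \<mu> f'" "sqint \<mu> g'" "ac f' g'" "proj \<mu> y = cls \<mu> f'" "form_deriv y = (1 / sqrt 2) *\<^sub>R cls \<mu> g'"
    using form_domain_E[OF assms(2)] .
  have a: "ac (\<lambda>p. f p + f' p) (\<lambda>p. g p + g' p)" using ac_combine[OF x(3) y(3) x(2) y(2), of 1 1] by simp
  have p: "proj \<mu> (x + y) = cls \<mu> (\<lambda>p. f p + f' p)" using x y by (simp add: proj_add cls_add)
  note * = form_deriv_eq[OF sqint_add[OF x(1) y(1)] sqint_add[OF x(2) y(2)] a p]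
  show "x + y \<in> form_domain" by (rule *(1))
  show "form_deriv (x + y) = form_deriv x + form_deriv y" unfolding *(2) x(5) y(5) cls_add[OF x(2) y(2)] by (rule scaleR_add_right)
qed

lemma form_deriv_cscale:
  assumes "x \<in> form_domain"
  shows "cscale z x \<in> form_domain" "form_deriv (cscale z x) = cscale z (form_deriv x)"
proof -
  obtain f g where x: "sqint \<mu> f" "sqint \<mu> g" "ac f g" "proj \<mu> x = cls \<mu> f" "form_deriv x = (1 / sqrt 2) *\<^sub>R cls \<mu> g"
    using form_domain_E[OF assms(1)] .
  have a: "ac (\<lambda>p. z * f p) (\<lambda>p. z * g p)" using ac_combine[OF x(3) x(3) x(2) x(2), of z 0] by simp
  have p: "proj \<mu> (cscale z x) = cls \<mu> (\<lambda>p. z * f p)" using x by (simp add: proj_cscale cscale_cls)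
  note * = form_deriv_eq[OF sqint_scale[OF x(1)] sqint_scale[OF x(2)] a p]
  show "cscale z x \<in> form_domain" by (rule *(1))
  show "form_deriv (cscale z x) = cscale z (form_deriv x)" unfolding *(2) x(5) cscale_cls[OF x(2), symmetric] cscale_scaleR ..
qed

lemma form_deriv_proj: "proj \<mu> x \<in> form_domain \<longleftrightarrow> x \<in> form_domain" "x \<in> form_domain \<Longrightarrow> form_deriv (proj \<mu> x) = form_deriv x"
  by (auto simp: form_domain_def form_deriv_def)

lemma closed_operator_form_deriv: "closed_operator form_domain form_deriv"
proof
  have "0 \<in> form_domain" by (rule form_deriv_kernel(1)) (use proj_scaleR[of \<mu> 0 0] in simp)
  moreover have scale: "c *\<^sub>R x \<in> form_domain" "form_deriv (c *\<^sub>R x) = c *\<^sub>R form_deriv x" if "x \<in> form_domain" for c x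
    using form_deriv_cscale[OF that, of "complex_of_real c"] by (simp_all add: cscale_of_real)
  ultimately show "subspace form_domain" unfolding subspace_def using form_deriv_add(1) by blast
  show "form_deriv (c *\<^sub>R x) = c *\<^sub>R form_deriv x" if "x \<in> form_domain" for c x by (rule scale(2)[OF that])
  show "form_deriv (x + y) = form_deriv x + form_deriv y" if "x \<in> form_domain" "y \<in> form_domain" for x y by (rule form_deriv_add(2)[OF that])
  fix X x d assume X: "\<And>n. X n \<in> form_domain" and lim: "X \<longlonglongrightarrow> x" "(\<lambda>n. form_deriv (X n)) \<longlonglongrightarrow> d"
  have "\<forall>n. \<exists>f g. sqint \<mu> f \<and> sqint \<mu> g \<and> ac f g \<and> proj \<mu> (X n) = cls \<mu> f \<and> form_deriv (X n) = (1 / sqrt 2) *\<^sub>R cls \<mu> g"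
    using form_domain_E[OF X] by metis
  then obtain f g where fg: "\<And>n. sqint \<mu> (f n)" "\<And>n. sqint \<mu> (g n)" "\<And>n. ac (f n) (g n)"
    "\<And>n. proj \<mu> (X n) = cls \<mu> (f n)" "\<And>n. form_deriv (X n) = (1 / sqrt 2) *\<^sub>R cls \<mu> (g n)" by metis
  have l1: "(\<lambda>n. cls \<mu> (f n)) \<longlonglongrightarrow> proj \<mu> x"
    using bounded_linear.tendsto[OF bounded_linear_proj lim(1), of \<mu>] by (simp add: fg(4))
  have l2: "(\<lambda>n. cls \<mu> (g n)) \<longlonglongrightarrow> sqrt 2 *\<^sub>R d"
    using tendsto_scaleR[OF tendsto_const lim(2), of "sqrt 2"] by (simp add: fg(5))
  have "\<exists>h k. sqint \<mu> h \<and> sqint \<mu> k \<and> ac h k \<and> proj \<mu> x = cls \<mu> h \<and> sqrt 2 *\<^sub>R d = cls \<mu> k"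
    by (rule ac_closed[of f g, OF fg(1-3) l1 l2])
  then obtain h k where hk: "sqint \<mu> h" "sqint \<mu> k" "ac h k" "proj \<mu> x = cls \<mu> h" "sqrt 2 *\<^sub>R d = cls \<mu> k"
    by blast
  show "x \<in> form_domain \<and> form_deriv x = d"
    using form_deriv_eq[OF hk(1-4)] by (simp flip: hk(5))
qed

text \<open>The part of \<open>F\<close> orthogonal to the functions on the tree belongs to the form
  domain itself, hence is orthogonal to itself. For the other part \<open>ac_total\<close>
  applies.\<close>

lemma total_form_domain:
  assumes o: "\<And>v. v \<in> form_domain \<Longrightarrow> inner F v = 0"
  shows "F = 0"
proof (rule ac_total)
  define w where "w = F - proj \<mu> F"
  have "w \<in> form_domain" by (rule form_deriv_kernel(1)) (simp add: w_def proj_diff)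
  then have "inner F w = 0" by (rule o)
  moreover have "inner w (proj \<mu> F) = 0" unfolding w_def by (rule inner_diff_proj)
  ultimately have "inner w w = 0" by (simp add: w_def inner_diff_right inner_commute)
  then show "proj \<mu> F = F" by (simp add: w_def)
  show "inner F (cls \<mu> f) = 0" if "sqint \<mu> f" "sqint \<mu> g" "ac f g" for f g by (rule o[OF form_deriv_cls(1)[OF that]])
qed

sublocale Op: densely_defined_closed_operator form_domain form_deriv
  by (rule densely_defined_closed_operator.intro[OF closed_operator_form_deriv])
    (rule densely_defined_closed_operator_axioms.intro, erule total_form_domain)

section \<open>Identification with the Neumann operator\<close>

lemma tree_deriv_ac:
  assumes f: "sqint \<mu> f" "sqint \<mu> g" "ac f g"
  shows "sqint \<mu> (tree_deriv G f)" "AE x in \<mu>. tree_deriv G f x = g x"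
proof -
  have c: "continuous_map (tree_topology G) euclidean f" by (rule ac_continuous[OF f(3,2)])
  have "g \<in> L2 G \<and> has_weak_derivative G f g" using f has_weak_derivative_iff_ac[OF c f(2)] by (simp add: L2_sqint)
  then have "tree_deriv G f \<in> L2 G \<and> has_weak_derivative G f (tree_deriv G f)"
    unfolding tree_deriv_def by (rule someI[of "\<lambda>f'. f' \<in> L2 G \<and> has_weak_derivative G f f'"])
  then show s: "sqint \<mu> (tree_deriv G f)" and "AE x in \<mu>. tree_deriv G f x = g x"
    using ac_deriv_unique(1)[OF f(1) f(1) _ f(2) _ f(3) refl, of "tree_deriv G f"]
      has_weak_derivative_iff_ac[OF c, of "tree_deriv G f"] cls_eq_iff[OF _ f(2), of "tree_deriv G f"]
    by (auto simp: L2_sqint)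
qed

lemma neumann_form_ac:
  assumes f: "sqint \<mu> f" "sqint \<mu> g" "ac f g" and h: "sqint \<mu> h" "sqint \<mu> k" "ac h k"
  shows "neumann_form G f h = 1 / 2 * (LINT x|\<mu>. g x * cnj (k x))"
proof -
  have "(LINT x|\<mu>. tree_deriv G f x * cnj (tree_deriv G h x)) = (LINT x|\<mu>. g x * cnj (k x))"
  proof (rule integral_cong_AE)
    show "(\<lambda>x. tree_deriv G f x * cnj (tree_deriv G h x)) \<in> borel_measurable \<mu>"
      by (rule borel_measurable_integrable[OF sqint_mult_cnj[OF tree_deriv_ac(1)[OF f] tree_deriv_ac(1)[OF h]]])
    show "(\<lambda>x. g x * cnj (k x)) \<in> borel_measurable \<mu>"
      by (rule borel_measurable_integrable[OF sqint_mult_cnj[OF f(2) h(2)]])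
    show "AE x in \<mu>. tree_deriv G f x * cnj (tree_deriv G h x) = g x * cnj (k x)"
      using tree_deriv_ac(2)[OF f] tree_deriv_ac(2)[OF h] by eventually_elim simp
  qed
  then show ?thesis by (simp add: neumann_form_def)
qed

lemma Re_L2_inner: "sqint \<mu> f \<Longrightarrow> sqint \<mu> g \<Longrightarrow> Re (LINT x|\<mu>. f x * cnj (g x)) = inner (cls \<mu> f) (cls \<mu> g)"
  unfolding inner_cls by (rule integral_Re[symmetric]) (rule sqint_mult_cnj)

lemma Re_neumann_form:
  assumes f: "sqint \<mu> f" "sqint \<mu> g" "ac f g" and h: "sqint \<mu> h" "sqint \<mu> k" "ac h k"
  shows "Re (neumann_form G f h) = inner (form_deriv (cls \<mu> f)) (form_deriv (cls \<mu> h))"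
proof -
  have "Re (neumann_form G f h) = 1 / 2 * inner (cls \<mu> g) (cls \<mu> k)"
    unfolding neumann_form_ac[OF assms] Re_L2_inner[OF f(2) h(2), symmetric] by simp
  then show ?thesis unfolding form_deriv_cls(2)[OF f] form_deriv_cls(2)[OF h] by simp
qed

text \<open>The abstract identity is the real part of the concrete one. Test vectors of the abstract
  form domain are projected to functions on the tree, since neither side sees their orthogonal
  part.\<close>

lemma neumann_operator_iff:
  "(f, g) \<in> neumann_operator G \<longleftrightarrow> sqint \<mu> f \<and> sqint \<mu> g \<and> cls \<mu> f \<in> Op.dom \<and> Op.A (cls \<mu> f) = cls \<mu> g"
proof
  assume "(f, g) \<in> neumann_operator G"
  then obtain f0 where fg: "sqint \<mu> f" "sqint \<mu> g" and f0: "f0 \<in> H1 G" "AE x in \<mu>. f x = f0 x"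
    and form: "\<And>h. h \<in> H1 G \<Longrightarrow> neumann_form G f0 h = L2_inner G g h"
    by (auto simp: neumann_operator_def L2_sqint)
  obtain d where d: "sqint \<mu> f0" "sqint \<mu> d" "ac f0 d" using f0(1) unfolding H1_iff by blast
  have e: "cls \<mu> f = cls \<mu> f0" by (rule cls_eqI[OF fg(1) d(1) f0(2)])
  have "inner (form_deriv (cls \<mu> f)) (form_deriv v) = inner (cls \<mu> g) v" if v: "v \<in> form_domain" for v
  proof -
    obtain h k where h: "sqint \<mu> h" "sqint \<mu> k" "ac h k" "proj \<mu> v = cls \<mu> h" using form_domain_E[OF v] .
    have hH: "h \<in> H1 G" unfolding H1_iff using h by blast
    have "inner (form_deriv (cls \<mu> f)) (form_deriv v) = inner (form_deriv (cls \<mu> f0)) (form_deriv (cls \<mu> h))"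
      unfolding e h(4)[symmetric] using v by (simp add: form_deriv_proj)
    also have "\<dots> = Re (L2_inner G g h)"
      using Re_neumann_form[OF d h(1-3)] form[OF hH] by simp
    also have "\<dots> = inner (cls \<mu> g) (proj \<mu> v)"
      unfolding L2_inner_def Re_L2_inner[OF fg(2) h(1)] h(4) ..
    also have "\<dots> = inner (cls \<mu> g) v" using inner_proj[OF fg(2), of v] by (simp add: inner_commute)
    finally show ?thesis .
  qed
  then show "sqint \<mu> f \<and> sqint \<mu> g \<and> cls \<mu> f \<in> Op.dom \<and> Op.A (cls \<mu> f) = cls \<mu> g"
    using Op.A_unique[of "cls \<mu> f" "cls \<mu> g"] form_deriv_cls(1)[OF d] fg e by simp
next
  assume a: "sqint \<mu> f \<and> sqint \<mu> g \<and> cls \<mu> f \<in> Op.dom \<and> Op.A (cls \<mu> f) = cls \<mu> g"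
  then have fg: "sqint \<mu> f" "sqint \<mu> g" by auto
  obtain f0 d where d: "sqint \<mu> f0" "sqint \<mu> d" "ac f0 d" "cls \<mu> f = cls \<mu> f0"
    using form_domain_E[of "cls \<mu> f"] Op.dom_V a fg by (metis proj_cls)
  have f0: "f0 \<in> H1 G" using d unfolding H1_iff by blast
  have form: "neumann_form G f0 h = L2_inner G g h" if hH: "h \<in> H1 G" for h
  proof -
    obtain k where h: "sqint \<mu> h" "sqint \<mu> k" "ac h k" using hH unfolding H1_iff by blast
    have Re: "Re (neumann_form G f0 h) = Re (L2_inner G g h)" if h: "sqint \<mu> h" "sqint \<mu> k" "ac h k" for h k
    proof -
      have "Re (neumann_form G f0 h) = inner (form_deriv (cls \<mu> f)) (form_deriv (cls \<mu> h))"
        unfolding d(4) by (rule Re_neumann_form[OF d(1-3) h])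
      also have "\<dots> = inner (cls \<mu> g) (cls \<mu> h)" using Op.A_eq[of "cls \<mu> f" "cls \<mu> h"] form_deriv_cls(1)[OF h] a by simp
      finally show ?thesis unfolding L2_inner_def Re_L2_inner[OF fg(2) h(1)] .
    qed
    \<comment> \<open>Testing with \<open>\<i> * h\<close> supplies the imaginary part, as the
      abstract identity concerns real parts only.\<close>
    have ih: "sqint \<mu> (\<lambda>x. \<i> * h x)" "sqint \<mu> (\<lambda>x. \<i> * k x)" "ac (\<lambda>x. \<i> * h x) (\<lambda>x. \<i> * k x)"
      using sqint_scale[OF h(1)] sqint_scale[OF h(2)] ac_combine[OF h(3) h(3) h(2) h(2), of \<i> 0] by simp_all
    have rot: "(LINT x|\<mu>. u x * cnj (\<i> * w x)) = - \<i> * (LINT x|\<mu>. u x * cnj (w x))" for u w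
    proof -
      have "u x * cnj (\<i> * w x) = - \<i> * (u x * cnj (w x))" for x by simp
      then show ?thesis by (simp only: integral_mult_right_zero)
    qed
    have "Re (- \<i> * neumann_form G f0 h) = Re (- \<i> * L2_inner G g h)"
      using Re[OF ih] unfolding neumann_form_ac[OF d(1-3) ih] neumann_form_ac[OF d(1-3) h] L2_inner_def rot
      by simp
    then show ?thesis using Re[OF h] by (simp add: complex_eq_iff)
  qed
  show "(f, g) \<in> neumann_operator G"
    unfolding neumann_operator_def L2_sqint using fg f0 form d cls_eq_iff[OF fg(1) d(1)] by blast
qed

lemma L2_norm_cls: "sqint \<mu> f \<Longrightarrow> L2_norm G f = norm (cls \<mu> f)"
  unfolding L2_norm_def norm_cls[symmetric] by simp

text \<open>\<open>proj \<mu>\<close> is a contraction and leaves the energy unchanged, so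
  \<open>T_fixed_points\<close> applies.\<close>

lemma proj_T: "proj \<mu> h = h \<Longrightarrow> proj \<mu> (Op.T t h) = Op.T t h"
  by (rule Op.T_fixed_points[where N = "proj \<mu>"]) (auto simp: form_deriv_proj norm_proj_le simp flip: proj_diff)

lemma T_cscale: "Op.T t (cscale z h) = cscale z (Op.T t h)"
proof -
  have unit: "Op.T t (cscale w h) = cscale w (Op.T t h)" if w: "cmod w = 1" for w
  proof (rule Op.T_commute_isometry[where S' = "cscale w"])
    have "w * cnj w = 1" using w by (simp add: complex_norm_square[symmetric])
    then have "x = cscale w (cscale (cnj w) x)" for x :: "('v, 'e) point l2" by (simp add: cscale_cscale cscale_1)
    then have "x \<in> cscale w ` form_domain" if "x \<in> form_domain" for x using form_deriv_cscale(1)[OF that] by (rule image_eqI)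
    then show "cscale w ` form_domain = form_domain" using form_deriv_cscale(1) by auto
  qed (use w in \<open>auto simp: bounded_linear_cscale inner_cscale_isometry form_deriv_cscale(2)\<close>)
  show ?thesis
  proof (cases "z = 0")
    case True
    have "cscale 0 h = 0" for h :: "('v, 'e) point l2" using cscale_of_real[of 0 h] by simp
    then show ?thesis using True Op.T_simps(5) by simp
  next
    case False
    then have "cmod (sgn z) = 1" by (simp add: norm_sgn)
    then show ?thesis unfolding cscale_polar[of z] using unit Op.T_simps by simp
  qed
qed

lemma T_lincomb: "Op.T t (cscale a h + cscale b k) = cscale a (Op.T t h) + cscale b (Op.T t k)"
  using Op.T_simps by (simp add: T_cscale)

section \<open>Existence and uniqueness of the semigroup on functions\<close>

text \<open>The witness that the choice in \<open>neumann_semigroup\<close> is over a non-empty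
  set.\<close>

definition tree_semigroup :: "real \<Rightarrow> (('v, 'e) point \<Rightarrow> complex) \<Rightarrow> ('v, 'e) point \<Rightarrow> complex" where
  "tree_semigroup t f = rp \<mu> (Op.T t (cls \<mu> f))"

lemma sqint_tree_semigroup: "sqint \<mu> (tree_semigroup t f)" by (simp add: tree_semigroup_def sqint_rp)

lemma cls_tree_semigroup: "sqint \<mu> f \<Longrightarrow> cls \<mu> (tree_semigroup t f) = Op.T t (cls \<mu> f)"
  unfolding tree_semigroup_def by (simp add: proj_T flip: proj_def)

lemma generator_iff:
  assumes S: "\<And>t f. t \<ge> 0 \<Longrightarrow> sqint \<mu> f \<Longrightarrow> sqint \<mu> (S t f)"
  shows "(f, g) \<in> generator G S \<longleftrightarrow> sqint \<mu> f \<and> sqint \<mu> g \<and>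
    ((\<lambda>t. (1 / t) *\<^sub>R (cls \<mu> (S t f) - cls \<mu> f)) \<longlongrightarrow> cls \<mu> g) (at_right 0)"
proof -
  have "((\<lambda>t. L2_norm G (\<lambda>x. (S t f x - f x) / of_real t - g x)) \<longlongrightarrow> 0) (at_right 0) \<longleftrightarrow>
    ((\<lambda>t. (1 / t) *\<^sub>R (cls \<mu> (S t f) - cls \<mu> f)) \<longlongrightarrow> cls \<mu> g) (at_right 0)" if fg: "sqint \<mu> f" "sqint \<mu> g"
  proof -
    have "eventually (\<lambda>t. L2_norm G (\<lambda>x. (S t f x - f x) / of_real t - g x) =
      dist ((1 / t) *\<^sub>R (cls \<mu> (S t f) - cls \<mu> f)) (cls \<mu> g)) (at_right 0)"
      using eventually_at_right_less[of 0]
    proof eventually_elim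
      case (elim t)
      have s: "sqint \<mu> (\<lambda>x. S t f x - f x)" using S[of t f] elim fg by (intro sqint_diff) auto
      have e: "(\<lambda>x. (S t f x - f x) / of_real t - g x) = (\<lambda>x. complex_of_real (1 / t) * (S t f x - f x) - g x)"
        by (simp add: fun_eq_iff)
      show ?case
        unfolding e using s S[of t f] elim fg
        by (simp add: L2_norm_cls sqint_diff sqint_scale cls_diff cls_scaleR dist_norm del: of_real_divide)
    qed
    then show ?thesis unfolding tendsto_dist_iff[of _ "cls \<mu> g"] by (rule tendsto_cong)
  qed
  then show ?thesis by (auto simp: generator_def L2_sqint)
qed

lemma sqint_minus: "sqint \<mu> f \<Longrightarrow> sqint \<mu> (\<lambda>x. - f x)" and cls_minus: "sqint \<mu> f \<Longrightarrow> cls \<mu> (\<lambda>x. - f x) = - cls \<mu> f"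
  using sqint_diff[of \<mu> "\<lambda>_. 0" f] cls_diff[of \<mu> "\<lambda>_. 0" f] by simp_all

lemma tree_semigroup_semigroup: "c0_semigroup G tree_semigroup"
  unfolding c0_semigroup_def L2_sqint mem_Collect_eq Ball_def
proof (intro conjI allI impI)
  fix f g :: "('v, 'e) point \<Rightarrow> complex" and a b assume fg: "sqint \<mu> f" "sqint \<mu> g"
  show "AE x in \<mu>. tree_semigroup t (\<lambda>y. a * f y + b * g y) x = a * tree_semigroup t f x + b * tree_semigroup t g x" for t
    using fg by (subst cls_eq_iff[symmetric]) (simp_all add: sqint_tree_semigroup sqint_add sqint_scale cls_tree_semigroup cls_lincomb T_lincomb)
next
  fix t :: real
  have "L2_norm G (tree_semigroup t f) \<le> 1 * L2_norm G f" if "sqint \<mu> f" for f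
    using that Op.T_simps by (simp add: L2_norm_cls sqint_tree_semigroup cls_tree_semigroup)
  then show "\<exists>C. \<forall>f. sqint \<mu> f \<longrightarrow> L2_norm G (tree_semigroup t f) \<le> C * L2_norm G f" by blast
next
  fix f assume f: "sqint \<mu> f"
  show "AE x in \<mu>. tree_semigroup 0 f x = f x" using f by (subst cls_eq_iff[symmetric]) (simp_all add: sqint_tree_semigroup cls_tree_semigroup)
  show "AE x in \<mu>. tree_semigroup (s + t) f x = tree_semigroup s (tree_semigroup t f) x" if "0 \<le> s" "0 \<le> t" for s t
    using f that by (subst cls_eq_iff[symmetric]) (simp_all add: sqint_tree_semigroup cls_tree_semigroup Op.T_add)
  have "L2_norm G (\<lambda>x. tree_semigroup t f x - f x) = dist (Op.T t (cls \<mu> f)) (cls \<mu> f)" for t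
    using f by (simp add: L2_norm_cls sqint_diff sqint_tree_semigroup cls_diff cls_tree_semigroup dist_norm)
  then show "((\<lambda>t. L2_norm G (\<lambda>x. tree_semigroup t f x - f x)) \<longlongrightarrow> 0) (at_right 0)"
    using Op.T_tendsto[of "cls \<mu> f"] unfolding tendsto_dist_iff[of _ "cls \<mu> f"] by simp
qed (rule sqint_tree_semigroup)

lemma tree_semigroup_generator: "generator G tree_semigroup = {(f, \<lambda>x. - g x) |f g. (f, g) \<in> neumann_operator G}"
proof -
  have "(f, g) \<in> generator G tree_semigroup \<longleftrightarrow> (f, \<lambda>x. - g x) \<in> neumann_operator G" for f g
  proof (cases "sqint \<mu> f \<and> sqint \<mu> g")
    case True
    then have fg: "sqint \<mu> f" "sqint \<mu> g" by auto
    have "(f, g) \<in> generator G tree_semigroup \<longleftrightarrow> ((\<lambda>t. (1 / t) *\<^sub>R (Op.T t (cls \<mu> f) - cls \<mu> f)) \<longlongrightarrow> cls \<mu> g) (at_right 0)"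
      using generator_iff[of tree_semigroup f g, OF sqint_tree_semigroup] fg by (simp add: cls_tree_semigroup)
    also have "\<dots> \<longleftrightarrow> cls \<mu> f \<in> Op.dom \<and> Op.A (cls \<mu> f) = - cls \<mu> g"
      using Op.generator_dom[of "cls \<mu> f"] Op.generator_converse[of "cls \<mu> f" "cls \<mu> g"] by auto
    finally show ?thesis using fg by (simp add: neumann_operator_iff sqint_minus cls_minus)
  next
    case False
    then show ?thesis
      using generator_iff[of tree_semigroup f g, OF sqint_tree_semigroup] sqint_minus[of "\<lambda>x. - g x"] by (auto simp: neumann_operator_iff)
  qed
  moreover have "(f, \<lambda>x. - g x) \<in> neumann_operator G \<longleftrightarrow> (\<exists>g'. g = (\<lambda>x. - g' x) \<and> (f, g') \<in> neumann_operator G)" for f g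
  proof
    assume "(f, \<lambda>x. - g x) \<in> neumann_operator G"
    then show "\<exists>g'. g = (\<lambda>x. - g' x) \<and> (f, g') \<in> neumann_operator G" by (intro exI[of _ "\<lambda>x. - g x"]) simp
  qed auto
  ultimately show ?thesis by auto
qed

text \<open>Vectors orthogonal to the functions on the tree have zero energy; testing with the
  orthogonal part of \<open>A u\<close> shows that this part vanishes.\<close>

lemma A_proj:
  assumes u: "u \<in> Op.dom"
  shows "proj \<mu> u \<in> Op.dom" "Op.A (proj \<mu> u) = Op.A u" "proj \<mu> (Op.A u) = Op.A u"
proof -
  have uV: "u \<in> form_domain" by (rule Op.dom_V[OF u])
  have *: "inner (form_deriv (proj \<mu> u)) (form_deriv v) = inner (Op.A u) v" if "v \<in> form_domain" for v
    using Op.A_eq[OF u that] uV by (simp add: form_deriv_proj)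
  show "proj \<mu> u \<in> Op.dom" "Op.A (proj \<mu> u) = Op.A u"
    using Op.A_unique[OF _ *] uV form_deriv_proj(1) by auto
  define w where "w = Op.A u - proj \<mu> (Op.A u)"
  have pw: "proj \<mu> w = 0" by (simp add: w_def proj_diff)
  have "inner (Op.A u) w = 0" using Op.A_eq[OF u form_deriv_kernel(1)[OF pw]] form_deriv_kernel(2)[OF pw] by simp
  moreover have "inner w (proj \<mu> (Op.A u)) = 0" unfolding w_def by (rule inner_diff_proj)
  ultimately have "inner w w = 0" by (simp add: w_def inner_diff_right inner_commute)
  then show "proj \<mu> (Op.A u) = Op.A u" by (simp add: w_def)
qed

lemma dom_proj: "proj \<mu> u \<in> Op.dom \<Longrightarrow> u \<in> Op.dom"
proof -
  assume p: "proj \<mu> u \<in> Op.dom"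
  then have u: "u \<in> form_domain" using Op.dom_V form_deriv_proj(1) by blast
  show ?thesis by (rule Op.A_unique(1)[OF u, of "Op.A (proj \<mu> u)"]) (use Op.A_eq[OF p] u in \<open>simp add: form_deriv_proj\<close>)
qed

text \<open>\<open>Op.semigroup_unique\<close> speaks about the whole Hilbert space, whereas
  \<open>S\<close> acts on functions up to null sets of \<open>mu\<close>. \<open>S\<close> is
  therefore transferred to classes and continued by the identity on the orthogonal complement, which
  is how the constructed flow acts there.\<close>

lemma c0_semigroup_unique:
  assumes c0: "c0_semigroup G S" and gen: "generator G S = {(f, \<lambda>x. - g x) |f g. (f, g) \<in> neumann_operator G}"
    and f: "sqint \<mu> f" and t: "t \<ge> 0"
  shows "cls \<mu> (S t f) = Op.T t (cls \<mu> f)"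
proof -
  note c = c0[unfolded c0_semigroup_def L2_sqint Ball_def mem_Collect_eq]
  note sq = c[THEN conjunct1, rule_format]
  note S_lin = c[THEN conjunct2, THEN conjunct1, rule_format]
  note S_bd = c[THEN conjunct2, THEN conjunct2, THEN conjunct1, rule_format]
  note S_0 = c[THEN conjunct2, THEN conjunct2, THEN conjunct2, THEN conjunct1, rule_format]
  note S_add = c[THEN conjunct2, THEN conjunct2, THEN conjunct2, THEN conjunct2, THEN conjunct1, rule_format]
  note S_cont = c[THEN conjunct2, THEN conjunct2, THEN conjunct2, THEN conjunct2, THEN conjunct2, rule_format]
  have lin: "cls \<mu> (S t (\<lambda>y. a * f y + b * g y)) = cscale a (cls \<mu> (S t f)) + cscale b (cls \<mu> (S t g))"
    if "t \<ge> 0" "sqint \<mu> f" "sqint \<mu> g" for t f g a b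
  proof -
    have "AE x in \<mu>. S t (\<lambda>y. a * f y + b * g y) x = a * S t f x + b * S t g x"
      by (rule S_lin[OF that])
    then have "cls \<mu> (S t (\<lambda>y. a * f y + b * g y)) = cls \<mu> (\<lambda>x. a * S t f x + b * S t g x)"
      using that by (intro cls_eqI sq sqint_add sqint_scale) auto
    then show ?thesis using that by (simp add: cls_lincomb sq)
  qed
  have ex_bd: "\<exists>C. \<forall>f. sqint \<mu> f \<longrightarrow> norm (cls \<mu> (S t f)) \<le> C * norm (cls \<mu> f)" if t: "t \<ge> 0" for t
  proof -
    from S_bd[OF t] obtain C where C: "\<forall>f. sqint \<mu> f \<longrightarrow> L2_norm G (S t f) \<le> C * L2_norm G f" ..
    then have "norm (cls \<mu> (S t f)) \<le> C * norm (cls \<mu> f)" if "sqint \<mu> f" for f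
      unfolding L2_norm_cls[OF that, symmetric] L2_norm_cls[OF sq[OF t that], symmetric] using that by blast
    then show ?thesis by blast
  qed
  \<comment> \<open>\<open>c0_semigroup\<close> does not postulate that \<open>S t\<close> respects
    equality almost everywhere; it follows from linearity and boundedness, applied to the
    difference.\<close>
  have cong: "cls \<mu> (S t f) = cls \<mu> (S t g)" if t: "t \<ge> 0" and fg: "sqint \<mu> f" "sqint \<mu> g" and e: "cls \<mu> f = cls \<mu> g" for t f g
  proof -
    obtain C where C: "\<And>f. sqint \<mu> f \<Longrightarrow> norm (cls \<mu> (S t f)) \<le> C * norm (cls \<mu> f)" using ex_bd[OF t] by blast
    have s: "sqint \<mu> (\<lambda>y. 1 * f y + (- 1) * g y)" using sqint_diff[OF fg] by simp
    have m: "cscale (- 1) h = - h" for h :: "('v, 'e) point l2" using cscale_of_real[of "- 1" h] by simp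
    have "cls \<mu> (\<lambda>y. 1 * f y + (- 1) * g y) = 0" unfolding cls_lincomb[OF fg] using e by (simp add: m cscale_1)
    then have "norm (cls \<mu> (S t (\<lambda>y. 1 * f y + (- 1) * g y))) \<le> C * norm (0 :: ('v, 'e) point l2)" using C[OF s] by simp
    then have "cls \<mu> (S t (\<lambda>y. 1 * f y + (- 1) * g y)) = 0" by simp
    then show ?thesis unfolding lin[OF t fg] by (simp add: m cscale_1)
  qed
  define P where "P t h = cls \<mu> (S t (rp \<mu> h))" for t h
  have P_cls: "P t (cls \<mu> f) = cls \<mu> (S t f)" if "t \<ge> 0" "sqint \<mu> f" for t f
    unfolding P_def using that by (intro cong sqint_rp cls_rp_cong)
  have P_proj: "P t (proj \<mu> h) = P t h" if "t \<ge> 0" for t h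
    unfolding proj_def by (simp add: P_cls that sqint_rp) (simp add: P_def)
  have proj_P: "proj \<mu> (P t h) = P t h" if "t \<ge> 0" for t h unfolding P_def using that by (simp add: sq sqint_rp)
  define S' where "S' t h = (h - proj \<mu> h) + P t h" for t h
  have proj_S': "proj \<mu> (S' t h) = P t h" if "t \<ge> 0" for t h
    unfolding S'_def by (simp add: proj_add proj_diff proj_P that)
  have P_lin: "P t (cscale a h + cscale b k) = cscale a (P t h) + cscale b (P t k)" if t: "t \<ge> 0" for t h k a b
  proof -
    have "proj \<mu> (cscale a h + cscale b k) = cls \<mu> (\<lambda>x. a * rp \<mu> h x + b * rp \<mu> k x)"
      unfolding cls_lincomb[OF sqint_rp sqint_rp] by (simp add: proj_add proj_cscale flip: proj_def)
    then have "P t (cscale a h + cscale b k) = P t (cls \<mu> (\<lambda>x. a * rp \<mu> h x + b * rp \<mu> k x))"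
      using P_proj[OF t, of "cscale a h + cscale b k"] by simp
    also have "\<dots> = cls \<mu> (S t (\<lambda>x. a * rp \<mu> h x + b * rp \<mu> k x))"
      using t by (intro P_cls sqint_add sqint_scale sqint_rp)
    also have "\<dots> = cscale a (P t h) + cscale b (P t k)" unfolding P_def by (rule lin[OF t sqint_rp sqint_rp])
    finally show ?thesis .
  qed
  have "S' t (cls \<mu> f) = Op.T t (cls \<mu> f)"
  proof (rule Op.semigroup_unique[OF _ _ _ _ _ _ t])
    show "bounded_linear (S' t)" if t: "t \<ge> 0" for t
    proof -
      obtain C where C: "\<And>f. sqint \<mu> f \<Longrightarrow> norm (cls \<mu> (S t f)) \<le> C * norm (cls \<mu> f)" using ex_bd[OF t] by blast
      have "bounded_linear (P t)"
      proof (rule bounded_linear_intro[where K = "\<bar>C\<bar>"])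
        show "P t (x + y) = P t x + P t y" for x y using P_lin[OF t, of 1 x 1 y] by (simp add: cscale_1)
        show "P t (r *\<^sub>R x) = r *\<^sub>R P t x" for r x
          using P_lin[OF t, of "complex_of_real r" x 0 x] cscale_of_real[of 0 x] cscale_of_real[of 0 "P t x"] by (simp add: cscale_of_real)
        fix x
        have "norm (P t x) \<le> C * norm (proj \<mu> x)" unfolding P_def proj_def by (rule C[OF sqint_rp])
        also have "\<dots> \<le> \<bar>C\<bar> * norm (proj \<mu> x)" by (intro mult_right_mono) auto
        also have "\<dots> \<le> \<bar>C\<bar> * norm x" by (intro mult_left_mono norm_proj_le) auto
        finally show "norm (P t x) \<le> norm x * \<bar>C\<bar>" by (simp add: mult.commute)
      qed
      then show ?thesis
        unfolding S'_def[abs_def] by (intro bounded_linear_add bounded_linear_sub bounded_linear_proj bounded_linear_ident)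
    qed
    show "S' 0 h = h" for h
    proof -
      have "AE x in \<mu>. S 0 (rp \<mu> h) x = rp \<mu> h x" by (rule S_0[OF sqint_rp])
      then have "P 0 h = proj \<mu> h" unfolding P_def proj_def by (intro cls_eqI sq sqint_rp) auto
      then show ?thesis by (simp add: S'_def)
    qed
    show "S' (s + t) h = S' s (S' t h)" if "s \<ge> 0" "t \<ge> 0" for s t h
    proof -
      have "AE x in \<mu>. S (s + t) (rp \<mu> h) x = S s (S t (rp \<mu> h)) x"
        by (rule S_add[OF that sqint_rp])
      then have "P (s + t) h = cls \<mu> (S s (S t (rp \<mu> h)))"
        unfolding P_def using that by (intro cls_eqI sq sqint_rp) auto
      also have "\<dots> = P s (P t h)" unfolding P_def[of t] using that by (intro P_cls[symmetric] sq sqint_rp)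
      also have "\<dots> = P s (S' t h)" using P_proj[OF that(1), of "S' t h"] by (simp add: proj_S' that)
      finally have "P (s + t) h = P s (S' t h)" .
      then show ?thesis unfolding S'_def[of s] proj_S'[OF that(2)] by (simp add: S'_def)
    qed
    show "((\<lambda>t. S' t h) \<longlongrightarrow> h) (at_right 0)" for h
    proof -
      have "((\<lambda>t. L2_norm G (\<lambda>x. S t (rp \<mu> h) x - rp \<mu> h x)) \<longlongrightarrow> 0) (at_right 0)"
        by (rule S_cont[OF sqint_rp])
      moreover have "eventually (\<lambda>t. L2_norm G (\<lambda>x. S t (rp \<mu> h) x - rp \<mu> h x) = dist (S' t h) h) (at_right 0)"
        using eventually_at_right_less[of 0]
      proof eventually_elim
        case (elim t)
        then show ?case
          by (simp add: L2_norm_cls sqint_diff sq sqint_rp cls_diff dist_norm S'_def P_def flip: proj_def)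
      qed
      ultimately show ?thesis unfolding tendsto_dist_iff[of _ h] by (simp add: tendsto_cong)
    qed
    have diff: "S' t u - u = cls \<mu> (S t (rp \<mu> u)) - cls \<mu> (rp \<mu> u)" for t u
      by (simp add: S'_def P_def proj_def)
    show "((\<lambda>t. (1 / t) *\<^sub>R (S' t u - u)) \<longlongrightarrow> - Op.A u) (at_right 0)" if u: "u \<in> Op.dom" for u
    proof -
      have "(rp \<mu> u, rp \<mu> (Op.A u)) \<in> neumann_operator G"
        unfolding neumann_operator_iff using A_proj[OF u] by (simp add: sqint_rp flip: proj_def)
      then have "(rp \<mu> u, \<lambda>x. - rp \<mu> (Op.A u) x) \<in> generator G S" unfolding gen by blast
      then have "((\<lambda>t. (1 / t) *\<^sub>R (cls \<mu> (S t (rp \<mu> u)) - cls \<mu> (rp \<mu> u))) \<longlongrightarrow> cls \<mu> (\<lambda>x. - rp \<mu> (Op.A u) x)) (at_right 0)"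
        by (subst (asm) generator_iff) (simp_all add: sq)
      moreover have "cls \<mu> (\<lambda>x. - rp \<mu> (Op.A u) x) = - Op.A u"
        using A_proj(3)[OF u] by (simp add: cls_minus sqint_rp flip: proj_def)
      ultimately show ?thesis unfolding diff by simp
    qed
    \<comment> \<open>The difference quotients lie in the range of \<open>proj \<mu>\<close>, so
      they also converge to \<open>proj \<mu> g\<close>, and the hypothesis on the generator of
      \<open>S\<close> applies to representatives.\<close>
    show "u \<in> Op.dom" if lim: "((\<lambda>t. (1 / t) *\<^sub>R (S' t u - u)) \<longlongrightarrow> g) (at_right 0)" for u g
    proof -
      have "((\<lambda>t. proj \<mu> ((1 / t) *\<^sub>R (S' t u - u))) \<longlongrightarrow> proj \<mu> g) (at_right 0)"
        by (rule bounded_linear.tendsto[OF bounded_linear_proj lim])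
      moreover have "eventually (\<lambda>t. proj \<mu> ((1 / t) *\<^sub>R (S' t u - u)) = (1 / t) *\<^sub>R (S' t u - u)) (at_right 0)"
        using eventually_at_right_less[of 0]
      proof eventually_elim
        case (elim t)
        then show ?case unfolding diff by (simp add: proj_scaleR proj_diff sq sqint_rp)
      qed
      ultimately have "((\<lambda>t. (1 / t) *\<^sub>R (S' t u - u)) \<longlongrightarrow> proj \<mu> g) (at_right 0)" by (simp add: tendsto_cong)
      then have "(rp \<mu> u, rp \<mu> g) \<in> generator G S"
        unfolding diff by (subst generator_iff) (simp_all add: sq sqint_rp flip: proj_def)
      then obtain g' where "(rp \<mu> u, g') \<in> neumann_operator G" unfolding gen by blast
      then have "proj \<mu> u \<in> Op.dom" unfolding neumann_operator_iff by (simp add: proj_def)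
      then show ?thesis by (rule dom_proj)
    qed
  qed
  then show ?thesis using f t by (simp add: S'_def P_cls)
qed

text \<open>\<open>tree_semigroup\<close> shows that the choice is legitimate, uniqueness that its
  outcome does not matter.\<close>

lemma cls_neumann_semigroup:
  assumes "sqint \<mu> f" "t \<ge> 0"
  shows "cls \<mu> (neumann_semigroup G t f) = Op.T t (cls \<mu> f)" "sqint \<mu> (neumann_semigroup G t f)"
proof -
  let ?P = "\<lambda>T. c0_semigroup G T \<and> generator G T = {(f, \<lambda>x. - g x) |f g. (f, g) \<in> neumann_operator G}"
  have P: "?P (neumann_semigroup G)"
    unfolding neumann_semigroup_def by (rule someI[of ?P tree_semigroup]) (simp only: tree_semigroup_semigroup tree_semigroup_generator simp_thms)
  show "cls \<mu> (neumann_semigroup G t f) = Op.T t (cls \<mu> f)"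
    by (rule c0_semigroup_unique[OF P[THEN conjunct1] P[THEN conjunct2] assms])
  show "sqint \<mu> (neumann_semigroup G t f)"
    using P[THEN conjunct1, unfolded c0_semigroup_def L2_sqint, THEN conjunct1] assms by simp
qed

end

section \<open>Heat flow and invariant measures\<close>

lemma sqint_Re:
  assumes f: "sqint M f"
  shows "sqint M (\<lambda>x. complex_of_real (Re (f x)))" "sqint M (\<lambda>x. complex_of_real (Im (f x)))"
proof -
  have m: "f \<in> borel_measurable M" and i: "integrable M (\<lambda>x. (cmod (f x))\<^sup>2)" using f by (simp_all add: sqint_def)
  have "(cmod (complex_of_real (Re z)))\<^sup>2 \<le> (cmod z)\<^sup>2" "(cmod (complex_of_real (Im z)))\<^sup>2 \<le> (cmod z)\<^sup>2" for z
    by (simp_all add: cmod_power2)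
  then show "sqint M (\<lambda>x. complex_of_real (Re (f x)))" "sqint M (\<lambda>x. complex_of_real (Im (f x)))"
    using m by (intro sqint_bound[OF _ i]; measurable)+
qed

context rooted_tree
begin

lemma continuous_AE_eq:
  fixes u v :: "('v, 'e) point \<Rightarrow> complex"
  assumes u: "continuous_map (tree_topology G) euclidean u" and v: "continuous_map (tree_topology G) euclidean v"
    and ae: "AE x in \<mu>. u x = v x" and p: "p \<in> points G"
  shows "u p = v p"
proof -
  have c: "continuous_map (tree_topology G) euclidean (\<lambda>x. cmod (u x - v x))"
    using u v unfolding continuous_tree_iff by (auto intro!: continuous_intros)
  have "AE x in \<mu>. cmod (u x - v x) \<le> 0" using ae by eventually_elim simp
  from continuous_AE_imp_all[OF c this p] show ?thesis by simp
qed

section \<open>Positivity and boundedness of the flow\<close>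

text \<open>The derivative of \<open>\<bar>Re f\<bar>\<close> is \<open>sgn (Re f) * Re g\<close> by
  \<open>abs_integral\<close>, pointwise no larger than \<open>g\<close>.\<close>

lemma absr_form_domain:
  assumes "x \<in> form_domain"
  shows "absr \<mu> x \<in> form_domain" "norm (form_deriv (absr \<mu> x)) \<le> norm (form_deriv x)"
proof -
  obtain f g where x: "sqint \<mu> f" "sqint \<mu> g" "ac f g" "proj \<mu> x = cls \<mu> f" "form_deriv x = (1 / sqrt 2) *\<^sub>R cls \<mu> g"
    using form_domain_E[OF assms] .
  define d where "d p = complex_of_real (sgn (Re (f p)) * Re (g p))" for p
  have le: "(cmod (d p))\<^sup>2 \<le> (cmod (g p))\<^sup>2" for p
  proof -
    have "cmod (d p) \<le> \<bar>Re (g p)\<bar>" by (simp add: d_def norm_mult sgn_if)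
    also have "\<dots> \<le> cmod (g p)" by (rule abs_Re_le_cmod)
    finally show ?thesis by (intro power_mono) auto
  qed
  have dm: "d \<in> borel_measurable \<mu>"
    unfolding d_def using sqint_measurable[OF x(1)] sqint_measurable[OF x(2)] by measurable
  have ds: "sqint \<mu> d" by (rule sqint_bound[OF dm _ le]) (use x(2) in \<open>simp add: sqint_def\<close>)
  have a: "ac (\<lambda>p. complex_of_real \<bar>Re (f p)\<bar>) d"
    unfolding ac_def
  proof (intro ballI impI)
    fix e a b assume e: "e \<in> E" and ab: "a \<in> J e" "b \<in> J e" "a \<le> b"
    have gi: "integrable lborel (\<lambda>s. indicator {y..z} s *\<^sub>R g (ch e s))" if "y \<in> J e" "z \<in> J e" for y z
      using edge_set_integrable[OF e that x(2)] unfolding set_integrable_def .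
    have eq: "indicator {y..z} s *\<^sub>R Re (g (ch e s)) = Re (indicator {y..z} s *\<^sub>R g (ch e s))" for y z s by simp
    have "\<bar>Re (f (ch e b))\<bar> - \<bar>Re (f (ch e a))\<bar> = (LINT s:{a..b}|lborel. sgn (Re (f (ch e s))) * Re (g (ch e s)))"
    proof (rule abs_integral[OF ab(3)])
      show "set_integrable lborel {a..b} (\<lambda>s. Re (g (ch e s)))"
        unfolding set_integrable_def eq by (rule integrable_Re[OF gi[OF ab(1,2)]])
      fix y z assume yz: "a \<le> y" "y \<le> z" "z \<le> b"
      then have J: "y \<in> J e" "z \<in> J e" using J_interval[OF ab(1,2)] by auto
      show "Re (f (ch e z)) - Re (f (ch e y)) = (LINT s:{y..z}|lborel. Re (g (ch e s)))"
        unfolding set_lebesgue_integral_def eq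
        using acD[OF x(3) e J yz(2)] integral_Re[OF gi[OF J]] by (simp add: set_lebesgue_integral_def flip: minus_complex.sel(1))
    qed
    then show "complex_of_real \<bar>Re (f (ch e b))\<bar> - complex_of_real \<bar>Re (f (ch e a))\<bar> = (LINT s:{a..b}|lborel. d (ch e s))"
      unfolding d_def set_integral_complex_of_real of_real_diff[symmetric] by simp
  qed
  have e: "absr \<mu> x = cls \<mu> (\<lambda>p. complex_of_real \<bar>Re (f p)\<bar>)"
    using absr_proj[of \<mu> x] absr_cls[OF x(1)] x(4) by simp
  note D = form_deriv_cls[OF sqint_abs_Re[OF x(1)] ds a]
  show "absr \<mu> x \<in> form_domain" unfolding e by (rule D(1))
  have "(norm (cls \<mu> d))\<^sup>2 \<le> (norm (cls \<mu> g))\<^sup>2"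
    unfolding norm_cls[OF ds] norm_cls[OF x(2)]
    by (rule integral_mono) (use ds x(2) le in \<open>auto simp: sqint_def\<close>)
  then have "norm (cls \<mu> d) \<le> norm (cls \<mu> g)" by (rule power2_le_imp_le) simp
  then show "norm (form_deriv (absr \<mu> x)) \<le> norm (form_deriv x)"
    unfolding e D(2) x(5) norm_scaleR by (intro mult_left_mono) auto
qed

text \<open>The equation \<open>f = \<bar>Re f\<bar>\<close> says at once that \<open>f\<close> is
  real and non-negative, and it is the fixed point equation of \<open>absr \<mu>\<close>.\<close>

lemma T_nonneg:
  assumes f: "sqint \<mu> f" "AE x in \<mu>. f x = complex_of_real \<bar>Re (f x)\<bar>" and u: "sqint \<mu> u" "Op.T t (cls \<mu> f) = cls \<mu> u"
  shows "AE x in \<mu>. u x = complex_of_real \<bar>Re (u x)\<bar>"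
proof -
  have "cls \<mu> f = absr \<mu> (cls \<mu> f)"
    unfolding absr_cls[OF f(1)] by (rule cls_eqI[OF f(1) sqint_abs_Re[OF f(1)] f(2)])
  then have "absr \<mu> (Op.T t (cls \<mu> f)) = Op.T t (cls \<mu> f)"
    by (intro Op.T_fixed_points absr_form_domain norm_absr_diff_le) auto
  then have "cls \<mu> u = cls \<mu> (\<lambda>x. complex_of_real \<bar>Re (u x)\<bar>)" unfolding u(2) absr_cls[OF u(1)] by simp
  then show ?thesis using cls_eq_iff[OF u(1) sqint_abs_Re[OF u(1)]] by simp
qed

text \<open>Positivity applied to \<open>C + r\<close> and \<open>C - r\<close>; constants have zero
  energy and are stationary. The explicit factors 1 and \<open>s\<close> fit the shape of
  \<open>cls_lincomb\<close>.\<close>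

lemma T_real_bound:
  assumes r: "sqint \<mu> (\<lambda>x. complex_of_real (r x))" "AE x in \<mu>. \<bar>r x\<bar> \<le> C"
    and u: "sqint \<mu> u" "Op.T t (cls \<mu> (\<lambda>x. complex_of_real (r x))) = cls \<mu> u"
  shows "AE x in \<mu>. cmod (u x) \<le> C"
proof -
  have *: "AE x in \<mu>. 1 * complex_of_real C + complex_of_real s * u x = complex_of_real \<bar>Re (1 * complex_of_real C + complex_of_real s * u x)\<bar>"
    if s: "s = 1 \<or> s = - 1" for s :: real
  proof (rule T_nonneg)
    show "sqint \<mu> (\<lambda>x. 1 * complex_of_real C + complex_of_real s * complex_of_real (r x))"
      "sqint \<mu> (\<lambda>x. 1 * complex_of_real C + complex_of_real s * u x)"
      by (intro sqint_add sqint_scale sqint_const r u)+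
    show "Op.T t (cls \<mu> (\<lambda>x. 1 * complex_of_real C + complex_of_real s * complex_of_real (r x))) =
      cls \<mu> (\<lambda>x. 1 * complex_of_real C + complex_of_real s * u x)"
      unfolding cls_lincomb[OF sqint_const r(1)] cls_lincomb[OF sqint_const u(1)] T_lincomb u(2) Op.T_fixed[OF form_deriv_const] ..
    show "AE x in \<mu>. 1 * complex_of_real C + complex_of_real s * complex_of_real (r x) =
      complex_of_real \<bar>Re (1 * complex_of_real C + complex_of_real s * complex_of_real (r x))\<bar>"
      using r(2)
    proof eventually_elim
      case (elim x)
      then have "0 \<le> C + s * r x" using s by auto
      then show ?case by (simp flip: of_real_mult of_real_add)
    qed
  qed
  show ?thesis
    using *[of 1, simplified] *[of "- 1", simplified]
  proof eventually_elim
    case (elim x)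
    have "Im (complex_of_real C + u x) = 0" "Re (complex_of_real C + u x) \<ge> 0"
      by (subst elim(1), simp del: plus_complex.sel)+
    moreover have "Re (complex_of_real C - u x) \<ge> 0" by (subst elim(2)) (simp del: minus_complex.sel)
    ultimately have "Im (u x) = 0" "\<bar>Re (u x)\<bar> \<le> C" by auto
    then show ?case by (simp add: cmod_eq_Re)
  qed
qed

text \<open>Real and imaginary parts are bounded separately, which costs the factor 2. Independence
  of \<open>t\<close> is what the later domination requires.\<close>

lemma T_bound:
  assumes f: "sqint \<mu> f" "AE x in \<mu>. cmod (f x) \<le> C" and u: "sqint \<mu> u" "Op.T t (cls \<mu> f) = cls \<mu> u"
  shows "AE x in \<mu>. cmod (u x) \<le> 2 * C"
proof -
  let ?a = "tree_semigroup t (\<lambda>x. complex_of_real (Re (f x)))" and ?b = "tree_semigroup t (\<lambda>x. complex_of_real (Im (f x)))"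
  have "AE x in \<mu>. \<bar>Re (f x)\<bar> \<le> C" using f(2) by eventually_elim (rule order_trans[OF abs_Re_le_cmod])
  then have a: "AE x in \<mu>. cmod (?a x) \<le> C" by (rule T_real_bound[OF sqint_Re(1)[OF f(1)] _ sqint_tree_semigroup cls_tree_semigroup[OF sqint_Re(1)[OF f(1)], symmetric]])
  have "AE x in \<mu>. \<bar>Im (f x)\<bar> \<le> C" using f(2) by eventually_elim (rule order_trans[OF abs_Im_le_cmod])
  then have b: "AE x in \<mu>. cmod (?b x) \<le> C" by (rule T_real_bound[OF sqint_Re(2)[OF f(1)] _ sqint_tree_semigroup cls_tree_semigroup[OF sqint_Re(2)[OF f(1)], symmetric]])
  have "f = (\<lambda>x. 1 * complex_of_real (Re (f x)) + \<i> * complex_of_real (Im (f x)))" by (simp add: complex_eq[symmetric])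
  then have "cls \<mu> f = cls \<mu> (\<lambda>x. 1 * complex_of_real (Re (f x)) + \<i> * complex_of_real (Im (f x)))" by simp
  then have "cls \<mu> u = cls \<mu> (\<lambda>x. 1 * ?a x + \<i> * ?b x)"
    unfolding cls_lincomb[OF sqint_tree_semigroup sqint_tree_semigroup] cls_tree_semigroup[OF sqint_Re(1)[OF f(1)]] cls_tree_semigroup[OF sqint_Re(2)[OF f(1)]]
      T_lincomb[symmetric] cls_lincomb[OF sqint_Re[OF f(1)], symmetric] u(2)[symmetric] by simp
  then have "AE x in \<mu>. u x = 1 * ?a x + \<i> * ?b x"
    using cls_eq_iff[OF u(1) sqint_add[OF sqint_scale[OF sqint_tree_semigroup] sqint_scale[OF sqint_tree_semigroup]]] by blast
  then show ?thesis
    using a b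
  proof eventually_elim
    case (elim x)
    have "cmod (u x) \<le> cmod (?a x) + cmod (\<i> * ?b x)" unfolding elim(1) using norm_triangle_ineq[of "?a x" "\<i> * ?b x"] by simp
    then show ?case using elim by (simp add: norm_mult)
  qed
qed

section \<open>Heat flow of bounded functions and its limit\<close>

lemma Linfty_E:
  assumes "f \<in> Linfty G"
  obtains C where "AE x in \<mu>. cmod (f x) \<le> C"
  using assms by (auto simp: Linfty_def)

lemma Linfty_sqint:
  assumes "f \<in> Linfty G"
  shows "sqint \<mu> f"
proof -
  obtain C where C: "AE x in \<mu>. cmod (f x) \<le> C" using Linfty_E[OF assms] .
  have m: "f \<in> borel_measurable \<mu>" using assms by (simp add: Linfty_def)
  have "integrable \<mu> (\<lambda>x. (cmod (f x))\<^sup>2)"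
  proof (rule Bochner_Integration.integrable_bound)
    show "integrable \<mu> (\<lambda>_. C\<^sup>2)" by (rule finite_measure.integrable_const[OF finite_mu])
    show "(\<lambda>x. (cmod (f x))\<^sup>2) \<in> borel_measurable \<mu>" using m by measurable
    show "AE x in \<mu>. norm ((cmod (f x))\<^sup>2) \<le> norm (C\<^sup>2)"
      using C by eventually_elim (simp add: power_mono)
  qed
  then show ?thesis using m by (simp add: sqint_def)
qed

text \<open>\<open>T_energy\<close> puts the flow into the form domain at every positive time, and
  vectors there have continuous representatives.\<close>

lemma heat_exists:
  assumes f: "f \<in> Linfty G" "AE x in \<mu>. cmod (f x) \<le> C" and t: "t > 0"
  shows "\<exists>u g. sqint \<mu> u \<and> sqint \<mu> g \<and> ac u g \<and> Op.T t (cls \<mu> f) = cls \<mu> u \<and>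
    t * (norm (cls \<mu> g))\<^sup>2 \<le> (norm (cls \<mu> f))\<^sup>2 \<and> (\<forall>p\<in>points G. cmod (u p) \<le> 2 * C)"
proof -
  note s = Linfty_sqint[OF f(1)]
  obtain u g where u: "sqint \<mu> u" "sqint \<mu> g" "ac u g" "proj \<mu> (Op.T t (cls \<mu> f)) = cls \<mu> u"
    "form_deriv (Op.T t (cls \<mu> f)) = (1 / sqrt 2) *\<^sub>R cls \<mu> g" using form_domain_E[OF Op.T_energy(1)[OF t]] .
  have eq: "Op.T t (cls \<mu> f) = cls \<mu> u" using u(4) proj_T[OF proj_cls[OF s], of t] by simp
  have "t * (norm (cls \<mu> g))\<^sup>2 \<le> (norm (cls \<mu> f))\<^sup>2"
    using Op.T_energy(2)[OF t, of "cls \<mu> f"] by (simp add: u(5) power_divide)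
  moreover have "cmod (u p) \<le> 2 * C" if "p \<in> points G" for p
  proof (rule continuous_AE_imp_all[OF _ T_bound[OF s f(2) u(1) eq] that])
    show "continuous_map (tree_topology G) euclidean (\<lambda>p. cmod (u p))"
      using ac_continuous[OF u(3,2)] unfolding continuous_tree_iff by (auto intro: continuous_on_norm)
  qed
  ultimately show ?thesis using u eq by blast
qed

text \<open>The chosen representative agrees at every point with the one from
  \<open>heat_exists\<close>, since continuous functions that are equal almost everywhere coincide.
  Its derivative and the energy estimate carry over.\<close>

lemma heat:
  assumes f: "f \<in> Linfty G" "AE x in \<mu>. cmod (f x) \<le> C" and t: "t > 0"
  shows "continuous_map (tree_topology G) euclidean (neumann_heat G t f)"
    and "sqint \<mu> (neumann_heat G t f)" and "Op.T t (cls \<mu> f) = cls \<mu> (neumann_heat G t f)"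
    and "p \<in> points G \<Longrightarrow> cmod (neumann_heat G t f p) \<le> 2 * C"
    and "\<exists>g. sqint \<mu> g \<and> ac (neumann_heat G t f) g \<and> t * (norm (cls \<mu> g))\<^sup>2 \<le> (norm (cls \<mu> f))\<^sup>2"
proof -
  obtain u g where u: "sqint \<mu> u" "sqint \<mu> g" "ac u g" "Op.T t (cls \<mu> f) = cls \<mu> u"
    "t * (norm (cls \<mu> g))\<^sup>2 \<le> (norm (cls \<mu> f))\<^sup>2" "\<And>p. p \<in> points G \<Longrightarrow> cmod (u p) \<le> 2 * C"
    using heat_exists[OF assms] by blast
  note S = cls_neumann_semigroup[OF Linfty_sqint[OF f(1)] less_imp_le[OF t]]
  let ?P = "\<lambda>u. continuous_map (tree_topology G) euclidean u \<and> bounded (u ` points G) \<and> (AE x in \<mu>. neumann_semigroup G t f x = u x)"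
  have ae: "AE x in \<mu>. neumann_semigroup G t f x = u x"
    using S(1) u(4) cls_eq_iff[OF S(2) u(1)] by simp
  have c: "continuous_map (tree_topology G) euclidean u" by (rule ac_continuous[OF u(3,2)])
  have "?P u" using c ae u(6) by (auto simp: bounded_iff)
  then have P: "?P (neumann_heat G t f)" unfolding neumann_heat_def by (rule someI[of ?P])
  then show ch: "continuous_map (tree_topology G) euclidean (neumann_heat G t f)" by blast
  have "AE x in \<mu>. neumann_semigroup G t f x = neumann_heat G t f x" using P by blast
  with ae have ae2: "AE x in \<mu>. u x = neumann_heat G t f x" by eventually_elim simp
  have eq: "neumann_heat G t f p = u p" if "p \<in> points G" for p
    by (rule continuous_AE_eq[OF c ch ae2 that, symmetric])
  show s: "sqint \<mu> (neumann_heat G t f)"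
    by (rule sqint_cong_AE[OF u(1) _ ae2]) (simp add: measurable_mu continuous_tree_measurable[OF ch])
  show "Op.T t (cls \<mu> f) = cls \<mu> (neumann_heat G t f)" unfolding u(4) by (rule cls_eqI[OF u(1) s ae2])
  show "p \<in> points G \<Longrightarrow> cmod (neumann_heat G t f p) \<le> 2 * C" using u(6) by (simp add: eq)
  have "ac (neumann_heat G t f) g" using u(3) ch_points by (simp add: ac_def eq)
  then show "\<exists>g. sqint \<mu> g \<and> ac (neumann_heat G t f) g \<and> t * (norm (cls \<mu> g))\<^sup>2 \<le> (norm (cls \<mu> f))\<^sup>2"
    using u by blast
qed

lemma heat_nonneg:
  assumes f: "f \<in> Linfty G" "AE x in \<mu>. f x = complex_of_real \<bar>Re (f x)\<bar>" and t: "t > 0" and p: "p \<in> points G"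
  shows "neumann_heat G t f p = complex_of_real \<bar>Re (neumann_heat G t f p)\<bar>"
proof -
  obtain C where C: "AE x in \<mu>. cmod (f x) \<le> C" using Linfty_E[OF f(1)] .
  note h = heat[OF f(1) C t]
  show ?thesis
  proof (rule continuous_AE_eq[OF h(1) _ T_nonneg[OF Linfty_sqint[OF f(1)] f(2) h(2,3)] p])
    show "continuous_map (tree_topology G) euclidean (\<lambda>p. complex_of_real \<bar>Re (neumann_heat G t f p)\<bar>)"
      using h(1) unfolding continuous_tree_iff by (auto intro!: continuous_intros)
  qed
qed

lemma sqint_integrable: "sqint \<mu> f \<Longrightarrow> integrable \<mu> f"
  using sqint_mult_cnj[OF _ sqint_const[of 1], of f] by simp

text \<open>The constants 1 and \<open>\<i>\<close> have zero energy; the real inner products with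
  them are the real and the imaginary part of the integral.\<close>

lemma heat_mean:
  assumes f: "f \<in> Linfty G" and t: "t > 0"
  shows "(LINT x|\<mu>. neumann_heat G t f x) = (LINT x|\<mu>. f x)"
proof -
  obtain C where C: "AE x in \<mu>. cmod (f x) \<le> C" using Linfty_E[OF f(1)] .
  note h = heat[OF f(1) C t] and s = Linfty_sqint[OF f]
  have *: "Re (LINT x|\<mu>. neumann_heat G t f x * cnj c) = Re (LINT x|\<mu>. f x * cnj c)" for c
    unfolding Re_L2_inner[OF h(2) sqint_const] Re_L2_inner[OF s sqint_const] h(3)[symmetric]
    by (rule Op.T_conserved[OF form_deriv_const])
  show ?thesis
    using *[of 1] *[of \<i>] by (simp add: complex_eq_iff)
qed

text \<open>If \<open>mu\<close> were zero, even \<open>1 \<le> 0\<close> would hold almost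
  everywhere and thus, by continuity, at the root.\<close>

lemma mu_pos: "0 < measure \<mu> (points G)"
proof (rule ccontr)
  assume "\<not> 0 < measure \<mu> (points G)"
  then have "measure \<mu> (points G) = 0" using measure_nonneg[of \<mu> "points G"] by linarith
  then have "emeasure \<mu> (space \<mu>) = 0" using finite_measure.emeasure_eq_measure[OF finite_mu] by simp
  then have "AE x in \<mu>. (1 :: real) \<le> 0"
    by (intro AE_I[where N = "space \<mu>"]) (use sets.top[of \<mu>] in auto)
  then have "(1 :: real) \<le> 0"
    by (intro continuous_AE_imp_all[of "\<lambda>_. 1" 0 "Vertex (origin G)"] origin_point) (auto simp: continuous_tree_iff)
  then show False by simp
qed

lemma heat_diff_tendsto:
  assumes f: "f \<in> Linfty G" and p: "p \<in> points G" and q: "q \<in> points G"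
  shows "((\<lambda>t. neumann_heat G t f p - neumann_heat G t f q) \<longlongrightarrow> 0) at_top"
proof -
  obtain C where C: "AE x in \<mu>. cmod (f x) \<le> C" using Linfty_E[OF f(1)] .
  have "\<exists>K\<ge>0. \<forall>f g. sqint \<mu> g \<longrightarrow> ac f g \<longrightarrow> cmod (f p - f q) \<le> K * norm (cls \<mu> g)"
    using near_all[OF p q] unfolding near_def .
  then obtain K where K: "K \<ge> 0" "\<forall>f g. sqint \<mu> g \<longrightarrow> ac f g \<longrightarrow> cmod (f p - f q) \<le> K * norm (cls \<mu> g)" by blast
  define N where "N = norm (cls \<mu> f)"
  have le: "cmod (neumann_heat G t f p - neumann_heat G t f q) \<le> K * (N / sqrt t)" if t: "t > 0" for t
  proof -
    obtain g where g: "sqint \<mu> g" "ac (neumann_heat G t f) g" "t * (norm (cls \<mu> g))\<^sup>2 \<le> N\<^sup>2"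
      using heat(5)[OF f C t] unfolding N_def by blast
    have "(norm (cls \<mu> g) * sqrt t)\<^sup>2 \<le> N\<^sup>2" using g(3) t by (simp add: power_mult_distrib mult.commute)
    then have "norm (cls \<mu> g) * sqrt t \<le> N" by (rule power2_le_imp_le) (simp add: N_def)
    then have "norm (cls \<mu> g) \<le> N / sqrt t" using t by (simp add: pos_le_divide_eq)
    then have "K * norm (cls \<mu> g) \<le> K * (N / sqrt t)" using K(1) by (rule mult_left_mono)
    then show ?thesis using K(2) g by (meson order_trans)
  qed
  show ?thesis
  proof (rule Lim_null_comparison)
    show "eventually (\<lambda>t. norm (neumann_heat G t f p - neumann_heat G t f q) \<le> K * (N / sqrt t)) at_top"
      using eventually_gt_at_top[of 0] by eventually_elim (rule le)
    show "((\<lambda>t. K * (N / sqrt t)) \<longlongrightarrow> 0) at_top"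
      by (rule tendsto_mult_right_zero)
        (rule tendsto_divide_0[OF tendsto_const filterlim_at_top_imp_at_infinity[OF sqrt_at_top]])
  qed
qed

text \<open>Integrated over \<open>q\<close>, the vanishing differences of the values at
  \<open>p\<close> and \<open>q\<close> become \<open>m * neumann_heat G t f p - L\<close>, because
  the integral is conserved. The time-independent bound \<open>4 * C\<close> permits dominated
  convergence.\<close>

lemma heat_tendsto:
  assumes f: "f \<in> Linfty G" and p: "p \<in> points G"
  shows "((\<lambda>t. neumann_heat G t f p) \<longlongrightarrow> 1 / complex_of_real (measure \<mu> (points G)) * (LINT x|\<mu>. f x)) at_top"
proof -
  define m where "m = complex_of_real (measure \<mu> (points G))"
  have m: "m \<noteq> 0" using mu_pos by (simp add: m_def)
  define L where "L = (LINT x|\<mu>. f x)"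
  obtain C where C: "AE x in \<mu>. cmod (f x) \<le> C" using Linfty_E[OF f(1)] .
  \<comment> \<open>Set to 0 for \<open>t \<le> 0\<close>, where nothing is known about
    \<open>neumann_heat\<close> although measurability is required at every
    \<open>t\<close>.\<close>
  define s where "s t q = (if t > 0 then neumann_heat G t f p - neumann_heat G t f q else 0)" for t q
  have ev: "eventually (\<lambda>t. s t q = neumann_heat G t f p - neumann_heat G t f q) at_top" for q
    using eventually_gt_at_top[of 0] by eventually_elim (simp add: s_def)
  have "((\<lambda>t. LINT q|\<mu>. s t q) \<longlongrightarrow> (LINT q|\<mu>. 0)) at_top"
  proof (rule integral_dominated_convergence_at_top)
    show "integrable \<mu> (\<lambda>_. 4 * C)" by (rule finite_measure.integrable_const[OF finite_mu])
    show "s t \<in> borel_measurable \<mu>" for t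
    proof (cases "t > 0")
      case True
      have "neumann_heat G t f \<in> borel_measurable \<mu>" using sqint_measurable[OF heat(2)[OF f C True]] .
      then show ?thesis using True by (simp add: s_def[abs_def])
    qed (simp add: s_def[abs_def])
    show "AE q in \<mu>. ((\<lambda>t. s t q) \<longlongrightarrow> 0) at_top"
      using heat_diff_tendsto[OF f p] tendsto_cong[OF ev] by (intro AE_I2) simp
    show "eventually (\<lambda>t. AE q in \<mu>. norm (s t q) \<le> 4 * C) at_top"
      using eventually_gt_at_top[of 0]
    proof eventually_elim
      case (elim t)
      have "norm (s t q) \<le> 4 * C" if "q \<in> points G" for q
        using norm_triangle_ineq4[of "neumann_heat G t f p" "neumann_heat G t f q"]
          heat(4)[OF f C elim p] heat(4)[OF f C elim that] elim by (simp add: s_def)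
      then show ?case by (intro AE_I2) simp
    qed
  qed simp
  moreover have "eventually (\<lambda>t. (LINT q|\<mu>. s t q) = m * neumann_heat G t f p - L) at_top"
    using eventually_gt_at_top[of 0]
  proof eventually_elim
    case (elim t)
    have "(LINT q|\<mu>. s t q) = (LINT q|\<mu>. neumann_heat G t f p - neumann_heat G t f q)" using elim by (simp add: s_def)
    also have "\<dots> = (LINT q|\<mu>. neumann_heat G t f p) - (LINT q|\<mu>. neumann_heat G t f q)"
      by (rule Bochner_Integration.integral_diff)
        (rule sqint_integrable[OF sqint_const], rule sqint_integrable[OF heat(2)[OF f C elim]])
    also have "\<dots> = m * neumann_heat G t f p - L"
      unfolding heat_mean[OF f elim] L_def by (simp add: m_def scaleR_conv_of_real)
    finally show ?case .
  qed
  ultimately have "((\<lambda>t. m * neumann_heat G t f p - L) \<longlongrightarrow> 0) at_top" by (simp add: tendsto_cong)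
  then have "((\<lambda>t. 1 / m * ((m * neumann_heat G t f p - L) + L)) \<longlongrightarrow> 1 / m * (0 + L)) at_top"
    by (intro tendsto_mult tendsto_add tendsto_const)
  then show ?thesis using m by (simp add: m_def L_def)
qed

section \<open>Invariant measures\<close>

lemma of_real_Linfty:
  fixes f :: "('v, 'e) point \<Rightarrow> real"
  assumes f: "f \<in> borel_measurable (tree_borel G)" "bounded (f ` points G)"
  shows "(\<lambda>x. complex_of_real (f x)) \<in> Linfty G"
proof -
  obtain C where "\<forall>x\<in>points G. \<bar>f x\<bar> \<le> C" using f(2) by (auto simp: bounded_iff)
  then have "AE x in \<mu>. cmod (complex_of_real (f x)) \<le> C" by (intro AE_I2) simp
  moreover have "(\<lambda>x. complex_of_real (f x)) \<in> borel_measurable \<mu>" unfolding measurable_mu using f(1) by measurable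
  ultimately show ?thesis unfolding Linfty_def by blast
qed

lemma invariant_mu: "invariant_measure G \<mu>"
  unfolding invariant_measure_def
proof (intro conjI allI impI)
  show "emeasure \<mu> (space \<mu>) \<noteq> 0" using mu_pos finite_measure.emeasure_eq_measure[OF finite_mu] by simp
  fix t :: real and f :: "('v, 'e) point \<Rightarrow> real"
  assume t: "t > 0" and f: "f \<in> borel_measurable (tree_borel G)" "bounded (f ` points G)" "\<forall>x\<in>points G. 0 \<le> f x"
  let ?f = "\<lambda>x. complex_of_real (f x)"
  note F = of_real_Linfty[OF f(1,2)]
  obtain C where C: "AE x in \<mu>. cmod (?f x) \<le> C" using Linfty_E[OF F] .
  note hi = sqint_integrable[OF heat(2)[OF F C t]] and fi = sqint_integrable[OF Linfty_sqint[OF F]]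
  \<comment> \<open>\<open>ennreal\<close> cuts off negative values, so positivity is what relates
    its integral to the conserved one.\<close>
  have "0 \<le> Re (neumann_heat G t ?f x)" if "x \<in> points G" for x
  proof -
    have "neumann_heat G t ?f x = complex_of_real \<bar>Re (neumann_heat G t ?f x)\<bar>"
      by (rule heat_nonneg[OF F _ t that], rule AE_I2) (use f(3) in simp)
    then have "Re (neumann_heat G t ?f x) = \<bar>Re (neumann_heat G t ?f x)\<bar>" by (metis Re_complex_of_real)
    then show ?thesis by linarith
  qed
  then have "(\<integral>\<^sup>+x. ennreal (Re (neumann_heat G t ?f x)) \<partial>\<mu>) = ennreal (LINT x|\<mu>. Re (neumann_heat G t ?f x))"
    by (intro nn_integral_eq_integral integrable_Re hi AE_I2) simp
  also have "(LINT x|\<mu>. Re (neumann_heat G t ?f x)) = Re (LINT x|\<mu>. ?f x)"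
    unfolding integral_Re[OF hi] heat_mean[OF F t] ..
  also have "\<dots> = (LINT x|\<mu>. f x)" by simp
  also have "ennreal \<dots> = (\<integral>\<^sup>+x. ennreal (f x) \<partial>\<mu>)"
    by (intro nn_integral_eq_integral[symmetric] AE_I2) (use integrable_Re[OF fi] f(3) in simp_all)
  finally show "(\<integral>\<^sup>+x. ennreal (Re (neumann_heat G t ?f x)) \<partial>\<mu>) = (\<integral>\<^sup>+x. ennreal (f x) \<partial>\<mu>)" .
qed simp_all

lemma invariant_lower:
  assumes inv: "invariant_measure G \<sigma>" and B: "B \<in> sets (tree_borel G)"
  shows "\<mu> B = 0 \<Longrightarrow> emeasure \<sigma> B = 0"
    and "ennreal (measure \<mu> B / measure \<mu> (points G)) * emeasure \<sigma> (points G) \<le> emeasure \<sigma> B"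
proof -
  have sp: "space \<sigma> = points G" and st: "sets \<sigma> = sets (tree_borel G)" using inv by (auto simp: invariant_measure_def)
  let ?f = "\<lambda>x. complex_of_real (indicator B x)"
  have Bm: "(indicator B :: _ \<Rightarrow> real) \<in> borel_measurable (tree_borel G)" using B by simp
  have Bb: "bounded ((indicator B :: _ \<Rightarrow> real) ` points G)" by (auto simp: bounded_iff indicator_def intro!: exI[of _ 1])
  note F = of_real_Linfty[OF Bm Bb]
  obtain C where C: "AE x in \<mu>. cmod (?f x) \<le> C" using Linfty_E[OF F] .
  have I: "(\<integral>\<^sup>+x. ennreal (Re (neumann_heat G t ?f x)) \<partial>\<sigma>) = emeasure \<sigma> B" if t: "t > 0" for t
  proof -
    have "(\<integral>\<^sup>+x. ennreal (Re (neumann_heat G t ?f x)) \<partial>\<sigma>) = (\<integral>\<^sup>+x. ennreal (indicator B x) \<partial>\<sigma>)"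
      using inv t Bm Bb unfolding invariant_measure_def by simp
    then show ?thesis using B st by (simp add: ennreal_indicator)
  qed
  show "emeasure \<sigma> B = 0" if z: "\<mu> B = 0"
  proof -
    have "B \<in> null_sets \<mu>" using z B by (simp add: null_sets_def)
    then have ae: "AE x in \<mu>. ?f x = 0" by (rule AE_mp[OF AE_not_in]) simp
    note h = heat[OF F C zero_less_one]
    have "cls \<mu> ?f = cls \<mu> (\<lambda>_. 0)" by (rule cls_eqI[OF Linfty_sqint[OF F] sqint_const ae])
    then have "cls \<mu> (neumann_heat G 1 ?f) = cls \<mu> (\<lambda>_. 0)" using h(3) Op.T_simps(5)[of 1] by simp
    then have ae0: "AE x in \<mu>. neumann_heat G 1 ?f x = 0" using cls_eq_iff[OF h(2) sqint_const[of 0]] by simp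
    \<comment> \<open>Vanishing at every point, and not only almost everywhere for
      \<open>mu\<close>, is what allows integration against \<open>\<sigma>\<close>, whose relation
      to \<open>mu\<close> is still unknown.\<close>
    have "neumann_heat G 1 ?f x = 0" if "x \<in> points G" for x
      by (rule continuous_AE_eq[OF h(1) _ ae0 that]) (simp add: continuous_tree_iff)
    then have "(\<integral>\<^sup>+x. ennreal (Re (neumann_heat G 1 ?f x)) \<partial>\<sigma>) = (\<integral>\<^sup>+x. 0 \<partial>\<sigma>)"
      by (intro nn_integral_cong) (simp add: sp)
    then show ?thesis using I[of 1] by simp
  qed
  define r where "r = measure \<mu> B / measure \<mu> (points G)"
  have L: "(LINT x|\<mu>. ?f x) = complex_of_real (measure \<mu> B)"
    using B sets.sets_into_space[OF B] by (simp add: Int_absorb2)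
  \<comment> \<open>Integer times, because Fatou's lemma is applied to a sequence.\<close>
  have lim: "(\<lambda>n. ennreal (Re (neumann_heat G (real (Suc n)) ?f x))) \<longlonglongrightarrow> ennreal r" if "x \<in> points G" for x
  proof (rule tendsto_ennrealI)
    have "filterlim (\<lambda>n. real (Suc n)) at_top sequentially"
      using filterlim_compose[OF filterlim_real_sequentially filterlim_Suc] .
    from filterlim_compose[OF heat_tendsto[OF F that] this]
    have "(\<lambda>n. neumann_heat G (real (Suc n)) ?f x) \<longlonglongrightarrow> complex_of_real r" unfolding L by (simp add: r_def)
    from tendsto_Re[OF this] show "(\<lambda>n. Re (neumann_heat G (real (Suc n)) ?f x)) \<longlonglongrightarrow> r" by simp
  qed
  have "ennreal r * emeasure \<sigma> (points G) = (\<integral>\<^sup>+x. ennreal r \<partial>\<sigma>)" by (simp add: sp)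
  also have "\<dots> = (\<integral>\<^sup>+x. liminf (\<lambda>n. ennreal (Re (neumann_heat G (real (Suc n)) ?f x))) \<partial>\<sigma>)"
    by (intro nn_integral_cong lim_imp_Liminf[symmetric] lim) (simp_all add: sp)
  also have "\<dots> \<le> liminf (\<lambda>n. \<integral>\<^sup>+x. ennreal (Re (neumann_heat G (real (Suc n)) ?f x)) \<partial>\<sigma>)"
  proof (rule nn_integral_liminf)
    fix n
    have "neumann_heat G (real (Suc n)) ?f \<in> borel_measurable (tree_borel G)"
      by (rule continuous_tree_measurable[OF heat(1)[OF F C]]) simp
    then have "neumann_heat G (real (Suc n)) ?f \<in> borel_measurable \<sigma>"
      using measurable_cong_sets[OF st refl] by blast
    then show "(\<lambda>x. ennreal (Re (neumann_heat G (real (Suc n)) ?f x))) \<in> borel_measurable \<sigma>" by measurable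
  qed
  also have "\<dots> = emeasure \<sigma> B" by (subst I) (simp_all add: Liminf_const)
  finally show "ennreal (measure \<mu> B / measure \<mu> (points G)) * emeasure \<sigma> (points G) \<le> emeasure \<sigma> B" unfolding r_def .
qed

lemma invariant_unique:
  assumes inv: "invariant_measure G \<sigma>"
  shows "\<exists>c :: ennreal. c \<noteq> 0 \<and> (sigma_finite_measure \<sigma> \<longrightarrow> c \<noteq> \<infinity>) \<and> \<sigma> = scale_measure c \<mu>"
proof -
  have sp: "space \<sigma> = points G" and st: "sets \<sigma> = sets (tree_borel G)" and nz: "emeasure \<sigma> (points G) \<noteq> 0"
    using inv by (auto simp: invariant_measure_def)
  define m where "m = measure \<mu> (points G)"
  have m: "m > 0" unfolding m_def by (rule mu_pos)
  have em: "emeasure \<mu> B = ennreal (measure \<mu> B)" for B by (rule finite_measure.emeasure_eq_measure[OF finite_mu])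
  note low = invariant_lower[OF inv, folded m_def]
  show ?thesis
  proof (cases "emeasure \<sigma> (points G) = \<infinity>")
    case True
    \<comment> \<open>With the convention that \<open>\<infinity>\<close> times 0 is 0, the
      dichotomy between null sets and sets of infinite measure is a scaling by
      \<open>\<infinity>\<close>.\<close>
    have "emeasure \<sigma> B = \<infinity> * emeasure \<mu> B" if B: "B \<in> sets (tree_borel G)" for B
    proof (cases "emeasure \<mu> B = 0")
      case True
      then show ?thesis using low(1)[OF B] by simp
    next
      case False
      then have "measure \<mu> B > 0" using em[of B] by (simp add: zero_less_measure_iff)
      then have "ennreal (measure \<mu> B / m) * \<infinity> = \<infinity>" using m by (simp add: ennreal_mult_top)
      then have "emeasure \<sigma> B = \<infinity>" using low(2)[OF B] True by (simp add: top_unique)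
      then show ?thesis using False by (simp add: ennreal_top_mult)
    qed
    then have "\<sigma> = scale_measure \<infinity> \<mu>" by (intro measure_eqI) (simp_all add: st)
    \<comment> \<open>Sigma-finiteness would cover the tree by countably many sets of finite
      measure, all of them null for \<open>mu\<close>.\<close>
    moreover have False if sf: "sigma_finite_measure \<sigma>"
    proof -
      obtain A :: "nat \<Rightarrow> ('v, 'e) point set" where A: "range A \<subseteq> sets \<sigma>" "(\<Union>i. A i) = space \<sigma>" "\<And>i. emeasure \<sigma> (A i) \<noteq> \<infinity>"
        using sigma_finite_measure.sigma_finite[OF sf] by blast
      have "emeasure \<mu> (A i) = 0" for i
      proof (rule ccontr)
        assume "emeasure \<mu> (A i) \<noteq> 0"
        then have "emeasure \<sigma> (A i) = \<infinity>" unfolding \<open>\<sigma> = scale_measure \<infinity> \<mu>\<close> by (simp add: ennreal_top_mult)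
        then show False using A(3) by blast
      qed
      then have "A i \<in> null_sets \<mu>" for i using A(1) st by (auto simp: null_sets_def)
      then have "(\<Union>i. A i) \<in> null_sets \<mu>" by (rule null_sets_UN)
      then have "emeasure \<mu> (points G) = 0" unfolding A(2) sp by (rule null_setsD1)
      then show False using em[of "points G"] m by (simp add: m_def)
    qed
    ultimately show ?thesis by (intro exI[of _ \<infinity>]) auto
  next
    case False
    interpret \<sigma>: finite_measure \<sigma> by (rule finite_measureI) (use False in \<open>simp add: sp\<close>)
    interpret \<mu>: finite_measure \<mu> by (rule finite_mu)
    define s where "s = measure \<sigma> (points G)"
    have s: "s > 0" using nz \<sigma>.emeasure_eq_measure[of "points G"] by (simp add: s_def zero_less_measure_iff)
    have le: "measure \<mu> B / m * s \<le> measure \<sigma> B" if B: "B \<in> sets (tree_borel G)" for B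
      using low(2)[OF B] m by (simp add: \<sigma>.emeasure_eq_measure s_def flip: ennreal_mult)
    have eq: "measure \<sigma> B = s / m * measure \<mu> B" if B: "B \<in> sets (tree_borel G)" for B
    proof (rule antisym)
      have c: "points G - B \<in> sets (tree_borel G)" using sets.compl_sets[OF B] by simp
      have "measure \<mu> (points G - B) = m - measure \<mu> B" using \<mu>.finite_measure_compl[of B] B by (simp add: m_def)
      then have "(m - measure \<mu> B) / m * s \<le> measure \<sigma> (points G - B)" using le[OF c] by simp
      also have "\<dots> = s - measure \<sigma> B" using \<sigma>.finite_measure_compl[of B] B by (simp add: s_def sp st)
      finally show "measure \<sigma> B \<le> s / m * measure \<mu> B" using m by (simp add: field_simps)
      show "s / m * measure \<mu> B \<le> measure \<sigma> B" using le[OF B] by (simp add: mult.commute)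
    qed
    have "\<sigma> = scale_measure (ennreal (s / m)) \<mu>"
    proof (rule measure_eqI)
      fix B assume "B \<in> sets \<sigma>"
      then have "B \<in> sets (tree_borel G)" by (simp only: st)
      then have "emeasure \<sigma> B = ennreal (s / m * measure \<mu> B)" unfolding \<sigma>.emeasure_eq_measure by (simp only: eq)
      also have "\<dots> = ennreal (s / m) * ennreal (measure \<mu> B)" by (rule ennreal_mult) (use s m in auto)
      finally show "emeasure \<sigma> B = emeasure (scale_measure (ennreal (s / m)) \<mu>) B"
        by (simp add: \<mu>.emeasure_eq_measure)
    qed (simp add: st)
    then show ?thesis using s m by (intro exI[of _ "ennreal (s / m)"]) auto
  qed
qed

end

theorem theorem3p5:
  fixes G :: "('v, 'e) metric_tree"
  assumes "rooted_metric_tree G"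
  shows "invariant_measure G (mu G)
    \<and> (\<forall>\<sigma>. invariant_measure G \<sigma> \<longrightarrow>
         (\<exists>c :: ennreal. c \<noteq> 0 \<and> (sigma_finite_measure \<sigma> \<longrightarrow> c \<noteq> \<infinity>) \<and>
            \<sigma> = scale_measure c (mu G)))
    \<and> (\<forall>f \<in> Linfty G. \<forall>x \<in> points G.
         ((\<lambda>t. neumann_heat G t f x) \<longlongrightarrow>
           1 / complex_of_real (measure (mu G) (points G)) * (LINT y|mu G. f y)) at_top)"
proof -
  interpret rooted_tree G using assms by (rule rooted_tree.intro)
  show ?thesis using invariant_mu invariant_unique heat_tendsto by blast
qed

end
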